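(* Let $G=H\times D$ be a product of a semisimple group $H$ and a torus $D$. Let $X_+$ be a nondegenerate representation of $H$, let $Y$ be a representation of $D$, and let $Z$ be a representation of $G$. Assume that (1) the cone of weights of $Y$ has full dimension (in $\chi(D)_{\mathbb Q}$); and (2) there is a vector $\nu\in\chi(D)_{\mathbb Q}^\vee$ such that $\langle\nu,\alpha^+\rangle\ge0$ and $\langle\nu,\alpha^-\rangle<0$ for all $D$-weights $\alpha^+$ of $Y$ and $\alpha^-$ of $Z$. For any integer $t>0$, let $Z^{(t)}$ denote the representation of $G$ obtained by scaling the $D$-weights of $Z$ by $t$. Then, for all $t\gg0$, the representation $(X_+\otimes Y)\oplus Z^{(t)}$ of $G$ is Weyl-generic.
   Context: All groups and representations are over $\mathbb{C}$, representations are finite-dimensional, and reductive (in particular semisimple) groups are connected. $\chi(K)$ is the group of characters $K\to\mathbb{G}_m$ and $\chi(K)_{\mathbb Q}=\chi(K)\otimes\mathbb{Q}$. The cone of weights of $Y$ is the set of nonnegative rational linear combinations of weights of $Y$; its dimension is the dimension of its linear span. $Z^{(t)}$: if $Z=\bigoplus_\alpha Z_\alpha$ is the decomposition into $D$-weight spaces (each $Z_\alpha$ an $H$-representation), then $Z^{(t)}=\bigoplus_\alpha Z_\alpha$ with the same $H$-action and with $D$ acting on $Z_\alpha$ by the character $t\alpha$. Nondegenerate: let $T_H\subseteq H$ be a maximal torus. For a positive-dimensional representation $X$ of $H$, the degeneracy $\mathrm{degen}(X)$ is the smallest integer $n$ such that there exist $T_H$-weights $\xi_1,\dots,\xi_{n+1}$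 of $X$ and $a_i\in\mathbb{Q}_{\ge0}$ with $\sum a_i=1$ and $\sum a_i\xi_i=0$. It always satisfies $\mathrm{degen}(X)\le\mathrm{rank}(H)$; $X$ is nondegenerate if $\mathrm{degen}(X)=\mathrm{rank}(H)$. Weyl-generic: for a character $\theta$ and 1-parameter subgroup $\lambda$ of a torus $T$, $\langle\theta,\lambda\rangle$ is the integer $a$ with $\theta(\lambda(t))=t^a$, extended linearly to $\theta\in\chi(T)_{\mathbb Q}$. For a $T$-representation $V$ and $\theta\in\chi(T)_{\mathbb Q}$, $V^{ss}_\theta(T)$ is the set of $x\in V$ such that whenever $\lim_{t\to0}\lambda(t)x$ exists for a 1-parameter subgroup $\lambda$ of $T$, one has $\langle\theta,\lambda\rangle\ge0$. Put $\Sigma(V,T)=\{\theta\mid V^{ss}_\theta(T)\ne\emptyset\}$ and $\omega(V,T)=\{\theta\in\Sigma(V,T)\mid\text{some }x\in V^{ss}_\theta(T)\text{ has positive-dimensional stabilizer in }T\}$. If $G$ is a connected complex reductive group with maximal torus $T$ and Weyl group $W$, a representation $(V,G)$ is Weyl-generic if the set $\Sigma(V,T)^W$ of $W$-invariant elements of $\Sigma(V,T)$ is not contained in $\omega(V,T)$.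
   Formalization: The torus D is assumed nontrivial; for D trivial and H nontrivial (e.g. H=SL_2, X_+=C^2, Y=C, Z=0) the claim fails, since the only W-invariant character is 0 and the zero vector is semistable with stabilizer T. *)

theory Defs
  imports
    "HOL-Algebra.Solvable_Groups"
    "HOL-Algebra.Group_Action"
    "HOL-Library.Extended_Nat"
    "Jordan_Normal_Form.Matrix"
    "Jordan_Normal_Form.Determinant"
begin

section \<open>Rational characters\<close>

text \<open>
  The nowhere vanishing functions on a type form an abelian group \<open>M\<close> under multiplication.
  The type \<open>'a qchar\<close> is \<open>M \<otimes> \<rat>\<close>, written additively: it is the localisation of \<open>M\<close> at the
  positive integers, the pair \<open>(f, n)\<close> standing for \<open>(1/n) f\<close>. Since \<open>\<rat>\<close> is flat over \<open>\<int>\<close>,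
  for every group \<open>X\<close> of characters inside \<open>M\<close> the space \<open>X \<otimes> \<rat>\<close> is the span of \<open>X\<close> in
  \<open>'a qchar\<close>.
\<close>

definition qchar_rel :: "('a \<Rightarrow> complex) \<times> nat \<Rightarrow> ('a \<Rightarrow> complex) \<times> nat \<Rightarrow> bool" where
  "qchar_rel x y \<longleftrightarrow> (\<forall>a. fst x a \<noteq> 0) \<and> (\<forall>a. fst y a \<noteq> 0) \<and> 0 < snd x \<and> 0 < snd y \<and>
     (\<exists>k>0. \<forall>a. fst x a ^ (k * snd y) = fst y a ^ (k * snd x))"

lemma part_equivp_qchar_rel: "part_equivp (qchar_rel :: ('a \<Rightarrow> complex) \<times> nat \<Rightarrow> _)"
proof (rule part_equivpI)
  show "\<exists>x :: ('a \<Rightarrow> complex) \<times> nat. qchar_rel x x"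
    by (rule exI[of _ "(\<lambda>_. 1, 1)"]) (auto simp: qchar_rel_def)
  show "symp (qchar_rel :: ('a \<Rightarrow> complex) \<times> nat \<Rightarrow> _)"
    unfolding symp_def qchar_rel_def by metis
  show "transp (qchar_rel :: ('a \<Rightarrow> complex) \<times> nat \<Rightarrow> _)"
  proof (rule transpI)
    fix x y z :: "('a \<Rightarrow> complex) \<times> nat"
    assume xy: "qchar_rel x y" and yz: "qchar_rel y z"
    obtain f n g m h l where [simp]: "x = (f, n)" "y = (g, m)" "z = (h, l)"
      by (metis surj_pair)
    obtain k k' where k: "k > 0" "\<And>a. f a ^ (k * m) = g a ^ (k * n)"
      and k': "k' > 0" "\<And>a. g a ^ (k' * l) = h a ^ (k' * m)"
      using xy yz by (auto simp: qchar_rel_def)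
    have "f a ^ ((k * k' * m) * l) = h a ^ ((k * k' * m) * n)" for a
    proof -
      have "f a ^ ((k * k' * m) * l) = (f a ^ (k * m)) ^ (k' * l)"
        by (simp add: power_mult[symmetric] mult_ac)
      also have "\<dots> = (g a ^ (k' * l)) ^ (k * n)"
        by (simp add: k power_mult[symmetric] mult_ac)
      also have "\<dots> = h a ^ ((k * k' * m) * n)"
        by (simp add: k' power_mult[symmetric] mult_ac)
      finally show ?thesis .
    qed
    moreover have "k * k' * m > 0" using k(1) k'(1) xy by (auto simp: qchar_rel_def)
    ultimately have "\<exists>j>0. \<forall>a. f a ^ (j * l) = h a ^ (j * n)" by blast
    then show "qchar_rel x z" using xy yz by (simp add: qchar_rel_def)
  qed
qed

quotient_type 'a qchar = "('a \<Rightarrow> complex) \<times> nat" / partial: qchar_rel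
  by (rule part_equivp_qchar_rel)

lemma qchar_relI:
  assumes "\<And>a. f a \<noteq> 0" "\<And>a. g a \<noteq> 0" "0 < n" "0 < m" "0 < k"
    and "\<And>a. f a ^ (k * m) = g a ^ (k * n)"
  shows "qchar_rel (f, n) (g, m)"
  using assms by (auto simp: qchar_rel_def)

instantiation qchar :: (type) ab_group_add
begin

lift_definition zero_qchar :: "'a qchar" is "(\<lambda>_. 1, 1)"
  by (auto simp: qchar_rel_def)

lift_definition plus_qchar :: "'a qchar \<Rightarrow> 'a qchar \<Rightarrow> 'a qchar"
  is "\<lambda>(f, n) (g, m). (\<lambda>a. f a ^ m * g a ^ n, n * m)"
proof (clarsimp simp: split_paired_all)
  fix f f' g g' :: "'a \<Rightarrow> complex" and n n' m m' :: nat
  assume 1: "qchar_rel (f, n) (f', n')" and 2: "qchar_rel (g, m) (g', m')"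
  obtain k where k: "k > 0" "\<And>a. f a ^ (k * n') = f' a ^ (k * n)"
    using 1 by (auto simp: qchar_rel_def)
  obtain l where l: "l > 0" "\<And>a. g a ^ (l * m') = g' a ^ (l * m)"
    using 2 by (auto simp: qchar_rel_def)
  show "qchar_rel (\<lambda>a. f a ^ m * g a ^ n, n * m) (\<lambda>a. f' a ^ m' * g' a ^ n', n' * m')"
  proof (rule qchar_relI[where k = "k * l"])
    fix a
    have "(f a ^ m * g a ^ n) ^ (k * l * (n' * m'))
        = (f a ^ (k * n')) ^ (l * m * m') * (g a ^ (l * m')) ^ (k * n * n')"
      by (simp add: power_mult_distrib power_mult[symmetric] mult_ac)
    also have "\<dots> = (f' a ^ m' * g' a ^ n') ^ (k * l * (n * m))"
      unfolding k(2) l(2) by (simp add: power_mult_distrib power_mult[symmetric] mult_ac)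
    finally show "(f a ^ m * g a ^ n) ^ (k * l * (n' * m'))
        = (f' a ^ m' * g' a ^ n') ^ (k * l * (n * m))" .
  qed (use 1 2 k(1) l(1) in \<open>auto simp: qchar_rel_def\<close>)
qed

lift_definition uminus_qchar :: "'a qchar \<Rightarrow> 'a qchar" is "\<lambda>(f, n). (\<lambda>a. inverse (f a), n)"
  by (auto simp: qchar_rel_def power_inverse)

definition minus_qchar :: "'a qchar \<Rightarrow> 'a qchar \<Rightarrow> 'a qchar" where
  "minus_qchar x y = x + - y"

instance
proof
  fix x y z :: "'a qchar"
  show "x + y + z = x + (y + z)"
    by transfer
      (auto simp: qchar_rel_def power_mult_distrib power_mult[symmetric] mult_ac intro!: exI[of _ 1])
  show "x + y = y + x"
    by transfer (auto simp: qchar_rel_def mult_ac intro!: exI[of _ 1])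
  show "0 + x = x"
    by transfer (auto simp: qchar_rel_def intro!: exI[of _ 1])
  show "- x + x = 0"
    by transfer (auto simp: qchar_rel_def power_mult_distrib[symmetric] intro!: exI[of _ 1])
  show "x - y = x + - y" by (rule minus_qchar_def)
qed

end

lift_definition qscale :: "rat \<Rightarrow> 'a qchar \<Rightarrow> 'a qchar"
  is "\<lambda>r (f, n). (\<lambda>a. f a powi fst (quotient_of r), nat (snd (quotient_of r)) * n)"
proof (clarsimp simp: split_paired_all)
  fix r and f g :: "'a \<Rightarrow> complex" and n m :: nat
  assume 1: "qchar_rel (f, n) (g, m)"
  obtain p q where pq: "quotient_of r = (p, q)" by force
  have q: "q > 0" using quotient_of_denom_pos[OF pq] .
  obtain k where k: "k > 0" "\<And>a. f a ^ (k * m) = g a ^ (k * n)"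
    using 1 by (auto simp: qchar_rel_def)
  have "qchar_rel (\<lambda>a. f a powi p, nat q * n) (\<lambda>a. g a powi p, nat q * m)"
  proof (rule qchar_relI[where k = k])
    fix a
    have "(f a powi p) ^ (k * (nat q * m)) = (f a ^ (k * m)) powi (p * q)"
      using q by (simp flip: power_int_of_nat power_int_mult add: mult_ac)
    also have "\<dots> = (g a powi p) ^ (k * (nat q * n))"
      unfolding k(2) using q by (simp flip: power_int_of_nat power_int_mult add: mult_ac)
    finally show "(f a powi p) ^ (k * (nat q * m)) = (g a powi p) ^ (k * (nat q * n))" .
  qed (use 1 k(1) q in \<open>auto simp: qchar_rel_def\<close>)
  then show "qchar_rel (\<lambda>a. f a powi fst (quotient_of r), nat (snd (quotient_of r)) * n)
              (\<lambda>a. g a powi fst (quotient_of r), nat (snd (quotient_of r)) * m)"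
    by (simp add: pq)
qed

lemma power_int_cong_denominators:
  assumes "f \<noteq> (0 :: complex)" "b > 0" "d > 0" "a * d = c * b"
  shows "(f powi a) ^ (nat d * m) = (f powi c) ^ (nat b * m)"
proof -
  have "(f powi a) ^ (nat d * m) = f powi (a * d * int m)"
    using assms(1-3) by (simp flip: power_int_of_nat power_int_mult add: mult_ac)
  also have "\<dots> = f powi (c * b * int m)" using assms(4) by (simp only:)
  also have "\<dots> = (f powi c) ^ (nat b * m)"
    using assms(1-3) by (simp flip: power_int_of_nat power_int_mult add: mult_ac)
  finally show ?thesis .
qed

lemma quotient_of_cross:
  assumes "quotient_of r = (a, b)" "c > 0" "r = of_int d / of_int c"
  shows "a * c = d * b"
proof -
  have "of_int a / of_int b = (of_int d / of_int c :: rat)" "b > 0"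
    using assms quotient_of_div quotient_of_denom_pos by metis+
  then have "of_int (a * c) = (of_int (d * b) :: rat)" using assms(2)
    by (simp add: field_simps)
  then show ?thesis by (simp only: of_int_eq_iff)
qed

lemma vector_space_qscale: "vector_space (qscale :: rat \<Rightarrow> 'a qchar \<Rightarrow> 'a qchar)"
proof
  fix r s :: rat and x y :: "'a qchar"
  obtain p q where r: "quotient_of r = (p, q)" by force
  obtain p' q' where s: "quotient_of s = (p', q')" by force
  note q = quotient_of_denom_pos[OF r] quotient_of_denom_pos[OF s]
  note rs = quotient_of_div[OF r] quotient_of_div[OF s]
  show "qscale r (x + y) = qscale r x + qscale r y"
  proof (transfer fixing: r, clarsimp simp: r split_paired_all)
    fix f g :: "'a \<Rightarrow> complex" and n m :: nat
    assume *: "qchar_rel (f, n) (f, n)" "qchar_rel (g, m) (g, m)"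
    show "qchar_rel (\<lambda>a. (f a ^ m * g a ^ n) powi p, nat q * (n * m))
       (\<lambda>a. (f a powi p) ^ (nat q * m) * (g a powi p) ^ (nat q * n), nat q * n * (nat q * m))"
    proof (rule qchar_relI[where k = 1])
      fix a
      show "((f a ^ m * g a ^ n) powi p) ^ (1 * (nat q * n * (nat q * m)))
        = ((f a powi p) ^ (nat q * m) * (g a powi p) ^ (nat q * n)) ^ (1 * (nat q * (n * m)))"
        using q by (simp flip: power_int_of_nat power_int_mult
            add: power_int_mult_distrib power_mult_distrib mult_ac)
    qed (use * q in \<open>auto simp: qchar_rel_def\<close>)
  qed
  show "qscale (r + s) x = qscale r x + qscale s x"
  proof -
    obtain P Q where u: "quotient_of (r + s) = (P, Q)" by force
    have Q: "Q > 0" using quotient_of_denom_pos[OF u] .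
    have cross: "P * (q * q') = (p * q' + p' * q) * Q"
      by (rule quotient_of_cross[OF u]) (use q in \<open>simp_all add: rs field_simps\<close>)
    show ?thesis
    proof (transfer fixing: r s, clarsimp simp: r s u split_paired_all)
      fix f :: "'a \<Rightarrow> complex" and n :: nat
      assume *: "qchar_rel (f, n) (f, n)"
      show "qchar_rel (\<lambda>a. f a powi P, nat Q * n)
         (\<lambda>a. (f a powi p) ^ (nat q' * n) * (f a powi p') ^ (nat q * n),
           nat q * n * (nat q' * n))"
      proof (rule qchar_relI[where k = 1])
        fix a
        have nz: "f a \<noteq> 0" using * by (auto simp: qchar_rel_def)
        have "(f a powi p) ^ (nat q' * n) * (f a powi p') ^ (nat q * n)
            = f a powi (p * q' * int n) * f a powi (p' * q * int n)"
          using q by (simp flip: power_int_of_nat power_int_mult add: mult_ac)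
        also have "\<dots> = f a powi ((p * q' + p' * q) * int n)"
          using nz by (simp add: power_int_add[symmetric] algebra_simps)
        also have "\<dots> = (f a powi (p * q' + p' * q)) ^ n"
          by (simp add: power_int_mult)
        finally have 1: "(f a powi p) ^ (nat q' * n) * (f a powi p') ^ (nat q * n)
            = (f a powi (p * q' + p' * q)) ^ n" .
        have "(f a powi P) ^ (nat (q * q') * (n * n))
            = (f a powi (p * q' + p' * q)) ^ (nat Q * (n * n))"
          by (rule power_int_cong_denominators) (use nz Q q cross in auto)
        then show "(f a powi P) ^ (1 * (nat q * n * (nat q' * n)))
          = ((f a powi p) ^ (nat q' * n) * (f a powi p') ^ (nat q * n)) ^ (1 * (nat Q * n))"
          unfolding 1 using q by (simp add: nat_mult_distrib power_mult[symmetric] mult_ac)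
      qed (use * q Q in \<open>auto simp: qchar_rel_def\<close>)
    qed
  qed
  show "qscale r (qscale s x) = qscale (r * s) x"
  proof -
    obtain P Q where u: "quotient_of (r * s) = (P, Q)" by force
    have Q: "Q > 0" using quotient_of_denom_pos[OF u] .
    have cross: "P * (q * q') = (p' * p) * Q"
      by (rule quotient_of_cross[OF u]) (use q in \<open>simp_all add: rs field_simps\<close>)
    show ?thesis
    proof (transfer fixing: r s, clarsimp simp: r s u split_paired_all)
      fix f :: "'a \<Rightarrow> complex" and n :: nat
      assume *: "qchar_rel (f, n) (f, n)"
      show "qchar_rel (\<lambda>a. (f a powi p') powi p, nat q * (nat q' * n))
         (\<lambda>a. f a powi P, nat Q * n)"
      proof (rule qchar_relI[where k = 1])
        fix a
        have nz: "f a \<noteq> 0" using * by (auto simp: qchar_rel_def)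
        have "(f a powi (p' * p)) ^ (nat Q * n) = (f a powi P) ^ (nat (q * q') * n)"
          by (rule power_int_cong_denominators) (use nz Q q cross in auto)
        then show "((f a powi p') powi p) ^ (1 * (nat Q * n))
            = (f a powi P) ^ (1 * (nat q * (nat q' * n)))"
          using q by (simp add: nat_mult_distrib power_int_mult mult_ac)
      qed (use * q Q in \<open>auto simp: qchar_rel_def\<close>)
    qed
  qed
  show "qscale 1 x = x"
    by transfer (auto simp: qchar_rel_def intro!: exI[of _ 1])
qed

global_interpretation qchar: vector_space "qscale :: rat \<Rightarrow> 'a qchar \<Rightarrow> 'a qchar"
  by (rule vector_space_qscale)

text \<open>The class of \<open>f \<otimes> 1\<close>; meaningful for nowhere vanishing \<open>f\<close> only.\<close>

definition qchar_of :: "('a \<Rightarrow> complex) \<Rightarrow> 'a qchar" where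
  "qchar_of f = abs_qchar (f, 1)"

text \<open>The action on \<open>M \<otimes> \<rat>\<close> of precomposition with \<open>w\<close>.\<close>

lift_definition qchar_pullback :: "('a \<Rightarrow> 'a) \<Rightarrow> 'a qchar \<Rightarrow> 'a qchar"
  is "\<lambda>w (f, n). (f \<circ> w, n)"
  by (auto simp: qchar_rel_def)


section \<open>Linear algebraic groups\<close>

text \<open>A linear algebraic group over \<open>\<complex>\<close> is a Zariski closed subgroup \<open>G\<close> of some \<open>GL n\<close>.\<close>

definition GL :: "nat \<Rightarrow> complex mat monoid" where
  "GL n = units_of (ring_mat TYPE(complex) n ())"

abbreviation sub_grp :: "nat \<Rightarrow> complex mat set \<Rightarrow> complex mat monoid" where
  "sub_grp n G \<equiv> (GL n)\<lparr>carrier := G\<rparr>"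

text \<open>The coordinate ring \<open>\<complex>[x\<^sub>i\<^sub>j, 1/det]\<close> of \<open>GL n\<close>, as functions.\<close>

inductive_set regular_fun :: "nat \<Rightarrow> (complex mat \<Rightarrow> complex) set" for n where
  const: "(\<lambda>_. c) \<in> regular_fun n"
| entry: "i < n \<Longrightarrow> j < n \<Longrightarrow> (\<lambda>A. A $$ (i, j)) \<in> regular_fun n"
| inverse_det: "(\<lambda>A. 1 / det A) \<in> regular_fun n"
| add: "p \<in> regular_fun n \<Longrightarrow> q \<in> regular_fun n \<Longrightarrow> (\<lambda>A. p A + q A) \<in> regular_fun n"
| mult: "p \<in> regular_fun n \<Longrightarrow> q \<in> regular_fun n \<Longrightarrow> (\<lambda>A. p A * q A) \<in> regular_fun n"

definition zariski_closed :: "nat \<Rightarrow> complex mat set \<Rightarrow> bool" where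
  "zariski_closed n S \<longleftrightarrow>
     (\<exists>F \<subseteq> regular_fun n. S = {A \<in> carrier (GL n). \<forall>p\<in>F. p A = 0})"

definition zariski_connected :: "nat \<Rightarrow> complex mat set \<Rightarrow> bool" where
  "zariski_connected n S \<longleftrightarrow> S \<noteq> {} \<and>
     \<not> (\<exists>A B. zariski_closed n A \<and> zariski_closed n B \<and> S \<subseteq> A \<union> B \<and>
          S \<inter> A \<noteq> {} \<and> S \<inter> B \<noteq> {} \<and> S \<inter> A \<inter> B = {})"

definition zariski_irreducible :: "nat \<Rightarrow> complex mat set \<Rightarrow> bool" where
  "zariski_irreducible n S \<longleftrightarrow> S \<noteq> {} \<and>
     (\<forall>A B. zariski_closed n A \<longrightarrow> zariski_closed n B \<longrightarrow> S \<subseteq> A \<union> B \<longrightarrow> S \<subseteq> A \<or> S \<subseteq> B)"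

text \<open>Krull dimension of a closed set (with value \<open>0\<close> for the empty set).\<close>

definition zariski_dim :: "nat \<Rightarrow> complex mat set \<Rightarrow> enat" where
  "zariski_dim n S = Sup {enat k | k. \<exists>C :: nat \<Rightarrow> complex mat set.
     (\<forall>i\<le>k. zariski_closed n (C i) \<and> zariski_irreducible n (C i) \<and> C i \<subseteq> S) \<and>
     (\<forall>i<k. C i \<subset> C (Suc i))}"

definition algebraic_group :: "nat \<Rightarrow> complex mat set \<Rightarrow> bool" where
  "algebraic_group n G \<longleftrightarrow> subgroup G (GL n) \<and> zariski_closed n G"

definition semisimple_group :: "nat \<Rightarrow> complex mat set \<Rightarrow> bool" where
  "semisimple_group n G \<longleftrightarrow> algebraic_group n G \<and> zariski_connected n G \<and>
     (\<forall>R. R \<lhd> sub_grp n G \<and> zariski_closed n R \<and> zariski_connected n R \<and>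
          solvable (sub_grp n R) \<longrightarrow> R = {\<one>\<^bsub>GL n\<^esub>})"

definition regular_on :: "nat \<Rightarrow> complex mat set \<Rightarrow> (complex mat \<Rightarrow> complex) \<Rightarrow> bool" where
  "regular_on n G f \<longleftrightarrow> (\<exists>p\<in>regular_fun n. \<forall>g\<in>G. f g = p g)"

text \<open>Homomorphisms of algebraic groups from \<open>G \<subseteq> GL n\<close> to \<open>K \<subseteq> GL m\<close>.\<close>

definition algebraic_hom ::
  "nat \<Rightarrow> complex mat set \<Rightarrow> nat \<Rightarrow> complex mat set \<Rightarrow> (complex mat \<Rightarrow> complex mat) set" where
  "algebraic_hom n G m K = {f \<in> hom (sub_grp n G) (sub_grp m K).
     \<forall>i<m. \<forall>j<m. regular_on n G (\<lambda>g. f g $$ (i, j))}"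

text \<open>The split torus \<open>\<G>\<^sub>m\<^sup>r\<close>, as the group of invertible diagonal matrices.\<close>

definition std_torus :: "nat \<Rightarrow> complex mat set" where
  "std_torus r = {A \<in> carrier (GL r). diagonal_mat A}"

definition torus_of_rank :: "nat \<Rightarrow> nat \<Rightarrow> complex mat set \<Rightarrow> bool" where
  "torus_of_rank n r T \<longleftrightarrow> algebraic_group n T \<and>
     (\<exists>f \<in> algebraic_hom r (std_torus r) n T. \<exists>f' \<in> algebraic_hom n T r (std_torus r).
        (\<forall>a\<in>std_torus r. f' (f a) = a) \<and> (\<forall>s\<in>T. f (f' s) = s))"

definition torus :: "nat \<Rightarrow> complex mat set \<Rightarrow> bool" where
  "torus n T \<longleftrightarrow> (\<exists>r. torus_of_rank n r T)"

definition torus_rank :: "nat \<Rightarrow> complex mat set \<Rightarrow> nat" where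
  "torus_rank n T = (THE r. torus_of_rank n r T)"

definition maximal_torus :: "nat \<Rightarrow> complex mat set \<Rightarrow> complex mat set \<Rightarrow> bool" where
  "maximal_torus n G T \<longleftrightarrow> torus n T \<and> T \<subseteq> G \<and> (\<forall>S. torus n S \<and> T \<subseteq> S \<and> S \<subseteq> G \<longrightarrow> S = T)"

text \<open>The product \<open>H \<times> D\<close>, embedded block diagonally in \<open>GL (n + k)\<close>.\<close>

definition block :: "complex mat \<Rightarrow> complex mat \<Rightarrow> complex mat" where
  "block h d = four_block_mat h (0\<^sub>m (dim_row h) (dim_col d)) (0\<^sub>m (dim_row d) (dim_col h)) d"

definition group_prod :: "complex mat set \<Rightarrow> complex mat set \<Rightarrow> complex mat set" where
  "group_prod H D = {block h d | h d. h \<in> H \<and> d \<in> D}"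

definition block_fst :: "nat \<Rightarrow> complex mat \<Rightarrow> complex mat" where
  "block_fst n g = (case split_block g n n of (A, B, C, E) \<Rightarrow> A)"

definition block_snd :: "nat \<Rightarrow> complex mat \<Rightarrow> complex mat" where
  "block_snd n g = (case split_block g n n of (A, B, C, E) \<Rightarrow> E)"


section \<open>Characters and one-parameter subgroups\<close>

text \<open>
  Characters \<open>K \<rightarrow> \<G>\<^sub>m\<close>, extended by \<open>1\<close> outside \<open>K\<close>: this makes equal characters equal as HOL
  functions, and makes them nowhere vanishing.
\<close>

definition characters :: "nat \<Rightarrow> complex mat set \<Rightarrow> (complex mat \<Rightarrow> complex) set" where
  "characters n K = {\<phi>. regular_on n K \<phi> \<and> (\<forall>g\<in>K. \<phi> g \<noteq> 0) \<and> (\<forall>g. g \<notin> K \<longrightarrow> \<phi> g = 1) \<and>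
     (\<forall>g\<in>K. \<forall>h\<in>K. \<phi> (g * h) = \<phi> g * \<phi> h)}"

definition rational_characters :: "nat \<Rightarrow> complex mat set \<Rightarrow> complex mat qchar set" where
  "rational_characters n K = qchar.span (qchar_of ` characters n K)"

definition linear_functional_on :: "'a qchar set \<Rightarrow> ('a qchar \<Rightarrow> rat) \<Rightarrow> bool" where
  "linear_functional_on V \<nu> \<longleftrightarrow>
     (\<forall>x\<in>V. \<forall>y\<in>V. \<nu> (x + y) = \<nu> x + \<nu> y) \<and> (\<forall>c. \<forall>x\<in>V. \<nu> (qscale c x) = c * \<nu> x)"

text \<open>One-parameter subgroups are defined on \<open>\<G>\<^sub>m = GL 1\<close>; \<open>scalar1 a\<close> is the point \<open>a\<close> of it.\<close>

definition scalar1 :: "complex \<Rightarrow> complex mat" where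
  "scalar1 a = mat 1 1 (\<lambda>_. a)"

definition one_param_subgroups :: "nat \<Rightarrow> complex mat set \<Rightarrow> (complex mat \<Rightarrow> complex mat) set" where
  "one_param_subgroups n T = algebraic_hom 1 (carrier (GL 1)) n T"

definition char_pairing :: "(complex mat \<Rightarrow> complex) \<Rightarrow> (complex mat \<Rightarrow> complex mat) \<Rightarrow> int" where
  "char_pairing \<phi> \<mu> = (THE a. \<forall>t. t \<noteq> 0 \<longrightarrow> \<phi> (\<mu> (scalar1 t)) = t powi a)"

text \<open>The linear extension \<open>\<langle>(1/N) \<phi>, \<mu>\<rangle> = (1/N) \<langle>\<phi>, \<mu>\<rangle>\<close>.\<close>

definition pairing ::
  "nat \<Rightarrow> complex mat set \<Rightarrow> complex mat qchar \<Rightarrow> (complex mat \<Rightarrow> complex mat) \<Rightarrow> rat" where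
  "pairing n T \<theta> \<mu> = (THE q. \<exists>\<phi>\<in>characters n T. \<exists>N>0::nat.
     \<theta> = qscale (1 / of_nat N) (qchar_of \<phi>) \<and> q = of_int (char_pairing \<phi> \<mu>) / of_nat N)"


section \<open>Representations\<close>

definition alg_representation ::
  "nat \<Rightarrow> complex mat set \<Rightarrow> nat \<Rightarrow> (complex mat \<Rightarrow> complex mat) \<Rightarrow> bool" where
  "alg_representation n G m \<rho> \<longleftrightarrow> \<rho> \<in> algebraic_hom n G m (carrier (GL m))"

definition weight_space ::
  "complex mat set \<Rightarrow> nat \<Rightarrow> (complex mat \<Rightarrow> complex mat) \<Rightarrow> (complex mat \<Rightarrow> complex) \<Rightarrow> complex vec set"
  where
  "weight_space T m \<rho> \<phi> = {v \<in> carrier_vec m. \<forall>s\<in>T. \<rho> s *\<^sub>v v = \<phi> s \<cdot>\<^sub>v v}"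

definition weights ::
  "nat \<Rightarrow> complex mat set \<Rightarrow> nat \<Rightarrow> (complex mat \<Rightarrow> complex mat) \<Rightarrow> (complex mat \<Rightarrow> complex) set"
  where
  "weights n T m \<rho> = {\<phi> \<in> characters n T. weight_space T m \<rho> \<phi> \<noteq> {0\<^sub>v m}}"

definition weight_cone ::
  "nat \<Rightarrow> complex mat set \<Rightarrow> nat \<Rightarrow> (complex mat \<Rightarrow> complex mat) \<Rightarrow> complex mat qchar set" where
  "weight_cone n T m \<rho> = {(\<Sum>\<phi>\<in>S. qscale (c \<phi>) (qchar_of \<phi>)) | S c.
     finite S \<and> S \<subseteq> weights n T m \<rho> \<and> (\<forall>\<phi>\<in>S. 0 \<le> c \<phi>)}"

definition kronecker :: "complex mat \<Rightarrow> complex mat \<Rightarrow> complex mat" where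
  "kronecker A B = mat (dim_row A * dim_row B) (dim_col A * dim_col B)
     (\<lambda>(i, j). A $$ (i div dim_row B, j div dim_col B) * B $$ (i mod dim_row B, j mod dim_col B))"

text \<open>For representations \<open>X\<close> of \<open>H \<subseteq> GL n\<close> and \<open>Y\<close> of \<open>D\<close>, the representation
  \<open>X \<otimes> Y\<close> of \<open>H \<times> D\<close>.\<close>

definition ext_tensor ::
  "nat \<Rightarrow> (complex mat \<Rightarrow> complex mat) \<Rightarrow> (complex mat \<Rightarrow> complex mat) \<Rightarrow> complex mat \<Rightarrow> complex mat"
  where
  "ext_tensor n X Y g = kronecker (X (block_fst n g)) (Y (block_snd n g))"

definition direct_sum ::
  "(complex mat \<Rightarrow> complex mat) \<Rightarrow> (complex mat \<Rightarrow> complex mat) \<Rightarrow> complex mat \<Rightarrow> complex mat" where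
  "direct_sum V W g = block (V g) (W g)"

text \<open>
  For an \<open>s\<close>-dimensional representation \<open>Z\<close> of \<open>H \<times> D\<close>, where \<open>H \<subseteq> GL n\<close> and \<open>D \<subseteq> GL k\<close>, the
  representation \<open>Z\<^sup>(\<^sup>t\<^sup>)\<close>: on each \<open>D\<close>-weight space \<open>Z\<^sub>\<alpha>\<close>, the element \<open>(h, d)\<close> acts as \<open>h\<close> does in
  \<open>Z\<close>, times \<open>\<alpha>(d)\<^sup>t\<close>. The weight spaces span, so the matrix is determined.
\<close>

definition scale_weights ::
  "nat \<Rightarrow> nat \<Rightarrow> complex mat set \<Rightarrow> nat \<Rightarrow> nat \<Rightarrow> (complex mat \<Rightarrow> complex mat) \<Rightarrow> complex mat \<Rightarrow> complex mat"
  where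
  "scale_weights n k D s t Z g =
     (let h = block_fst n g; d = block_snd n g; Z_D = (\<lambda>d. Z (block (1\<^sub>m n) d)) in
      THE M. M \<in> carrier_mat s s \<and>
        (\<forall>\<alpha>\<in>weights k D s Z_D. \<forall>v\<in>weight_space D s Z_D \<alpha>.
           M *\<^sub>v v = \<alpha> d ^ t \<cdot>\<^sub>v (Z (block h (1\<^sub>m k)) *\<^sub>v v)))"


section \<open>Nondegenerate representations\<close>

definition degen :: "nat \<Rightarrow> complex mat set \<Rightarrow> nat \<Rightarrow> (complex mat \<Rightarrow> complex mat) \<Rightarrow> nat" where
  "degen n T m X = (LEAST N. \<exists>\<xi> a. (\<forall>i\<in>{1..N+1}. \<xi> i \<in> weights n T m X \<and> (0::rat) \<le> a i) \<and>
     (\<Sum>i=1..N+1. a i) = 1 \<and> (\<Sum>i=1..N+1. qscale (a i) (qchar_of (\<xi> i))) = 0)"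

text \<open>As maximal tori are conjugate, the condition does not depend on the maximal torus \<open>T\<close>;
  the rank of \<open>H\<close> is that of \<open>T\<close>.\<close>

definition nondegenerate ::
  "nat \<Rightarrow> complex mat set \<Rightarrow> nat \<Rightarrow> (complex mat \<Rightarrow> complex mat) \<Rightarrow> bool" where
  "nondegenerate n H m X \<longleftrightarrow> 0 < m \<and>
     (\<forall>T. maximal_torus n H T \<longrightarrow> degen n T m X = torus_rank n T)"


section \<open>Weyl-generic representations\<close>

definition semistable ::
  "nat \<Rightarrow> complex mat set \<Rightarrow> nat \<Rightarrow> (complex mat \<Rightarrow> complex mat) \<Rightarrow> complex mat qchar \<Rightarrow> complex vec set"
  where
  "semistable n T m \<rho> \<theta> = {x \<in> carrier_vec m. \<forall>\<mu>\<in>one_param_subgroups n T.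
     (\<exists>l\<in>carrier_vec m. \<forall>i<m. ((\<lambda>t. (\<rho> (\<mu> (scalar1 t)) *\<^sub>v x) $ i) \<longlongrightarrow> l $ i) (at 0)) \<longrightarrow>
     0 \<le> pairing n T \<theta> \<mu>}"

definition stabilizer_in ::
  "complex mat set \<Rightarrow> (complex mat \<Rightarrow> complex mat) \<Rightarrow> complex vec \<Rightarrow> complex mat set" where
  "stabilizer_in T \<rho> x = {s \<in> T. \<rho> s *\<^sub>v x = x}"

definition Sigma_set ::
  "nat \<Rightarrow> complex mat set \<Rightarrow> nat \<Rightarrow> (complex mat \<Rightarrow> complex mat) \<Rightarrow> complex mat qchar set" where
  "Sigma_set n T m \<rho> = {\<theta> \<in> rational_characters n T. semistable n T m \<rho> \<theta> \<noteq> {}}"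

definition omega_set ::
  "nat \<Rightarrow> complex mat set \<Rightarrow> nat \<Rightarrow> (complex mat \<Rightarrow> complex mat) \<Rightarrow> complex mat qchar set" where
  "omega_set n T m \<rho> = {\<theta> \<in> Sigma_set n T m \<rho>.
     \<exists>x\<in>semistable n T m \<rho> \<theta>. 0 < zariski_dim n (stabilizer_in T \<rho> x)}"

text \<open>
  The Weyl group \<open>N\<^sub>G(T) / C\<^sub>G(T)\<close>, as the group of automorphisms of \<open>T\<close> induced by conjugation.
  The maps are the identity outside \<open>T\<close>, so that pulling back along them preserves the
  convention that characters are \<open>1\<close> there.
\<close>

definition weyl_group :: "nat \<Rightarrow> complex mat set \<Rightarrow> complex mat set \<Rightarrow> (complex mat \<Rightarrow> complex mat) set" where
  "weyl_group n G T = (\<lambda>g s. if s \<in> T then g \<otimes>\<^bsub>GL n\<^esub> s \<otimes>\<^bsub>GL n\<^esub> inv\<^bsub>GL n\<^esub> g else s) `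
     normalizer (sub_grp n G) T"

text \<open>For a connected reductive group \<open>G\<close>; as maximal tori are conjugate, the condition does not
  depend on the maximal torus \<open>T\<close>.\<close>

definition weyl_generic ::
  "nat \<Rightarrow> complex mat set \<Rightarrow> nat \<Rightarrow> (complex mat \<Rightarrow> complex mat) \<Rightarrow> bool" where
  "weyl_generic n G m V \<longleftrightarrow> (\<forall>T. maximal_torus n G T \<longrightarrow>
     \<not> {\<theta> \<in> Sigma_set n T m V. \<forall>w\<in>weyl_group n G T. qchar_pullback w \<theta> = \<theta>} \<subseteq> omega_set n T m V)"

end

theory Submission
  imports "HOL-Complex_Analysis.Complex_Analysis" "Jordan_Normal_Form.Jordan_Normal_Form_Existence" Defs
begin

text \<open>A maximal torus of \<open>H \<times> D\<close> is \<open>T \<times> D\<close> with \<open>T\<close> maximal in \<open>H\<close>. Let \<open>\<theta> = (0, \<delta>)\<close> with \<open>\<delta>\<close> a generic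
  positive combination of weights of \<open>Y\<close>; it is invariant because \<open>D\<close> is central. Since semisimple
  groups have no characters, \<open>det X\<^sub>+\<close> is trivial on \<open>T\<close>, so \<open>0\<close> is a positive combination of weights
  of \<open>X\<^sub>+\<close> and \<open>\<theta>\<close> lies in the cone spanned by the weights, i.e. in \<open>\<Sigma>\<close>. The weights of a point with
  infinite stabilizer are orthogonal to a nonzero cocharacter, and then genericity or nondegeneracy
  produces a destabilising cocharacter if \<open>t\<close> is large. The bound on \<open>t\<close> is uniform over all maximal
  tori, because only finitely many weight configurations occur: maximal tori are cut out of the
  diagonal matrices by equations of bounded degree.\<close>

text \<open>The threshold for t found by the convexity argument depends on the weights seen by a
  maximal torus, and different maximal tori are not compared by conjugation. Instead each torus of H
  is placed inside the diagonal torus of its own eigenspace decomposition. There all exponents are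
  bounded in terms of finitely many regular functions on \<open>GL n\<close>: equations for the Lie
  algebra of H, and the matrix entries of X and of Z on H. Only tuples of subsets of a finite box
  remain, and one threshold is chosen for each.

  Semisimplicity, as defined, speaks only of normal solvable subgroups, whereas triviality of
  characters is what the proof consumes. The bridge is Lie-theoretic. If a character is nontrivial
  on some one-parameter subgroup, the kernel k of its differential is a proper ideal, and the
  orthogonal complement q of k for the trace form is nonzero with tr ([x, y] z) = 0 on q. Cartan's
  trick and Engel's theorem give a nonzero commutative subspace of q stable under the adjoint
  action; the Zariski closure of its exponential is a nontrivial normal connected commutative
  subgroup.\<close>

unbundle no vec_syntax
no_notation fps_nth (infixl \<open>$\<close> 75)

abbreviation (input) GLs :: "nat => complex mat set" where "GLs n == carrier (GL n)"
abbreviation (input) sqm :: "nat => 'a mat set" where "sqm n == carrier_mat n n"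
abbreviation (input) ginv :: "nat => complex mat => complex mat" where "ginv n g == inv\<^bsub>GL n\<^esub> g"

section \<open>Regular functions\<close>

lemma GL_carrier: "A:GLs n \<longleftrightarrow> A:sqm n & det A ~= 0"
proof -
have "A:sqm n" if "A:Units (ring_mat TYPE(complex) n ())" using that unfolding Units_def ring_mat_simps by blast
thus ?thesis unfolding GL_def units_of_carrier
 using det_non_zero_imp_unit[of A n "()"] unit_imp_det_non_zero[of A n "()"] by blast
qed

lemma GL_mult [simp]: "x \<otimes>\<^bsub>GL n\<^esub> y = x * y" by (simp add: GL_def units_of_mult ring_mat_simps)

lemma GL_one [simp]: "\<one>\<^bsub>GL n\<^esub> = 1\<^sub>m n" by (simp add: GL_def units_of_one ring_mat_simps)

lemma group_GL: "group (GL n)"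
proof -
interpret ring "ring_mat TYPE(complex) n ()" by (rule ring_mat)
show ?thesis unfolding GL_def by (rule units_group)
qed

lemma GL_mat: "A:GLs n ==> A:sqm n" by (simp add: GL_carrier)

lemma GL_det: "A:GLs n ==> det A ~= 0" by (simp add: GL_carrier)

lemma GL_times: "A:GLs n ==> B:GLs n ==> A * B:GLs n"
using group.is_monoid[OF group_GL, of n] monoid.m_closed[of "GL n" A B] by simp

lemma GL_inv_closed: "A:GLs n ==> ginv n A:GLs n" using group.inv_closed[OF group_GL] by blast

lemma GL_inv_left: "A:GLs n ==> ginv n A * A = 1\<^sub>m n" using group.l_inv[OF group_GL, of A n] by simp

lemma GL_inv_right: "A:GLs n ==> A * ginv n A = 1\<^sub>m n" using group.r_inv[OF group_GL, of A n] by simp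

lemma GL_one_closed: "1\<^sub>m n:GLs n" by (simp add: GL_carrier)

lemma GL_inv_unique:
assumes "A:GLs n" "B:sqm n" "B * A = 1\<^sub>m n"
shows "ginv n A = B"
proof -
have "det B * det A = 1" using det_mult[OF assms(2) GL_mat[OF assms(1)]] assms(3) by simp
hence "B:GLs n" using assms(2) by (auto simp: GL_carrier)
thus ?thesis using group.inv_equality[OF group_GL] assms by simp
qed

lemma reg_cong:
"regular_on n S f ==> (!!g. g:S ==> f g = f' g) ==> regular_on n S f'" by (force simp: regular_on_def)

lemma regular_on_subset: "regular_on n S f ==> S' <= S ==> regular_on n S' f" by (auto simp: regular_on_def)

lemma regular_on_fun: "p:regular_fun n ==> regular_on n S p" by (auto simp: regular_on_def)

lemma reg_const: "regular_on n S (%_. c)" by (rule regular_on_fun) (rule regular_fun.const)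

lemma reg_entry: "i < n ==> j < n ==> regular_on n S (%A. A $$ (i, j))" by (rule regular_on_fun) (rule regular_fun.entry)

lemma regular_on_inverse_det: "regular_on n S (%A. 1 / det A)" by (rule regular_on_fun) (rule regular_fun.inverse_det)

lemma regular_on_add:
assumes "regular_on n S f" "regular_on n S g" shows "regular_on n S (%A. f A + g A)"
proof -
obtain p q where "p:regular_fun n" "!!g. g:S ==> f g = p g" "q:regular_fun n" "!!h. h:S ==> g h = q h"
 using assms by (auto simp: regular_on_def)
thus ?thesis unfolding regular_on_def by (intro bexI[OF _ regular_fun.add[of p n q]]) auto
qed

lemma reg_mult:
assumes "regular_on n S f" "regular_on n S g" shows "regular_on n S (%A. f A * g A)"
proof -
obtain p q where "p:regular_fun n" "!!g. g:S ==> f g = p g" "q:regular_fun n" "!!h. h:S ==> g h = q h"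
 using assms by (auto simp: regular_on_def)
thus ?thesis unfolding regular_on_def by (intro bexI[OF _ regular_fun.mult[of p n q]]) auto
qed

lemma regular_on_minus:
assumes "regular_on n S f" "regular_on n S g" shows "regular_on n S (%A. f A - g A)"
proof -
have "regular_on n S (%A. f A + (-1) * g A)" by (intro regular_on_add reg_mult reg_const assms)
thus ?thesis by simp
qed

lemma regular_on_sum:
"(!!i. i:I ==> regular_on n S (f i)) ==> regular_on n S (%A. SUM i:I. f i A)"
by (induction I rule: infinite_finite_induct) (simp_all add: reg_const regular_on_add)

lemma regular_on_prod:
"(!!i. i:I ==> regular_on n S (f i)) ==> regular_on n S (%A. PROD i:I. f i A)"
by (induction I rule: infinite_finite_induct) (simp_all add: reg_const reg_mult)

lemma regular_on_power: "regular_on n S f ==> regular_on n S (%A. f A ^ k)"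
by (induction k) (simp_all add: reg_const reg_mult)

lemma regular_on_det:
assumes "!!A. A:S ==> F A:sqm m" and "!!i j. i < m ==> j < m ==> regular_on n S (%A. F A $$ (i, j))"
shows "regular_on n S (%A. det (F A))"
proof (rule reg_cong)
show "regular_on n S (%A. SUM p:{p. p permutes {0..<m}}. signof p * (PROD i = 0..<m. F A $$ (i, p i)))"
 by (intro regular_on_sum reg_mult regular_on_prod reg_const assms)
  (auto simp: permutes_in_image)
show "(SUM p:{p. p permutes {0..<m}}. signof p * (PROD i = 0..<m. F A $$ (i, p i))) = det (F A)"
 if "A:S" for A using det_def'[OF assms(1)[OF that]] by simp
qed

lemma regular_on_times_entry:
assumes "!!A. A:S ==> F A:carrier_mat a b" "!!A. A:S ==> F' A:carrier_mat b c"
 and "!!i j. i < a ==> j < b ==> regular_on n S (%A. F A $$ (i, j))"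
 and "!!i j. i < b ==> j < c ==> regular_on n S (%A. F' A $$ (i, j))" and "i < a" "j < c"
shows "regular_on n S (%A. (F A * F' A) $$ (i, j))"
proof (rule reg_cong)
show "regular_on n S (%A. SUM l = 0..<b. F A $$ (i, l) * F' A $$ (l, j))"
 by (intro regular_on_sum reg_mult) (use assms in auto)
show "(SUM l = 0..<b. F A $$ (i, l) * F' A $$ (l, j)) = (F A * F' A) $$ (i, j)" if "A:S" for A
 using assms(1,2)[OF that] assms(5,6) by (auto simp: scalar_prod_def)
qed

lemma GL_inv_adj:
assumes "A:GLs n"
shows "ginv n A = (1 / det A) \<cdot>\<^sub>m adj_mat A"
proof (rule GL_inv_unique[OF assms])
have A: "A:sqm n" using assms by (simp add: GL_carrier)
note adj = adj_mat[OF A]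
show "(1 / det A) \<cdot>\<^sub>m adj_mat A:sqm n" using adj by simp
show "(1 / det A) \<cdot>\<^sub>m adj_mat A * A = 1\<^sub>m n" using adj(1,3) A GL_det[OF assms]
 by (simp add: mult_smult_assoc_mat[of _ n n _ n]) (auto intro!: eq_matI)
qed

text \<open>Cramer's rule: up to sign and the factor \<open>1 / det A\<close> the entry is a minor
  of size n - 1, and the entries of \<open>mat_delete A j i\<close> are entries of \<open>A\<close>
  with shifted indices.\<close>

lemma regular_on_inv_entry:
assumes "S <= GLs n" "i < n" "j < n"
shows "regular_on n S (%A. (ginv n A) $$ (i, j))"
proof (rule reg_cong)
show "regular_on n S (%A. 1 / det A * ((-1)^(j+i) * det (mat_delete A j i)))"
proof (intro reg_mult regular_on_inverse_det reg_const regular_on_det[where m = "n - 1"])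
 fix A assume "A:S"
 hence A: "A:sqm n" using assms GL_carrier by blast
 thus "mat_delete A j i:sqm (n - 1)" by (auto simp: mat_delete_def)
next
 fix i' j' assume "i' < n - 1" "j' < n - 1"
 hence "regular_on n S (%A. A $$ (if i' < j then i' else Suc i', if j' < i then j' else Suc j'))"
  by (intro reg_entry) (auto split: if_splits)
 thus "regular_on n S (%A. mat_delete A j i $$ (i', j'))"
 proof (rule reg_cong)
  fix A assume "A:S"
  hence "A:sqm n" using assms GL_carrier by blast
  thus "A $$ (if i' < j then i' else Suc i', if j' < i then j' else Suc j') = mat_delete A j i $$ (i', j')"
  using \<open>i' < n - 1\<close> \<open>j' < n - 1\<close> by (auto simp: mat_delete_def)
 qed
qed
fix A assume "A:S"
hence A: "A:GLs n" using assms by blast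
thus "1 / det A * ((-1)^(j+i) * det (mat_delete A j i)) = (ginv n A) $$ (i, j)" using GL_mat[OF A] assms(2,3)
 by (simp add: GL_inv_adj adj_mat_def cofactor_def)
qed

text \<open>Induction over the generators of the coordinate ring. Since \<open>1 / det\<close> is
  one of them and is no polynomial in the entries, regularity of \<open>1 / det (F A)\<close> has to
  be supplied along with that of the entries.\<close>

lemma regular_on_compose:
assumes "!!A. A:S ==> F A:S'" and "!!i j. i < m ==> j < m ==> regular_on n S (%A. F A $$ (i, j))"
 and "regular_on n S (%A. 1 / det (F A))" and "regular_on m S' p"
shows "regular_on n S (%A. p (F A))"
proof -
obtain q where q: "q:regular_fun m" "!!g. g:S' ==> p g = q g" using assms(4) by (auto simp: regular_on_def)
from q(1) have "regular_on n S (%A. q (F A))"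
proof induction
 case (add p q) thus ?case by (simp add: regular_on_add)
next
 case (mult p q) thus ?case by (simp add: reg_mult)
qed (use assms in \<open>simp_all add: reg_const\<close>)
thus ?thesis by (rule reg_cong) (use q assms(1) in auto)
qed

lemma regular_on_inv:
assumes S: "S <= GLs n" and p: "regular_on n S' p" and S': "!!A. A:S ==> ginv n A:S'"
shows "regular_on n S (%A. p (ginv n A))"
proof (rule regular_on_compose[OF S' _ _ p])
show "regular_on n S (%A. (ginv n A) $$ (i, j))" if "i < n" "j < n" for i j by (rule regular_on_inv_entry[OF S that])
have "regular_on n S (%A. det A)"
 by (rule regular_on_det[where m = n]) (use S in \<open>auto simp: GL_carrier reg_entry\<close>)
thus "regular_on n S (%A. 1 / det (ginv n A))"
proof (rule reg_cong)
 fix g assume "g:S"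
 hence g: "g:GLs n" using S by blast
 have "det (ginv n g) * det g = 1" using det_mult[OF GL_mat[OF GL_inv_closed[OF g]] GL_mat[OF g]]
  by (simp add: GL_inv_left[OF g])
 thus "det g = 1 / det (ginv n g)" by (metis mult.commute nonzero_eq_divide_eq mult_zero_left zero_neq_one)
qed
qed

lemma sub_GL:
assumes "subgroup G (GL n)"
shows "G <= GLs n" "1\<^sub>m n:G" "!!a b. a:G ==> b:G ==> a * b:G"
 "!!a. a:G ==> ginv n a:G" using subgroup.subset[OF assms] subgroup.one_closed[OF assms]
 subgroup.m_closed[OF assms] subgroup.m_inv_closed[OF assms] by auto

lemma alg_homD:
assumes "f:algebraic_hom n G m K"
shows "!!a. a:G ==> f a:K" "!!a b. a:G ==> b:G ==> f (a * b) = f a * f b"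
 "!!i j. i < m ==> j < m ==> regular_on n G (%g. f g $$ (i, j))" using assms by (auto simp: algebraic_hom_def hom_def)

lemma algebraic_hom_one_inv:
assumes f: "f:algebraic_hom n G m K" and G: "subgroup G (GL n)" and K: "K <= GLs m"
shows "f (1\<^sub>m n) = 1\<^sub>m m" "!!a. a:G ==> f (ginv n a) = ginv m (f a)"
proof -
note g = sub_GL[OF G] and h = alg_homD[OF f]
have f1: "f (1\<^sub>m n):GLs m" using h(1) g(2) K by blast
have "1\<^sub>m n * 1\<^sub>m n = (1\<^sub>m n :: complex mat)" by simp
hence "f (1\<^sub>m n) * f (1\<^sub>m n) = f (1\<^sub>m n)" using h(2) g(2) by metis
hence "f (1\<^sub>m n) \<otimes>\<^bsub>GL m\<^esub> f (1\<^sub>m n) = f (1\<^sub>m n) \<otimes>\<^bsub>GL m\<^esub> \<one>\<^bsub>GL m\<^esub>"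
 using GL_mat[OF f1] by simp
thus one: "f (1\<^sub>m n) = 1\<^sub>m m"
 using group.l_cancel_one[OF group_GL f1 f1] right_mult_one_mat[OF GL_mat[OF f1]] by simp
fix a assume a: "a:G"
hence "f (ginv n a) * f a = 1\<^sub>m m" using h(2)[of "ginv n a" a] g(4) GL_inv_left[of a n] g(1) one by auto
thus "f (ginv n a) = ginv m (f a)" using GL_inv_unique[of "f a" m "f (ginv n a)"] h(1)[OF a] h(1)[OF g(4)[OF a]] K
 by (metis GL_mat subsetD)
qed

text \<open>An algebraic homomorphism is only known to have regular entries. That
  \<open>1 / det (f g)\<close> is regular as well follows from the group structure: it is the
  determinant of \<open>f\<close> at the inverse of \<open>g\<close>, and inversion is
  regular.\<close>

lemma regular_on_algebraic_hom:
assumes f: "f:algebraic_hom n G m K" and G: "subgroup G (GL n)" and K: "K <= GLs m" and q: "regular_on m K q"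
shows "regular_on n G (%g. q (f g))"
proof (rule regular_on_compose[where S' = K and m = m])
note g = sub_GL[OF G] and h = alg_homD[OF f]
show "!!A. A:G ==> f A:K" by (rule h)
show "!!i j. i < m ==> j < m ==> regular_on n G (%A. f A $$ (i, j))" by (rule h)
have "regular_on n G (%A. det (f A))"
 by (rule regular_on_det[where m = m]) (use h(1) K in \<open>auto intro: GL_mat h(3)\<close>)
hence "regular_on n G (%A. det (f (ginv n A)))" by (rule regular_on_inv[OF g(1)]) (rule g(4))
thus "regular_on n G (%A. 1 / det (f A))"
proof (rule reg_cong)
 fix a assume a: "a:G"
 have fa: "f a:GLs m" using a h(1) K by blast
 have "det (ginv m (f a)) * det (f a) = 1" using det_mult[OF GL_mat[OF GL_inv_closed[OF fa]] GL_mat[OF fa]]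
  by (simp add: GL_inv_left[OF fa])
 thus "det (f (ginv n a)) = 1 / det (f a)" unfolding algebraic_hom_one_inv(2)[OF f G K a]
  by (metis mult.commute nonzero_eq_divide_eq mult_zero_left zero_neq_one)
qed
qed (rule q)

section \<open>Lie algebras inside an associative algebra\<close>

text \<open>A basis of \<open>S\<close> extends to one of \<open>T\<close>. The finite set
  \<open>B\<close> is there because the ambient space may have infinite dimension, and an infinite
  basis would have cardinality 0.\<close>

lemma (in vector_space) dim_psubset_span:
assumes "subspace S" "S \<subset> T" "T <= span B" "finite B"
shows "dim S < dim T"
proof -
obtain b where b: "b <= S" "independent b" "S <= span b" "card b = dim S" using basis_exists by blast
obtain c where c: "b <= c" "c <= T" "independent c" "T <= span c"
 using maximal_independent_subset_extend[of b T] b assms(2) by (metis psubset_imp_subset subset_trans)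
have fc: "finite c" using independent_span_bound[OF assms(4) c(3)] c(2) assms(3) by blast
have "card c = dim T" using basis_card_eq_dim[OF c(2,4,3)] by simp
moreover have "b ~= c"
proof
 assume "b = c"
 hence "T <= S" using c(4) b(1) assms(1) span_minimal by blast
 thus False using assms(2) by blast
qed
ultimately show ?thesis using psubset_card_mono[OF fc, of b] c(1) b(4) by auto
qed

text \<open>The algebra may be of infinite dimension, so that one ring can house matrices of every
  size; finiteness enters the theorems through a finite spanning set \<open>B\<close>.\<close>

locale complex_algebra = vector_space scale for scale :: "complex => 'a::ring_1 => 'a" (infixr "\<star>" 75) +
assumes scale_mult_left: "(c \<star> x) * y = c \<star> (x * y)" and scale_mult_right: "x * (c \<star> y) = c \<star> (x * y)"
begin

definition br :: "'a => 'a => 'a" where "br x y = x * y - y * x"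

lemma br_add: "br (x + y) z = br x z + br y z" "br x (y + z) = br x y + br x z" by (simp_all add: br_def algebra_simps)

lemma br_scale: "br (c \<star> x) y = c \<star> br x y" "br x (c \<star> y) = c \<star> br x y"
by (simp_all add: br_def scale_mult_left scale_mult_right scale_right_diff_distrib)

lemma br_zero [simp]: "br 0 x = 0" "br x 0 = 0" by (simp_all add: br_def)

lemma br_sum: "br x (SUM i:I. f i) = (SUM i:I. br x (f i))" by (simp add: br_def sum_distrib_left sum_distrib_right sum_subtractf)

lemma jacobi: "br m (br x u) = br (br m x) u + br x (br m u)" by (simp add: br_def algebra_simps)

text \<open>Left multiplication by \<open>l\<close> and right multiplication by \<open>r\<close>
  commute, so the power 2k of their difference lands in the span of the products
  \<open>l ^ i * z * r ^ j\<close> with i + j = 2k. In each of them i or j is at least k. Working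
  with the span avoids binomial coefficients.\<close>

lemma two_sided_nilpotent:
fixes l z r :: 'a
assumes l: "l ^ k * z = 0" and r: "z * r ^ k = 0"
shows "((%z. l * z - z * r) ^^ (2 * k)) z = 0"
proof -
have "((%z. l * z - z * r) ^^ m) z:span {l ^ i * z * r ^ j | i j. i + j = m}" for m
proof (induction m)
 case 0
 thus ?case by (auto intro!: span_base exI[of _ 0])
next
 case (Suc m)
 have "l * w - w * r:span {l ^ i * z * r ^ j | i j. i + j = Suc m}" if "w:span {l ^ i * z * r ^ j | i j. i + j = m}" for w
  using that
 proof (induction rule: span_induct_alt)
  case base
  thus ?case by (simp add: span_zero)
 next
  case (step c x y)
  obtain i j where ij: "x = l ^ i * z * r ^ j" "i + j = m" using step by auto
  have "l * x = l ^ Suc i * z * r ^ j" "x * r = l ^ i * z * r ^ Suc j" by (simp_all add: ij(1) mult.assoc power_commutes)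
  moreover have "Suc i + j = Suc m" "i + Suc j = Suc m" using ij(2) by simp_all
  ultimately have 1: "l * x:span {l ^ i * z * r ^ j | i j. i + j = Suc m}"
  and 2: "x * r:span {l ^ i * z * r ^ j | i j. i + j = Suc m}" by (blast intro: span_base)+
  have "l * (c \<star> x + y) - (c \<star> x + y) * r = c \<star> (l * x - x * r) + (l * y - y * r)"
  by (simp add: algebra_simps scale_mult_left scale_mult_right scale_right_diff_distrib)
  thus ?case using 1 2 step.IH by (simp add: span_add span_diff span_scale)
 qed
 thus ?case using Suc by simp
qed
from this[of "2 * k"] have "((%z. l * z - z * r) ^^ (2 * k)) z :span {l ^ i * z * r ^ j | i j. i + j = 2 * k}" .
moreover have "{l ^ i * z * r ^ j | i j. i + j = 2 * k} <= {0}"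
proof clarify
 fix i j assume ij: "i + j = 2 * k"
 show "l ^ i * z * r ^ j = 0"
 proof (cases "i >= k")
  case True
  hence "l ^ i = l ^ (i - k) * l ^ k" by (simp add: power_add[symmetric])
  hence "l ^ i * z = 0" using l by (simp add: mult.assoc)
  thus ?thesis by simp
 next
  case False
  hence "r ^ j = r ^ k * r ^ (j - k)" using ij by (simp add: power_add[symmetric])
  hence "z * r ^ j = 0" using r by (simp flip: mult.assoc)
  thus ?thesis by (simp add: mult.assoc)
 qed
qed
ultimately show ?thesis by (metis (no_types, lifting) empty_iff insert_iff span_empty span_insert_0 span_mono subset_iff)
qed

definition ad_nilpotent :: "'a => bool" where
"ad_nilpotent x \<longleftrightarrow> (ALL z. EX k. (br x ^^ k) z = 0)"

lemma nilpotent_imp_ad_nilpotent: "x ^ k = 0 ==> ad_nilpotent x"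
using two_sided_nilpotent[of x k _ x] unfolding ad_nilpotent_def br_def[abs_def] by auto

text \<open>Engel's theorem for the adjoint action on the quotient of \<open>U\<close> by
  \<open>U'\<close>. The relative form is what the induction on dim L consumes: for a proper
  subalgebra \<open>M\<close> of maximal dimension it is applied both to the action of
  \<open>M\<close> on \<open>L / M\<close> and to that on \<open>U / U'\<close>.\<close>

lemma engel:
assumes "subspace L" "L <= span B" "finite B" and "!!x y. x:L ==> y:L ==> br x y:L" "!!x. x:L ==> ad_nilpotent x"
 and "subspace U" "subspace U'" "U' \<subset> U" and "!!x u. x:L ==> u:U ==> br x u:U" "!!x u. x:L ==> u:U' ==> br x u:U'"
shows "EX u:U - U'. ALL x:L. br x u:U'" using assms
proof (induction "dim L" arbitrary: L U U' rule: less_induct)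
case (less L U U')
note L = less.prems(1,2) and fin = less.prems(3) and Lbr = less.prems(4) and Lnil = less.prems(5)
 and U = less.prems(6,7,8) and LU = less.prems(9) and LU' = less.prems(10)
show ?case
proof (cases "L = {0}")
 case True
 thus ?thesis using U subspace_0[OF U(2)] by auto
next
 case False
 define P where "P M \<longleftrightarrow> subspace M & M \<subset> L & (ALL x:M. ALL y:M. br x y:M)" for M
 have "P {0}" using False subspace_0[OF L(1)] by (auto simp: P_def)
 moreover have lt: "dim M < dim L" if "P M" for M using dim_psubset_span[OF _ _ L(2) fin] that by (auto simp: P_def)
 ultimately have "EX M. P M & (ALL N. P N --> dim N <= dim M)"
  by (intro ex_has_greatest_nat[of P "{0}" dim "dim L"]) (auto intro: less_imp_le)
 then obtain M where M: "P M" and max: "!!N. P N ==> dim N <= dim M" by blast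
 have M': "subspace M" "M \<subset> L" "!!x y. x:M ==> y:M ==> br x y:M" "dim M < dim L" using M lt[OF M] by (simp_all add: P_def)
 have MB: "M <= span B" using M'(2) L(2) by blast
 \<comment> \<open>The induction hypothesis for \<open>M\<close> acting on \<open>L / M\<close>
   gives an element outside \<open>M\<close> that normalises \<open>M\<close>.\<close>
 have "EX u:L - M. ALL x:M. br x u:M" by (rule less.hyps[OF M'(4,1) MB fin M'(3) _ L(1) M'(1,2)]) (use M' Lnil Lbr in auto)
 then obtain x where x: "x:L" "x \<notin> M" "!!m. m:M ==> br m x:M" by blast
 define N where "N = {m + c \<star> x | m c. m:M}"
 \<comment> \<open>\<open>N\<close> is a subalgebra because \<open>x\<close> normalises
   \<open>M\<close>, and it is strictly larger than \<open>M\<close>, so maximality of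
   \<open>M\<close> leaves only L. Thus \<open>M\<close> is an ideal of codimension one.\<close>
 have "N = L"
 proof (rule ccontr)
  assume "N ~= L"
  have N: "subspace N"
  proof (rule subspaceI)
  have "0 + 0 \<star> x:N" unfolding N_def using subspace_0[OF M'(1)] by blast
  thus "0:N" by simp
  fix a b assume "a:N" "b:N"
  then obtain m c m' c' where "a = m + c \<star> x" "b = m' + c' \<star> x" "m:M" "m':M" by (auto simp: N_def)
  hence "a + b = (m + m') + (c + c') \<star> x" "m + m':M" by (simp_all add: scale_left_distrib subspace_add[OF M'(1)])
  thus "a + b:N" unfolding N_def by blast
  next
  fix d a assume "a:N"
  then obtain m c where "a = m + c \<star> x" "m:M" by (auto simp: N_def)
  hence "d \<star> a = d \<star> m + (d * c) \<star> x" "d \<star> m:M"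
   by (auto simp: scale_right_distrib subspace_scale[OF M'(1)])
  thus "d \<star> a:N" unfolding N_def by blast
  qed
  have "N <= L" unfolding N_def using M'(2) x(1) by (auto intro!: subspace_add[OF L(1)] subspace_scale[OF L(1)])
  note \<open>N <= L\<close>
  moreover have "br a b:N" if ab: "a:N" "b:N" for a b
  proof -
  obtain m c m' c' where e: "a = m + c \<star> x" "b = m' + c' \<star> x" "m:M" "m':M" using ab by (auto simp: N_def)
  have "br x x = 0" by (simp add: br_def)
  moreover have "br x m' = - br m' x" by (simp add: br_def)
  ultimately have "br a b = br m m' + c' \<star> br m x - c \<star> br m' x" unfolding e by (simp add: br_add br_scale)
  moreover have "br m m' + c' \<star> br m x - c \<star> br m' x:M"
   using e x(3) M'(3) by (intro subspace_diff[OF M'(1)] subspace_add[OF M'(1)] subspace_scale[OF M'(1)]) auto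
  ultimately have "br a b:M" by simp
  hence "br a b + 0 \<star> x:N" unfolding N_def by blast
  thus ?thesis by simp
  qed
  ultimately have "P N" using \<open>N ~= L\<close> N by (auto simp: P_def)
  moreover have "M \<subset> N"
  proof
  show "M <= N"
  proof
   fix m assume "m:M"
   hence "m + 0 \<star> x:N" unfolding N_def by blast
   thus "m:N" by simp
  qed
  have "0 + 1 \<star> x:N" unfolding N_def using subspace_0[OF M'(1)] by blast
  thus "M ~= N" using x(2) by auto
  qed
  ultimately have "dim M < dim N" using dim_psubset_span[OF M'(1) _ _ fin, of N] L(2) \<open>N <= L\<close> by blast
  with max[OF \<open>P N\<close>] show False by simp
 qed
 \<comment> \<open>Vectors killed by \<open>M\<close> modulo \<open>U'\<close>. By the induction
   hypothesis not all of them lie in \<open>U'\<close>, and by the Jacobi identity \<open>x\<close>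
   preserves them. The last iterate of \<open>br x\<close> on \<open>u0\<close> that is still
   outside \<open>U'\<close> is killed by \<open>M\<close> and by \<open>x\<close>, hence by
   L.\<close>
 define U1 where "U1 = {u:U. ALL m:M. br m u:U'}"
 have "EX u:U - U'. ALL x:M. br x u:U'" by (rule less.hyps[OF M'(4,1) MB fin M'(3) _ U]) (use M' Lnil LU LU' in auto)
 then obtain u0 where u0: "u0:U1" "u0 \<notin> U'" by (auto simp: U1_def)
 have xU1: "br x u:U1" if u: "u:U1" for u
 proof -
  have "br m (br x u):U'" if m: "m:M" for m
  using u m x M'(2) LU' subspace_add[OF U(2), of "br (br m x) u" "br x (br m u)"] jacobi[of m x u] by (auto simp: U1_def)
  thus ?thesis using u LU x(1) by (auto simp: U1_def)
 qed
 obtain k where "(br x ^^ k) u0 = 0" using Lnil[OF x(1)] by (auto simp: ad_nilpotent_def)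
 hence "(br x ^^ k) u0:U'" using subspace_0[OF U(2)] by simp
 hence ex: "EX k. (br x ^^ k) u0:U'" ..
 define k0 where "k0 = (LEAST k. (br x ^^ k) u0:U')"
 have k0: "(br x ^^ k0) u0:U'" unfolding k0_def by (rule LeastI_ex[OF ex])
 have "k0 ~= 0" using k0 u0 by (auto intro!: Nat.gr0I)
 then obtain k1 where k1: "k0 = Suc k1" by (cases k0) auto
 have "(br x ^^ k1) u0 \<notin> U'" using not_less_Least[of k1 "%k. (br x ^^ k) u0:U'"] k1 unfolding k0_def by auto
 moreover have "(br x ^^ k) u0:U1" for k by (induction k) (use u0 xU1 in auto)
 moreover have "br x ((br x ^^ k1) u0):U'" using k0 k1 by simp
 ultimately obtain u where u: "u:U1" "u \<notin> U'" "br x u:U'" by blast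
 have "br y u:U'" if "y:L" for y
 proof -
  obtain m c where y: "y = m + c \<star> x" "m:M" using \<open>y:L\<close> \<open>N = L\<close> by (auto simp: N_def)
  hence "br y u = br m u + c \<star> br x u" by (simp add: br_add br_scale)
  moreover have "br m u:U'" using y u by (auto simp: U1_def)
  ultimately show ?thesis using u(3) by (simp add: subspace_add[OF U(2)] subspace_scale[OF U(2)])
 qed
 thus ?thesis using u by (auto simp: U1_def)
qed
qed

text \<open>The operators f - a and f - b differ by the nonzero scalar b - a. By induction on i + j
  both send \<open>m\<close> into \<open>K\<close>, hence so does their difference, which is a
  multiple of the identity. This replaces an appeal to coprime polynomials in f.\<close>

lemma generalized_eigen_coprime:
assumes K: "subspace K" and stab: "!!z. z:K ==> f z:K"
 and lin: "!!y z. f (y - z) = f y - f z" "!!c z. f (c \<star> z) = c \<star> f z" and ab: "a ~= b"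
 and "((%z. f z - a \<star> z) ^^ i) m:K" "((%z. f z - b \<star> z) ^^ j) m:K"
shows "m:K" using assms(6,7)
proof (induction "i + j" arbitrary: i j m rule: less_induct)
case (less i j m)
show ?case
proof (cases "i = 0 \<or> j = 0")
 case True
 thus ?thesis using less.prems by auto
next
 case False
 then obtain i' j' where ij: "i = Suc i'" "j = Suc j'" by (meson not0_implies_Suc)
 let ?fa = "%z. f z - a \<star> z" and ?fb = "%z. f z - b \<star> z"
 have st: "?fa z:K" "?fb z:K" if "z:K" for z using that by (simp_all add: subspace_diff[OF K] subspace_scale[OF K] stab)
 have comm: "?fa (?fb z) = ?fb (?fa z)" for z by (simp add: lin scale_right_diff_distrib algebra_simps)
 have ab': "?fa ((?fb ^^ j) z) = (?fb ^^ j) (?fa z)" for j z by (induction j) (simp_all add: comm)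
 have ba': "?fb ((?fa ^^ i) z) = (?fa ^^ i) (?fb z)" for i z by (induction i) (simp_all flip: comm)
 have sti: "(?fa ^^ i) m:K ==> (?fa ^^ i) (?fb m):K" for i using st(2) by (simp flip: ba')
 have stj: "(?fb ^^ j) m:K ==> (?fb ^^ j) (?fa m):K" for j using st(1) by (simp flip: ab')
 have 1: "?fa m:K"
 proof (rule less.hyps)
  show "(?fa ^^ i') (?fa m):K" using less.prems(1) unfolding ij funpow_Suc_right comp_def .
  show "(?fb ^^ j) (?fa m):K" by (rule stj[OF less.prems(2)])
 qed (simp add: ij)
 have 2: "?fb m:K"
 proof (rule less.hyps)
  show "(?fa ^^ i) (?fb m):K" by (rule sti[OF less.prems(1)])
  show "(?fb ^^ j') (?fb m):K" using less.prems(2) unfolding ij funpow_Suc_right comp_def .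
 qed (simp add: ij)
 have "inverse (b - a) \<star> (?fa m - ?fb m):K" by (intro subspace_scale[OF K] subspace_diff[OF K] 1 2)
 moreover have "?fa m - ?fb m = (b - a) \<star> m" by (simp add: scale_left_diff_distrib)
 ultimately show ?thesis using ab by simp
qed
qed

text \<open>Applying the N-th power of f - a removes the component of eigenvalue a modulo
  \<open>K\<close>; by induction the images of the other components lie in \<open>K\<close>, and
  \<open>generalized_eigen_coprime\<close> undoes the power. It serves to show that an f-stable
  subspace contains the generalised eigencomponents of its elements.\<close>

lemma generalized_eigen_components:
assumes K: "subspace K" and stab: "!!z. z:K ==> f z:K"
 and lin: "!!y z. f (y + z) = f y + f z" "!!c z. f (c \<star> z) = c \<star> f z"
 and F: "finite F" and "!!mu. mu:F ==> ((%z. f z - mu \<star> z) ^^ N) (m mu):K" and "(SUM mu:F. m mu):K"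
shows "ALL mu:F. m mu:K" using F assms(6,7)
proof (induction F arbitrary: m rule: finite_induct)
case empty
thus ?case by simp
next
case (insert a F)
have f0: "f 0 = 0" using lin(2)[of 0 0] by simp
have fneg: "f (- z) = - f z" for z using lin(2)[of "-1" z] by simp
have lind: "f (y - z) = f y - f z" for y z using lin(1)[of y "- z"] fneg by simp
let ?g = "%z. (((%z. f z - a \<star> z) ^^ N) z)"
have g_lin: "?g (y + z) = ?g y + ?g z" "?g 0 = 0" for y z by (induction N) (simp_all add: lin f0 scale_right_distrib)
have g_sum: "?g (SUM mu:F. m mu) = (SUM mu:F. ?g (m mu))"
 using insert(1) by (induction F rule: finite_induct) (simp_all add: g_lin)
have st: "f z - b \<star> z:K" if "z:K" for z b using that by (simp add: subspace_diff[OF K] subspace_scale[OF K] stab)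
have g_st: "?g z:K" if "z:K" for z using that by (induction N) (auto simp: st)
have comm: "f (f z - b \<star> z) - a \<star> (f z - b \<star> z) = f (f z - a \<star> z) - b \<star> (f z - a \<star> z)" for z b
 by (simp add: lin lind scale_right_diff_distrib algebra_simps)
have comm2: "f (((%z. f z - b \<star> z) ^^ k) z) - a \<star> (((%z. f z - b \<star> z) ^^ k) z)
  = ((%z. f z - b \<star> z) ^^ k) (f z - a \<star> z)" for z b k by (induction k) (simp_all add: comm)
have comm3: "?g (((%z. f z - b \<star> z) ^^ k) z) = ((%z. f z - b \<star> z) ^^ k) (?g z)" for z b k
 by (induction N) (simp_all add: comm2)
have "?g (SUM mu:insert a F. m mu):K" using g_st insert.prems(2) by blast
hence "?g (m a) + (SUM mu:F. ?g (m mu)):K" using insert(1,2) by (simp add: g_lin g_sum)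
moreover have gaK: "?g (m a):K" using insert.prems(1) by blast
ultimately have s: "(SUM mu:F. ?g (m mu)):K" using subspace_diff[OF K, of "?g (m a) + (SUM mu:F. ?g (m mu))" "?g (m a)"] by simp
have "ALL mu:F. ?g (m mu):K"
proof (rule insert.IH[OF _ s])
 fix mu assume "mu:F"
 hence "?g (((%z. f z - mu \<star> z) ^^ N) (m mu)):K" using insert.prems(1) g_st by blast
 thus "((%z. f z - mu \<star> z) ^^ N) (?g (m mu)):K" by (simp add: comm3)
qed
hence F: "m mu:K" if "mu:F" for mu
 using generalized_eigen_coprime[OF K stab lind lin(2), of a mu N "m mu" N] insert.hyps insert.prems(1) that by auto
hence "(SUM mu:F. m mu):K" by (rule subspace_sum[OF K])
hence "m a:K" using insert.prems(2) insert.hyps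
 subspace_diff[OF K, of "(SUM mu:insert a F. m mu)" "SUM mu:F. m mu"] by simp
thus ?case using F by auto
qed

end

context complex_algebra
begin

text \<open>The elements \<open>e a\<close> stand for the projections onto the generalised
  eigenspaces of \<open>x\<close>. Their traces are the multiplicities, of which only this is
  retained: they are nonnegative reals and vanish only for the zero projection. \<open>p\<close> is
  the unit of \<open>A\<close>, which may differ from the unit of the surrounding ring.\<close>

definition spectral ::
"'a set => ('a => complex) => 'a => 'a => complex set => (complex => 'a) => nat => bool" where
"spectral A tr p x F e K \<longleftrightarrow> finite F &
 (ALL a:F. e a:A & x * e a = e a * x & (x - a \<star> 1) ^ K * e a = 0 & tr (x * e a) = a * tr (e a) &
  (EX r>=0. tr (e a) = of_real r & (r = 0 --> e a = 0))) &
 (ALL a:F. ALL b:F. e a * e b = (if a = b then e a else 0)) & (SUM a:F. e a) = p"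

text \<open>Cartan's trick: pair \<open>x\<close> with the complex conjugate \<open>y\<close> of its semisimple part. As \<open>m\<close> is
  stable under the derivation \<open>br x\<close>, it is stable under \<open>br y\<close>, whence
  \<open>0 = tr (x * y)\<close>, a sum of squared moduli of eigenvalues.\<close>

lemma cartan_nilpotent:
assumes A: "subspace A" and mult: "!!x y. x:A ==> y:A ==> x * y:A" and p: "!!x. x:A ==> p * x = x" "!!x. x:A ==> x * p = x"
 and tr: "!!x y. tr (x + y) = tr x + tr y" "!!c x. tr (c \<star> x) = c * tr x"
 and tr_comm: "!!x y. x:A ==> y:A ==> tr (x * y) = tr (y * x)" and m: "subspace m" "m <= A" "m = span {br x y | x y. x:m & y:m}"
 and m_br: "!!x y. x:m ==> y:m ==> br x y:m" and tr0: "!!x y. x:m ==> y:m ==> tr (x * y) = 0"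
 and x: "x:m" and spec: "EX F e K. spectral A tr p x F e K"
shows "EX k. x ^ k = 0"
proof -
obtain F e K where "spectral A tr p x F e K" using spec by blast
hence F: "finite F" and e: "!!a. a:F ==> e a:A" "!!a. a:F ==> x * e a = e a * x"
  "!!a. a:F ==> (x - a \<star> 1) ^ K * e a = 0" "!!a. a:F ==> tr (x * e a) = a * tr (e a)"
  "!!a. a:F ==> EX r>=0. tr (e a) = of_real r & (r = 0 --> e a = 0)"
 and ee: "!!a b. a:F ==> b:F ==> e a * e b = (if a = b then e a else 0)" and sum_e: "(SUM a:F. e a) = p"
 unfolding spectral_def by blast+
have tr_zero: "tr 0 = 0" using tr(2)[of 0 0] by simp
have tr_sum: "tr (SUM a:I. f a) = (SUM a:I. tr (f a))" for I :: "'i set" and f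
 by (induction I rule: infinite_finite_induct) (simp_all add: tr tr_zero)
have tr_diff: "tr (u - v) = tr u - tr v" for u v using tr(1)[of "u - v" v] by simp
define y where "y = (SUM a:F. cnj a \<star> e a)"
have yA: "y:A" unfolding y_def by (intro subspace_sum[OF A] subspace_scale[OF A] e(1))
have ye: "y * e b = cnj b \<star> e b" "e b * y = cnj b \<star> e b" if "b:F" for b
proof -
 have "y * e b = (SUM a:F. if a = b then cnj b \<star> e b else 0)" unfolding y_def sum_distrib_right scale_mult_left
  by (rule sum.cong) (use that ee in auto)
 thus "y * e b = cnj b \<star> e b" using that F by simp
 have "e b * y = (SUM a:F. if a = b then cnj b \<star> e b else 0)" unfolding y_def sum_distrib_left scale_mult_right
  by (rule sum.cong) (use that ee in auto)
 thus "e b * y = cnj b \<star> e b" using that F by simp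
qed
have y_stab: "br y z:m" if z: "z:m" for z
proof -
 have zA: "z:A" using z m(2) by blast
 let ?Q = "%ab. fst ab - snd ab"
 define c where "c ab = e (fst ab) * z * e (snd ab)" for ab
 \<comment> \<open>Each \<open>e a * z * e b\<close> is a generalised eigenvector of
   \<open>br x\<close> for a - b and an eigenvector of \<open>br y\<close> for the conjugate of a -
   b. Pairs with the same difference are collected, and it is these sums that
   \<open>generalized_eigen_components\<close> places in \<open>m\<close>.\<close>
 define n where "n mu = (SUM ab:{ab:F \<times> F. ?Q ab = mu}. c ab)" for mu
 have "z = p * z * p" using p zA by simp
 also have "... = (SUM a:F. SUM b:F. e a * z * e b)"
  unfolding sum_e[symmetric] by (subst sum.swap) (simp add: sum_distrib_left sum_distrib_right)
 also have "... = (SUM ab:F \<times> F. c ab)" by (simp add: c_def sum.cartesian_product case_prod_unfold)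
 finally have z_c: "z = (SUM ab:F \<times> F. c ab)" .
 also have "... = (SUM mu:?Q ` (F \<times> F). n mu)" unfolding n_def by (rule sum.image_gen) (use F in simp)
 finally have z_n: "z = (SUM mu:?Q ` (F \<times> F). n mu)" .
 have gen: "((%w. br x w - ?Q ab \<star> w) ^^ (2 * K)) (c ab) = 0" if ab: "ab:F \<times> F" for ab
 proof -
  let ?l = "x - fst ab \<star> 1" and ?r = "x - snd ab \<star> 1"
  have D: "(%w. br x w - ?Q ab \<star> w) = (%w. ?l * w - w * ?r)"
  by (simp add: fun_eq_iff br_def algebra_simps scale_mult_left scale_mult_right scale_left_diff_distrib)
  have "?l ^ K * c ab = 0" unfolding c_def using e(3)[of "fst ab"] ab by (auto simp flip: mult.assoc)
  moreover have "e (snd ab) * ?r ^ K = ?r ^ K * e (snd ab)"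
  proof (induction K)
  case (Suc K)
  have "e (snd ab) * ?r = ?r * e (snd ab)" using e(2)[of "snd ab"] ab
   by (auto simp: algebra_simps scale_mult_left scale_mult_right)
  hence "e (snd ab) * ?r ^ Suc K = ?r * (e (snd ab) * ?r ^ K)" by (simp flip: mult.assoc)
  thus ?case by (simp add: Suc mult.assoc)
  qed simp
  hence "c ab * ?r ^ K = 0" unfolding c_def using e(3)[of "snd ab"] ab by (auto simp: mult.assoc)
  ultimately show ?thesis unfolding D by (rule two_sided_nilpotent)
 qed
 have lin0: "((%w. br x w - mu \<star> w) ^^ k) (SUM i:I. f i) = (SUM i:I. ((%w. br x w - mu \<star> w) ^^ k) (f i))"
  for I :: "(complex \<times> complex) set" and f mu k by (induction k) (simp_all add: br_sum sum_subtractf scale_sum_right)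
 have n_m: "ALL mu:?Q ` (F \<times> F). n mu:m"
 proof (rule generalized_eigen_components[OF m(1), of "br x" _ "2 * K"])
  show "br x w:m" if "w:m" for w by (rule m_br[OF x that])
  show "((%z. br x z - mu \<star> z) ^^ (2 * K)) (n mu):m" for mu
  proof -
  have "((%z. br x z - mu \<star> z) ^^ (2 * K)) (n mu) = 0" unfolding n_def lin0 by (rule sum.neutral) (use gen in auto)
  thus ?thesis using subspace_0[OF m(1)] by simp
  qed
  show "(SUM mu:?Q ` (F \<times> F). n mu):m" using z z_n by simp
 qed (use F in \<open>simp_all add: br_add br_scale\<close>)
 have "br y (c ab) = cnj (?Q ab) \<star> c ab" if "ab:F \<times> F" for ab
 proof -
  have "y * e (fst ab) = cnj (fst ab) \<star> e (fst ab)" "e (snd ab) * y = cnj (snd ab) \<star> e (snd ab)" using ye that by auto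
  thus ?thesis unfolding br_def c_def mult.assoc[symmetric]
  by (simp add: mult.assoc scale_left_diff_distrib scale_mult_left scale_mult_right)
 qed
 hence "br y (n mu) = cnj mu \<star> n mu" for mu unfolding n_def br_sum scale_sum_right by (intro sum.cong) auto
 hence "br y z = (SUM mu:?Q ` (F \<times> F). cnj mu \<star> n mu)" by (subst z_n) (simp add: br_sum)
 thus ?thesis using n_m by (auto intro!: subspace_sum[OF m(1)] subspace_scale[OF m(1)])
qed
\<comment> \<open>\<open>m\<close> is spanned by brackets, and tr ([u, v] y) = - tr (u [y, v]),
  where [y, v] lies in \<open>m\<close> by \<open>y_stab\<close>. So vanishing of the trace form on
  \<open>m\<close> extends to pairs with \<open>y\<close>, although \<open>y\<close> need not lie in
  \<open>m\<close>.\<close>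
have tr_y: "tr (w * y) = 0" if "w:m" for w
proof -
 have "w:span {br x y | x y. x:m & y:m}" using that m(3) by blast
 thus ?thesis
 proof (induction rule: span_induct_alt)
  case base
  thus ?case by (simp add: tr_zero)
 next
  case (step d b w)
  then obtain u v where uv: "b = br u v" "u:m" "v:m" by blast
  have inA: "u:A" "v:A" "v * y:A" "u * y:A" using uv m(2) mult yA by auto
  have "tr (b * y) = tr (u * (v * y)) - tr (v * (u * y))" unfolding uv br_def by (simp add: left_diff_distrib tr_diff mult.assoc)
  also have "tr (v * (u * y)) = tr (u * (y * v))" using tr_comm[OF inA(2,4)] by (simp add: mult.assoc)
  also have "tr (u * (v * y)) - tr (u * (y * v)) = - tr (u * br y v)" by (simp add: br_def right_diff_distrib tr_diff)
  also have "... = 0" using tr0[OF uv(2) y_stab[OF uv(3)]] by simp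
  finally show ?case using step.IH by (simp add: distrib_right tr scale_mult_left)
 qed
qed
have "tr (x * y) = (SUM a:F. cnj a * (a * tr (e a)))"
 unfolding y_def by (simp add: sum_distrib_left scale_mult_right tr_sum tr e(4))
also have "... = (SUM a:F. of_real ((cmod a)\<^sup>2 * Re (tr (e a))))"
proof (rule sum.cong[OF refl])
 fix a assume "a:F"
 then obtain r where r: "tr (e a) = of_real r" using e(5) by blast
 show "cnj a * (a * tr (e a)) = of_real ((cmod a)\<^sup>2 * Re (tr (e a)))" unfolding r of_real_mult complex_norm_square by simp
qed
finally have "of_real (SUM a:F. (cmod a)\<^sup>2 * Re (tr (e a))) = (0 :: complex)" using tr_y[OF x] unfolding of_real_sum by simp
hence "(SUM a:F. (cmod a)\<^sup>2 * Re (tr (e a))) = 0" unfolding of_real_eq_0_iff .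
moreover have nonneg: "0 <= (cmod a)\<^sup>2 * Re (tr (e a))" if a: "a:F" for a using e(5)[OF a] by auto
ultimately have zero: "(cmod a)\<^sup>2 * Re (tr (e a)) = 0" if "a:F" for a
 using sum_nonneg_eq_0_iff[OF F, of "%a. (cmod a)\<^sup>2 * Re (tr (e a))"] that by blast
have e0: "e a = 0" if a: "a:F" "a ~= 0" for a using zero[OF a(1)] e(5)[OF a(1)] a(2) by auto
have "x ^ K * e a = 0" if "a:F" for a using e(3)[OF that] e0[OF that] by (cases "a = 0") auto
hence "x ^ K * p = 0" unfolding sum_e[symmetric] sum_distrib_left by simp
\<comment> \<open>The projections add up to \<open>p\<close> and not to 1, so it is
  \<open>x ^ K * p\<close> that vanishes; one more factor \<open>x\<close> absorbs
  \<open>p\<close>.\<close>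
moreover have "p * x = x" using p(1) x m(2) by blast
hence "x ^ Suc K = x ^ K * p * x" by (simp only: power_Suc2 mult.assoc)
ultimately have "x ^ Suc K = 0" by simp
thus ?thesis by blast
qed

text \<open>Take a nonzero \<open>Ga\<close>-stable subalgebra \<open>m\<close> of \<open>q\<close>
  of least dimension. If it is not commutative, its derived algebra is again of this kind and so
  equals \<open>m\<close>. The trace form then vanishes on \<open>m\<close>, Cartan's argument makes
  its elements nilpotent, and the centre of \<open>m\<close> is the desired subspace.\<close>

theorem commutative_stable_subspace:
assumes A: "subspace A" "A <= span B" "finite B" and mult: "!!x y. x:A ==> y:A ==> x * y:A"
 and p: "!!x. x:A ==> p * x = x" "!!x. x:A ==> x * p = x"
 and tr: "!!x y. tr (x + y) = tr x + tr y" "!!c x. tr (c \<star> x) = c * tr x"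
 and tr_comm: "!!x y. x:A ==> y:A ==> tr (x * y) = tr (y * x)" and spec: "!!x. x:A ==> EX F e K. spectral A tr p x F e K"
 and q: "subspace q" "q <= A" "q ~= {0}" "!!x y. x:q ==> y:q ==> br x y:q"
  "!!x y z. x:q ==> y:q ==> z:q ==> tr (br x y * z) = 0"
 and Ga: "!!ph x y. ph:Ga ==> ph (x + y) = ph x + ph y" "!!ph c x. ph:Ga ==> ph (c \<star> x) = c \<star> ph x"
  "!!ph x y. ph:Ga ==> x:A ==> y:A ==> ph (x * y) = ph x * ph y"
  "!!ph. ph:Ga ==> EX \<psi>:Ga. ALL x:A. ph (\<psi> x) = x" "!!ph x. ph:Ga ==> x:q ==> ph x:q"
shows "EX C. subspace C & C <= q & C ~= {0} & (ALL ph:Ga. ph ` C <= C) & (ALL x:C. ALL y:C. x * y = y * x)"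
proof -
have Ga_diff: "ph (x - y) = ph x - ph y" if "ph:Ga" for ph x y using Ga(1)[OF that, of "x - y" y] by simp
have Ga_zero: "ph 0 = 0" if "ph:Ga" for ph using Ga_diff[OF that, of 0 0] by simp
have Ga_br: "ph (br x y) = br (ph x) (ph y)" if "ph:Ga" "x:A" "y:A" for ph x y
 unfolding br_def Ga_diff[OF that(1)] Ga(3)[OF that] Ga(3)[OF that(1,3,2)] ..
define P where "P m \<longleftrightarrow> subspace m & m <= q & m ~= {0} & (ALL x:m. ALL y:m. br x y:m) & (ALL ph:Ga. ph ` m <= m)" for m
have "P q" using q Ga(5) by (auto simp: P_def)
hence "EX m. P m & (ALL m'. P m' --> dim m <= dim m')" by (rule ex_has_least_nat)
then obtain m where Pm: "P m" and least: "!!m'. P m' ==> dim m <= dim m'" by blast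
have m: "subspace m" "m <= q" "m ~= {0}" "!!x y. x:m ==> y:m ==> br x y:m"
 "!!ph x. ph:Ga ==> x:m ==> ph x:m" using Pm unfolding P_def by blast+
have mA: "m <= A" using m q by blast
show ?thesis
proof (cases "ALL x:m. ALL y:m. br x y = 0")
 case True
 hence "ALL x:m. ALL y:m. x * y = y * x" by (simp add: br_def)
 thus ?thesis using m by (intro exI[of _ m]) auto
next
 case False
 let ?S = "{br x y | x y. x:m & y:m}"
 have sub: "span ?S <= m" by (rule span_minimal) (use m in auto)
 have "P (span ?S)" unfolding P_def
 proof (intro conjI ballI)
  show "span ?S <= q" using sub m by blast
  obtain x y where xy: "x:m" "y:m" "br x y ~= 0" using False by blast
  hence "br x y:span ?S" by (intro span_base) auto
  with xy(3) show "span ?S ~= {0}" by auto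
  show "br x y:span ?S" if "x:span ?S" "y:span ?S" for x y
  proof (rule span_base)
  show "br x y:?S" using that sub by blast
  qed
  fix ph assume ph: "ph:Ga"
  have "ph z:span ?S" if "z:span ?S" for z using that
  proof (induction rule: span_induct_alt)
  case base
  thus ?case by (simp add: Ga_zero[OF ph] span_zero)
  next
  case (step c x z)
  then obtain u v where uv: "x = br u v" "u:m" "v:m" by blast
  have "ph x = br (ph u) (ph v)" unfolding uv(1) using Ga_br[OF ph] uv(2,3) mA by blast
  hence "ph x:span ?S" using m(5)[OF ph] uv(2,3) by (auto intro!: span_base)
  thus ?case using step.IH Ga(1,2)[OF ph] by (simp add: span_add span_scale)
  qed
  thus "ph ` span ?S <= span ?S" by blast
 qed simp
 hence le: "dim m <= dim (span ?S)" by (rule least)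
 have perfect: "m = span ?S"
 proof (rule ccontr)
  assume "m ~= span ?S"
  hence "span ?S \<subset> m" using sub by blast
  moreover have "m <= span B" using mA A(2) by blast
  ultimately have "dim (span ?S) < dim m" by (intro dim_psubset_span[OF subspace_span _ _ A(3)])
  with le show False by simp
 qed
 have tr_zero: "tr 0 = 0" using tr(2)[of 0 0] by simp
 have tr0: "tr (x * y) = 0" if x: "x:m" and y: "y:m" for x y
 proof -
  have "x:span ?S" using x perfect by blast
  thus ?thesis
  proof (induction rule: span_induct_alt)
  case base
  thus ?case by (simp add: tr_zero)
  next
  case (step c b z)
  then obtain u v where "b = br u v" "u:m" "v:m" by blast
  hence "tr (b * y) = 0" using q(5) m(2) y by blast
  thus ?case using step.IH by (simp add: distrib_right tr scale_mult_left)
  qed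
 qed
 have nil: "ad_nilpotent x" if x: "x:m" for x
 proof -
  have "EX k. x ^ k = 0" by (rule cartan_nilpotent[OF A(1) mult p tr tr_comm m(1) mA perfect m(4) tr0 x spec])
   (use x mA in blast)+
  thus ?thesis using nilpotent_imp_ad_nilpotent by blast
 qed
 have mB: "m <= span B" using mA A(2) by (rule subset_trans)
 have m0: "{0} \<subset> m" using m(3) subspace_0[OF m(1)] by auto
 have br0: "br x u:{0}" if "x:m" "u:{0}" for x u using that(2) by simp
 \<comment> \<open>With the zero subspace as \<open>U'\<close>, Engel's theorem yields a nonzero
   central element of \<open>m\<close>. The centre is \<open>Ga\<close>-stable because every
   \<open>ph\<close> has a right inverse on \<open>A\<close> inside \<open>Ga\<close>.\<close>
 note E = engel[of m B m "{0}", OF m(1) mB A(3) m(4) nil m(1) subspace_single_0 m0 m(4) br0]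
 from E obtain u where u: "u:m" "u ~= 0" "!!x. x:m ==> br x u = 0" by auto
 define C where "C = {z:m. ALL x:m. br x z = 0}"
 have "subspace C" unfolding C_def using m(1)
  by (auto intro!: subspaceI simp: subspace_0 subspace_add subspace_scale br_add br_scale)
 moreover have "C <= q" "C ~= {0}" using u m(2) by (auto simp: C_def)
 moreover have "x * y = y * x" if "x:C" "y:C" for x y
 proof -
  have "br x y = 0" using that unfolding C_def by blast
  thus ?thesis by (simp add: br_def)
 qed
 moreover have "ph z:C" if ph: "ph:Ga" and z: "z:C" for ph z
 proof -
  obtain \<psi> where \<psi>: "\<psi>:Ga" "!!x. x:A ==> ph (\<psi> x) = x" using Ga(4)[OF ph] by blast
  have "br x (ph z) = 0" if x: "x:m" for x
  proof -
  have "br x (ph z) = br (ph (\<psi> x)) (ph z)" using \<psi>(2) x mA by auto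
  also have "... = ph (br (\<psi> x) z)"
   using Ga_br[OF ph, of "\<psi> x" z] z m(5)[OF \<psi>(1) x] mA unfolding C_def by fastforce
  also have "... = 0" using z m(5)[OF \<psi>(1) x] Ga_zero[OF ph] by (simp add: C_def)
  finally show ?thesis .
  qed
  thus ?thesis using z m(5)[OF ph] by (auto simp: C_def)
 qed
 ultimately show ?thesis by (intro exI[of _ C]) blast
qed
qed

end

section \<open>Matrices as operators\<close>

text \<open>Square matrices of all sizes are embedded in the ring of linear endomorphisms of
  \<open>nat \<Rightarrow> complex\<close>; this gives type class algebra for matrices of a size which is not a type.\<close>

typedef lop = "{f :: (nat => complex) => (nat => complex).
 (ALL u v. f (%i. u i + v i) = (%i. f u i + f v i)) & (ALL c u. f (%i. c * u i) = (%i. c * f u i))}"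
by (rule exI[of _ "%u. u"]) simp

setup_lifting type_definition_lop

instantiation lop :: ring_1
begin

lift_definition zero_lop :: lop is "%u i. 0" by simp
lift_definition one_lop :: lop is "%u. u" by simp
lift_definition plus_lop :: "lop => lop => lop" is "%f g u i. f u i + g u i" by (simp add: algebra_simps)
lift_definition minus_lop :: "lop => lop => lop" is "%f g u i. f u i - g u i" by (simp add: algebra_simps)
lift_definition uminus_lop :: "lop => lop" is "%f u i. - f u i" by (simp add: algebra_simps)
lift_definition times_lop :: "lop => lop => lop" is "%f g u. f (g u)" by simp

instance
proof
fix a b c :: lop
show "a + b + c = a + (b + c)" by transfer (simp add: add.assoc)
show "a + b = b + a" by transfer (simp add: add.commute)
show "0 + a = a" by transfer simp
show "- a + a = 0" by transfer simp
show "a - b = a + - b" by transfer simp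
show "a * b * c = a * (b * c)" by transfer simp
show "1 * a = a" by transfer simp
show "a * 1 = a" by transfer simp
show "(a + b) * c = a * c + b * c" by transfer simp
show "a * (b + c) = a * b + a * c" by transfer simp
show "(0 :: lop) ~= 1" by transfer (auto simp: fun_eq_iff dest: spec[of _ "%_. 1"])
qed

end

lift_definition lscale :: "complex => lop => lop" is "%c f u i. c * f u i" by (simp add: algebra_simps)

global_interpretation lop: complex_algebra lscale
proof
fix a b :: complex and x y :: lop
show "lscale a (x + y) = lscale a x + lscale a y" by transfer (simp add: algebra_simps)
show "lscale (a + b) x = lscale a x + lscale b x" by transfer (simp add: algebra_simps)
show "lscale a (lscale b x) = lscale (a * b) x" by transfer (simp add: algebra_simps)
show "lscale 1 x = x" by transfer simp
show "lscale a x * y = lscale a (x * y)" by transfer simp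
show "x * lscale a y = lscale a (x * y)" by transfer simp
qed

text \<open>The matrix acts on the first \<open>n\<close> coordinates and the result is zero
  elsewhere. The embedding is therefore multiplicative but not unital: the identity matrix becomes a
  projection, the \<open>p\<close> of the abstract theorems.\<close>

lift_definition of_mat :: "nat => complex mat => lop" is
"%n A u i. if i < n then (SUM j<n. A $$ (i, j) * u j) else 0"
by (auto simp: fun_eq_iff algebra_simps sum.distrib sum_distrib_left)

lemma of_mat_add: "A:sqm n ==> B:sqm n ==> of_mat n (A + B) = of_mat n A + of_mat n B"
by transfer (auto simp: fun_eq_iff algebra_simps sum.distrib)

lemma of_mat_minus: "A:sqm n ==> B:sqm n ==> of_mat n (A - B) = of_mat n A - of_mat n B"
by transfer (auto simp: fun_eq_iff algebra_simps sum_subtractf)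

lemma of_mat_smult: "A:sqm n ==> of_mat n (c \<cdot>\<^sub>m A) = lscale c (of_mat n A)"
by transfer (auto simp: fun_eq_iff algebra_simps sum_distrib_left)

lemma of_mat_times:
"A:sqm n ==> B:sqm n ==> of_mat n (A * B) = of_mat n A * of_mat n B"
proof (transfer, rule ext, rule ext)
fix n :: nat and A B :: "complex mat" and u i
assume AB: "A:sqm n" "B:sqm n"
have "(A * B) $$ (i, j) = (SUM l<n. A $$ (i, l) * B $$ (l, j))" if "i < n" "j < n" for j
 using AB that by (auto simp: scalar_prod_def lessThan_atLeast0)
hence "(SUM j<n. (A * B) $$ (i, j) * u j) = (SUM l<n. A $$ (i, l) * (SUM j<n. B $$ (l, j) * u j))" if "i < n"
 using that by (simp add: sum_distrib_left sum_distrib_right mult.assoc) (rule sum.swap)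
thus "(if i < n then SUM j<n. (A * B) $$ (i, j) * u j else 0) =
  (if i < n then SUM j<n. A $$ (i, j) * (if j < n then SUM ja<n. B $$ (j, ja) * u ja else 0) else 0)" by (auto intro!: sum.cong)
qed

lemma of_mat_zero: "of_mat n (0\<^sub>m n n) = 0" by transfer (auto simp: fun_eq_iff)

lemma of_mat_inj:
assumes "A:sqm n" "B:sqm n" "of_mat n A = of_mat n B"
shows "A = B"
proof (rule eq_matI)
fix i j assume "i < dim_row B" "j < dim_col B"
hence ij: "i < n" "j < n" using assms by auto
have "Rep_lop (of_mat n A) (%l. if l = j then 1 else 0) i = Rep_lop (of_mat n B) (%l. if l = j then 1 else 0) i"
 using assms(3) by simp
thus "A $$ (i, j) = B $$ (i, j)" using ij by (simp add: of_mat.rep_eq if_distrib cong: if_cong)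
qed (use assms in auto)

definition ltr :: "nat => lop => complex" where
"ltr n f = (SUM i<n. Rep_lop f (%l. if l = i then 1 else 0) i)"

lemma ltr_add: "ltr n (f + g) = ltr n f + ltr n g" by (simp add: ltr_def plus_lop.rep_eq sum.distrib)

lemma ltr_scale: "ltr n (lscale c f) = c * ltr n f" by (simp add: ltr_def lscale.rep_eq sum_distrib_left)

lemma ltr_of_mat: "ltr n (of_mat n A) = (SUM i<n. A $$ (i, i))" by (simp add: ltr_def of_mat.rep_eq if_distrib cong: if_cong)

lemma ltr_commute:
assumes "A:sqm n" "B:sqm n"
shows "ltr n (of_mat n A * of_mat n B) = ltr n (of_mat n B * of_mat n A)"
proof -
have "(A * B) $$ (i, i) = (SUM l<n. A $$ (i, l) * B $$ (l, i))" if "i < n" for i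
 using assms that by (auto simp: scalar_prod_def lessThan_atLeast0)
moreover have "(B * A) $$ (i, i) = (SUM l<n. B $$ (i, l) * A $$ (l, i))" if "i < n" for i
 using assms that by (auto simp: scalar_prod_def lessThan_atLeast0)
ultimately show ?thesis using assms by (simp flip: of_mat_times add: ltr_of_mat) (subst sum.swap, simp add: mult.commute)
qed

definition mats :: "nat => lop set" where "mats n = of_mat n ` sqm n"

lemma subspace_mats: "lop.subspace (mats n)"
proof (rule lop.subspaceI)
show "0:mats n" unfolding mats_def by (rule image_eqI[of _ _ "0\<^sub>m n n"]) (simp_all add: of_mat_zero)
fix x y assume "x:mats n" "y:mats n"
then obtain A B where "x = of_mat n A" "y = of_mat n B" "A:sqm n" "B:sqm n" by (auto simp: mats_def)
thus "x + y:mats n" unfolding mats_def by (intro image_eqI[of _ _ "A + B"]) (simp_all add: of_mat_add)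
next
fix c x assume "x:mats n"
then obtain A where "x = of_mat n A" "A:sqm n" by (auto simp: mats_def)
thus "lscale c x:mats n" unfolding mats_def by (intro image_eqI[of _ _ "c \<cdot>\<^sub>m A"]) (simp_all add: of_mat_smult)
qed

lemma mats_mult: "x:mats n ==> y:mats n ==> x * y:mats n" unfolding mats_def by (auto simp flip: of_mat_times)

definition mat_unit :: "nat => nat => nat => complex mat" where
"mat_unit n i j = mat n n (%(k, l). if k = i & l = j then 1 else 0)"

lemma Rep_lop_sum: "Rep_lop (SUM a:I. f a) u i = (SUM a:I. Rep_lop (f a) u i)"
by (induction I rule: infinite_finite_induct) (simp_all add: zero_lop.rep_eq plus_lop.rep_eq)

lemma lop_eqI: "(!!u i. Rep_lop f u i = Rep_lop g u i) ==> f = g" by (simp add: Rep_lop_inject[symmetric] fun_eq_iff)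

lemma mats_span: "mats n <= lop.span ((%(i, j). of_mat n (mat_unit n i j)) ` ({..<n} \<times> {..<n}))"
proof
fix x assume "x:mats n"
then obtain A where A: "x = of_mat n A" "A:sqm n" by (auto simp: mats_def)
have "x = (SUM ij:{..<n} \<times> {..<n}. lscale (A $$ ij) (of_mat n (mat_unit n (fst ij) (snd ij))))"
proof (rule lop_eqI)
 fix u i
 have "(SUM a<n. SUM b<n. A $$ (a, b) * (if i < n then SUM j<n. mat_unit n a b $$ (i, j) * u j else 0))
  = (SUM a<n. SUM b<n. if a = i then A $$ (i, b) * u b else 0)"
  by (intro sum.cong refl) (auto simp: mat_unit_def if_distrib if_distribR cong: if_cong)
 also have "... = (SUM a<n. if a = i then (SUM b<n. A $$ (i, b) * u b) else 0)" by (intro sum.cong refl) auto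
 also have "... = Rep_lop x u i" by (auto simp: A(1) of_mat.rep_eq)
 finally show "Rep_lop x u i = Rep_lop (SUM ij:{..<n} \<times> {..<n}. lscale (A $$ ij) (of_mat n (mat_unit n (fst ij) (snd ij)))) u i"
  by (simp add: Rep_lop_sum lscale.rep_eq of_mat.rep_eq sum.cartesian_product')
qed
also have "...:lop.span ((%(i, j). of_mat n (mat_unit n i j)) ` ({..<n} \<times> {..<n}))"
 by (intro lop.span_sum lop.span_scale lop.span_base) force
finally show "x:lop.span ((%(i, j). of_mat n (mat_unit n i j)) ` ({..<n} \<times> {..<n}))" .
qed

text \<open>This is all that is used of the Jordan form: it is upper triangular, and a nonzero entry
  links two positions with the same eigenvalue.\<close>

lemma jordan_matrix_entries:
fixes n_as :: "(nat \<times> complex) list"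
assumes "i < sum_list (map fst n_as)" "j < sum_list (map fst n_as)" and "jordan_matrix n_as $$ (i, j) ~= 0"
shows "i <= j & jordan_matrix n_as $$ (i, i) = jordan_matrix n_as $$ (j, j)" using assms
proof (induction n_as arbitrary: i j)
case Nil
thus ?case by simp
next
case (Cons na n_as)
obtain n a where na: "na = (n, a)" by force
let ?s = "sum_list (map fst n_as)"
have e: "jordan_matrix (na # n_as) $$ (k, l) = (if k < n then if l < n then jordan_block n a $$ (k, l) else 0
  else if l < n then 0 else jordan_matrix n_as $$ (k - n, l - n))" if "k < n + ?s" "l < n + ?s" for k l
 using that unfolding na jordan_matrix_Cons by (subst index_mat_four_block) auto
have ij: "i < n + ?s" "j < n + ?s" using Cons.prems(1,2) by (auto simp: na)
show ?case
proof (cases "i < n")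
 case True
 thus ?thesis using Cons.prems(3) ij by (auto simp: e split: if_splits)
next
 case False
 hence "n <= i" "n <= j" "jordan_matrix n_as $$ (i - n, j - n) ~= 0" using Cons.prems(3) ij by (auto simp: e split: if_splits)
 moreover from this have "i - n <= j - n & jordan_matrix n_as $$ (i - n, i - n) = jordan_matrix n_as $$ (j - n, j - n)"
  using ij by (intro Cons.IH) auto
 ultimately show ?thesis using ij by (auto simp: e)
qed
qed

lemma jordan_decomposition:
fixes X :: "complex mat"
assumes X: "X:sqm n"
obtains P Q J where "P:sqm n" "Q:sqm n" "J:sqm n"
 "P * Q = 1\<^sub>m n" "Q * P = 1\<^sub>m n" "X = P * J * Q"
 "!!i j. i < n ==> j < n ==> J $$ (i, j) ~= 0 ==> i <= j & J $$ (i, i) = J $$ (j, j)"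
proof -
obtain as where "char_poly X = (\<Prod>a\<leftarrow>as. [:- a, 1:])" using char_poly_factorized[OF X] by auto
then obtain n_as where "jordan_nf X n_as" using jordan_nf_exists[OF X] by blast
then obtain P Q where "similar_mat_wit X (jordan_matrix n_as) P Q" by (auto simp: jordan_nf_def similar_mat_def)
note w = similar_mat_witD2[OF X this]
show thesis
proof (rule that[OF w(6,7,5) w(1,2,3)])
 have "sum_list (map fst n_as) = n" using w(5) by (metis carrier_matD(1) jordan_matrix_dim(1))
 thus "i <= j & jordan_matrix n_as $$ (i, i) = jordan_matrix n_as $$ (j, j)"
  if "i < n" "j < n" "jordan_matrix n_as $$ (i, j) ~= 0" for i j using jordan_matrix_entries[of i n_as j] that by auto
qed
qed

text \<open>In a Jordan basis the projection for the eigenvalue a is the diagonal matrix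
  \<open>D a\<close> marking the positions where a stands. It commutes with \<open>J\<close> because
  \<open>J\<close> has no entries between different eigenvalues, and its trace counts the marked
  positions.\<close>

lemma spectral_mats:
assumes "x:mats n"
shows "EX F e K. lop.spectral (mats n) (ltr n) (of_mat n (1\<^sub>m n)) x F e K"
proof -
obtain X where X: "X:sqm n" "x = of_mat n X" using assms by (auto simp: mats_def)
obtain P Q J where PQ: "P:sqm n" "Q:sqm n" "J:sqm n"
 "P * Q = 1\<^sub>m n" "Q * P = 1\<^sub>m n" "X = P * J * Q"
 and J: "!!i j. i < n ==> j < n ==> J $$ (i, j) ~= 0 ==> i <= j & J $$ (i, i) = J $$ (j, j)"
 using jordan_decomposition[OF X(1)] by metis
define D where "D a = mat n n (%(i, j). if i = j & J $$ (i, i) = a then (1 :: complex) else 0)" for a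
have D: "D a:sqm n" for a by (simp add: D_def)
define F where "F = (%i. J $$ (i, i)) ` {..<n}"
define p q j d u where "p = of_mat n P" and "q = of_mat n Q" and "j = of_mat n J"
 and "d a = of_mat n (D a)" and "u = of_mat n (1\<^sub>m n)" for a
have u: "u * of_mat n A = of_mat n A" "of_mat n A * u = of_mat n A" if "A:sqm n" for A
 using that by (simp_all add: u_def flip: of_mat_times)
have pq: "p * q = u" "q * p = u" using PQ by (simp_all add: p_def q_def u_def flip: of_mat_times)
have x: "x = p * j * q" unfolding X(2) PQ(6) p_def j_def q_def using PQ by (simp add: of_mat_times mult.assoc)
have uq: "u * q = q" "p * u = p" "u * j = j" "j * u = j" "u * d a = d a" "d a * u = d a" for a
 using u PQ D by (simp_all add: p_def q_def j_def d_def)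
have JD: "(J * D a) $$ (k, l) = (if J $$ (l, l) = a then J $$ (k, l) else 0)" if "k < n" "l < n" for k l a
proof -
 have "(J * D a) $$ (k, l) = (SUM m = 0..<n. J $$ (k, m) * D a $$ (m, l))" using that PQ(3) D[of a] by (simp add: scalar_prod_def)
 also have "... = (SUM m = 0..<n. if m = l then (if J $$ (l, l) = a then J $$ (k, l) else 0) else 0)"
  by (rule sum.cong) (use that in \<open>auto simp: D_def\<close>)
 finally show ?thesis using that by simp
qed
have DJ: "(D a * J) $$ (k, l) = (if J $$ (k, k) = a then J $$ (k, l) else 0)" if "k < n" "l < n" for k l a
proof -
 have "(D a * J) $$ (k, l) = (SUM m = 0..<n. D a $$ (k, m) * J $$ (m, l))" using that PQ(3) D[of a] by (simp add: scalar_prod_def)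
 also have "... = (SUM m = 0..<n. if m = k then (if J $$ (k, k) = a then J $$ (k, l) else 0) else 0)"
  by (rule sum.cong) (use that in \<open>auto simp: D_def\<close>)
 finally show ?thesis using that by simp
qed
have "J * D a = D a * J" for a
proof (rule eq_matI)
 fix k l assume "k < dim_row (D a * J)" "l < dim_col (D a * J)"
 hence kl: "k < n" "l < n" using PQ(3) D[of a] by auto
 thus "(J * D a) $$ (k, l) = (D a * J) $$ (k, l)" unfolding JD[OF kl] DJ[OF kl] using J[OF kl] by (cases "J $$ (k, l) = 0") auto
qed (use PQ(3) D[of a] in auto)
hence jd: "j * d a = d a * j" for a using PQ(3) D[of a] by (simp add: j_def d_def flip: of_mat_times)
have dd: "d a * d b = (if a = b then d a else 0)" for a b
proof -
 have "D a * D b = (if a = b then D a else 0\<^sub>m n n)"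
 proof (rule eq_matI)
  fix k l assume "k < dim_row (if a = b then D a else 0\<^sub>m n n)" "l < dim_col (if a = b then D a else 0\<^sub>m n n)"
  hence kl: "k < n" "l < n" using D[of a] by (auto split: if_splits)
  have "(D a * D b) $$ (k, l) = (SUM m = 0..<n. D a $$ (k, m) * D b $$ (m, l))"
  using kl D[of a] D[of b] by (simp add: scalar_prod_def)
  also have "... = (SUM m = 0..<n. if m = k then D a $$ (k, k) * D b $$ (k, l) else 0)"
  by (rule sum.cong) (use kl in \<open>auto simp: D_def\<close>)
  also have "... = D a $$ (k, k) * D b $$ (k, l)" using kl by simp
  also have "... = (if a = b then D a else 0\<^sub>m n n) $$ (k, l)" using kl by (auto simp: D_def)
  finally show "(D a * D b) $$ (k, l) = (if a = b then D a else 0\<^sub>m n n) $$ (k, l)" .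
 qed (use D[of a] D[of b] in auto)
 hence "of_mat n (D a * D b) = (if a = b then of_mat n (D a) else 0)" by (simp add: of_mat_zero)
 thus ?thesis using D[of a] D[of b] by (simp add: d_def of_mat_times)
qed
have sum_d: "(SUM a:F. d a) = u"
proof (rule lop_eqI)
 fix v i
 have "(SUM a:F. SUM m<n. D a $$ (i, m) * v m) = v i" if i: "i < n"
 proof -
  have "(SUM m<n. D a $$ (i, m) * v m) = (if J $$ (i, i) = a then v i else 0)" for a
  proof -
  have "(SUM m<n. D a $$ (i, m) * v m) = (SUM m<n. if m = i then (if J $$ (i, i) = a then v i else 0) else 0)"
   by (rule sum.cong) (use i in \<open>auto simp: D_def\<close>)
  thus ?thesis using i by simp
  qed
  thus ?thesis using i by (simp add: F_def)
 qed
 moreover have "(SUM m<n. 1\<^sub>m n $$ (i, m) * v m) = v i" if i: "i < n"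
 proof -
  have "(SUM m<n. 1\<^sub>m n $$ (i, m) * v m) = (SUM m<n. if m = i then v i else 0)" by (rule sum.cong) (use i in auto)
  thus ?thesis using i by simp
 qed
 ultimately show "Rep_lop (SUM a:F. d a) v i = Rep_lop u v i" by (simp add: Rep_lop_sum d_def u_def of_mat.rep_eq)
qed
\<comment> \<open>\<open>M a k\<close> is the k-th power of J - a applied to \<open>D a\<close>. Its
  nonzero entries lie at least k places above the diagonal, since within the block of a each factor
  is strictly upper triangular; hence it vanishes for k = n.\<close>
define M where "M a k = ((%A. J * A - a \<cdot>\<^sub>m A) ^^ k) (D a)" for a k
have M: "M a k:sqm n" for a k unfolding M_def by (induction k) (use D PQ(3) in auto)
have M_entry: "r + k <= l & J $$ (r, r) = a" if "r < n" "l < n" "M a k $$ (r, l) ~= 0" for a k r l using that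
proof (induction k arbitrary: r)
 case 0
 thus ?case by (auto simp: M_def D_def split: if_splits)
next
 case (Suc k)
 have "M a (Suc k) $$ (r, l) = (J * M a k) $$ (r, l) - a * M a k $$ (r, l)"
  using Suc.prems(1,2) M[of a k] PQ(3) by (simp add: M_def)
 also have "(J * M a k) $$ (r, l) = (SUM m = 0..<n. J $$ (r, m) * M a k $$ (m, l))"
  using Suc.prems(1,2) PQ(3) M[of a k] by (simp add: scalar_prod_def)
 also have "... = J $$ (r, r) * M a k $$ (r, l) + (SUM m:{0..<n} - {r}. J $$ (r, m) * M a k $$ (m, l))"
  using Suc.prems(1) by (subst sum.remove[of _ r]) auto
 finally have "M a (Suc k) $$ (r, l) = (J $$ (r, r) - a) * M a k $$ (r, l) + (SUM m:{0..<n} - {r}. J $$ (r, m) * M a k $$ (m, l))"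
  by (simp add: algebra_simps)
 moreover have "(J $$ (r, r) - a) * M a k $$ (r, l) = 0" using Suc.IH[OF Suc.prems(1,2)] by auto
 ultimately have "(SUM m:{0..<n} - {r}. J $$ (r, m) * M a k $$ (m, l)) ~= 0" using Suc.prems(3) by simp
 then obtain m where m: "m:{0..<n} - {r}" "J $$ (r, m) * M a k $$ (m, l) ~= 0" by (rule sum.not_neutral_contains_not_neutral)
 thus ?case using Suc.IH[of m] Suc.prems J[of r m] by auto
qed
have M_n: "M a n = 0\<^sub>m n n" for a by (rule eq_matI) (use M[of a n] M_entry[where k = n] in force)+
define e where "e a = p * d a * q" for a
have pow: "(x - lscale a 1) ^ k * e a = p * of_mat n (M a k) * q" for a k
proof (induction k)
 case 0
 thus ?case by (simp add: e_def M_def d_def)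
next
 case (Suc k)
 have "(x - lscale a 1) ^ Suc k * e a = (x - lscale a 1) * (p * of_mat n (M a k) * q)" using Suc by (simp add: mult.assoc)
 also have "... = p * j * (q * p) * of_mat n (M a k) * q - lscale a (p * of_mat n (M a k) * q)"
  by (simp add: x left_diff_distrib lop.scale_mult_left mult.assoc)
 also have "p * j * (q * p) = p * j" by (simp add: pq uq mult.assoc)
 also have "p * j * of_mat n (M a k) * q - lscale a (p * of_mat n (M a k) * q)
  = p * (j * of_mat n (M a k) - lscale a (of_mat n (M a k))) * q"
  by (simp add: algebra_simps lop.scale_mult_left lop.scale_mult_right)
 also have "j * of_mat n (M a k) - lscale a (of_mat n (M a k)) = of_mat n (M a (Suc k))"
  using M[of a k] PQ(3) by (simp add: M_def j_def of_mat_minus of_mat_times of_mat_smult)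
 finally show ?case .
qed
have q_mats: "p:mats n" "q:mats n" "j:mats n" "d a:mats n" for a using PQ D by (auto simp: p_def q_def j_def d_def mats_def)
have tr_comm: "ltr n (a * b) = ltr n (b * a)" if "a:mats n" "b:mats n" for a b using that ltr_commute by (auto simp: mats_def)
have tr_d: "ltr n (d a) = of_nat (card {i:{..<n}. J $$ (i, i) = a})" for a
 by (simp add: d_def ltr_of_mat D_def sum.If_cases Int_def)
have tr_e: "ltr n (e a) = ltr n (d a)" for a
proof -
 have "ltr n (e a) = ltr n ((d a * q) * p)" using q_mats tr_comm[of p "d a * q"] by (simp add: e_def mats_mult mult.assoc)
 thus ?thesis by (simp add: mult.assoc pq uq)
qed
have tr_xe: "ltr n (x * e a) = a * ltr n (e a)" for a
proof -
 have "x * e a = p * (j * (q * p) * d a * q)" by (simp add: x e_def mult.assoc)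
 also have "... = p * (j * d a * q)" by (simp add: pq uq)
 finally have "ltr n (x * e a) = ltr n ((j * d a * q) * p)" using q_mats by (simp only:) (intro tr_comm mats_mult, auto)
 also have "... = ltr n (j * d a)" by (simp add: mult.assoc pq uq)
 also have "... = (SUM i<n. (J * D a) $$ (i, i))" using PQ(3) D[of a] by (simp add: j_def d_def ltr_of_mat flip: of_mat_times)
 also have "... = (SUM i<n. a * D a $$ (i, i))" by (rule sum.cong) (auto simp: JD simp del: index_mult_mat(1), auto simp: D_def)
 also have "... = a * ltr n (d a)" by (simp add: d_def ltr_of_mat sum_distrib_left)
 finally show ?thesis by (simp add: tr_e)
qed
have "lop.spectral (mats n) (ltr n) u x F e n" unfolding lop.spectral_def
proof (intro conjI ballI)
 show "finite F" by (simp add: F_def)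
 fix a assume "a:F"
 show "e a:mats n" unfolding e_def using q_mats by (intro mats_mult) auto
 show "x * e a = e a * x"
 proof -
  have "x * e a = p * j * (q * p) * d a * q" by (simp add: x e_def mult.assoc)
  also have "... = p * (j * d a) * q" by (simp add: pq uq mult.assoc)
  also have "... = p * d a * (q * p) * j * q" unfolding jd by (simp add: pq uq mult.assoc)
  finally show ?thesis by (simp add: x e_def mult.assoc)
 qed
 show "(x - lscale a 1) ^ n * e a = 0" unfolding pow M_n by (simp add: of_mat_zero)
 show "ltr n (x * e a) = a * ltr n (e a)" by (rule tr_xe)
 define c where "c = card {i:{..<n}. J $$ (i, i) = a}"
 have "{i:{..<n}. J $$ (i, i) = a} ~= {}" using \<open>a:F\<close> by (auto simp: F_def)
 hence "c ~= 0" unfolding c_def by (subst card_eq_0_iff) simp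
 thus "EX r>=0. ltr n (e a) = complex_of_real r & (r = 0 --> e a = 0)"
  by (intro exI[of _ "real c"] conjI) (simp_all only: tr_e tr_d c_def[symmetric] of_real_of_nat_eq, simp_all)
 fix b
 have "e a * e b = p * (d a * (q * p) * d b) * q" by (simp add: e_def mult.assoc)
 also have "... = p * (if a = b then d a else 0) * q" by (simp add: pq uq dd)
 finally show "e a * e b = (if a = b then e a else 0)" by (simp add: e_def)
next
 have "sum e F = p * (SUM a:F. d a) * q" by (simp add: e_def sum_distrib_left sum_distrib_right)
 thus "sum e F = u" by (simp add: sum_d uq pq)
qed
thus ?thesis unfolding u_def by blast
qed

section \<open>Differentiation and the matrix exponential\<close>

lemma sq_mult [simp]: "A:sqm n ==> B:sqm n ==> A * B:sqm n" by (rule mult_carrier_mat)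

lemma sq_entry:
"A:sqm n ==> B:sqm n ==> i < n ==> j < n ==> (A * B) $$ (i, j) = (SUM l = 0..<n. A $$ (i, l) * B $$ (l, j))"
by (simp add: scalar_prod_def)

lemma of_mat_uminus: "A:sqm n ==> of_mat n (- A) = - of_mat n A" by transfer (auto simp: fun_eq_iff sum_negf)

lemma of_mat_eqI:
"of_mat n A = of_mat n B ==> A:sqm n ==> B:sqm n ==> A = B" by (rule of_mat_inj)

lemma of_mat_one:
assumes "A:sqm n"
shows "of_mat n (1\<^sub>m n) * of_mat n A = of_mat n A" "of_mat n A * of_mat n (1\<^sub>m n) = of_mat n A"
using assms by (simp_all flip: of_mat_times)

lemmas of_mat_hom = of_mat_add of_mat_minus of_mat_uminus of_mat_smult of_mat_times of_mat_zero of_mat_one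

definition mderiv :: "nat => (complex => complex mat) => complex mat => complex => bool" where
"mderiv n ga V s \<longleftrightarrow> (ALL t. ga t:sqm n) & V:sqm n &
 (ALL i<n. ALL j<n. ((%t. ga t $$ (i, j)) has_field_derivative V $$ (i, j)) (at s))"

text \<open>The gradient is characterised by the chain rule along matrix curves, which is how it is
  used. Its components are required to be regular again, so that derivations can be
  iterated.\<close>

definition has_grad :: "nat => (complex mat => complex) => (nat => nat => complex mat => complex) => bool" where
"has_grad n p gr \<longleftrightarrow> p:regular_fun n & (ALL i<n. ALL j<n. gr i j:regular_fun n) &
 (ALL ga V s. mderiv n ga V s --> ga s:GLs n -->
  ((%t. p (ga t)) has_field_derivative (SUM i<n. SUM j<n. gr i j (ga s) * V $$ (i, j))) (at s))"

lemma has_gradD: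
assumes "has_grad n p gr" "mderiv n ga V s" "ga s:GLs n"
shows "((%t. p (ga t)) has_field_derivative (SUM i<n. SUM j<n. gr i j (ga s) * V $$ (i, j))) (at s)"
using assms unfolding has_grad_def by blast

lemma has_grad_const: "has_grad n (%_. c) (%_ _ _. 0)" by (auto simp: has_grad_def intro: regular_fun.const)

lemma has_grad_entry:
assumes "a < n" "b < n"
shows "has_grad n (%A. A $$ (a, b)) (%i j _. if i = a & j = b then 1 else 0)" unfolding has_grad_def
proof (intro conjI allI impI)
fix ga V s assume "mderiv n ga V s"
hence "((%t. ga t $$ (a, b)) has_field_derivative V $$ (a, b)) (at s)" using assms by (simp add: mderiv_def)
moreover have "(SUM i<n. SUM j<n. (if i = a & j = b then 1 else 0) * V $$ (i, j)) = V $$ (a, b)"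
proof -
 have "(SUM j<n. (if i = a & j = b then 1 else 0) * V $$ (i, j)) = (if i = a then V $$ (a, b) else 0)" for i
 proof -
  have "(SUM j<n. (if i = a & j = b then 1 else 0) * V $$ (i, j))
   = (SUM j<n. if j = b then (if i = a then V $$ (a, b) else 0) else 0)" by (rule sum.cong) auto
  thus ?thesis using assms by simp
 qed
 thus ?thesis using assms by simp
qed
ultimately show "((%t. ga t $$ (a, b)) has_field_derivative
  (SUM i<n. SUM j<n. (if i = a & j = b then 1 else 0) * V $$ (i, j))) (at s)" by simp
qed (use assms in \<open>auto intro: regular_fun.entry regular_fun.const\<close>)

lemma has_grad_add:
assumes "has_grad n p gp" "has_grad n q gq"
shows "has_grad n (%A. p A + q A) (%i j A. gp i j A + gq i j A)" unfolding has_grad_def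
proof (intro conjI allI impI)
show "(%A. p A + q A):regular_fun n" using assms by (auto simp: has_grad_def intro: regular_fun.add)
show "(%A. gp i j A + gq i j A):regular_fun n" if "i < n" "j < n" for i j
 using assms that by (auto simp: has_grad_def intro: regular_fun.add)
fix ga V s assume "mderiv n ga V s" "ga s:GLs n"
from DERIV_add[OF has_gradD[OF assms(1) this] has_gradD[OF assms(2) this]]
show "((%t. p (ga t) + q (ga t)) has_field_derivative (SUM i<n. SUM j<n. (gp i j (ga s) + gq i j (ga s)) * V $$ (i, j))) (at s)"
 by (simp add: distrib_right sum.distrib)
qed

lemma has_grad_mult:
assumes "has_grad n p gp" "has_grad n q gq"
shows "has_grad n (%A. p A * q A) (%i j A. gp i j A * q A + p A * gq i j A)" unfolding has_grad_def
proof (intro conjI allI impI)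
show "(%A. p A * q A):regular_fun n" using assms by (auto simp: has_grad_def intro: regular_fun.mult)
show "(%A. gp i j A * q A + p A * gq i j A):regular_fun n" if "i < n" "j < n" for i j
 using assms that by (auto simp: has_grad_def intro!: regular_fun.add regular_fun.mult)
fix ga V s assume "mderiv n ga V s" "ga s:GLs n"
from DERIV_mult[OF has_gradD[OF assms(1) this] has_gradD[OF assms(2) this]]
show "((%t. p (ga t) * q (ga t)) has_field_derivative
  (SUM i<n. SUM j<n. (gp i j (ga s) * q (ga s) + p (ga s) * gq i j (ga s)) * V $$ (i, j))) (at s)"
 by (simp add: distrib_right distrib_left sum.distrib sum_distrib_left sum_distrib_right mult_ac)
qed

lemma has_grad_sum:
"(!!i. i:I ==> EX g. has_grad n (f i) g) ==> EX g. has_grad n (%A. SUM i:I. f i A) g"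
proof (induction I rule: infinite_finite_induct)
case (insert i I)
then obtain g h where "has_grad n (f i) g" "has_grad n (%A. SUM i:I. f i A) h" by blast
from has_grad_add[OF this] show ?case using insert.hyps by auto
qed (use has_grad_const[of n 0] in auto)

lemma has_grad_prod:
"(!!i. i:I ==> EX g. has_grad n (f i) g) ==> EX g. has_grad n (%A. PROD i:I. f i A) g"
proof (induction I rule: infinite_finite_induct)
case (insert i I)
then obtain g h where "has_grad n (f i) g" "has_grad n (%A. PROD i:I. f i A) h" by blast
from has_grad_mult[OF this] show ?case using insert.hyps by auto
qed (use has_grad_const[of n 1] in auto)

text \<open>\<open>d\<close> is the Leibniz polynomial, a sum of products of entries to which the
  previous rules apply; it agrees with \<open>det\<close> on square matrices. The gradient of the
  reciprocal stays regular because it involves \<open>det\<close> only through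
  \<open>1 / det\<close>.\<close>

lemma has_grad_inverse_det: "EX g. has_grad n (%A. 1 / det A) g"
proof -
define d where "d A = (SUM p:{p. p permutes {0..<n}}. signof p * (PROD i = 0..<n. A $$ (i, p i)))" for A :: "complex mat"
have dd: "det A = d A" if "A:sqm n" for A using det_def'[OF that] by (simp add: d_def)
have "EX g. has_grad n d g" unfolding d_def
proof (rule has_grad_sum)
 fix p assume p: "p:{p. p permutes {0..<n}}"
 have "EX g. has_grad n (%A. PROD i = 0..<n. A $$ (i, p i)) g"
 proof (rule has_grad_prod)
  fix i assume "i:{0..<n}"
  hence "i < n" "p i < n" using p by (auto simp: permutes_in_image)
  thus "EX g. has_grad n (%A. A $$ (i, p i)) g" using has_grad_entry by blast
 qed
 then obtain g where "has_grad n (%A. PROD i = 0..<n. A $$ (i, p i)) g" ..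
 from has_grad_mult[OF has_grad_const this]
 show "EX g. has_grad n (%A. signof p * (PROD i = 0..<n. A $$ (i, p i))) g" by blast
qed
then obtain g where g: "has_grad n d g" ..
have "has_grad n (%A. 1 / det A) (%i j A. (- 1) * (1 / det A * (1 / det A) * g i j A))" unfolding has_grad_def
proof (intro conjI allI impI)
 show "(%A. 1 / det A):regular_fun n" by (rule regular_fun.inverse_det)
 show "(%A. (- 1) * (1 / det A * (1 / det A) * g i j A)):regular_fun n" if "i < n" "j < n" for i j
 proof (intro regular_fun.mult regular_fun.const regular_fun.inverse_det)
  show "g i j:regular_fun n" using g that by (simp add: has_grad_def)
 qed
 fix ga V s assume ga: "mderiv n ga V s" "ga s:GLs n"
 have car: "ga t:sqm n" for t using ga(1) by (simp add: mderiv_def)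
 have "((%t. d (ga t)) has_field_derivative (SUM i<n. SUM j<n. g i j (ga s) * V $$ (i, j))) (at s)" by (rule has_gradD[OF g ga])
 moreover have "d (ga s) ~= 0" using GL_det[OF ga(2)] dd[OF car] by simp
 ultimately have "((%t. inverse (d (ga t))) has_field_derivative
  - (inverse (d (ga s)) * (SUM i<n. SUM j<n. g i j (ga s) * V $$ (i, j)) * inverse (d (ga s)))) (at s)" by (rule DERIV_inverse')
 thus "((%t. 1 / det (ga t)) has_field_derivative
  (SUM i<n. SUM j<n. (- 1) * (1 / det (ga s) * (1 / det (ga s)) * g i j (ga s)) * V $$ (i, j))) (at s)"
  by (simp add: dd[OF car] sum_distrib_left sum_distrib_right sum_negf inverse_eq_divide mult_ac)
qed
thus ?thesis by blast
qed

lemma regular_fun_has_grad: "p:regular_fun n ==> EX g. has_grad n p g"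
proof (induction rule: regular_fun.induct)
case (const c)
thus ?case using has_grad_const by blast
next
case (entry i j)
thus ?case using has_grad_entry by blast
next
case inverse_det
thus ?case by (rule has_grad_inverse_det)
next
case (add p q)
thus ?case using has_grad_add by blast
next
case (mult p q)
thus ?case using has_grad_mult by blast
qed

definition grad :: "nat => (complex mat => complex) => nat => nat => complex mat => complex" where
"grad n p = (SOME g. has_grad n p g)"

lemma has_grad_grad: "p:regular_fun n ==> has_grad n p (grad n p)" unfolding grad_def using someI_ex[OF regular_fun_has_grad] .

definition ddir :: "nat => (complex mat => complex) => complex mat => complex mat => complex" where
"ddir n p A V = (SUM i<n. SUM j<n. grad n p i j A * V $$ (i, j))"

lemma ddir_chain:
"p:regular_fun n ==> mderiv n ga V s ==> ga s:GLs n ==> ((%t. p (ga t)) has_field_derivative ddir n p (ga s) V) (at s)"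
unfolding ddir_def by (rule has_gradD[OF has_grad_grad])

lemma ddir_add: "V:sqm n ==> W:sqm n ==> ddir n p A (V + W) = ddir n p A V + ddir n p A W"
by (simp add: ddir_def distrib_left sum.distrib)

lemma ddir_smult: "V:sqm n ==> ddir n p A (c \<cdot>\<^sub>m V) = c * ddir n p A V"
by (simp add: ddir_def sum_distrib_left mult_ac)

lemma ddir_zero: "ddir n p A (0\<^sub>m n n) = 0" by (simp add: ddir_def)

lemma ddir_mderiv:
assumes "mderiv n ga V s"
shows "((%t. ddir n p A (ga t)) has_field_derivative ddir n p A V) (at s)"
unfolding ddir_def by (intro DERIV_sum DERIV_cmult) (use assms in \<open>simp add: mderiv_def\<close>)

lemma has_mderiv_const: "C:sqm n ==> mderiv n (%_. C) (0\<^sub>m n n) s" by (simp add: mderiv_def)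

lemma has_mderiv_times:
assumes "mderiv n ga V s" "mderiv n de W s"
shows "mderiv n (%t. ga t * de t) (V * de s + ga s * W) s" unfolding mderiv_def
proof (intro conjI allI impI)
have c: "ga t:sqm n" "de t:sqm n" "V:sqm n" "W:sqm n" for t using assms by (auto simp: mderiv_def)
show "ga t * de t:sqm n" for t using c by simp
show "V * de s + ga s * W:sqm n" using c by auto
fix i j assume ij: "i < n" "j < n"
note e = sq_entry[OF _ _ ij]
have "((%t. SUM l = 0..<n. ga t $$ (i, l) * de t $$ (l, j)) has_field_derivative
  (SUM l = 0..<n. V $$ (i, l) * de s $$ (l, j) + W $$ (l, j) * ga s $$ (i, l))) (at s)"
 by (intro DERIV_sum DERIV_mult) (use assms ij in \<open>simp_all add: mderiv_def\<close>)
moreover have "(V * de s + ga s * W) $$ (i, j) = (SUM l = 0..<n. V $$ (i, l) * de s $$ (l, j) + W $$ (l, j) * ga s $$ (i, l))"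
proof -
 have "(V * de s + ga s * W) $$ (i, j) = (V * de s) $$ (i, j) + (ga s * W) $$ (i, j)"
  using carrier_matD[OF c(1)[of s]] carrier_matD[OF c(4)] ij by (intro index_add_mat(1)) auto
 thus ?thesis by (simp only: e[OF c(3,2)] e[OF c(1,4)] sum.distrib mult.commute)
qed
ultimately show "((%t. (ga t * de t) $$ (i, j)) has_field_derivative (V * de s + ga s * W) $$ (i, j)) (at s)"
 by (simp only: e[OF c(1,2)])
qed

lemma has_mderiv_zero_const:
assumes "!!s. mderiv n ga (0\<^sub>m n n) s"
shows "ga s = ga 0"
proof (rule eq_matI)
have c: "ga t:sqm n" for t using assms[of 0] by (auto simp: mderiv_def)
fix i j assume "i < dim_row (ga 0)" "j < dim_col (ga 0)"
hence ij: "i < n" "j < n" using c[of 0] by auto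
have "EX d. ALL x:UNIV. ga x $$ (i, j) = d"
 by (rule has_field_derivative_zero_constant) (use assms ij in \<open>auto simp: mderiv_def\<close>)
thus "ga s $$ (i, j) = ga 0 $$ (i, j)" by (metis UNIV_I)
next
have c: "ga t:sqm n" for t using assms[of 0] by (auto simp: mderiv_def)
show "dim_row (ga s) = dim_row (ga 0)" "dim_col (ga s) = dim_col (ga 0)" using c[of s] c[of 0] by auto
qed

definition mcoeff :: "complex mat => nat => nat => nat => complex" where
"mcoeff x i j k = (x ^\<^sub>m k) $$ (i, j) / fact k"

text \<open>The exponential of the matrix s x. The scalar is kept as a separate argument so that
  every entry is an everywhere convergent power series in s, to be differentiated term by
  term.\<close>

definition mexp :: "nat => complex mat => complex => complex mat" where
"mexp n x s = mat n n (%(i, j). \<Sum>k. mcoeff x i j k * s ^ k)"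

lemma mexp_carrier [simp]: "mexp n x s:sqm n" by (simp add: mexp_def)

lemma mexp_dim [simp]: "dim_row (mexp n x s) = n" "dim_col (mexp n x s) = n" by (simp_all add: mexp_def)

lemma pow_mat_Suc_entry:
assumes "x:sqm n" "i < n" "j < n"
shows "(x ^\<^sub>m Suc k) $$ (i, j) = (SUM l = 0..<n. (x ^\<^sub>m k) $$ (i, l) * x $$ (l, j))"
proof -
have "x ^\<^sub>m k:sqm n" using assms(1) by simp
thus ?thesis using assms by (simp add: scalar_prod_def)
qed

lemma pow_mat_bound:
fixes x :: "complex mat"
assumes x: "x:sqm n"
shows "EX b>=0. ALL k. ALL i<n. ALL j<n. norm ((x ^\<^sub>m k) $$ (i, j)) <= b ^ k"
proof -
define b where "b = 1 + (SUM j = 0..<n. SUM l = 0..<n. norm (x $$ (l, j)))"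
have b: "b >= 0" by (auto simp: b_def intro!: add_nonneg_nonneg sum_nonneg)
have col: "(SUM l = 0..<n. norm (x $$ (l, j))) <= b" if "j < n" for j
proof -
 have "(SUM l = 0..<n. norm (x $$ (l, j))) <= (SUM j = 0..<n. SUM l = 0..<n. norm (x $$ (l, j)))"
  using that by (intro member_le_sum) (auto intro: sum_nonneg)
 thus ?thesis by (simp add: b_def)
qed
have "norm ((x ^\<^sub>m k) $$ (i, j)) <= b ^ k" if "i < n" "j < n" for k i j using that
proof (induction k arbitrary: j)
 case 0
 thus ?case using x by simp
next
 case (Suc k)
 have "norm ((x ^\<^sub>m Suc k) $$ (i, j)) <= (SUM l = 0..<n. norm ((x ^\<^sub>m k) $$ (i, l)) * norm (x $$ (l, j)))"
  unfolding pow_mat_Suc_entry[OF x Suc.prems] by (rule order_trans[OF norm_sum]) (simp add: norm_mult)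
 also have "... <= (SUM l = 0..<n. b ^ k * norm (x $$ (l, j)))" using Suc by (intro sum_mono mult_right_mono) auto
 also have "... = b ^ k * (SUM l = 0..<n. norm (x $$ (l, j)))" by (simp add: sum_distrib_left)
 also have "... <= b ^ k * b" using col[OF Suc.prems(2)] b by (intro mult_left_mono) auto
 finally show ?case by (simp add: mult.commute)
qed
thus ?thesis using b by blast
qed

lemma mexp_summable:
fixes x :: "complex mat"
assumes x: "x:sqm n" and ij: "i < n" "j < n"
shows "summable (%k. mcoeff x i j k * s ^ k)"
proof -
obtain b where b: "b >= 0" "!!k. norm ((x ^\<^sub>m k) $$ (i, j)) <= b ^ k" using pow_mat_bound[OF x] ij by blast
show ?thesis
proof (rule summable_comparison_test)
 show "summable (%k. inverse (fact k) * (b * norm s) ^ k :: real)" by (rule summable_exp)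
 have "norm (mcoeff x i j k * s ^ k) <= inverse (fact k) * (b * norm s) ^ k" for k
 proof -
  have "norm (mcoeff x i j k * s ^ k) = norm ((x ^\<^sub>m k) $$ (i, j)) * (inverse (fact k) * norm s ^ k)"
  by (simp add: mcoeff_def norm_mult norm_divide norm_power norm_inverse norm_fact divide_inverse)
  also have "... <= b ^ k * (inverse (fact k) * norm s ^ k)" using b(2)[of k] by (intro mult_right_mono) auto
  finally show ?thesis by (simp add: power_mult_distrib mult_ac)
 qed
 thus "EX N. ALL k>=N. norm (mcoeff x i j k * s ^ k) <= inverse (fact k) * (b * norm s) ^ k" by blast
qed
qed

lemma mexp_deriv:
assumes x: "x:sqm n"
shows "mderiv n (mexp n x) (mexp n x s * x) s" unfolding mderiv_def
proof (intro conjI allI impI)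
show "mexp n x t:sqm n" for t by simp
show "mexp n x s * x:sqm n" using x by simp
fix i j assume ij: "i < n" "j < n"
let ?c = "mcoeff x i"
have "((%s. \<Sum>k. ?c j k * s ^ k) has_field_derivative (\<Sum>k. diffs (?c j) k * s ^ k)) (at s)"
 by (rule termdiffs_strong_converges_everywhere) (rule mexp_summable[OF x ij])
moreover have "(\<Sum>k. diffs (?c j) k * s ^ k) = (mexp n x s * x) $$ (i, j)"
proof -
 have "diffs (?c j) k * s ^ k = (SUM l = 0..<n. ?c l k * s ^ k * x $$ (l, j))" for k
 proof -
  have "diffs (?c j) k = (x ^\<^sub>m Suc k) $$ (i, j) / fact k"
  by (simp add: diffs_def mcoeff_def field_simps del: of_nat_Suc pow_mat.simps)
  thus ?thesis unfolding pow_mat_Suc_entry[OF x ij]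
  by (simp add: mcoeff_def sum_divide_distrib sum_distrib_left sum_distrib_right mult_ac)
 qed
 hence "(\<Sum>k. diffs (?c j) k * s ^ k) = (\<Sum>k. SUM l = 0..<n. ?c l k * s ^ k * x $$ (l, j))" by simp
 also have "... = (SUM l = 0..<n. \<Sum>k. ?c l k * s ^ k * x $$ (l, j))"
  by (rule suminf_sum) (intro summable_mult2 mexp_summable[OF x ij(1)], simp)
 also have "... = (SUM l = 0..<n. (\<Sum>k. ?c l k * s ^ k) * x $$ (l, j))"
  by (intro sum.cong refl suminf_mult2[symmetric] mexp_summable[OF x ij(1)]) simp
 also have "... = (mexp n x s * x) $$ (i, j)" using ij x by (simp add: scalar_prod_def mexp_def)
 finally show ?thesis .
qed
ultimately show "((%t. mexp n x t $$ (i, j)) has_field_derivative (mexp n x s * x) $$ (i, j)) (at s)"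
 using ij by (simp add: mexp_def)
qed

lemma mexp_0: "x:sqm n ==> mexp n x 0 = 1\<^sub>m n"
proof (rule eq_matI)
fix i j assume x: "x:sqm n" and "i < dim_row (1\<^sub>m n :: complex mat)" "j < dim_col (1\<^sub>m n :: complex mat)"
hence ij: "i < n" "j < n" by auto
have "(\<Sum>k. mcoeff x i j k * 0 ^ k) = mcoeff x i j 0" by (subst suminf_finite[of "{0}"]) auto
thus "mexp n x 0 $$ (i, j) = 1\<^sub>m n $$ (i, j)" using ij x by (simp add: mexp_def mcoeff_def)
qed (simp_all add: mexp_def)

lemma mexp_commute:
assumes x: "x:sqm n" and y: "y:sqm n" and xy: "x * y = y * x"
shows "y * mexp n x s = mexp n x s * y"
proof (rule eq_matI)
fix i j assume "i < dim_row (mexp n x s * y)" "j < dim_col (mexp n x s * y)"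
hence ij: "i < n" "j < n" using y by (auto simp: mexp_def)
have pw: "x ^\<^sub>m k:sqm n" for k using x by simp
have comm: "y * x ^\<^sub>m k = x ^\<^sub>m k * y" for k
proof (induction k)
 case (Suc k)
 have "y * (x ^\<^sub>m k * x) = x ^\<^sub>m k * x * y"
 proof (rule of_mat_eqI[of n])
  have "of_mat n x * of_mat n y = of_mat n y * of_mat n x"
  "of_mat n y * of_mat n (x ^\<^sub>m k) = of_mat n (x ^\<^sub>m k) * of_mat n y"
  using Suc x y pw xy by (simp_all flip: of_mat_times)
  thus "of_mat n (y * (x ^\<^sub>m k * x)) = of_mat n (x ^\<^sub>m k * x * y)"
  using x y pw by (simp add: of_mat_hom) (simp flip: mult.assoc, simp add: mult.assoc)
 qed (use x y pw in simp_all)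
 thus ?case by simp
qed (use x y in simp)
let ?c = "%i j k. mcoeff x i j k * s ^ k"
have "(y * mexp n x s) $$ (i, j) = (SUM l = 0..<n. \<Sum>k. y $$ (i, l) * ?c l j k)" unfolding sq_entry[OF y mexp_carrier ij]
 by (intro sum.cong refl) (use ij in \<open>simp add: mexp_def suminf_mult[OF mexp_summable[OF x]]\<close>)
also have "... = (\<Sum>k. SUM l = 0..<n. y $$ (i, l) * ?c l j k)"
 by (rule suminf_sum[symmetric]) (intro summable_mult mexp_summable[OF x _ ij(2)], simp)
also have "... = (\<Sum>k. (y * x ^\<^sub>m k) $$ (i, j) / fact k * s ^ k)"
 unfolding sq_entry[OF y pw ij] by (simp add: mcoeff_def sum_divide_distrib sum_distrib_left sum_distrib_right mult_ac)
also have "... = (\<Sum>k. SUM l = 0..<n. ?c i l k * y $$ (l, j))"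
 unfolding comm sq_entry[OF pw y ij] by (simp add: mcoeff_def sum_divide_distrib sum_distrib_left sum_distrib_right mult_ac)
also have "... = (SUM l = 0..<n. \<Sum>k. ?c i l k * y $$ (l, j))"
 by (rule suminf_sum) (intro summable_mult2 mexp_summable[OF x ij(1)], simp)
also have "... = (mexp n x s * y) $$ (i, j)" unfolding sq_entry[OF mexp_carrier y ij]
 by (intro sum.cong refl) (use ij in \<open>simp add: mexp_def suminf_mult2[OF mexp_summable[OF x]]\<close>)
finally show "(y * mexp n x s) $$ (i, j) = (mexp n x s * y) $$ (i, j)" .
qed (use y in \<open>auto simp: mexp_def\<close>)

lemma mexp_inverse:
assumes x: "x:sqm n"
shows "mexp n x s * mexp n (- x) s = 1\<^sub>m n"
proof -
let ?E = "mexp n x" and ?F = "mexp n (- x)"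
have mx: "- x:sqm n" using x by simp
have "mderiv n (%t. ?E t * ?F t) (0\<^sub>m n n) s" for s
proof -
 have "mderiv n (%t. ?E t * ?F t) (?E s * x * ?F s + ?E s * (?F s * - x)) s"
  by (rule has_mderiv_times[OF mexp_deriv[OF x] mexp_deriv[OF mx]])
 moreover have "?E s * x * ?F s + ?E s * (?F s * - x) = 0\<^sub>m n n"
 proof (rule of_mat_eqI[of n])
  have "of_mat n x * of_mat n (?F s) = of_mat n (?F s) * of_mat n x"
  using mexp_commute[OF mx x, of s] x by (simp flip: of_mat_times)
  thus "of_mat n (?E s * x * ?F s + ?E s * (?F s * - x)) = of_mat n (0\<^sub>m n n)"
  using x mx by (simp add: of_mat_hom mult.assoc)
 qed (use x mx in simp_all)
 ultimately show ?thesis by simp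
qed
hence "?E s * ?F s = ?E 0 * ?F 0" by (rule has_mderiv_zero_const)
thus ?thesis using x by (simp add: mexp_0)
qed

lemma mexp_GL: "x:sqm n ==> mexp n x s:GLs n"
proof -
assume x: "x:sqm n"
have "det (mexp n x s) * det (mexp n (- x) s) = 1" using det_mult[of "mexp n x s" n "mexp n (- x) s"] mexp_inverse[OF x] by simp
thus ?thesis by (auto simp: GL_carrier)
qed

lemma mexp_inv: "x:sqm n ==> ginv n (mexp n x s) = mexp n (- x) s"
proof (rule GL_inv_unique)
assume x: "x:sqm n"
thus "mexp n x s:GLs n" by (rule mexp_GL)
show "mexp n (- x) s * mexp n x s = 1\<^sub>m n" using mexp_inverse[of "- x" n s] x by simp
qed simp

text \<open>\<open>F s * mexp n (- z) s\<close> has derivative zero and equals the identity at 0.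
  The laws for sums, scalar multiples and conjugation all follow from this uniqueness.\<close>

lemma mexp_unique:
assumes F: "!!s. mderiv n F (F s * z) s" "F 0 = 1\<^sub>m n" and z: "z:sqm n"
shows "F s = mexp n z s"
proof -
let ?E = "mexp n (- z)"
have mz: "- z:sqm n" using z by simp
have Fc: "F s:sqm n" for s using F(1)[of 0] by (simp add: mderiv_def)
have "mderiv n (%t. F t * ?E t) (0\<^sub>m n n) s" for s
proof -
 have "mderiv n (%t. F t * ?E t) (F s * z * ?E s + F s * (?E s * - z)) s"
  by (rule has_mderiv_times[OF F(1) mexp_deriv[OF mz]])
 moreover have "F s * z * ?E s + F s * (?E s * - z) = 0\<^sub>m n n"
 proof (rule of_mat_eqI[of n])
  have "of_mat n z * of_mat n (?E s) = of_mat n (?E s) * of_mat n z"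
  using mexp_commute[OF mz z, of s] z by (simp flip: of_mat_times)
  thus "of_mat n (F s * z * ?E s + F s * (?E s * - z)) = of_mat n (0\<^sub>m n n)"
  using z mz Fc by (simp add: of_mat_hom mult.assoc)
 qed (use z mz Fc in simp_all)
 ultimately show ?thesis by simp
qed
hence "F s * ?E s = F 0 * ?E 0" by (rule has_mderiv_zero_const)
hence 1: "F s * ?E s = 1\<^sub>m n" using z F(2) by (simp add: mexp_0)
show ?thesis
proof (rule of_mat_eqI[of n])
 have "of_mat n (F s * ?E s) = of_mat n (1\<^sub>m n)" "of_mat n (?E s * mexp n z s) = of_mat n (1\<^sub>m n)"
  using 1 mexp_inverse[OF mz, of s] z by simp_all
 hence e: "of_mat n (F s) * of_mat n (?E s) = of_mat n (1\<^sub>m n)"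
  "of_mat n (?E s) * of_mat n (mexp n z s) = of_mat n (1\<^sub>m n)" using Fc by (simp_all add: of_mat_times)
 have "of_mat n (F s) = of_mat n (F s) * of_mat n (1\<^sub>m n)" using Fc by (simp add: of_mat_one)
 also have "... = (of_mat n (F s) * of_mat n (?E s)) * of_mat n (mexp n z s)" by (simp only: e(2)[symmetric] mult.assoc)
 also have "... = of_mat n (mexp n z s)" by (simp add: e(1) of_mat_one)
 finally show "of_mat n (F s) = of_mat n (mexp n z s)" .
qed (use Fc in simp_all)
qed

lemma mexp_add:
assumes x: "x:sqm n" and y: "y:sqm n" and xy: "x * y = y * x"
shows "mexp n x s * mexp n y s = mexp n (x + y) s"
proof (rule mexp_unique)
fix s
have "mderiv n (%s. mexp n x s * mexp n y s) (mexp n x s * x * mexp n y s + mexp n x s * (mexp n y s * y)) s"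
 by (rule has_mderiv_times[OF mexp_deriv[OF x] mexp_deriv[OF y]])
moreover have "mexp n x s * x * mexp n y s + mexp n x s * (mexp n y s * y) = mexp n x s * mexp n y s * (x + y)"
proof (rule of_mat_eqI[of n])
 have "of_mat n x * of_mat n (mexp n y s) = of_mat n (mexp n y s) * of_mat n x"
  using mexp_commute[OF y x, of s] x xy by (simp flip: of_mat_times)
 thus "of_mat n (mexp n x s * x * mexp n y s + mexp n x s * (mexp n y s * y)) = of_mat n (mexp n x s * mexp n y s * (x + y))"
  using x y by (simp add: of_mat_hom mult.assoc distrib_left)
qed (use x y in simp_all)
ultimately show "mderiv n (%s. mexp n x s * mexp n y s) (mexp n x s * mexp n y s * (x + y)) s" by simp
qed (use x y in \<open>auto simp: mexp_0\<close>)

lemma mexp_smult: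
assumes x: "x:sqm n"
shows "mexp n (c \<cdot>\<^sub>m x) s = mexp n x (c * s)"
proof -
have "mexp n x (c * s) = mexp n (c \<cdot>\<^sub>m x) s"
proof (rule mexp_unique[where F = "%s. mexp n x (c * s)"])
 fix s
 have d: "mderiv n (mexp n x) (mexp n x (c * s) * x) (c * s)" by (rule mexp_deriv[OF x])
 show "mderiv n (%s. mexp n x (c * s)) (mexp n x (c * s) * (c \<cdot>\<^sub>m x)) s" unfolding mderiv_def
 proof (intro conjI allI impI)
  fix i j assume ij: "i < n" "j < n"
  have "((%s. c * s) has_field_derivative c) (at s)" by (auto intro!: derivative_eq_intros)
  moreover have "((%t. mexp n x t $$ (i, j)) has_field_derivative (mexp n x (c * s) * x) $$ (i, j)) (at (c * s))"
  using d ij by (simp add: mderiv_def)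
  ultimately have "((%t. mexp n x (c * t) $$ (i, j)) has_field_derivative (mexp n x (c * s) * x) $$ (i, j) * c) (at s)"
  by (rule DERIV_chain2[rotated])
  moreover have "(mexp n x (c * s) * (c \<cdot>\<^sub>m x)) $$ (i, j) = (mexp n x (c * s) * x) $$ (i, j) * c"
  using ij x by (simp add: mult_smult_distrib[of _ n n _ n] del: index_mult_mat(1))
  ultimately show "((%t. mexp n x (c * t) $$ (i, j)) has_field_derivative (mexp n x (c * s) * (c \<cdot>\<^sub>m x)) $$ (i, j)) (at s)"
  by simp
 qed (use x in auto)
qed (use x in \<open>auto simp: mexp_0\<close>)
thus ?thesis ..
qed

lemma mexp_conj:
assumes x: "x:sqm n" and g: "g:GLs n"
shows "g * mexp n x s * ginv n g = mexp n (g * x * ginv n g) s"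
proof (rule mexp_unique)
note gm = GL_mat[OF g] and gi = GL_mat[OF GL_inv_closed[OF g]]
note gl = GL_inv_left[OF g] and gr = GL_inv_right[OF g]
let ?i = "ginv n g"
note as = assoc_mult_mat[of _ n n _ n _ n]
fix s
have 1: "mderiv n (%t. g * mexp n x t) (0\<^sub>m n n * mexp n x s + g * (mexp n x s * x)) s"
 by (rule has_mderiv_times[OF has_mderiv_const[OF gm] mexp_deriv[OF x]])
have 2: "mderiv n (%t. g * mexp n x t * ?i)
 ((0\<^sub>m n n * mexp n x s + g * (mexp n x s * x)) * ?i + g * mexp n x s * 0\<^sub>m n n) s"
 by (rule has_mderiv_times[OF 1 has_mderiv_const[OF gi]])
have "of_mat n ?i * of_mat n g = of_mat n (1\<^sub>m n)" using gm gi by (simp add: gl flip: of_mat_times)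
hence e: "of_mat n ?i * (of_mat n g * v) = of_mat n (1\<^sub>m n) * v" for v by (simp flip: mult.assoc)
have "(0\<^sub>m n n * mexp n x s + g * (mexp n x s * x)) * ?i + g * mexp n x s * 0\<^sub>m n n
  = g * mexp n x s * ?i * (g * x * ?i)"
proof (rule of_mat_eqI[of n])
 have "of_mat n (1\<^sub>m n) * (of_mat n x * v) = of_mat n x * v" for v using x by (simp add: of_mat_one flip: mult.assoc)
 thus "of_mat n ((0\<^sub>m n n * mexp n x s + g * (mexp n x s * x)) * ?i + g * mexp n x s * 0\<^sub>m n n)
  = of_mat n (g * mexp n x s * ?i * (g * x * ?i))" using gm gi x by (simp add: of_mat_hom mult.assoc e)
qed (use gm gi x in simp_all)
thus "mderiv n (%s. g * mexp n x s * ?i) (g * mexp n x s * ?i * (g * x * ?i)) s" using 2 by simp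
show "g * mexp n x 0 * ?i = 1\<^sub>m n" using gm x by (simp add: mexp_0 gr)
show "g * x * ?i:sqm n" using gm gi x by simp
qed

section \<open>The Lie algebra of a linear algebraic group\<close>

definition vanishing :: "nat => complex mat set => (complex mat => complex) set" where
"vanishing n G = {p:regular_fun n. ALL g:G. p g = 0}"

text \<open>The Zariski tangent space at the identity; that it is closed under brackets and under
  conjugation by G is proved below.\<close>

definition lie :: "nat => complex mat set => complex mat set" where
"lie n G = {x:carrier_mat n n. ALL p:vanishing n G. ddir n p (1\<^sub>m n) x = 0}"

lemma lie_carrier: "x:lie n G ==> x:sqm n" by (simp add: lie_def)

lemma translate_regular:
assumes "p:regular_fun n" "g:GLs n" "h:GLs n"
obtains q where "q:regular_fun n" "!!A. A:GLs n ==> q A = p (g * A * h)"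
proof -
have "regular_on n (GLs n) (%A. p (g * A * h))"
proof (rule regular_on_compose[where m = n])
 show "g * A * h:GLs n" if "A:GLs n" for A using that assms by (simp add: GL_times)
 show "regular_on n (GLs n) (%A. (g * A * h) $$ (i, j))" if "i < n" "j < n" for i j
 proof (rule regular_on_times_entry[where a = n and b = n and c = n])
  show "regular_on n (GLs n) (%A. (g * A) $$ (i, j))" if "i < n" "j < n" for i j
  by (rule regular_on_times_entry[where a = n and b = n and c = n])
   (use that assms in \<open>auto intro: GL_mat reg_const reg_entry\<close>)
 qed (use that assms in \<open>auto intro: GL_mat sq_mult reg_const\<close>)
 have "regular_on n (GLs n) (%A. 1 / det g * (1 / det A) * (1 / det h))"
  by (intro reg_mult reg_const regular_on_inverse_det)
 thus "regular_on n (GLs n) (%A. 1 / det (g * A * h))"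
 proof (rule reg_cong)
  fix A assume "A:GLs n"
  hence "det (g * A * h) = det g * det A * det h" using assms by (simp add: det_mult[of _ n] GL_carrier)
  thus "1 / det g * (1 / det A) * (1 / det h) = 1 / det (g * A * h)" by simp
 qed
 show "regular_on n (GLs n) p" by (rule regular_on_fun[OF assms(1)])
qed
then obtain q where "q:regular_fun n" "ALL A:GLs n. p (g * A * h) = q A" by (auto simp: regular_on_def)
thus thesis by (intro that[of q]) simp_all
qed

text \<open>The left-invariant vector field of \<open>x\<close> preserves the coordinate ring, which
  permits its repeated application in \<open>mexp_mem\<close>.\<close>

lemma derivation_regular:
assumes "p:regular_fun n" "x:sqm n"
obtains q where "q:regular_fun n" "!!A. A:GLs n ==> q A = ddir n p A (A * x)"
proof -
have "regular_on n (GLs n) (%A. SUM i<n. SUM j<n. grad n p i j A * (A * x) $$ (i, j))"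
proof (intro regular_on_sum reg_mult)
 fix i j assume ij: "i:{..<n}" "j:{..<n}"
 show "regular_on n (GLs n) (grad n p i j)" using has_grad_grad[OF assms(1)] ij by (intro regular_on_fun) (simp add: has_grad_def)
 show "regular_on n (GLs n) (%A. (A * x) $$ (i, j))" by (rule regular_on_times_entry[where a = n and b = n and c = n])
  (use ij assms in \<open>auto intro: GL_mat reg_const reg_entry\<close>)
qed
then obtain q where "q:regular_fun n" "ALL A:GLs n. ddir n p A (A * x) = q A" by (auto simp: regular_on_def ddir_def)
thus thesis by (intro that[of q]) simp_all
qed

lemma mexp_deriv0: "x:sqm n ==> mderiv n (mexp n x) x 0" using mexp_deriv[of x n 0] by (simp add: mexp_0)

text \<open>The translate A -> p (g A) also vanishes on \<open>G\<close>, so its derivative at the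
  identity along \<open>x\<close> is zero; this is the derivative of \<open>p\<close> at
  \<open>g\<close> along \<open>g * x\<close>. Hence the left-invariant field of \<open>x\<close>
  preserves the ideal of \<open>G\<close>.\<close>

lemma vanishing_derivation:
assumes G: "subgroup G (GL n)" and x: "x:lie n G" and p: "p:vanishing n G" and g: "g:G"
shows "ddir n p g (g * x) = 0"
proof -
note sg = sub_GL[OF G]
have gG: "g:GLs n" using g sg(1) by blast
note xc = lie_carrier[OF x]
have pr: "p:regular_fun n" using p by (simp add: vanishing_def)
obtain q where q: "q:regular_fun n" "!!A. A:GLs n ==> q A = p (g * A * 1\<^sub>m n)"
 using translate_regular[OF pr gG GL_one_closed] by blast
have q': "q A = p (g * A)" if "A:GLs n" for A
 using q(2)[OF that] right_mult_one_mat[OF sq_mult[OF GL_mat[OF gG] GL_mat[OF that]]] by simp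
have "q:vanishing n G" unfolding vanishing_def using q(1) q' p sg(1,3) g by (auto simp: vanishing_def)
hence q0: "ddir n q (1\<^sub>m n) x = 0" using x by (simp add: lie_def)
have "((%t. q (mexp n x t)) has_field_derivative ddir n q (mexp n x 0) x) (at 0)"
 by (rule ddir_chain[OF q(1) mexp_deriv0[OF xc] mexp_GL[OF xc]])
hence 1: "((%t. p (g * mexp n x t)) has_field_derivative 0) (at 0)" using xc q0 by (simp add: mexp_0 q'[OF mexp_GL])
have "mderiv n (%t. g * mexp n x t) (0\<^sub>m n n * mexp n x 0 + g * x) 0"
 by (rule has_mderiv_times[OF has_mderiv_const[OF GL_mat[OF gG]] mexp_deriv0[OF xc]])
hence "((%t. p (g * mexp n x t)) has_field_derivative ddir n p (g * mexp n x 0) (0\<^sub>m n n * mexp n x 0 + g * x)) (at 0)"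
 by (rule ddir_chain[OF pr _ GL_times[OF gG mexp_GL[OF xc]]])
moreover have "g * mexp n x 0 = g" "0\<^sub>m n n * mexp n x 0 + g * x = g * x"
 using GL_mat[OF gG] xc by (simp_all add: mexp_0 left_add_zero_mat[of _ n n])
ultimately show ?thesis using DERIV_unique[OF 1] by simp
qed

text \<open>For \<open>p\<close> in the ideal of \<open>G\<close> all derivatives of the entire
  function s -> p (exp (s x)) vanish at 0, since the left-invariant derivation maps the ideal to
  itself. So the function is zero, and \<open>G\<close> is closed.\<close>

lemma mexp_mem:
assumes G: "algebraic_group n G" and x: "x:lie n G"
shows "mexp n x s:G"
proof -
have sub: "subgroup G (GL n)" using G by (simp add: algebraic_group_def)
note xc = lie_carrier[OF x]
have d: "((%t. p (mexp n x t)) has_field_derivative ddir n p (mexp n x s) (mexp n x s * x)) (at s)" if "p:vanishing n G" for p s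
 by (rule ddir_chain[OF _ mexp_deriv[OF xc] mexp_GL[OF xc]]) (use that in \<open>simp add: vanishing_def\<close>)
have zero: "(deriv ^^ k) (%t. p (mexp n x t)) 0 = 0" if "p:vanishing n G" for p k using that
proof (induction k arbitrary: p)
 case 0
 have "1\<^sub>m n:G" by (rule sub_GL(2)[OF sub])
 thus ?case using 0 xc by (simp add: mexp_0 vanishing_def)
next
 case (Suc k)
 hence "p:regular_fun n" by (simp add: vanishing_def)
 then obtain q where q: "q:regular_fun n" "!!A. A:GLs n ==> q A = ddir n p A (A * x)" using derivation_regular[OF _ xc] by blast
 have "q g = 0" if "g:G" for g
 proof -
  have "g:GLs n" using sub_GL(1)[OF sub] that by blast
  thus ?thesis using q(2) vanishing_derivation[OF sub x Suc.prems that] by simp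
 qed
 hence qv: "q:vanishing n G" using q(1) by (simp add: vanishing_def)
 have "deriv (%t. p (mexp n x t)) = (%t. q (mexp n x t))"
  using d[OF Suc.prems] q(2)[OF mexp_GL[OF xc]] by (auto intro!: ext DERIV_imp_deriv)
 hence "(deriv ^^ Suc k) (%t. p (mexp n x t)) = (deriv ^^ k) (%t. q (mexp n x t))"
  by (simp add: funpow_Suc_right del: funpow.simps)
 thus ?case using Suc.IH[OF qv] by simp
qed
have van: "p (mexp n x s) = 0" if "p:vanishing n G" for p
proof (rule holomorphic_fun_eq_0_on_connected[of "%t. p (mexp n x t)" UNIV 0 s])
 show "(%t. p (mexp n x t)) holomorphic_on UNIV" using d[OF that] by (subst holomorphic_on_open) auto
qed (use zero[OF that] in \<open>simp_all add: connected_UNIV\<close>)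
obtain F where F: "F <= regular_fun n" "G = {A:GLs n. ALL p:F. p A = 0}"
 using G by (auto simp: algebraic_group_def zariski_closed_def)
have "p:vanishing n G" if "p:F" for p using F that by (auto simp: vanishing_def)
thus ?thesis using van mexp_GL[OF xc] by (subst F(2)) auto
qed

lemma tangent_lie:
assumes "mderiv n ga V 0" "ga 0 = 1\<^sub>m n" "!!t. ga t:G"
shows "V:lie n G" unfolding lie_def
proof (intro CollectI conjI ballI)
show "V:sqm n" using assms(1) by (simp add: mderiv_def)
fix p assume p: "p:vanishing n G"
have "((%t. p (ga t)) has_field_derivative ddir n p (ga 0) V) (at 0)"
 by (rule ddir_chain[OF _ assms(1)]) (use p assms(2) GL_one_closed in \<open>auto simp: vanishing_def\<close>)
moreover have "(%t. p (ga t)) = (%t. 0)" using p assms(3) by (auto simp: vanishing_def)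
ultimately have "((%t. 0) has_field_derivative ddir n p (1\<^sub>m n) V) (at 0)" using assms(2) by simp
thus "ddir n p (1\<^sub>m n) V = 0" by (rule DERIV_unique) (rule DERIV_const)
qed

lemma lie_zero: "0\<^sub>m n n:lie n G" by (simp add: lie_def ddir_zero)

lemma lie_add: "x:lie n G ==> y:lie n G ==> x + y:lie n G" by (simp add: lie_def ddir_add)

lemma lie_smult: "x:lie n G ==> c \<cdot>\<^sub>m x:lie n G" by (simp add: lie_def ddir_smult)

lemma lie_conj:
assumes G: "algebraic_group n G" and x: "x:lie n G" and g: "g:G"
shows "g * x * ginv n g:lie n G"
proof -
have sub: "subgroup G (GL n)" using G by (simp add: algebraic_group_def)
note sg = sub_GL[OF sub]
have gG: "g:GLs n" using sg(1) g by blast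
note c = lie_carrier[OF x] GL_mat[OF gG] GL_mat[OF GL_inv_closed[OF gG]]
show ?thesis
proof (rule tangent_lie[where ga = "mexp n (g * x * ginv n g)"])
 show "mexp n (g * x * ginv n g) t:G" for t unfolding mexp_conj[OF c(1) gG, symmetric] using mexp_mem[OF G x] g sg(3,4) by blast
qed (use c in \<open>simp_all add: mexp_deriv0 mexp_0\<close>)
qed

lemma conj_mderiv:
assumes x: "x:sqm n" and y: "y:sqm n"
shows "mderiv n (%t. mexp n x t * y * mexp n (- x) t) (x * y - y * x) 0"
proof -
have mx: "- x:sqm n" using x by simp
have "mderiv n (%t. mexp n x t * y * mexp n (- x) t)
 ((x * y + mexp n x 0 * 0\<^sub>m n n) * mexp n (- x) 0 + mexp n x 0 * y * - x) 0"
 by (intro has_mderiv_times has_mderiv_const mexp_deriv0 x y mx)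
moreover have "(x * y + mexp n x 0 * 0\<^sub>m n n) * mexp n (- x) 0 + mexp n x 0 * y * - x = x * y - y * x"
proof (rule of_mat_eqI[of n])
 show "x * y - y * x:sqm n" using x y by (intro minus_carrier_mat sq_mult)
qed (use x y mx in \<open>simp_all add: mexp_0 of_mat_hom flip: mult.assoc\<close>)
ultimately show ?thesis by simp
qed

text \<open>The curve t -> exp (t x) y exp (- t x) stays in the tangent space, which is cut out by
  linear equations; hence so does its derivative [x, y] at 0.\<close>

lemma lie_bracket:
assumes G: "algebraic_group n G" and x: "x:lie n G" and y: "y:lie n G"
shows "x * y - y * x:lie n G" unfolding lie_def
proof (intro CollectI conjI ballI)
note c = lie_carrier[OF x] lie_carrier[OF y]
show "x * y - y * x:sqm n" using c by (intro minus_carrier_mat sq_mult)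
fix p assume p: "p:vanishing n G"
have "((%t. ddir n p (1\<^sub>m n) (mexp n x t * y * mexp n (- x) t)) has_field_derivative
  ddir n p (1\<^sub>m n) (x * y - y * x)) (at 0)" by (rule ddir_mderiv[OF conj_mderiv[OF c]])
moreover have "ddir n p (1\<^sub>m n) (mexp n x t * y * mexp n (- x) t) = 0" for t
 using lie_conj[OF G y mexp_mem[OF G x, of t]] p by (simp add: lie_def mexp_inv[OF c(1)])
ultimately have "((%t. 0) has_field_derivative ddir n p (1\<^sub>m n) (x * y - y * x)) (at 0)" by simp
thus "ddir n p (1\<^sub>m n) (x * y - y * x) = 0" by (rule DERIV_unique) (rule DERIV_const)
qed

section \<open>Homogeneous linear systems, and products of entire functions\<close>

lemma underdetermined_system:
fixes a :: "'j => 'i => 'f::field"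
assumes "finite I" "finite J" "card J < card I"
shows "EX u. (EX i:I. u i ~= 0) & (ALL j:J. (SUM i:I. a j i * u i) = 0)" using assms(2,1,3)
proof (induction J arbitrary: I a rule: finite_induct)
case empty
thus ?case by (intro exI[of _ "%_. 1"]) (auto simp: card_gt_0_iff)
next
case (insert j J)
show ?case
proof (cases "ALL i:I. a j i = 0")
 case True
 have "card J < card I" using insert by simp
 then obtain u where "EX i:I. u i ~= 0" "ALL j:J. (SUM i:I. a j i * u i) = 0" using insert.IH[of I a] insert.prems(1) by blast
 thus ?thesis using True by (intro exI[of _ u]) simp
next
 case False
 then obtain k where k: "k:I" "a j k ~= 0" by blast
 \<comment> \<open>Gaussian elimination: equation \<open>j\<close> is used to remove the unknown
   \<open>k\<close> from all other equations.\<close>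
 define b where "b j' i = a j' i - a j' k * a j i / a j k" for j' i
 have "card J < card (I - {k})" using insert k by simp
 then obtain u where u: "EX i:I - {k}. u i ~= 0" "ALL j:J. (SUM i:I - {k}. b j i * u i) = 0"
  using insert.IH[of "I - {k}" b] insert.prems(1) by blast
 define S where "S = (SUM i:I - {k}. a j i * u i)"
 define v where "v i = (if i = k then - S / a j k else u i)" for i
 have sum_v: "(SUM i:I. c i * v i) = c k * (- S / a j k) + (SUM i:I - {k}. c i * u i)" for c
  using insert.prems(1) k(1) by (subst sum.remove[of _ k]) (auto simp: v_def intro!: sum.cong)
 have "(SUM i:I. a j i * v i) = 0" unfolding sum_v using k by (simp add: S_def)
 moreover have "(SUM i:I. a j' i * v i) = 0" if "j':J" for j'
 proof -
  have "(SUM i:I - {k}. b j' i * u i) = (SUM i:I - {k}. a j' i * u i) - a j' k / a j k * S" unfolding b_def S_def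
  by (simp only: left_diff_distrib sum_subtractf sum_distrib_left) (simp add: mult_ac)
  thus ?thesis unfolding sum_v using u(2) that by simp
 qed
 moreover have "EX i:I. v i ~= 0" using u(1) by (auto simp: v_def)
 ultimately show ?thesis by blast
qed
qed

text \<open>\<open>f\<close> is nonzero on a nonempty open set, where \<open>g\<close> must vanish;
  the identity theorem does the rest. This will give irreducibility of exponential images.\<close>

lemma entire_product_zero:
assumes "f holomorphic_on UNIV" "g holomorphic_on UNIV" "!!s. f s = 0 \<or> g s = 0" "f a ~= (0 :: complex)"
shows "g b = (0 :: complex)"
proof -
have cf: "continuous_on UNIV f" by (rule holomorphic_on_imp_continuous_on[OF assms(1)])
have "open (f -` (- {0}))" using cf by (intro open_vimage) auto
thus ?thesis by (rule analytic_continuation_open[of _ UNIV g "%_. 0"]) (use assms in auto)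
qed

section \<open>Characters of semisimple groups are trivial\<close>

definition zclosure :: "nat => complex mat set => complex mat set" where
"zclosure n E = {A:GLs n. ALL p:vanishing n E. p A = 0}"

lemma zariski_closed_zclosure: "zariski_closed n (zclosure n E)" unfolding zariski_closed_def zclosure_def vanishing_def by blast

lemma zclosure_superset: "E <= GLs n ==> E <= zclosure n E" by (auto simp: zclosure_def vanishing_def)

lemma zclosure_minimal: "zariski_closed n S ==> E <= S ==> zclosure n E <= S"
unfolding zariski_closed_def zclosure_def vanishing_def by blast

lemma zclosure_regular:
assumes "regular_on n (GLs n) f" "E <= GLs n" "!!e. e:E ==> f e = 0" "A:zclosure n E"
shows "f A = 0"
proof -
obtain p where p: "p:regular_fun n" "ALL g:GLs n. f g = p g" using assms(1) by (auto simp: regular_on_def)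
have "p e = 0" if "e:E" for e using p(2) assms(2,3) that by (metis subsetD)
hence "p:vanishing n E" using p(1) by (simp add: vanishing_def)
hence "A:GLs n" "p A = 0" using assms(4) by (auto simp: zclosure_def)
thus ?thesis using p(2) by simp
qed

lemma zclosure_translate:
assumes E: "E <= GLs n" and g: "g:GLs n" "h:GLs n" and m: "!!e. e:E ==> g * e * h:zclosure n E" and A: "A:zclosure n E"
shows "g * A * h:zclosure n E" unfolding zclosure_def
proof (intro CollectI conjI ballI)
have AG: "A:GLs n" using A by (simp add: zclosure_def)
thus "g * A * h:GLs n" using g by (simp add: GL_times)
fix p assume p: "p:vanishing n E"
then obtain q where q: "q:regular_fun n" "!!A. A:GLs n ==> q A = p (g * A * h)"
 using translate_regular[OF _ g] by (auto simp: vanishing_def)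
have "q e = 0" if "e:E" for e using q(2) E m[OF that] that p by (auto simp: zclosure_def)
hence "q:vanishing n E" using q(1) by (simp add: vanishing_def)
hence "q A = 0" using A by (simp add: zclosure_def)
thus "p (g * A * h) = 0" unfolding q(2)[OF AG] .
qed

text \<open>Products are treated one factor at a time: translations by elements of \<open>E\<close>
  preserve the closure, so for \<open>B\<close> in the closure right translation by \<open>B\<close>
  sends \<open>E\<close>, and hence its closure, into the closure. Inversion is regular and
  preserves \<open>E\<close>.\<close>

lemma zclosure_subgroup:
assumes E: "subgroup E (GL n)"
shows "subgroup (zclosure n E) (GL n)"
proof -
note sg = sub_GL[OF E]
let ?R = "zclosure n E"
have RG: "?R <= GLs n" by (auto simp: zclosure_def)
have ER: "E <= ?R" by (rule zclosure_superset[OF sg(1)])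
have l1: "1\<^sub>m n * A = A" "A * 1\<^sub>m n = A" if "A:GLs n" for A using GL_mat[OF that] by auto
have m1: "e * A:?R" if e: "e:E" and A: "A:?R" for e A
proof -
 have eG: "e:GLs n" and AG: "A:GLs n" using e A sg(1) RG by blast+
 have "e * A * 1\<^sub>m n:?R"
 proof (rule zclosure_translate[OF sg(1) eG GL_one_closed _ A])
  fix a assume a: "a:E"
  have "e * a * 1\<^sub>m n = e * a" by (rule l1(2)[OF GL_times[OF eG]]) (use a sg(1) in blast)
  thus "e * a * 1\<^sub>m n:?R" using sg(3)[OF e a] ER by auto
 qed
 thus ?thesis unfolding l1(2)[OF GL_times[OF eG AG]] .
qed
have m2: "A * B:?R" if A: "A:?R" and B: "B:?R" for A B
proof -
 have AG: "A:GLs n" and BG: "B:GLs n" using A B RG by blast+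
 have "1\<^sub>m n * A * B:?R"
 proof (rule zclosure_translate[OF sg(1) GL_one_closed BG _ A])
  fix e assume e: "e:E"
  hence "e:GLs n" using sg(1) by blast
  thus "1\<^sub>m n * e * B:?R" using m1[OF e B] by (simp add: l1(1))
 qed
 thus ?thesis by (simp add: l1(1)[OF AG])
qed
have i: "ginv n A:?R" if A: "A:?R" for A unfolding zclosure_def
proof (intro CollectI conjI ballI)
 have AG: "A:GLs n" using A RG by blast
 thus "ginv n A:GLs n" by (rule GL_inv_closed)
 fix p assume p: "p:vanishing n E"
 show "p (ginv n A) = 0"
 proof (rule zclosure_regular[OF _ sg(1) _ A])
  show "regular_on n (GLs n) (%A. p (ginv n A))" by (rule regular_on_inv[OF subset_refl, of n "GLs n"])
   (use p GL_inv_closed in \<open>auto simp: vanishing_def intro: regular_on_fun\<close>)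
  show "p (ginv n e) = 0" if "e:E" for e using p sg(4)[OF that] by (simp add: vanishing_def)
 qed
qed
show ?thesis
proof (rule group.subgroupI[OF group_GL RG])
 show "?R ~= {}" using ER sg(2) by blast
qed (simp_all add: i m2)
qed

text \<open>Commuting with a fixed matrix is a closed condition. It is extended to the closure first
  for a matrix of \<open>E\<close> and then for a matrix of the closure.\<close>

lemma zclosure_commute:
assumes E: "subgroup E (GL n)" and comm: "!!a b. a:E ==> b:E ==> a * b = b * a" and A: "A:zclosure n E" and B: "B:zclosure n E"
shows "A * B = B * A"
proof -
note sg = sub_GL[OF E]
have RG: "zclosure n E <= GLs n" by (auto simp: zclosure_def)
have key: "C * B = B * C" if C: "C:GLs n" and CE: "!!e. e:E ==> C * e = e * C" and B: "B:zclosure n E" for C B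
proof (rule eq_matI)
 have c: "C:sqm n" "B:sqm n" using C B RG GL_mat by blast+
 fix i j assume "i < dim_row (B * C)" "j < dim_col (B * C)"
 hence ij: "i < n" "j < n" using c by auto
 have "(C * B) $$ (i, j) - (B * C) $$ (i, j) = 0"
 proof (rule zclosure_regular[OF _ sg(1) _ B])
  show "regular_on n (GLs n) (%A. (C * A) $$ (i, j) - (A * C) $$ (i, j))"
  by (intro regular_on_minus regular_on_times_entry[where a = n and b = n and c = n])
   (use ij c in \<open>auto intro: GL_mat reg_const reg_entry\<close>)
  show "(C * e) $$ (i, j) - (e * C) $$ (i, j) = 0" if "e:E" for e using CE[OF that] by simp
 qed
 thus "(C * B) $$ (i, j) = (B * C) $$ (i, j)" by simp
next
 have c: "C:sqm n" "B:sqm n" using C B RG GL_mat by blast+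
 show "dim_row (C * B) = dim_row (B * C)" "dim_col (C * B) = dim_col (B * C)" using c by auto
qed
have "A * e = e * A" if e: "e:E" for e
proof (rule key[symmetric])
 show "e:GLs n" using e sg(1) by blast
 show "e * e' = e' * e" if "e':E" for e' by (rule comm[OF e that])
qed (rule A)
thus ?thesis by (intro key[OF _ _ B]) (use A RG in blast)+
qed

lemma solvable_commutative:
assumes R: "subgroup R (GL n)" and comm: "!!a b. a:R ==> b:R ==> a * b = b * a"
shows "solvable (sub_grp n R)"
proof -
interpret g: group "sub_grp n R" by (rule group.subgroup_imp_group[OF group_GL R])
have "derived_set (sub_grp n R) R <= {\<one>\<^bsub>sub_grp n R\<^esub>}"
proof clarsimp
 fix a b assume ab: "a:R" "b:R"
 have ainv: "inv\<^bsub>sub_grp n R\<^esub> a:R" "inv\<^bsub>sub_grp n R\<^esub> b:R" using ab g.inv_closed by auto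
 have c: "a:sqm n" "b:sqm n" "inv\<^bsub>sub_grp n R\<^esub> a:sqm n" using ab ainv sub_GL(1)[OF R] GL_mat by blast+
 have "a * b * inv\<^bsub>sub_grp n R\<^esub> a = b * (a * inv\<^bsub>sub_grp n R\<^esub> a)"
  using comm[OF ab] c by (simp add: assoc_mult_mat[of _ n n _ n _ n])
 also have "... = b" using g.r_inv[of a] ab c by simp
 finally show "a * b * inv\<^bsub>sub_grp n R\<^esub> a * inv\<^bsub>sub_grp n R\<^esub> b = 1\<^sub>m n"
  using g.r_inv[of b] ab by simp
qed
hence "derived (sub_grp n R) R <= {\<one>\<^bsub>sub_grp n R\<^esub>}"
 unfolding derived_def using g.generate_subgroup_incl[OF _ normal.axioms(1)[OF g.one_is_normal]] by blast
moreover have "\<one>\<^bsub>sub_grp n R\<^esub>:derived (sub_grp n R) R" unfolding derived_def by (rule generate.one)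
ultimately have "derived (sub_grp n R) R = {\<one>\<^bsub>sub_grp n R\<^esub>}" by blast
hence "((derived (sub_grp n R)) ^^ 1) R = {\<one>\<^bsub>sub_grp n R\<^esub>}" by simp
hence "solvable_seq (sub_grp n R) R" using g.trivial_derived_seq_imp_solvable[of R 1] g.subgroup_self by simp
thus ?thesis by (simp add: solvable_def)
qed

text \<open>The hypothesis \<open>irr\<close> is irreducibility of \<open>E\<close> in terms of
  functions: a product of regular functions vanishing on \<open>E\<close> has a factor vanishing on
  \<open>E\<close>. If two closed sets cover the closure, one of them contains \<open>E\<close> and
  with it the closure.\<close>

lemma zariski_connected_zclosure:
assumes E: "E <= GLs n" "E ~= {}"
 and irr: "!!p q a b. p:regular_fun n ==> q:regular_fun n ==> (!!e. e:E ==> p e = 0 \<or> q e = 0) ==>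
  a:E ==> b:E ==> p a ~= 0 ==> q b = 0"
shows "zariski_connected n (zclosure n E)" unfolding zariski_connected_def
proof (intro conjI notI)
have ER: "E <= zclosure n E" by (rule zclosure_superset[OF E(1)])
thus "zclosure n E = {} ==> False" using E(2) by blast
assume "EX A B. zariski_closed n A & zariski_closed n B & zclosure n E <= A \<union> B &
   zclosure n E \<inter> A ~= {} & zclosure n E \<inter> B ~= {} & zclosure n E \<inter> A \<inter> B = {}"
then obtain A B where AB: "zariski_closed n A" "zariski_closed n B" "zclosure n E <= A \<union> B"
 "zclosure n E \<inter> A ~= {}" "zclosure n E \<inter> B ~= {}" "zclosure n E \<inter> A \<inter> B = {}" by blast
obtain P where P: "P <= regular_fun n" "A = {x:GLs n. ALL p:P. p x = 0}" using AB(1) by (auto simp: zariski_closed_def)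
obtain Q where Q: "Q <= regular_fun n" "B = {x:GLs n. ALL p:Q. p x = 0}" using AB(2) by (auto simp: zariski_closed_def)
have "E <= A \<or> E <= B"
proof (rule ccontr)
 assume "~ (E <= A \<or> E <= B)"
 then obtain a b where ab: "a:E" "a \<notin> A" "b:E" "b \<notin> B" by blast
 then obtain p where p: "p:P" "p a ~= 0" using P(2) E(1) by blast
 obtain q where q: "q:Q" "q b ~= 0" using ab Q(2) E(1) by blast
 have "p e = 0 \<or> q e = 0" if "e:E" for e
 proof -
  have "e:A \<union> B" using that ER AB(3) by blast
  thus ?thesis using P(2) Q(2) p(1) q(1) by blast
 qed
 thus False using irr[of p q a b] p q P(1) Q(1) ab by blast
qed
thus False using zclosure_minimal[OF AB(1), of E] zclosure_minimal[OF AB(2), of E] AB(4,5,6) by blast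
qed

text \<open>The exponentials of \<open>C\<close> form a commutative group normalised by
  \<open>G\<close>. Its Zariski closure is commutative, hence solvable, and it is normal and
  connected; semisimplicity makes it trivial. But then s -> exp (s x) is constant for x in
  \<open>C\<close>, which forces x = 0.\<close>

lemma semisimple_no_commutative_ideal:
assumes ss: "semisimple_group n G" and C: "lop.subspace C" "C <= of_mat n ` lie n G" "C ~= {0}"
 and comm: "!!x y. x:C ==> y:C ==> x * y = y * x" and stable: "!!g z. g:G ==> z:C ==> of_mat n g * z * of_mat n (ginv n g):C"
shows False
proof -
have G: "algebraic_group n G" "subgroup G (GL n)" and zc: "zariski_closed n G"
 using ss by (auto simp: semisimple_group_def algebraic_group_def)
note sg = sub_GL[OF G(2)]
define L where "L = {x:carrier_mat n n. of_mat n x:C}"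
have Lc: "x:sqm n" if "x:L" for x using that by (simp add: L_def)
have Llie: "x:lie n G" if x: "x:L" for x
proof -
 obtain y where "y:lie n G" "of_mat n x = of_mat n y" using x C(2) by (auto simp: L_def)
 thus ?thesis using of_mat_inj[OF Lc[OF x] lie_carrier] by metis
qed
have L_add: "x + y:L" if "x:L" "y:L" for x y using that lop.subspace_add[OF C(1)] by (simp add: L_def of_mat_add)
have L_smult: "c \<cdot>\<^sub>m x:L" if "x:L" for c x using that lop.subspace_scale[OF C(1)] by (simp add: L_def of_mat_smult)
have L_minus: "- x:L" if "x:L" for x using that lop.subspace_neg[OF C(1)] by (simp add: L_def of_mat_uminus)
have L_zero: "0\<^sub>m n n:L" using lop.subspace_0[OF C(1)] by (simp add: L_def of_mat_zero)
have L_comm: "x * y = y * x" if "x:L" "y:L" for x y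
proof (rule of_mat_eqI[of n])
 show "of_mat n (x * y) = of_mat n (y * x)" using that comm by (simp add: L_def of_mat_times)
qed (use that in \<open>simp_all add: L_def\<close>)
define E where "E = (%x. mexp n x 1) ` L"
have EG: "E <= G" using mexp_mem[OF G(1) Llie] by (auto simp: E_def)
have E_mult: "a * b:E" if ab: "a:E" "b:E" for a b
proof -
 obtain x y where "a = mexp n x 1" "b = mexp n y 1" "x:L" "y:L" using ab unfolding E_def by blast
 thus ?thesis using mexp_add[OF Lc Lc L_comm, of x y 1] L_add by (auto simp: E_def)
qed
have E_inv: "ginv n a:E" if a: "a:E" for a
proof -
 obtain x where "a = mexp n x 1" "x:L" using a by (auto simp: E_def)
 thus ?thesis using mexp_inv[OF Lc, of x 1] L_minus by (auto simp: E_def)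
qed
have E_sub: "subgroup E (GL n)"
 by (rule group.subgroupI[OF group_GL]) (use EG sg(1) L_zero E_mult E_inv in \<open>auto simp: E_def\<close>)
have E_comm: "a * b = b * a" if ab: "a:E" "b:E" for a b
proof -
 obtain x y where e: "a = mexp n x 1" "b = mexp n y 1" and xy: "x:L" "y:L" using ab unfolding E_def by blast
 have "x + y = y + x" using Lc[OF xy(1)] Lc[OF xy(2)] by (rule comm_add_mat)
 thus ?thesis unfolding e using mexp_add[OF Lc Lc L_comm, of x y 1] mexp_add[OF Lc Lc L_comm, of y x 1] xy by simp
qed
have E_conj: "g * a * ginv n g:E" if g: "g:G" and a: "a:E" for g a
proof -
 obtain x where x: "a = mexp n x 1" "x:L" using a by (auto simp: E_def)
 have gG: "g:GLs n" using g sg(1) by blast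
 note c = GL_mat[OF gG] GL_mat[OF GL_inv_closed[OF gG]] Lc[OF x(2)]
 have "of_mat n (g * x * ginv n g):C" using stable[OF g, of "of_mat n x"] x(2) c by (simp add: L_def of_mat_times mult.assoc)
 hence "g * x * ginv n g:L" using c by (simp add: L_def)
 thus ?thesis unfolding x(1) mexp_conj[OF c(3) gG] by (auto simp: E_def)
qed
let ?R = "zclosure n E"
have R_sub: "subgroup ?R (GL n)" by (rule zclosure_subgroup[OF E_sub])
have RG: "?R <= G" by (rule zclosure_minimal[OF zc EG])
have ER: "E <= ?R" using zclosure_superset EG sg(1) by blast
have R_conj: "g * a * ginv n g:?R" if "g:G" "a:?R" for g a
proof (rule zclosure_translate[OF _ _ _ _ that(2)])
 show "g * e * ginv n g:?R" if "e:E" for e using E_conj[OF \<open>g:G\<close> that] ER by blast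
qed (use that EG sg GL_inv_closed in auto)
have normal: "?R \<lhd> sub_grp n G"
proof -
 interpret g: group "sub_grp n G" by (rule group.subgroup_imp_group[OF group_GL G(2)])
 show ?thesis unfolding g.normal_inv_iff
 proof (intro conjI ballI)
  show "subgroup ?R (sub_grp n G)" by (rule group.subgroup_incl[OF group_GL R_sub G(2) RG])
  fix x h assume "x:carrier (sub_grp n G)" "h:?R"
  thus "x \<otimes>\<^bsub>sub_grp n G\<^esub> h \<otimes>\<^bsub>sub_grp n G\<^esub> inv\<^bsub>sub_grp n G\<^esub> x:?R"
  using R_conj[of x h] group.m_inv_consistent[OF group_GL G(2)] by simp
 qed
qed
have connected: "zariski_connected n ?R"
proof (rule zariski_connected_zclosure)
 show "E <= GLs n" "E ~= {}" using EG sg(1) L_zero by (auto simp: E_def)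
 fix p q a b assume p: "p:regular_fun n" and q: "q:regular_fun n"
  and pq: "!!e. e:E ==> p e = 0 \<or> q e = 0" and ab: "a:E" "b:E" and pa: "p a ~= 0"
 obtain x y where e: "a = mexp n x 1" "b = mexp n y 1" and xy: "x:L" "y:L" using ab by (auto simp: E_def)
 \<comment> \<open>The entire curve s -> exp (x + s (y - x)) runs inside \<open>E\<close> from
   \<open>a\<close> to \<open>b\<close>. Along it \<open>p\<close> and \<open>q\<close> become
   entire functions with product zero.\<close>
 define z where "z = y + - x"
 have z: "z:L" unfolding z_def using xy L_add L_minus by blast
 define ga where "ga s = mexp n x 1 * mexp n z s" for s
 have ga: "ga s = mexp n (x + s \<cdot>\<^sub>m z) 1" for s
  unfolding ga_def using mexp_add[OF Lc Lc L_comm, of x "s \<cdot>\<^sub>m z" 1] xy z L_smult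
  mexp_smult[OF Lc[OF z], of s 1] by simp
 have gaE: "ga s:E" for s unfolding ga E_def using xy z L_add L_smult by blast
 have "x + 0 \<cdot>\<^sub>m z = x" "x + 1 \<cdot>\<^sub>m z = y"
  using Lc[OF xy(1)] Lc[OF xy(2)] by (auto simp: z_def intro!: eq_matI)
 hence ga01: "ga 0 = a" "ga 1 = b" unfolding ga e by simp_all
 have d: "mderiv n ga (0\<^sub>m n n * mexp n z s + mexp n x 1 * (mexp n z s * z)) s" for s
  unfolding ga_def by (rule has_mderiv_times[OF has_mderiv_const[OF mexp_carrier] mexp_deriv[OF Lc[OF z]]])
 have h: "(%s. r (ga s)) holomorphic_on UNIV" if r: "r:regular_fun n" for r unfolding holomorphic_on_open[OF open_UNIV]
  using ddir_chain[OF r d] gaE EG sg(1) by blast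
 have "q (ga 1) = 0" by (rule entire_product_zero[OF h[OF p] h[OF q], of 0]) (use pq gaE pa ga01 in auto)
 thus "q b = 0" using ga01 by simp
qed
have "solvable (sub_grp n ?R)" by (rule solvable_commutative[OF R_sub]) (rule zclosure_commute[OF E_sub E_comm])
hence R1: "?R = {1\<^sub>m n}" using ss normal connected zariski_closed_zclosure unfolding semisimple_group_def GL_one by blast
obtain c where c: "c:C" "c ~= 0" using C(3) lop.subspace_0[OF C(1)] by blast
then obtain x where x: "x:lie n G" "c = of_mat n x" using C(2) by blast
have xL: "x:L" using c x lie_carrier by (simp add: L_def)
have "mexp n x s = 1\<^sub>m n" for s
proof -
 have "mexp n (s \<cdot>\<^sub>m x) 1:E" using L_smult[OF xL] by (auto simp: E_def)
 thus ?thesis using ER R1 mexp_smult[OF Lc[OF xL], of s 1] by auto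
qed
hence "mderiv n (%_. 1\<^sub>m n) x 0" using mexp_deriv0[OF Lc[OF xL]] by (metis ext)
hence d: "((%_. 1\<^sub>m n $$ (i, j)) has_field_derivative x $$ (i, j)) (at 0)" if "i < n" "j < n" for i j
 using that by (simp add: mderiv_def del: index_one_mat)
have "x = 0\<^sub>m n n" using Lc[OF xL] DERIV_unique[OF d DERIV_const] by (intro eq_matI) auto
thus False using c x by (simp add: of_mat_zero)
qed

text \<open>If \<open>m\<close> were nonzero, the differential \<open>d\<close> of \<open>ch\<close>
  at the identity would be a nonzero linear form on the Lie algebra that is invariant under
  conjugation and kills brackets. From its kernel a commutative stable subspace is built, against
  \<open>semisimple_no_commutative_ideal\<close>.\<close>

theorem semisimple_char_trivial:
assumes ss: "semisimple_group n G" and ch: "regular_on n G ch" "!!g. g:G ==> ch g ~= 0"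
  "!!g h. g:G ==> h:G ==> ch (g * h) = ch g * ch h"
 and mu: "mu:one_param_subgroups n G" "!!t. t ~= 0 ==> ch (mu (scalar1 t)) = t powi m"
shows "m = 0"
proof (rule ccontr)
assume m: "m ~= 0"
have G: "algebraic_group n G" "subgroup G (GL n)" using ss by (auto simp: semisimple_group_def algebraic_group_def)
note sg = sub_GL[OF G(2)]
let ?M = "of_mat n"
obtain p where p: "p:regular_fun n" "!!g. g:G ==> ch g = p g" using ch(1) by (auto simp: regular_on_def)
define d where "d x = ddir n p (1\<^sub>m n) x" for x
have ch1: "ch (1\<^sub>m n) = 1" using ch(3)[OF sg(2) sg(2)] ch(2)[OF sg(2)] by simp
have d_exp: "((%t. p (mexp n y t)) has_field_derivative d y) (at 0)" if "y:sqm n" for y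
 using ddir_chain[OF p(1) mexp_deriv0[OF that] mexp_GL[OF that]] that by (simp add: d_def mexp_0)
have d_conj: "d (g * y * ginv n g) = d y" if g: "g:G" and y: "y:lie n G" for g y
proof -
 have gG: "g:GLs n" using g sg(1) by blast
 note c = lie_carrier[OF y] lie_carrier[OF lie_conj[OF G(1) y g]]
 have "p (mexp n (g * y * ginv n g) t) = p (mexp n y t)" for t
 proof -
  have e: "mexp n y t:G" by (rule mexp_mem[OF G(1) y])
  have "ch (g * mexp n y t * ginv n g) = ch (mexp n y t) * ch (g * ginv n g)" using ch(3) g e sg(3,4) by simp
  hence "ch (g * mexp n y t * ginv n g) = ch (mexp n y t)" using GL_inv_right[OF gG] ch1 by simp
  thus ?thesis unfolding mexp_conj[OF c(1) gG] using p(2) e mexp_mem[OF G(1) lie_conj[OF G(1) y g]] by simp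
 qed
 thus ?thesis using DERIV_unique[OF d_exp[OF c(2)]] d_exp[OF c(1)] by simp
qed
have d_br: "d (x * y - y * x) = 0" if x: "x:lie n G" and y: "y:lie n G" for x y
proof -
 note c = lie_carrier[OF x] lie_carrier[OF y]
 have "((%t. d (mexp n x t * y * mexp n (- x) t)) has_field_derivative d (x * y - y * x)) (at 0)"
  unfolding d_def by (rule ddir_mderiv[OF conj_mderiv[OF c]])
 moreover have "d (mexp n x t * y * mexp n (- x) t) = d y" for t
  using d_conj[OF mexp_mem[OF G(1) x, of t] y] by (simp add: mexp_inv[OF c(1)])
 ultimately have "((%t. d y) has_field_derivative d (x * y - y * x)) (at 0)" by simp
 thus ?thesis by (rule DERIV_unique) (rule DERIV_const)
qed
\<comment> \<open>\<open>V\<close> is the velocity at t = 0 of the curve t -> mu (exp t). The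
  character equals exp (m t) along this curve, so d V = m.\<close>
obtain V where V: "V:lie n G" "d V ~= 0"
proof -
 define de where "de t = scalar1 (exp t)" for t
 have de: "de t:GLs 1" for t by (auto simp: de_def scalar1_def GL_carrier det_single)
 have ded: "mderiv 1 de (de t) t" for t unfolding mderiv_def
 proof (intro conjI allI impI)
  show "de s:sqm 1" for s by (simp add: de_def scalar1_def)
  fix i j :: nat assume "i < 1" "j < 1"
  thus "((%t. de t $$ (i, j)) has_field_derivative de t $$ (i, j)) (at t)" by (simp add: de_def scalar1_def)
 qed (simp add: de_def scalar1_def)
 note muh = alg_homD[OF mu(1)[unfolded one_param_subgroups_def]]
 have muG: "mu (de t):G" for t by (rule muh(1)[OF de])
 have "EX v. ((%t. mu (de t) $$ (i, j)) has_field_derivative v) (at 0)" if ij: "i < n" "j < n" for i j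
 proof -
  obtain r where r: "r:regular_fun 1" "!!g. g:GLs 1 ==> mu g $$ (i, j) = r g" using muh(3)[OF ij] by (auto simp: regular_on_def)
  show ?thesis using ddir_chain[OF r(1) ded de] r(2)[OF de] by auto
 qed
 then obtain v where v: "!!i j. i < n ==> j < n ==> ((%t. mu (de t) $$ (i, j)) has_field_derivative v i j) (at 0)" by metis
 define V where "V = mat n n (%(i, j). v i j)"
 have dV: "mderiv n (%t. mu (de t)) V 0" unfolding mderiv_def
 proof (intro conjI allI impI)
  show "mu (de t):sqm n" for t using muG[of t] sg(1) GL_mat by blast
 qed (use v in \<open>simp_all add: V_def\<close>)
 have d0: "de 0 = 1\<^sub>m 1" by (auto simp: de_def scalar1_def intro!: eq_matI)
 have mu0: "mu (de 0) = 1\<^sub>m n"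
  using algebraic_hom_one_inv(1)[OF mu(1)[unfolded one_param_subgroups_def] group.subgroup_self[OF group_GL] sg(1)]
  by (simp add: d0)
 show thesis
 proof (rule that)
  show "V:lie n G" by (rule tangent_lie[OF dV mu0 muG])
  have "((%t. p (mu (de t))) has_field_derivative d V) (at 0)" using ddir_chain[OF p(1) dV] mu0 GL_one_closed by (simp add: d_def)
  moreover have "p (mu (de t)) = exp (of_int m * t)" for t
  using mu(2)[of "exp t"] p(2)[OF muG, of t] by (simp add: de_def exp_power_int[symmetric])
  moreover have "((%t. exp (of_int m * t)) has_field_derivative of_int m) (at 0)" by (auto intro!: derivative_eq_intros)
  ultimately have "d V = of_int m" using DERIV_unique by simp
  thus "d V ~= 0" using m by simp
 qed
qed
define k where "k = {y:lie n G. d y = 0}"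
\<comment> \<open>The orthogonal complement of \<open>k\<close> for the trace form. All brackets lie
  in \<open>k\<close>, so tr ([x, y] z) = 0 on \<open>q\<close>; and \<open>q\<close> inherits from
  \<open>k\<close> the stability under brackets and conjugation.\<close>
define q where "q = {z:lie n G. ALL y:k. ltr n (?M z * ?M y) = 0}"
have dz: "d (0\<^sub>m n n) = 0" by (simp add: d_def ddir_zero)
have da: "d (x + y) = d x + d y" if "x:lie n G" "y:lie n G" for x y using that by (simp add: d_def ddir_add lie_carrier)
have ds: "d (c \<cdot>\<^sub>m x) = c * d x" if "x:lie n G" for c x using that by (simp add: d_def ddir_smult lie_carrier)
have sub_lie: "lop.subspace (?M ` lie n G)"
proof (rule lop.subspaceI)
 show "0:?M ` lie n G" using lie_zero of_mat_zero by (metis imageI)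
 show "x + y:?M ` lie n G" if "x:?M ` lie n G" "y:?M ` lie n G" for x y
  using that lie_add by (force simp: of_mat_add[symmetric] lie_carrier)
 show "lscale c x:?M ` lie n G" if "x:?M ` lie n G" for c x
  using that lie_smult by (force simp: of_mat_smult[symmetric] lie_carrier)
qed
have sub_k: "lop.subspace (?M ` k)"
proof (rule lop.subspaceI)
 have "0\<^sub>m n n:k" using lie_zero dz by (simp add: k_def)
 thus "0:?M ` k" using of_mat_zero by (metis imageI)
 show "x + y:?M ` k" if "x:?M ` k" "y:?M ` k" for x y
  using that lie_add da by (force simp: k_def of_mat_add[symmetric] lie_carrier)
 show "lscale c x:?M ` k" if "x:?M ` k" for c x using that lie_smult ds by (force simp: k_def of_mat_smult[symmetric] lie_carrier)
qed
have ltr0: "ltr n 0 = 0" using ltr_scale[of n 0 0] by simp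
have ltr_diff: "ltr n (x - y) = ltr n x - ltr n y" for x y using ltr_add[of n "x - y" y] by simp
have ltr_sum: "ltr n (SUM i:I. f i) = (SUM i:I. ltr n (f i))" for I :: "lop set" and f
 by (induction I rule: infinite_finite_induct) (simp_all add: ltr_add ltr0)
have sub_q: "lop.subspace (?M ` q)"
proof (rule lop.subspaceI)
 have "0\<^sub>m n n:q" using lie_zero ltr0 by (simp add: q_def of_mat_zero)
 thus "0:?M ` q" using of_mat_zero by (metis imageI)
 show "x + y:?M ` q" if xy: "x:?M ` q" "y:?M ` q" for x y
 proof -
  obtain a b where ab: "a:q" "b:q" "x = ?M a" "y = ?M b" using xy by blast
  hence "a + b:q" by (auto simp: q_def lie_add of_mat_add lie_carrier distrib_right ltr_add)
  moreover have "a:sqm n" "b:sqm n" using ab lie_carrier by (auto simp: q_def)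
  hence "x + y = ?M (a + b)" using ab by (simp add: of_mat_add)
  ultimately show ?thesis by blast
 qed
 show "lscale c x:?M ` q" if xq: "x:?M ` q" for c x
 proof -
  obtain a where a: "a:q" "x = ?M a" using xq by blast
  hence "c \<cdot>\<^sub>m a:q" by (auto simp: q_def lie_smult of_mat_smult lie_carrier lop.scale_mult_left ltr_scale)
  moreover have "a:sqm n" using a lie_carrier by (auto simp: q_def)
  hence "lscale c x = ?M (c \<cdot>\<^sub>m a)" using a by (simp add: of_mat_smult)
  ultimately show ?thesis by blast
 qed
qed
have lie_mats: "?M ` lie n G <= mats n" using lie_carrier by (auto simp: mats_def)
define B where "B = (%(i, j). of_mat n (mat_unit n i j)) ` ({..<n} \<times> {..<n})"
have B: "finite B" "mats n <= lop.span B" using mats_span by (auto simp: B_def)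
have q_nonzero: "?M ` q ~= {0}"
proof -
 have "?M V \<notin> ?M ` k" using V of_mat_inj[OF lie_carrier[OF V(1)] lie_carrier] by (auto simp: k_def)
 hence "?M ` k \<subset> ?M ` lie n G" using V(1) by (auto simp: k_def)
 hence dim: "lop.dim (?M ` k) < lop.dim (?M ` lie n G)" using lop.dim_psubset_span[OF sub_k _ _ B(1)] lie_mats B(2) by blast
 obtain b where b: "b <= ?M ` lie n G" "lop.independent b" "?M ` lie n G <= lop.span b" "card b = lop.dim (?M ` lie n G)"
  using lop.basis_exists by blast
 obtain c where c: "c <= ?M ` k" "lop.independent c" "?M ` k <= lop.span c" "card c = lop.dim (?M ` k)"
  using lop.basis_exists by blast
 have kl: "?M ` k <= ?M ` lie n G" by (auto simp: k_def)
 have "finite b" using lop.independent_span_bound[OF B(1) b(2)] b(1) lie_mats B(2) by blast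
 moreover have "finite c" using lop.independent_span_bound[OF B(1) c(2)] c(1) kl lie_mats B(2) by blast
 \<comment> \<open>A dimension count: dim k orthogonality conditions on an element of the strictly
   larger space \<open>lie n G\<close>.\<close>
 ultimately obtain u where u: "EX x:b. u x ~= 0" "ALL w:c. (SUM x:b. ltr n (x * w) * u x) = 0"
  using underdetermined_system[of b c "%w x. ltr n (x * w)"] dim b(4) c(4) by auto
 define z where "z = (SUM x:b. lscale (u x) x)"
 have zl: "z:?M ` lie n G" unfolding z_def using b(1) by (intro lop.subspace_sum[OF sub_lie] lop.subspace_scale[OF sub_lie]) auto
 have z0: "z ~= 0" using lop.independentD[OF b(2) \<open>finite b\<close> subset_refl, of u] u(1) unfolding z_def by blast
 have zc: "ltr n (z * w) = 0" if "w:c" for w using u(2) that unfolding z_def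
  by (simp add: sum_distrib_right lop.scale_mult_left ltr_sum ltr_scale mult.commute)
 have zk: "ltr n (z * w) = 0" if "w:lop.span c" for w using that
 proof (induction rule: lop.span_induct_alt)
  case base
  thus ?case by (simp add: ltr0)
 next
  case (step a x y)
  thus ?case using zc by (simp add: distrib_left lop.scale_mult_right ltr_add ltr_scale)
 qed
 obtain Z where Z: "Z:lie n G" "z = ?M Z" using zl by blast
 have "Z:q" unfolding q_def using Z zk c(3) by blast
 thus ?thesis using z0 Z by auto
qed
have tr_comm: "ltr n (x * y) = ltr n (y * x)" if "x:mats n" "y:mats n" for x y using that ltr_commute by (auto simp: mats_def)
have Mmats: "?M x:mats n" if "x:lie n G" for x using that lie_mats by blast
have ql: "x:lie n G" if "x:q" for x using that by (simp add: q_def)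
have br_M: "lop.br (?M x) (?M y) = ?M (x * y - y * x)" if "x:lie n G" "y:lie n G" for x y
 using that by (simp add: lop.br_def of_mat_minus of_mat_times lie_carrier)
have br_k: "x * y - y * x:k" if "x:lie n G" "y:lie n G" for x y using that d_br lie_bracket[OF G(1)] by (simp add: k_def)
have q_br: "lop.br x y:?M ` q" if xy: "x:?M ` q" "y:?M ` q" for x y
proof -
 obtain a b where ab: "a:q" "b:q" "x = ?M a" "y = ?M b" using xy by blast
 note l = ql[OF ab(1)] ql[OF ab(2)]
 have "ltr n (?M (a * b - b * a) * ?M w) = 0" if w: "w:k" for w
 proof -
  have wl: "w:lie n G" using w by (simp add: k_def)
  have "ltr n (?M (a * b - b * a) * ?M w) = ltr n (?M a * (?M b * ?M w)) - ltr n (?M b * (?M a * ?M w))"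
  unfolding br_M[OF l, symmetric] lop.br_def by (simp add: left_diff_distrib ltr_diff mult.assoc)
  also have "ltr n (?M b * (?M a * ?M w)) = ltr n (?M a * (?M w * ?M b))"
  using tr_comm[of "?M b" "?M a * ?M w"] Mmats[OF l(1)] Mmats[OF l(2)] Mmats[OF wl] by (simp add: mats_mult mult.assoc)
  also have "ltr n (?M a * (?M b * ?M w)) - ltr n (?M a * (?M w * ?M b)) = ltr n (?M a * lop.br (?M b) (?M w))"
  by (simp add: lop.br_def right_diff_distrib ltr_diff)
  also have "... = 0" unfolding br_M[OF l(2) wl] using ab(1) br_k[OF l(2) wl] by (simp add: q_def)
  finally show ?thesis .
 qed
 hence "a * b - b * a:q" using lie_bracket[OF G(1) l] by (simp add: q_def)
 thus ?thesis unfolding ab br_M[OF l] by blast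
qed
have q_tr: "ltr n (lop.br x y * z) = 0" if xyz: "x:?M ` q" "y:?M ` q" "z:?M ` q" for x y z
proof -
 obtain a b c where abc: "a:q" "b:q" "c:q" "x = ?M a" "y = ?M b" "z = ?M c" using xyz by blast
 note l = ql[OF abc(1)] ql[OF abc(2)] ql[OF abc(3)]
 have "ltr n (?M (a * b - b * a) * ?M c) = ltr n (?M c * ?M (a * b - b * a))" by (intro tr_comm Mmats l lie_bracket[OF G(1)])
 also have "... = 0" using abc(3) br_k[OF l(1,2)] by (simp add: q_def)
 finally show ?thesis unfolding abc br_M[OF l(1,2)] .
qed
define Ga where "Ga = (%g z. ?M g * z * ?M (ginv n g)) ` G"
have gg: "?M (ginv n g) * ?M g = ?M (1\<^sub>m n)" "?M g * ?M (ginv n g) = ?M (1\<^sub>m n)"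
  "?M g:mats n" "?M (ginv n g):mats n" if "g:G" for g
proof -
 have gG: "g:GLs n" using that sg(1) by blast
 note c = GL_mat[OF gG] GL_mat[OF GL_inv_closed[OF gG]]
 show "?M (ginv n g) * ?M g = ?M (1\<^sub>m n)" "?M g * ?M (ginv n g) = ?M (1\<^sub>m n)"
  using c GL_inv_left[OF gG] GL_inv_right[OF gG] by (simp_all flip: of_mat_times)
 show "?M g:mats n" "?M (ginv n g):mats n" using c by (auto simp: mats_def)
qed
have one: "?M (1\<^sub>m n) * x = x" "x * ?M (1\<^sub>m n) = x" if "x:mats n" for x using that by (auto simp: mats_def of_mat_one)
have Ga_q: "ph x:?M ` q" if ph: "ph:Ga" and x: "x:?M ` q" for ph x
proof -
 obtain g where g: "g:G" "ph = (%z. ?M g * z * ?M (ginv n g))" using ph by (auto simp: Ga_def)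
 obtain a where a: "a:q" "x = ?M a" using x by blast
 have gG: "g:GLs n" using g sg(1) by blast
 have ig: "ginv n g:G" "ginv n (ginv n g) = g" using sg(4)[OF g(1)] group.inv_inv[OF group_GL gG] by auto
 note c = GL_mat[OF gG] GL_mat[OF GL_inv_closed[OF gG]]
 let ?i = "ginv n g"
 have alm: "a:lie n G" by (rule ql[OF a(1)])
 have phx: "ph x = ?M (g * a * ?i)" using c lie_carrier[OF alm] by (simp add: g a of_mat_times mult.assoc)
 have "ltr n (?M (g * a * ?i) * ?M w) = 0" if w: "w:k" for w
 proof -
  have wl: "w:lie n G" using w by (simp add: k_def)
  have w': "?i * w * g:k" using lie_conj[OF G(1) wl ig(1)] d_conj[OF ig(1) wl] w unfolding ig(2) by (simp add: k_def)
  have "ltr n (?M (g * a * ?i) * ?M w) = ltr n (?M g * (?M a * ?M ?i * ?M w))"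
  using c lie_carrier[OF alm] by (simp add: of_mat_times mult.assoc)
  also have "... = ltr n ((?M a * ?M ?i * ?M w) * ?M g)" using gg[OF g(1)] Mmats[OF alm] Mmats[OF wl] by (intro tr_comm mats_mult)
  also have "... = ltr n (?M a * ?M (?i * w * g))" using c lie_carrier[OF wl] by (simp add: of_mat_times mult.assoc)
  also have "... = 0" using a(1) w' by (simp add: q_def)
  finally show ?thesis .
 qed
 hence "g * a * ?i:q" using lie_conj[OF G(1) alm g(1)] by (simp add: q_def)
 thus ?thesis unfolding phx by blast
qed
have q_mats: "?M ` q <= mats n" using ql Mmats by blast
have Ga_add: "ph (x + y) = ph x + ph y" if "ph:Ga" for ph x y using that by (auto simp: Ga_def algebra_simps)
have Ga_scale: "ph (lscale c x) = lscale c (ph x)" if "ph:Ga" for ph c x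
 using that by (auto simp: Ga_def lop.scale_mult_left lop.scale_mult_right)
have Ga_mult: "ph (x * y) = ph x * ph y" if ph: "ph:Ga" and xy: "x:mats n" "y:mats n" for ph x y
proof -
 obtain g where g: "g:G" "ph = (%z. ?M g * z * ?M (ginv n g))" using ph by (auto simp: Ga_def)
 have "ph x * ph y = ?M g * x * (?M (ginv n g) * ?M g) * y * ?M (ginv n g)" by (simp add: g mult.assoc)
 also have "... = ?M g * (x * ?M (1\<^sub>m n)) * y * ?M (ginv n g)" unfolding gg(1)[OF g(1)] by (simp add: mult.assoc)
 finally show ?thesis using one xy by (simp add: g mult.assoc)
qed
have Ga_inv: "EX \<psi>:Ga. ALL x:mats n. ph (\<psi> x) = x" if ph: "ph:Ga" for ph
proof -
 obtain g where g: "g:G" "ph = (%z. ?M g * z * ?M (ginv n g))" using ph by (auto simp: Ga_def)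
 have gG: "g:GLs n" using g sg(1) by blast
 have ig: "ginv n g:G" "ginv n (ginv n g) = g" using sg(4)[OF g(1)] group.inv_inv[OF group_GL gG] by auto
 define \<psi> where "\<psi> z = ?M (ginv n g) * z * ?M g" for z
 have "\<psi> = (%z. ?M (ginv n g) * z * ?M (ginv n (ginv n g)))" by (simp add: \<psi>_def ig(2) fun_eq_iff)
 hence "\<psi>:Ga" unfolding Ga_def using ig(1) by blast
 moreover have "ph (\<psi> x) = x" if x: "x:mats n" for x
 proof -
  have "ph (\<psi> x) = (?M g * ?M (ginv n g)) * x * (?M g * ?M (ginv n g))" by (simp add: g \<psi>_def mult.assoc)
  thus ?thesis unfolding gg(2)[OF g(1)] using one x by simp
 qed
 ultimately show ?thesis by (intro bexI[of _ \<psi>]) simp_all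
qed
have "EX C. lop.subspace C & C <= ?M ` q & C ~= {0} & (ALL ph:Ga. ph ` C <= C) & (ALL x:C. ALL y:C. x * y = y * x)"
 by (rule lop.commutative_stable_subspace[where A = "mats n" and B = B and p = "?M (1\<^sub>m n)"
  and tr = "ltr n" and q = "?M ` q" and Ga = Ga])
  (fact subspace_mats B(2) B(1) mats_mult one(1) one(2) ltr_add ltr_scale tr_comm
  spectral_mats sub_q q_mats q_nonzero q_br q_tr Ga_add Ga_scale Ga_mult Ga_inv Ga_q)+
then obtain C where C': "lop.subspace C & C <= ?M ` q & C ~= {0} & (ALL ph:Ga. ph ` C <= C) & (ALL x:C. ALL y:C. x * y = y * x)" ..
have C: "lop.subspace C" "C <= ?M ` q" "C ~= {0}" using C' by simp_all
have C_stable: "ph ` C <= C" if "ph:Ga" for ph using C' that by simp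
have C_comm: "x * y = y * x" if "x:C" "y:C" for x y using C' that by blast
show False
proof (rule semisimple_no_commutative_ideal[OF ss C(1) _ C(3) C_comm])
 show "C <= ?M ` lie n G" using C(2) ql by blast
 show "of_mat n g * z * of_mat n (ginv n g):C" if "g:G" "z:C" for g z
  using C_stable[of "%z. ?M g * z * ?M (ginv n g)"] that unfolding Ga_def by blast
qed
qed

section \<open>Linear inequalities over the rationals and the integers\<close>

definition qdot :: "nat => (nat => rat) => (nat => rat) => rat" where
"qdot r x y = (SUM k<r. x k * y k)"

lemma qdot_lin:
"qdot r x (%k. y k - c * z k) = qdot r x y - c * qdot r x z"
"qdot r (%k. y k - c * z k) x = qdot r y x - c * qdot r z x"
by (simp_all add: qdot_def algebra_simps sum_subtractf sum_distrib_left)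

text \<open>Induction on the number of generators. If a vector \<open>y\<close> separates
  \<open>b\<close> from the cone of \<open>I\<close> but is negative on the new generator a_m,
  everything is projected along a_m to the hyperplane y = 0. A solution of the projected problem
  lifts by adding a multiple of a_m; a separating vector lifts by adding the multiple of
  \<open>y\<close> that makes it orthogonal to a_m.\<close>

lemma farkas:
fixes a :: "'i => nat => rat"
assumes "finite I"
shows "(EX c. (ALL i:I. 0 <= c i) & (ALL k<r. b k = (SUM i:I. c i * a i k))) \<or>
 (EX y. (ALL i:I. 0 <= qdot r (a i) y) & qdot r b y < 0)" using assms
proof (induction I arbitrary: a b rule: finite_induct)
case empty
show ?case
proof (cases "ALL k<r. b k = 0")
 case False
 then obtain k where k: "k < r" "b k ~= 0" by blast
 have "0 < (SUM k<r. b k * b k)" using k by (intro sum_pos2[of _ k]) (auto simp: zero_less_mult_iff not_less)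
 hence "qdot r b (%k. - b k) < 0" by (simp add: qdot_def sum_negf)
 thus ?thesis by blast
qed simp
next
case (insert m I)
show ?case
proof (cases "EX c. (ALL i:I. 0 <= c i) & (ALL k<r. b k = (SUM i:I. c i * a i k))")
 case True
 then obtain c where c: "ALL i:I. 0 <= c i" "ALL k<r. b k = (SUM i:I. c i * a i k)" by blast
 have "(SUM i:insert m I. (c(m := 0)) i * a i k) = (SUM i:I. c i * a i k)" for k using insert.hyps by (auto intro!: sum.cong)
 thus ?thesis using c by (intro disjI1 exI[of _ "c(m := 0)"]) auto
next
 case False
 then obtain y where y: "!!i. i:I ==> 0 <= qdot r (a i) y" "qdot r b y < 0" using insert.IH[where a = a and b = b] by blast
 define w where "w = qdot r (a m) y"
 show ?thesis
 proof (cases "0 <= w")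
  case True
  thus ?thesis using y by (intro disjI2 exI[of _ y]) (auto simp: w_def)
 next
  case w: False
  define a' where "a' i k = a i k - qdot r (a i) y / w * a m k" for i k
  define b' where "b' k = b k - qdot r b y / w * a m k" for k
  from insert.IH[where a = a' and b = b'] show ?thesis
  proof
  assume "EX c. (ALL i:I. 0 <= c i) & (ALL k<r. b' k = (SUM i:I. c i * a' i k))"
  then obtain c where c: "!!i. i:I ==> 0 <= c i" "!!k. k < r ==> b' k = (SUM i:I. c i * a' i k)" by blast
  \<comment> \<open>The coefficient of a_m forced by undoing the projection. It is nonnegative
    because the numerator and \<open>w\<close> are both at most 0.\<close>
  define e where "e = (qdot r b y - (SUM i:I. c i * qdot r (a i) y)) / w"
  have "0 <= (SUM i:I. c i * qdot r (a i) y)" using c(1) y(1) by (intro sum_nonneg) auto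
  hence "qdot r b y - (SUM i:I. c i * qdot r (a i) y) <= 0" using y(2) by linarith
  hence e: "0 <= e" unfolding e_def using w by (intro divide_nonpos_nonpos) auto
  have "b k = (SUM i:insert m I. (c(m := e)) i * a i k)" if "k < r" for k
  proof -
   have "(SUM i:insert m I. (c(m := e)) i * a i k) = e * a m k + (SUM i:I. (c(m := e)) i * a i k)" using insert.hyps by simp
   also have "(SUM i:I. (c(m := e)) i * a i k) = (SUM i:I. c i * a i k)" using insert.hyps by (intro sum.cong) auto
   finally have 1: "(SUM i:insert m I. (c(m := e)) i * a i k) = e * a m k + (SUM i:I. c i * a i k)" .
   have "(SUM i:I. c i * a' i k) = (SUM i:I. c i * a i k) - (SUM i:I. c i * qdot r (a i) y) / w * a m k"
    unfolding a'_def by (simp add: right_diff_distrib sum_subtractf sum_distrib_right sum_divide_distrib mult.assoc)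
   hence "b k = qdot r b y / w * a m k + (SUM i:I. c i * a i k) - (SUM i:I. c i * qdot r (a i) y) / w * a m k"
    using c(2)[OF that] by (simp add: b'_def)
   thus ?thesis by (subst 1) (simp add: e_def diff_divide_distrib left_diff_distrib)
  qed
  thus ?thesis using c(1) e by (intro disjI1 exI[of _ "c(m := e)"]) auto
  next
  assume "EX y. (ALL i:I. 0 <= qdot r (a' i) y) & qdot r b' y < 0"
  then obtain y' where y': "!!i. i:I ==> 0 <= qdot r (a' i) y'" "qdot r b' y' < 0" by blast
  define z where "z k = y' k - qdot r (a m) y' / w * y k" for k
  have "qdot r (a m) z = 0" unfolding z_def qdot_lin w_def[symmetric] using w by simp
  moreover have "qdot r (a i) z = qdot r (a' i) y'" for i unfolding z_def a'_def qdot_lin by simp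
  moreover have "qdot r b z = qdot r b' y'" unfolding z_def b'_def qdot_lin by simp
  ultimately show ?thesis using y' by (intro disjI2 exI[of _ z]) auto
  qed
 qed
qed
qed

definition idot :: "nat => (nat => int) => (nat => int) => int" where
"idot r x y = (SUM k<r. x k * y k)"

abbreviation (input) "idot2 h d s u v == idot h (fst s) u + idot d (snd s) v"
abbreviation (input) "idot2t h d t s u v == idot h (fst s) u + int t * idot d (snd s) v"

lemma idot_add: "idot r x (%k. y k + z k) = idot r x y + idot r x z"
"idot r (%k. y k + z k) x = idot r y x + idot r z x" by (simp_all add: idot_def algebra_simps sum.distrib)

lemma idot_mult: "idot r x (%k. c * y k) = c * idot r x y" "idot r (%k. c * y k) x = c * idot r y x"
by (simp_all add: idot_def sum_distrib_left mult_ac)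

lemma idot_minus: "idot r x (%k. - y k) = - idot r x y" by (simp_all add: idot_def sum_negf)

lemma idot_sum: "idot r (%k. SUM i:I. f i k) y = (SUM i:I. idot r (f i) y)"
by (simp add: idot_def sum_distrib_right) (rule sum.swap)

lemma clear_denominators:
fixes y :: "'k => rat"
assumes "finite K"
shows "EX N>0. EX z :: 'k => int. ALL k:K. of_int (z k) = of_nat N * y k" using assms
proof (induction K rule: finite_induct)
case empty
show ?case by (intro exI[of _ 1]) simp
next
case (insert j K)
then obtain N z where N: "N > 0" "ALL k:K. of_int (z k) = of_nat N * y k" by blast
obtain a b where ab: "quotient_of (y j) = (a, b)" by force
have b: "b > 0" "y j = of_int a / of_int b" using quotient_of_denom_pos[OF ab] quotient_of_div[OF ab] by auto
define z' where "z' k = (if k = j then int N * a else z k * b)" for k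
have "of_int (z' k) = of_nat (N * nat b) * y k" if "k:insert j K" for k using that N(2) b insert.hyps by (auto simp: z'_def)
moreover have "N * nat b > 0" using N(1) b(1) by simp
ultimately show ?case by blast
qed

lemma qdot_idot:
assumes "!!k. k < r ==> of_int (z k) = of_nat N * y k"
shows "of_int (idot r a z) = of_nat N * qdot r (%k. of_int (a k)) y"
proof -
have "of_int (idot r a z) = (SUM k<r. of_int (a k) * of_int (z k))" by (simp add: idot_def)
also have "... = (SUM k<r. of_int (a k) * (of_nat N * y k))" using assms by (intro sum.cong) auto
finally show ?thesis by (simp add: qdot_def sum_distrib_left mult_ac)
qed

text \<open>Farkas' lemma in dimension r + 1: every vector receives the extra coordinate 1, and the
  target is the last unit vector. A solution is a convex combination equal to 0. A separating vector
  has negative last coordinate, so its first r coordinates are positive on every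
  \<open>a i\<close>.\<close>

lemma gordan:
fixes a :: "'i => nat => int"
assumes I: "finite I"
shows "(EX c :: 'i => nat. (EX i:I. c i > 0) & (ALL k<r. (SUM i:I. int (c i) * a i k) = 0)) \<or>
 (EX l. ALL i:I. 1 <= idot r (a i) l)"
proof -
define a' where "a' i k = (if k < r then of_int (a i k) else 1 :: rat)" for i k
define b where "b k = (if k < r then 0 else 1 :: rat)" for k
have split: "qdot (Suc r) x y = qdot r x y + x r * y r" for x y by (simp add: qdot_def)
from farkas[OF I, of "Suc r" b a'] show ?thesis
proof
 assume "EX c. (ALL i:I. 0 <= c i) & (ALL k<Suc r. b k = (SUM i:I. c i * a' i k))"
 then obtain c where c: "!!i. i:I ==> 0 <= c i" "!!k. k < Suc r ==> b k = (SUM i:I. c i * a' i k)" by blast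
 obtain N z where N: "N > 0" "!!i. i:I ==> of_int (z i) = of_nat N * c i" using clear_denominators[OF I, of c] by blast
 have z0: "0 <= z i" if "i:I" for i
 proof -
  have "(0 :: rat) <= of_int (z i)" using N c(1) that by simp
  thus ?thesis by simp
 qed
 have "(SUM i:I. c i) = 1" using c(2)[of r] by (simp add: a'_def b_def)
 then obtain i where i: "i:I" "c i ~= 0" by (metis sum.neutral zero_neq_one)
 have "z i ~= 0" using N(1) N(2)[OF i(1)] i by auto
 hence "nat (z i) > 0" using z0[OF i(1)] by simp
 moreover have "(SUM i:I. int (nat (z i)) * a i k) = 0" if k: "k < r" for k
 proof -
  have "(of_int (SUM i:I. int (nat (z i)) * a i k) :: rat) = (SUM i:I. of_nat N * c i * of_int (a i k))"
  using z0 N(2) by (simp add: of_int_sum)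
  also have "... = of_nat N * (SUM i:I. c i * a' i k)" using k by (simp add: a'_def sum_distrib_left mult.assoc)
  also have "... = 0" using c(2)[of k] k by (simp add: b_def)
  finally show ?thesis by (simp only: of_int_eq_0_iff)
 qed
 ultimately show ?thesis using i(1) by (intro disjI1 exI[of _ "%i. nat (z i)"]) blast
next
 assume "EX y. (ALL i:I. 0 <= qdot (Suc r) (a' i) y) & qdot (Suc r) b y < 0"
 then obtain y where y: "!!i. i:I ==> 0 <= qdot (Suc r) (a' i) y" "qdot (Suc r) b y < 0" by blast
 have "qdot r b y = 0" by (simp add: qdot_def b_def)
 hence yr: "y r < 0" using y(2) by (simp add: split b_def)
 obtain N z where N: "N > 0" "!!k. k:{..<r} ==> of_int (z k) = of_nat N * y k" using clear_denominators[of "{..<r}" y] by blast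
 have "1 <= idot r (a i) z" if i: "i:I" for i
 proof -
  have "qdot r (a' i) y = qdot r (%k. of_int (a i k)) y" by (simp add: qdot_def a'_def)
  hence "0 < qdot r (%k. of_int (a i k)) y" using y(1)[OF i] yr by (simp add: split a'_def)
  hence "(0 :: rat) < of_int (idot r (a i) z)" using qdot_idot[of r z N y] N by simp
  thus ?thesis by simp
 qed
 thus ?thesis by blast
qed
qed

text \<open>Farkas' lemma for the vectors and their negatives, marked by the boolean component, so
  that cones become linear spans; the target is the j-th unit vector.\<close>

lemma span_or_perp:
fixes a :: "'i => nat => int"
assumes I: "finite I" and j: "j < r"
shows "(EX N>0. EX c :: 'i => int. ALL k<r. (SUM i:I. c i * a i k) = (if k = j then int N else 0)) \<or>
 (EX l. (EX k<r. l k ~= 0) & (ALL i:I. idot r (a i) l = 0))"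
proof -
define a' where "a' p k = (if snd p then of_int (a (fst p) k) else - of_int (a (fst p) k) :: rat)" for p k
define b where "b k = (if k = j then 1 else 0 :: rat)" for k
have fin: "finite (I \<times> (UNIV :: bool set))" using I by simp
from farkas[OF fin, of r b a'] show ?thesis
proof
 assume "EX c. (ALL i:I \<times> UNIV. 0 <= c i) & (ALL k<r. b k = (SUM i:I \<times> UNIV. c i * a' i k))"
 then obtain c where c: "!!k. k < r ==> b k = (SUM p:I \<times> UNIV. c p * a' p k)" by blast
 define e where "e i = c (i, True) - c (i, False)" for i
 have bek: "b k = (SUM i:I. e i * of_int (a i k))" if "k < r" for k
  unfolding c[OF that] sum.cartesian_product'[symmetric] sum.cartesian_product'
  by (simp add: sum.cartesian_product' UNIV_bool a'_def e_def algebra_simps)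
 obtain N z where N: "N > 0" "!!i. i:I ==> of_int (z i) = of_nat N * e i" using clear_denominators[OF I, of e] by blast
 have "(SUM i:I. z i * a i k) = (if k = j then int N else 0)" if k: "k < r" for k
 proof -
  have "(of_int (SUM i:I. z i * a i k) :: rat) = (SUM i:I. of_nat N * e i * of_int (a i k))" using N(2) by (simp add: of_int_sum)
  also have "... = of_nat N * b k" unfolding bek[OF k] by (simp add: sum_distrib_left mult.assoc)
  also have "... = of_int (if k = j then int N else 0)" by (simp add: b_def)
  finally show ?thesis by (simp only: of_int_eq_iff)
 qed
 thus ?thesis using N(1) by blast
next
 assume "EX y. (ALL i:I \<times> UNIV. 0 <= qdot r (a' i) y) & qdot r b y < 0"
 then obtain y where y: "!!i s. i:I ==> 0 <= qdot r (a' (i, s)) y" "qdot r b y < 0" by blast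
 have "qdot r b y = (SUM k<r. if k = j then y k else 0)" unfolding qdot_def b_def by (rule sum.cong) auto
 hence yj: "y j ~= 0" using y(2) j by simp
 obtain N z where N: "N > 0" "!!k. k:{..<r} ==> of_int (z k) = of_nat N * y k" using clear_denominators[of "{..<r}" y] by blast
 have "idot r (a i) z = 0" if i: "i:I" for i
 proof -
  have "qdot r (a' (i, True)) y = qdot r (%k. of_int (a i k)) y"
  "qdot r (a' (i, False)) y = - qdot r (%k. of_int (a i k)) y" by (simp_all add: qdot_def a'_def sum_negf)
  hence "qdot r (%k. of_int (a i k)) y = 0" using y(1)[OF i, of True] y(1)[OF i, of False] by simp
  hence "(of_int (idot r (a i) z) :: rat) = 0" using qdot_idot[of r z N y] N by simp
  thus ?thesis by simp
 qed
 moreover have "z j ~= 0"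
 proof
  assume "z j = 0"
  hence "of_nat N * y j = 0" using N(2)[of j] j by simp
  thus False using N(1) yj by simp
 qed
 ultimately show ?thesis using j by blast
qed
qed

text \<open>Caratheodory's theorem saves one vector here because all vectors lie in the hyperplane
  orthogonal to \<open>l\<close>: h of them suffice to express 0, instead of h + 1. This single unit
  is what contradicts nondegeneracy later.\<close>

lemma caratheodory_hyperplane:
fixes a :: "'i => nat => int"
assumes I: "finite I" and c0: "EX i:I. 0 < (c0 i :: nat)" "!!k. k < h ==> (SUM i:I. int (c0 i) * a i k) = 0"
 and l: "j < h" "l j ~= 0" "!!i. i:I ==> idot h (a i) l = 0"
shows "EX J<=I. EX c :: 'i => rat. J ~= {} & card J <= h & (ALL i:J. 0 < c i) & (ALL k<h. (SUM i:J. c i * of_int (a i k)) = 0)"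
proof -
define P where "P J \<longleftrightarrow> J <= I & J ~= {} & (EX c :: 'i => rat. (ALL i:J. 0 < c i) & (ALL k<h. (SUM i:J. c i * of_int (a i k)) = 0))" for J
have "P {i:I. c0 i > 0}"
proof -
 have "(SUM i:{i:I. c0 i > 0}. of_nat (c0 i) * of_int (a i k) :: rat) = 0" if "k < h" for k
 proof -
  have "(SUM i:{i:I. c0 i > 0}. of_nat (c0 i) * of_int (a i k) :: rat) = (SUM i:I. of_nat (c0 i) * of_int (a i k))"
  using I by (intro sum.mono_neutral_left) auto
  also have "... = of_int (SUM i:I. int (c0 i) * a i k)" by simp
  finally show ?thesis using c0(2)[OF that] by simp
 qed
 thus ?thesis unfolding P_def using c0(1) by (auto intro!: exI[of _ "%i. of_nat (c0 i)"])
qed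
hence "EX J. P J & (ALL J'. P J' --> card J <= card J')" by (rule ex_has_least_nat)
then obtain J where PJ: "P J" and least: "!!J'. P J' ==> card J <= card J'" by blast
then obtain c where J: "J <= I" "J ~= {}" and c: "!!i. i:J ==> (0 :: rat) < c i"
 "!!k. k < h ==> (SUM i:J. c i * of_int (a i k)) = 0" unfolding P_def by blast
have fJ: "finite J" using J(1) I finite_subset by blast
have "card J <= h"
proof (rule ccontr)
 assume "~ card J <= h"
 \<comment> \<open>On vectors orthogonal to \<open>l\<close> with \<open>l j\<close> nonzero,
   equation \<open>j\<close> follows from the other coordinates. Its place is free for the condition
   that the coefficients sum to 0.\<close>
 then obtain u where u: "EX i:J. u i ~= 0"
  "!!k. k:{..<h} ==> (SUM i:J. (if k = j then 1 else of_int (a i k)) * u i) = (0 :: rat)"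
  using underdetermined_system[OF fJ, of "{..<h}" "%k i. if k = j then 1 else of_int (a i k) :: rat"] by auto
 have su: "(SUM i:J. u i) = 0" using u(2)[of j] l(1) by simp
 have uk: "(SUM i:J. u i * of_int (a i k)) = 0" if k: "k < h" for k
 proof (cases "k = j")
  case False
  thus ?thesis using u(2)[of k] k by (simp add: mult.commute)
 next
  case True
  have "(SUM k<h. of_int (l k) * (SUM i:J. u i * of_int (a i k))) = (SUM i:J. u i * of_int (idot h (a i) l))"
  by (simp add: idot_def sum_distrib_left mult_ac) (rule sum.swap)
  also have "... = 0" using l(3) J(1) by (intro sum.neutral) auto
  finally have s: "(SUM k<h. of_int (l k) * (SUM i:J. u i * of_int (a i k))) = 0" .
  have "(SUM k<h. of_int (l k) * (SUM i:J. u i * of_int (a i k)))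
   = of_int (l j) * (SUM i:J. u i * of_int (a i j)) + (SUM k:{..<h} - {j}. of_int (l k) * (SUM i:J. u i * of_int (a i k)))"
  using l(1) by (subst sum.remove[of _ j]) auto
  also have "(SUM k:{..<h} - {j}. of_int (l k) * (SUM i:J. u i * of_int (a i k))) = 0"
  proof (rule sum.neutral, rule ballI)
  fix k assume k: "k:{..<h} - {j}"
  hence "(SUM i:J. u i * of_int (a i k)) = 0" using u(2)[of k] by (simp add: mult.commute)
  thus "of_int (l k) * (SUM i:J. u i * of_int (a i k)) = 0" by simp
  qed
  finally show ?thesis using s l(2) True by simp
 qed
 define U where "U = {i:J. u i > 0}"
 have "U ~= {}"
 proof
  assume "U = {}"
  hence "ALL i:J. 0 <= - u i" by (auto simp: U_def not_less)
  moreover have "(SUM i:J. - u i) = 0" using su by (simp add: sum_negf)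
  ultimately have "ALL i:J. - u i = 0" using sum_nonneg_eq_0_iff[OF fJ, of "%i. - u i"] by blast
  thus False using u(1) by auto
 qed
 have fU: "finite U" using fJ by (simp add: U_def)
 \<comment> \<open>The largest step against \<open>u\<close> that keeps all coefficients
   nonnegative. It kills the coefficient of \<open>i0\<close>, while the sum of all coefficients is
   unchanged and so stays positive.\<close>
 define \<tau> where "\<tau> = Min ((%i. c i / u i) ` U)"
 have "\<tau>:(%i. c i / u i) ` U" unfolding \<tau>_def using fU \<open>U ~= {}\<close> by (intro Min_in) auto
 then obtain i0 where i0: "i0:U" "\<tau> = c i0 / u i0" by blast
 have \<tau>le: "\<tau> <= c i / u i" if "i:U" for i unfolding \<tau>_def using fU that by (intro Min_le) auto
 have \<tau>0: "0 < \<tau>" unfolding i0(2) using i0(1) c(1) by (simp add: U_def)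
 define c' where "c' i = c i - \<tau> * u i" for i
 have c'0: "0 <= c' i" if "i:J" for i
 proof (cases "u i > 0")
  case True
  hence "\<tau> * u i <= c i" using \<tau>le[of i] that by (simp add: U_def field_simps)
  thus ?thesis by (simp add: c'_def)
 next
  case False
  hence "\<tau> * u i <= 0" using \<tau>0 by (simp add: mult_nonneg_nonpos)
  thus ?thesis using c(1)[OF that] by (simp add: c'_def)
 qed
 have c'i0: "c' i0 = 0" using i0 by (simp add: c'_def U_def)
 have sc': "(SUM i:J. c' i) > 0"
 proof -
  have "(SUM i:J. c' i) = (SUM i:J. c i) - \<tau> * (SUM i:J. u i)" by (simp add: c'_def sum_subtractf sum_distrib_left)
  thus ?thesis using su sum_pos[OF fJ J(2), of c] c(1) by simp
 qed
 define J' where "J' = {i:J. c' i > 0}"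
 have "i0:J" "i0 \<notin> J'" using c'i0 i0(1) by (simp_all add: J'_def U_def)
 hence J'sub: "J' \<subset> J" unfolding J'_def by blast
 have "J' ~= {}"
 proof
  assume "J' = {}"
  hence "!!i. i:J ==> c' i = 0" using c'0 by (force simp: J'_def)
  thus False using sc' by simp
 qed
 moreover have "(SUM i:J'. c' i * of_int (a i k)) = 0" if k: "k < h" for k
 proof -
  have "c' i = 0" if "i:J - J'" for i using that c'0[of i] by (auto simp: J'_def)
  hence "(SUM i:J'. c' i * of_int (a i k)) = (SUM i:J. c' i * of_int (a i k))"
  using fJ J'sub by (intro sum.mono_neutral_left) auto
  also have "... = (SUM i:J. c i * of_int (a i k)) - \<tau> * (SUM i:J. u i * of_int (a i k))"
  by (simp add: c'_def left_diff_distrib sum_subtractf sum_distrib_left mult.assoc)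
  finally show ?thesis using c(2)[OF k] uk[OF k] by simp
 qed
 ultimately have "P J'" unfolding P_def using J'sub J(1) by (auto simp: J'_def intro!: exI[of _ c'])
 hence "card J <= card J'" by (rule least)
 thus False using psubset_card_mono[OF fJ J'sub] by simp
qed
thus ?thesis using J c by blast
qed

text \<open>Vectors are treated one at a time. If the current combination vanishes on the new
  \<open>u\<close>, it is multiplied by N and one \<open>be0\<close> not vanishing on
  \<open>u\<close> is added; N exceeds every |idot d be0 v| for the old v, so nothing nonzero gets
  cancelled.\<close>

lemma generic_combination:
fixes Y :: "(nat => int) set"
assumes "finite U" "finite Y" "!!u. u:U ==> EX be:Y. idot d be u ~= 0"
shows "EX n :: (nat => int) => nat. ALL u:U. (SUM be:Y. int (n be) * idot d be u) ~= 0" using assms(1,3)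
proof (induction U rule: finite_induct)
case empty
thus ?case by simp
next
case (insert u U)
then obtain n where n: "!!v. v:U ==> (SUM be:Y. int (n be) * idot d be v) ~= 0" by blast
show ?case
proof (cases "(SUM be:Y. int (n be) * idot d be u) = 0")
 case False
 thus ?thesis using n by (intro exI[of _ n]) auto
next
 case True
 obtain be0 where b: "be0:Y" "idot d be0 u ~= 0" using insert.prems by blast
 define N where "N = Suc (SUM v:U. nat \<bar>idot d be0 v\<bar>)"
 define n' where "n' be = N * n be + (if be = be0 then 1 else 0)" for be
 have e: "(SUM be:Y. int (n' be) * idot d be v) = int N * (SUM be:Y. int (n be) * idot d be v) + idot d be0 v" for v
 proof -
  have "(SUM be:Y. int (n' be) * idot d be v) = (SUM be:Y. int N * (int (n be) * idot d be v) + (if be = be0 then idot d be0 v else 0))"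
  by (rule sum.cong) (auto simp: n'_def algebra_simps)
  thus ?thesis using assms(2) b(1) by (simp add: sum.distrib sum_distrib_left)
 qed
 have "(SUM be:Y. int (n' be) * idot d be v) ~= 0" if v: "v:U" for v
 proof
  assume "(SUM be:Y. int (n' be) * idot d be v) = 0"
  hence "idot d be0 v = - (int N * (SUM be:Y. int (n be) * idot d be v))" unfolding e by linarith
  hence "\<bar>idot d be0 v\<bar> = int N * \<bar>SUM be:Y. int (n be) * idot d be v\<bar>" by (simp add: abs_mult)
  moreover have "1 <= \<bar>SUM be:Y. int (n be) * idot d be v\<bar>" using n[OF v] by linarith
  ultimately have "int N <= \<bar>idot d be0 v\<bar>" by (metis mult_left_mono mult.right_neutral of_nat_0_le_iff)
  moreover have "nat \<bar>idot d be0 v\<bar> <= (SUM v:U. nat \<bar>idot d be0 v\<bar>)"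
  using insert.hyps v by (intro member_le_sum) auto
  ultimately show False unfolding N_def by linarith
 qed
 moreover have "(SUM be:Y. int (n' be) * idot d be u) ~= 0" unfolding e using True b(2) by simp
 ultimately show ?thesis by (intro exI[of _ n']) auto
qed
qed

text \<open>Weights of the maximal torus are pairs of a weight of
  the maximal torus of \<open>H\<close> (rank \<open>h\<close>) and one of \<open>D\<close> (rank \<open>d\<close>); \<open>X\<close>, \<open>Y\<close>, \<open>Z\<close> are sets of weights.
  Given a set of weights on which a nonzero cocharacter \<open>(\<mu>H, \<mu>D)\<close> vanishes, a cocharacter
  destabilising \<open>(0, \<delta>)\<close> is \<open>\<plusminus>(\<mu>H, \<mu>D)\<close> if \<open>\<mu>D \<noteq> 0\<close>, as \<open>\<delta>\<close> is generic. If \<open>\<mu>D = 0\<close>, then the weights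
  of \<open>X\<close> involved lie in a hyperplane, so by nondegeneracy some \<open>l\<close> is positive on them, and
  \<open>(N K l, - N \<nu> - \<delta>)\<close> is destabilising for suitable \<open>K\<close> and \<open>N\<close>, provided that \<open>t\<close> is large.\<close>

lemma destabilising_cocharacter:
fixes X Y :: "(nat => int) set" and Z :: "((nat => int) \<times> (nat => int)) set"
assumes fin: "finite X" "finite Y" "finite Z" and d: "0 < d" and Y: "!!u. EX j<d. u j ~= 0 ==> EX be:Y. idot d be u ~= 0"
 and \<nu>: "!!be. be:Y ==> 0 <= idot d be \<nu>" "!!z. z:Z ==> idot d (snd z) \<nu> <= - 1"
 and nondeg: "!!S mu (c :: (nat => int) => nat). S <= X ==> EX j<h. mu j ~= 0 ==> (!!xi. xi:S ==> idot h xi mu = 0) ==>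
  EX xi:S. 0 < c xi ==> (!!k. k < h ==> (SUM xi:S. int (c xi) * xi k) = 0) ==> False"
shows "EX t0>0. ALL t>=t0. EX n :: (nat => int) => nat. ALL S1 S2 muH muD. S1 <= X \<times> Y --> S2 <= Z -->
 (EX j<h. muH j ~= 0) \<or> (EX j<d. muD j ~= 0) --> (ALL s:S1. idot2 h d s muH muD = 0) -->
 (ALL s:S2. idot2t h d t s muH muD = 0) --> (EX vH vD. (ALL s:S1. 0 <= idot2 h d s vH vD) &
  (ALL s:S2. 0 <= idot2t h d t s vH vD) & (SUM be:Y. int (n be) * idot d be vD) < 0)"
proof -
define good where "good S l \<longleftrightarrow> (ALL xi:S. 1 <= idot h xi l)" for S l
define lam where "lam S = (SOME l. good S l)" for S
define M where "M = (SUM be:Y. \<bar>idot d be \<nu>\<bar>)"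
define C where "C = (SUM S:Pow X. SUM z:Z. \<bar>idot h (fst z) (lam S)\<bar>)"
\<comment> \<open>\<open>M\<close> bounds \<open>\<nu>\<close> on Y, and \<open>C\<close> bounds the
  chosen \<open>lam S\<close> on Z; neither depends on t. On \<open>S1\<close> the term N K from
  \<open>lam\<close> exceeds the loss N M by N, as K = M + 1. On \<open>S2\<close> the gain t N from
  \<open>\<nu>\<close> exceeds the loss N K C by at least N, as t is at least K C + 1.\<close>
define K where "K = M + 1"
define t0 where "t0 = nat (K * C + 1)"
have M: "0 <= M" unfolding M_def by (rule sum_nonneg) simp
have Mle: "idot d be \<nu> <= M" if "be:Y" for be
proof -
 have "\<bar>idot d be \<nu>\<bar> <= M" unfolding M_def using fin(2) that by (intro member_le_sum) auto
 thus ?thesis by linarith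
qed
have C0: "0 <= C" unfolding C_def by (intro sum_nonneg) simp
have Cle: "\<bar>idot h (fst z) (lam S)\<bar> <= C" if "S <= X" "z:Z" for S z
proof -
 have "\<bar>idot h (fst z) (lam S)\<bar> <= (SUM z:Z. \<bar>idot h (fst z) (lam S)\<bar>)"
  using fin(3) that by (intro member_le_sum) auto
 also have "... <= C" unfolding C_def using fin that by (intro member_le_sum) (auto intro: sum_nonneg)
 finally show ?thesis .
qed
have KC: "0 <= K * C" unfolding K_def using M C0 by simp
have "EX n :: (nat => int) => nat. ALL S1 S2 muH muD. S1 <= X \<times> Y --> S2 <= Z -->
 (EX j<h. muH j ~= 0) \<or> (EX j<d. muD j ~= 0) --> (ALL s:S1. idot2 h d s muH muD = 0) -->
 (ALL s:S2. idot2t h d t s muH muD = 0) --> (EX vH vD. (ALL s:S1. 0 <= idot2 h d s vH vD) &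
  (ALL s:S2. 0 <= idot2t h d t s vH vD) & (SUM be:Y. int (n be) * idot d be vD) < 0)" if t: "t0 <= t" for t
proof -
 have tK: "K * C + 1 <= int t" using t KC unfolding t0_def by linarith
 define perp where "perp S mu \<longleftrightarrow> (ALL s:fst S. idot h (fst s) (fst mu) + idot d (snd s) (snd mu) = 0) &
  (ALL s:snd S. idot h (fst s) (fst mu) + int t * idot d (snd s) (snd mu) = 0) & (EX j<d. snd mu j ~= 0)" for S mu
 define pick where "pick S = (SOME mu. perp S mu)" for S
 \<comment> \<open>One orthogonal cocharacter is fixed for each of the finitely many pairs of weight
   sets, so genericity of \<open>de\<close> means avoiding finitely many hyperplanes. The inserted
   unit vector makes \<open>de\<close> nonzero.\<close>
 define U where "U = insert (%k. if k = 0 then 1 else 0)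
  ((snd \<circ> pick) ` {S:Pow (X \<times> Y) \<times> Pow Z. EX mu. perp S mu})"
 have fU: "finite U" unfolding U_def using fin by simp
 have pick: "perp S (pick S)" if "perp S mu" for S mu unfolding pick_def using someI[of "perp S", OF that] .
 have Uex: "EX be:Y. idot d be u ~= 0" if u: "u:U" for u
 proof (rule Y)
  show "EX j<d. u j ~= 0"
  proof (cases "u = (%k. if k = 0 then 1 else 0)")
  case True
  thus ?thesis using d by (intro exI[of _ 0]) simp
  next
  case False
  then obtain S mu where "u = snd (pick S)" "perp S mu" using u unfolding U_def by auto
  thus ?thesis using pick[of S mu] by (simp add: perp_def)
  qed
 qed
 obtain n :: "(nat => int) => nat" where n: "!!u. u:U ==> (SUM be:Y. int (n be) * idot d be u) ~= 0"
  using generic_combination[OF fU fin(2) Uex] by blast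
 define de where "de k = (SUM be:Y. int (n be) * be k)" for k
 have de: "(SUM be:Y. int (n be) * idot d be v) = idot d de v" for v unfolding de_def idot_sum idot_mult ..
 have "idot d de (%k. if k = 0 then 1 else 0) ~= 0" using n[of "%k. if k = 0 then 1 else 0"] de by (simp add: U_def)
 moreover have "idot d de v = 0" if "ALL k<d. de k = 0" for v using that by (simp add: idot_def)
 ultimately obtain k0 where k0: "k0 < d" "de k0 ~= 0" by blast
 have dede: "0 < idot d de de" unfolding idot_def using k0 by (intro sum_pos2[of _ k0]) (auto simp: zero_less_mult_iff)
 have de\<nu>: "0 <= idot d de \<nu>" unfolding de[symmetric] using \<nu>(1) by (intro sum_nonneg) simp
 show ?thesis
 proof (intro exI[of _ n] allI impI)
  fix S1 S2 muH muD
  assume S: "S1 <= X \<times> Y" "S2 <= Z" and nz: "(EX j<h. muH j ~= 0) \<or> (EX j<d. muD j ~= 0)"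
  and p1: "ALL s:S1. idot2 h d s muH muD = 0" and p2: "ALL s:S2. idot2t h d t s muH muD = 0"
  show "EX vH vD. (ALL s:S1. 0 <= idot2 h d s vH vD) & (ALL s:S2. 0 <= idot2t h d t s vH vD) &
  (SUM be:Y. int (n be) * idot d be vD) < 0"
  proof (cases "EX mu. perp (S1, S2) mu")
  case True
  then obtain mu where "perp (S1, S2) mu" ..
  hence pk: "perp (S1, S2) (pick (S1, S2))" by (rule pick)
  obtain a b where ab: "pick (S1, S2) = (a, b)" by force
  have q: "ALL s:S1. idot2 h d s a b = 0"
   "ALL s:S2. idot2t h d t s a b = 0" using pk by (simp_all add: perp_def ab)
  have "(snd \<circ> pick) (S1, S2):U" unfolding U_def using S True by blast
  hence "b:U" by (simp add: ab)
  hence nb: "(SUM be:Y. int (n be) * idot d be b) ~= 0" by (rule n)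
  show ?thesis
  proof (cases "(SUM be:Y. int (n be) * idot d be b) < 0")
   case True
   thus ?thesis using q by (intro exI[of _ a] exI[of _ b]) simp
  next
   case False
   hence "(SUM be:Y. int (n be) * idot d be (%k. - b k)) < 0" using nb by (simp add: idot_minus sum_negf)
   moreover have "ALL s:S1. 0 <= idot h (fst s) (%k. - a k) + idot d (snd s) (%k. - b k)"
    using q(1) by (fastforce simp: idot_minus)
   moreover have "ALL s:S2. 0 <= idot h (fst s) (%k. - a k) + int t * idot d (snd s) (%k. - b k)"
    using q(2) by (fastforce simp: idot_minus)
   ultimately show ?thesis by blast
  qed
  next
  case False
  have muD: "muD k = 0" if "k < d" for k
  proof (rule ccontr)
   assume "muD k ~= 0"
   hence "perp (S1, S2) (muH, muD)" unfolding perp_def using p1 p2 that by auto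
   thus False using False by blast
  qed
  hence zero: "idot d be muD = 0" for be by (simp add: idot_def)
  have muH: "EX j<h. muH j ~= 0" using nz muD by blast
  define S where "S = fst ` S1"
  have SX: "S <= X" using \<open>S1 <= X \<times> Y\<close> by (auto simp: S_def)
  have S0: "idot h xi muH = 0" if "xi:S" for xi using that p1 zero by (auto simp: S_def)
  have "EX l. good S l" unfolding good_def
  proof (rule disjE[OF gordan[of S h "%xi. xi"]])
   show "finite S" using SX fin(1) by (rule finite_subset)
   assume "EX c :: (nat => int) => nat. (EX i:S. 0 < c i) & (ALL k<h. (SUM i:S. int (c i) * i k) = 0)"
   then obtain c :: "(nat => int) => nat" where c: "EX i:S. 0 < c i" "ALL k<h. (SUM i:S. int (c i) * i k) = 0" by blast
   have False by (rule nondeg[OF SX muH S0 c(1)]) (use c(2) in simp_all)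
   thus "EX l. ALL xi:S. 1 <= idot h xi l" ..
  qed simp
  hence lam: "good S (lam S)" unfolding lam_def by (rule someI_ex)
  \<comment> \<open>N dominates the contributions of the summand \<open>- de\<close> of
    \<open>vD\<close>, both on Y and, after multiplication by t, on Z.\<close>
  define N where "N = int t * (1 + (SUM be:Y. \<bar>idot d be de\<bar>) + (SUM z:Z. \<bar>idot d (snd z) de\<bar>))"
  have t1: "1 <= int t" using tK KC by linarith
  have sY: "0 <= (SUM be:Y. \<bar>idot d be de\<bar>)" and sZ: "0 <= (SUM z:Z. \<bar>idot d (snd z) de\<bar>)"
   by (intro sum_nonneg, simp)+
  have N0: "0 <= N" unfolding N_def using t1 sY sZ by simp
  have NY: "idot d be de <= N" if "be:Y" for be
  proof -
   have "\<bar>idot d be de\<bar> <= (SUM be:Y. \<bar>idot d be de\<bar>)" using fin(2) that by (intro member_le_sum) auto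
   hence "idot d be de <= 1 + (SUM be:Y. \<bar>idot d be de\<bar>) + (SUM z:Z. \<bar>idot d (snd z) de\<bar>)" using sZ by linarith
   also have "... = 1 * (1 + (SUM be:Y. \<bar>idot d be de\<bar>) + (SUM z:Z. \<bar>idot d (snd z) de\<bar>))" by simp
   also have "... <= N" unfolding N_def using t1 sY sZ by (intro mult_right_mono) linarith+
   finally show ?thesis .
  qed
  have NZ: "int t * idot d (snd z) de <= N" if "z:Z" for z
  proof -
   have "\<bar>idot d (snd z) de\<bar> <= (SUM z:Z. \<bar>idot d (snd z) de\<bar>)" using fin(3) that by (intro member_le_sum) auto
   hence "idot d (snd z) de <= 1 + (SUM be:Y. \<bar>idot d be de\<bar>) + (SUM z:Z. \<bar>idot d (snd z) de\<bar>)" using sY by linarith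
   thus ?thesis unfolding N_def using t1 by (intro mult_left_mono) linarith+
  qed
  define vH where "vH k = (N * K) * lam S k" for k
  define vD where "vD k = (- N) * \<nu> k + (- 1) * de k" for k
  have vH: "idot h xi vH = N * K * idot h xi (lam S)" for xi unfolding vH_def idot_mult ..
  have vD: "idot d be vD = - N * idot d be \<nu> - idot d be de" for be unfolding vD_def idot_add idot_mult by simp
  have "0 <= idot2 h d s vH vD" if s: "s:S1" for s
  proof -
   have "fst s:S" and sY: "snd s:Y" using s \<open>S1 <= X \<times> Y\<close> by (auto simp: S_def)
   hence "1 <= idot h (fst s) (lam S)" using lam by (simp add: good_def)
   hence "N * K * 1 <= N * K * idot h (fst s) (lam S)" using N0 M by (intro mult_left_mono) (auto simp: K_def)
   moreover have "N * idot d (snd s) \<nu> <= N * M" using Mle[OF sY] N0 by (intro mult_left_mono)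
   ultimately show ?thesis unfolding vH vD K_def using NY[OF sY] by (simp add: algebra_simps)
  qed
  moreover have "0 <= idot2t h d t s vH vD" if s: "s:S2" for s
  proof -
   have sZ: "s:Z" using s \<open>S2 <= Z\<close> by blast
   have "- C <= idot h (fst s) (lam S)" using Cle[OF SX sZ] by linarith
   hence "N * K * (- C) <= N * K * idot h (fst s) (lam S)" using N0 M by (intro mult_left_mono) (auto simp: K_def)
   moreover have "(int t * N) * idot d (snd s) \<nu> <= (int t * N) * (- 1)"
    using \<nu>(2)[OF sZ] N0 by (intro mult_left_mono) auto
   moreover have "N * (K * C + 1) <= N * int t" using tK N0 by (intro mult_left_mono)
   ultimately show ?thesis unfolding vH vD using NZ[OF sZ] by (simp add: algebra_simps)
  qed
  moreover have "(SUM be:Y. int (n be) * idot d be vD) < 0"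
  proof -
   have "0 <= N * idot d de \<nu>" using N0 de\<nu> by simp
   hence "idot d de vD < 0" unfolding vD using dede by linarith
   thus ?thesis unfolding de .
  qed
  ultimately show ?thesis by blast
  qed
 qed
qed
moreover have "0 < t0" unfolding t0_def using KC by linarith
ultimately show ?thesis by blast
qed

section \<open>Laurent polynomials and tori\<close>

text \<open>A point of the split torus of rank \<open>r\<close> is given by a nowhere vanishing sequence, of which
  only the first \<open>r\<close> entries matter.\<close>

definition nz :: "(nat => complex) set" where "nz = {c. ALL i. c i ~= 0}"

lemma nz_mult [simp]: "c:nz ==> c':nz ==> (%i. c i * c' i):nz" and nz_inverse [simp]: "c:nz ==> (%i. inverse (c i)):nz"
and nz_one [simp]: "(%i. 1):nz" and nz_shift: "c:nz ==> (%i. c (h + i)):nz" and nz_nonzero: "c:nz ==> c i ~= 0"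
by (auto simp: nz_def)

definition lmon :: "nat => (nat => int) => (nat => complex) => complex" where
"lmon r al c = (PROD i<r. c i powi al i)"

text \<open>Only the first \<open>r\<close> exponents enter a monomial; fixing the others to 0 makes
  distinct exponents give distinct monomials.\<close>

definition exps :: "nat => (nat => int) set" where "exps r = {al. ALL i>=r. al i = 0}"

definition trunc :: "nat => (nat => int) => nat => int" where
"trunc r al i = (if i < r then al i else 0)"

lemma trunc_exps [simp]: "trunc r al:exps r" by (simp add: trunc_def exps_def)

lemma lmon_trunc [simp]: "lmon r (trunc r al) = lmon r al" by (rule ext) (simp add: lmon_def trunc_def)

lemma lmon_nonzero: "c:nz ==> lmon r al c ~= 0" by (simp add: lmon_def nz_def)

lemma lmon_times: "lmon r al (%i. c i * c' i) = lmon r al c * lmon r al c'"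
by (simp add: lmon_def power_int_mult_distrib prod.distrib)

lemma lmon_one [simp]: "lmon r al (%_. 1) = 1" by (simp add: lmon_def)

lemma lmon_zero [simp]: "lmon r (%_. 0) c = 1" by (simp add: lmon_def)

lemma lmon_inverse: "lmon r al (%i. inverse (c i)) = lmon r (%i. - al i) c"
unfolding lmon_def by (intro prod.cong refl) (simp only: power_int_minus power_int_inverse)

lemma lmon_inverse': "lmon r al (%i. inverse (c i)) = inverse (lmon r al c)"
unfolding lmon_def power_int_inverse by (rule prod_inversef[unfolded comp_def])

lemma lmon_add: "c:nz ==> lmon r (%i. al i + be i) c = lmon r al c * lmon r be c"
by (simp add: lmon_def power_int_add nz_def prod.distrib)

lemma prod_powi: "(PROD i:I. f i :: complex) powi k = (PROD i:I. f i powi k)"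
by (induction I rule: infinite_finite_induct) (simp_all add: power_int_mult_distrib)

lemma lmon_powi: "lmon r al c powi k = lmon r (%i. al i * k) c" by (simp add: lmon_def power_int_mult prod_powi)

lemma lmon_sum:
assumes "c:nz"
shows "lmon r (%k. SUM i:I. f i k) c = (PROD i:I. lmon r (f i) c)"
proof (induction I rule: infinite_finite_induct)
case (insert x F)
thus ?case using lmon_add[OF assms, of r "f x" "%k. SUM i:F. f i k"] by simp
qed simp_all

lemma lmon_cong: "(!!i. i < r ==> c i = c' i) ==> lmon r al c = lmon r al c'" by (simp add: lmon_def)

lemma lmon_cong_exp: "(!!i. i < r ==> al i = be i) ==> lmon r al c = lmon r be c" by (simp add: lmon_def)

lemma lmon_separates:
assumes "al:exps r" "be:exps r" "al ~= be"
shows "EX c:nz. lmon r al c ~= lmon r be c"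
proof -
obtain i where i: "al i ~= be i" using assms(3) unfolding fun_eq_iff by auto
have ir: "i < r"
proof (rule ccontr)
 assume "~ i < r"
 hence "al i = 0" "be i = 0" using assms(1,2) by (simp_all add: exps_def)
 thus False using i by simp
qed
define c where "c j = (if j = i then 2 else 1 :: complex)" for j
have val: "lmon r ga c = 2 powi ga i" for ga
proof -
 have "lmon r ga c = (PROD j<r. if j = i then 2 powi ga i else 1)" unfolding lmon_def c_def by (rule prod.cong) auto
 thus ?thesis using ir by simp
qed
have inj: "(2 :: complex) powi a ~= 2 powi b" if "a ~= b" for a b :: int
proof
 assume "(2 :: complex) powi a = 2 powi b"
 hence "norm ((2 :: complex) powi a) = norm ((2 :: complex) powi b)" by simp
 hence "(2 :: real) powi a = 2 powi b" by (simp add: norm_power_int)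
 moreover have "a < b \<or> b < a" using that by linarith
 ultimately show False
  using power_int_strict_increasing[of a b "2 :: real"] power_int_strict_increasing[of b a "2 :: real"] by fastforce
qed
have "c:nz" by (simp add: nz_def c_def)
thus ?thesis using inj[OF i] by (intro bexI[of _ c]) (simp_all add: val)
qed

text \<open>Dedekind's argument: the relation at x y minus \<open>ch f y\<close> times the relation
  at x no longer involves \<open>f\<close>. It is stated for functions multiplicative on a set
  closed under \<open>mul\<close>, so that it applies to sequences.\<close>

lemma independence_of_characters:
fixes ch :: "'i => 'g => complex"
assumes "finite S" "C ~= {}" and mul: "!!x y. x:C ==> y:C ==> mul x y:C"
 and "!!i x y. i:S ==> x:C ==> y:C ==> ch i (mul x y) = ch i x * ch i y" and "!!i x. i:S ==> x:C ==> ch i x ~= 0"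
 and "!!i j. i:S ==> j:S ==> i ~= j ==> EX x:C. ch i x ~= ch j x" and "!!x. x:C ==> (SUM i:S. k i * ch i x) = 0"
shows "ALL i:S. k i = 0" using assms(1,4-7)
proof (induction S arbitrary: k rule: finite_induct)
case empty
thus ?case by simp
next
case (insert f S)
have S: "k i = 0" if i: "i:S" for i
proof -
 obtain y where y: "y:C" "ch i y ~= ch f y" using insert.prems(3)[of i f] i insert.hyps(2) by blast
 have "ALL i:S. k i * (ch i y - ch f y) = 0"
 proof (rule insert.IH)
  fix x assume x: "x:C"
  have "0 = (SUM i:insert f S. k i * ch i (mul x y)) - ch f y * (SUM i:insert f S. k i * ch i x)"
  using insert.prems(4)[OF x] insert.prems(4)[OF mul[OF x y(1)]] by simp
  also have "... = (SUM i:insert f S. k i * (ch i y - ch f y) * ch i x)" using insert.prems(1)[OF _ x y(1)]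
  by (simp add: sum_distrib_left sum_subtractf[symmetric] algebra_simps del: sum.insert)
  also have "... = (SUM i:S. k i * (ch i y - ch f y) * ch i x)" using insert.hyps by simp
  finally show "(SUM i:S. k i * (ch i y - ch f y) * ch i x) = 0" ..
 qed (rule insert.prems; (rule insertI2)?; assumption)+
 hence "k i * (ch i y - ch f y) = 0" by (rule bspec) (rule i)
 thus ?thesis using y(2) by simp
qed
obtain x where x: "x:C" using assms(2) by blast
have "k f * ch f x = 0" using insert.prems(4)[OF x] insert.hyps S by simp
thus ?case using S insert.prems(2)[of f x] x by simp
qed

lemma lmon_independent:
assumes "finite S" "S <= exps r" "!!c. c:nz ==> (SUM al:S. k al * lmon r al c) = 0"
shows "ALL al:S. k al = 0"
proof (rule independence_of_characters[where C = nz and mul = "%c c' i. c i * c' i" and ch = "lmon r"])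
show "nz ~= {}" using nz_one by blast
show "EX c:nz. lmon r al c ~= lmon r be c" if "al:S" "be:S" "al ~= be" for al be using lmon_separates that assms(2) by blast
show "lmon r al c ~= 0" if "c:nz" for al c using that by (rule lmon_nonzero)
qed (use assms in \<open>simp_all only: lmon_times nz_mult\<close>)

definition laurent :: "nat => ((nat => complex) => complex) => bool" where
"laurent r F \<longleftrightarrow> (EX S k. finite S & S <= exps r & (ALL c:nz. F c = (SUM al:S. k al * lmon r al c)))"

lemma laurentE:
assumes "laurent r F"
obtains S k where "finite S" "S <= exps r" "!!c. c:nz ==> F c = (SUM al:S. k al * lmon r al c)"
using assms unfolding laurent_def by auto

lemma laurent_cong: "laurent r F ==> (!!c. c:nz ==> F c = G c) ==> laurent r G" by (simp add: laurent_def)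

lemma laurent_lmon: "laurent r (%c. k * lmon r al c)"
unfolding laurent_def by (intro exI[of _ "{trunc r al}"] exI[of _ "%_. k"]) simp

lemma laurent_const: "laurent r (%c. k)" using laurent_lmon[of r k "%_. 0"] by simp

lemma laurent_coord: "i < r ==> laurent r (%c. c i)"
proof -
assume i: "i < r"
have "lmon r (%j. if j = i then 1 else 0) c = c i" for c
proof -
 have "lmon r (%j. if j = i then 1 else 0) c = (PROD j<r. if j = i then c i else 1)" unfolding lmon_def by (rule prod.cong) auto
 thus ?thesis using i by simp
qed
thus ?thesis using laurent_lmon[of r 1 "%j. if j = i then 1 else 0"] by simp
qed

lemma laurent_add:
assumes "laurent r F" "laurent r G"
shows "laurent r (%c. F c + G c)"
proof -
obtain S k where S: "finite S" "S <= exps r" "!!c. c:nz ==> F c = (SUM al:S. k al * lmon r al c)"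
 by (rule laurentE[OF assms(1)]) (rule that)
obtain S' k' where S': "finite S'" "S' <= exps r" "!!c. c:nz ==> G c = (SUM al:S'. k' al * lmon r al c)"
 by (rule laurentE[OF assms(2)]) (rule that)
let ?k = "%al. (if al:S then k al else 0) + (if al:S' then k' al else 0)"
have FG: "F c + G c = (SUM al:S \<union> S'. ?k al * lmon r al c)" if c: "c:nz" for c
proof -
 have "(SUM al:S. k al * lmon r al c) = (SUM al:S \<union> S'. (if al:S then k al else 0) * lmon r al c)"
  using S(1) S'(1) by (intro sum.mono_neutral_cong_left) simp_all
 moreover have "(SUM al:S'. k' al * lmon r al c) = (SUM al:S \<union> S'. (if al:S' then k' al else 0) * lmon r al c)"
  using S(1) S'(1) by (intro sum.mono_neutral_cong_left) simp_all
 ultimately show ?thesis unfolding S(3)[OF c] S'(3)[OF c] by (simp only: sum.distrib distrib_right)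
qed
have "finite (S \<union> S')" "S \<union> S' <= exps r" using S(1,2) S'(1,2) by simp_all
thus ?thesis unfolding laurent_def by (intro exI[of _ "S \<union> S'"] exI[of _ ?k] conjI ballI FG)
qed

lemma laurent_sum: "(!!i. i:I ==> laurent r (F i)) ==> laurent r (%c. SUM i:I. F i c)"
by (induction I rule: infinite_finite_induct) (simp_all add: laurent_const laurent_add)

lemma laurent_mult_mono:
assumes "laurent r F"
shows "laurent r (%c. a * lmon r be c * F c)"
proof -
obtain S k where S: "finite S" "S <= exps r" "!!c. c:nz ==> F c = (SUM al:S. k al * lmon r al c)"
 by (rule laurentE[OF assms]) (rule that)
have "laurent r (%c. SUM al:S. a * k al * lmon r (%i. be i + al i) c)" by (intro laurent_sum laurent_lmon)
thus ?thesis by (rule laurent_cong) (simp add: S(3) lmon_add sum_distrib_left mult_ac)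
qed

lemma laurent_mult:
assumes "laurent r F" "laurent r G"
shows "laurent r (%c. F c * G c)"
proof -
obtain S k where S: "finite S" "S <= exps r" "!!c. c:nz ==> F c = (SUM al:S. k al * lmon r al c)"
 by (rule laurentE[OF assms(1)]) (rule that)
have "laurent r (%c. SUM al:S. k al * lmon r al c * G c)" by (intro laurent_sum laurent_mult_mono assms(2))
thus ?thesis by (rule laurent_cong) (simp add: S(3) sum_distrib_right)
qed

lemma laurent_prod: "(!!i. i:I ==> laurent r (F i)) ==> laurent r (%c. PROD i:I. F i c)"
by (induction I rule: infinite_finite_induct) (simp_all add: laurent_const laurent_mult)

lemma laurent_inverse_arg:
assumes "laurent r F"
shows "laurent r (%c. F (%i. inverse (c i)))"
proof -
obtain S k where S: "finite S" "S <= exps r" "!!c. c:nz ==> F c = (SUM al:S. k al * lmon r al c)"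
 by (rule laurentE[OF assms]) (rule that)
have "laurent r (%c. SUM al:S. k al * lmon r (%i. - al i) c)" by (intro laurent_sum laurent_lmon)
thus ?thesis
proof (rule laurent_cong)
 fix c assume c: "c:nz"
 show "(SUM al:S. k al * lmon r (%i. - al i) c) = F (%i. inverse (c i))" unfolding S(3)[OF nz_inverse[OF c]] lmon_inverse ..
qed
qed

lemma laurent_extend:
assumes "laurent h F"
shows "laurent (h + d) F"
proof -
obtain S k where S: "finite S" "S <= exps h" "!!c. c:nz ==> F c = (SUM al:S. k al * lmon h al c)"
 by (rule laurentE[OF assms]) (rule that)
have m: "lmon h al c = lmon (h + d) (trunc h al) c" for al c
proof -
 show ?thesis unfolding lmon_def
 proof (rule prod.mono_neutral_cong_left)
  show "ALL i:{..<h + d} - {..<h}. c i powi trunc h al i = 1" by (simp add: trunc_def)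
 qed (simp_all add: trunc_def lessThan_subset_iff)
qed
have "laurent (h + d) (%c. SUM al:S. k al * lmon (h + d) (trunc h al) c)" by (intro laurent_sum laurent_lmon)
thus ?thesis by (rule laurent_cong) (simp only: S(3) m)
qed

definition join :: "nat => (nat => 'a) => (nat => 'a) => nat => 'a" where
"join h a b i = (if i < h then a i else b (i - h))"

lemma lmon_join: "lmon (h + d) (join h al be) c = lmon h al c * lmon d be (%i. c (h + i))"
proof -
have "{..<h + d} = {..<h} \<union> (%i. h + i) ` {..<d}"
proof (intro equalityI subsetI)
 fix i assume i: "i:{..<h + d}"
 show "i:{..<h} \<union> (%i. h + i) ` {..<d}"
 proof (cases "i < h")
  case False
  thus ?thesis using i by (intro UnI2 image_eqI[of _ _ "i - h"]) auto
 qed simp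
qed auto
hence "lmon (h + d) (join h al be) c
  = (PROD i<h. c i powi join h al be i) * (PROD i:(%i. h + i) ` {..<d}. c i powi join h al be i)"
 unfolding lmon_def by (simp only:) (rule prod.union_disjoint, auto)
also have "(PROD i:(%i. h + i) ` {..<d}. c i powi join h al be i) = lmon d be (%i. c (h + i))"
 by (simp add: prod.reindex lmon_def join_def)
finally show ?thesis by (simp add: lmon_def join_def)
qed

lemma laurent_shift:
assumes "laurent d F"
shows "laurent (h + d) (%c. F (%i. c (h + i)))"
proof -
obtain S k where S: "finite S" "S <= exps d" "!!c. c:nz ==> F c = (SUM al:S. k al * lmon d al c)"
 by (rule laurentE[OF assms]) (rule that)
have "laurent (h + d) (%c. SUM al:S. k al * lmon (h + d) (join h (%_. 0) al) c)" by (intro laurent_sum laurent_lmon)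
thus ?thesis by (rule laurent_cong) (simp add: S(3) lmon_join nz_shift)
qed

lemma laurent_dep:
assumes "laurent r F" "c:nz" "c':nz" "!!i. i < r ==> c i = c' i"
shows "F c = F c'"
proof -
obtain S k where S: "finite S" "S <= exps r" "!!c. c:nz ==> F c = (SUM al:S. k al * lmon r al c)"
 by (rule laurentE[OF assms(1)]) (rule that)
show ?thesis unfolding S(3)[OF assms(2)] S(3)[OF assms(3)] using lmon_cong[OF assms(4)] by simp
qed

text \<open>If \<open>F\<close> differed from all monomials, then \<open>F\<close> and the monomials
  of its expansion would be distinct characters related by that very expansion. The index
  \<open>None\<close> stands for \<open>F\<close>.\<close>

lemma laurent_multiplicative:
assumes F: "laurent r F" and mult: "!!c c'. c:nz ==> c':nz ==> F (%i. c i * c' i) = F c * F c'"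
 and nonzero: "!!c. c:nz ==> F c ~= 0"
shows "EX al:exps r. ALL c:nz. F c = lmon r al c"
proof (rule ccontr)
assume no: "~ ?thesis"
obtain S k where S: "finite S" "S <= exps r" "!!c. c:nz ==> F c = (SUM al:S. k al * lmon r al c)"
 by (rule laurentE[OF F]) (rule that)
define ch where "ch i = (case i of None => F | Some al => lmon r al)" for i
define l where "l i = (case i of None => - 1 | Some al => k al)" for i
have "ALL i:insert None (Some ` S). l i = 0"
proof (rule independence_of_characters[where C = nz and mul = "%c c' i. c i * c' i" and ch = ch])
 show "nz ~= {}" using nz_one by blast
 show "EX x:nz. ch i x ~= ch j x" if ij: "i:insert None (Some ` S)" "j:insert None (Some ` S)" "i ~= j" for i j
 proof (cases i)
  case None
  then obtain al where "j = Some al" "al:S" using ij(2,3) by auto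
  hence "al:exps r" using S(2) by blast
  then obtain c where "c:nz" "F c ~= lmon r al c" using no by blast
  thus ?thesis using None \<open>j = Some al\<close> by (intro bexI[of _ c]) (simp_all add: ch_def)
 next
  case (Some al)
  show ?thesis
  proof (cases j)
  case None
  have "al:exps r" using Some S(2) that(1) by auto
  then obtain c where "c:nz" "F c ~= lmon r al c" using no by blast
  thus ?thesis using None Some by (intro bexI[of _ c]) (simp_all add: ch_def)
  next
  case (Some be)
  have "al:exps r" "be:exps r" "al ~= be" using Some S(2) that \<open>i = Some al\<close> by auto
  then obtain c where "c:nz" "lmon r al c ~= lmon r be c" using lmon_separates by blast
  thus ?thesis using Some \<open>i = Some al\<close> by (intro bexI[of _ c]) (simp_all add: ch_def)
  qed
 qed
 show "(SUM i:insert None (Some ` S). l i * ch i x) = 0" if "x:nz" for x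
 proof -
  have "(SUM i:insert None (Some ` S). l i * ch i x) = - F x + (SUM al:S. k al * lmon r al x)"
  using S(1) by (simp add: sum.reindex l_def ch_def)
  thus ?thesis using S(3)[OF that] by simp
 qed
 show "ch i (%k. x k * y k) = ch i x * ch i y" if "x:nz" "y:nz" for i x y
  using mult[OF that] by (cases i) (simp_all add: ch_def lmon_times)
 show "ch i x ~= 0" if "x:nz" for i x using nonzero[OF that] lmon_nonzero[OF that] by (cases i) (simp_all add: ch_def)
 show "(%k. x k * y k):nz" if "x:nz" "y:nz" for x y using that by simp
 show "finite (insert None (Some ` S))" using S(1) by simp
qed
thus False by (simp add: l_def)
qed

lemma regular_on_powi:
assumes "regular_on n S f" "regular_on n S (%A. 1 / f A)"
shows "regular_on n S (%A. f A powi k)"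
proof (cases "0 <= k")
case True
thus ?thesis using regular_on_power[OF assms(1), of "nat k"] by (simp add: power_int_def)
next
case False
thus ?thesis using regular_on_power[OF assms(2), of "nat (- k)"] by (simp add: power_int_def divide_inverse power_inverse)
qed

lemma regular_on_laurent:
assumes F: "laurent d F" and ka: "!!j. j < d ==> regular_on n S (ka j)" "!!j. j < d ==> regular_on n S (%A. 1 / ka j A)"
 "!!j A. j < d ==> A:S ==> ka j A ~= 0"
shows "regular_on n S (%A. F (%j. if j < d then ka j A else 1))"
proof -
obtain E k where E: "finite E" "E <= exps d" "!!c. c:nz ==> F c = (SUM al:E. k al * lmon d al c)"
 by (rule laurentE[OF F]) (rule that)
have "regular_on n S (%A. SUM al:E. k al * (PROD j<d. ka j A powi al j))"
 by (rule regular_on_sum, rule reg_mult, rule reg_const, rule regular_on_prod,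
  rule regular_on_powi) (use ka(1,2) in auto)
thus ?thesis
proof (rule reg_cong)
 fix A assume "A:S"
 hence "(%j. if j < d then ka j A else 1):nz" using ka(3) by (simp add: nz_def)
 thus "(SUM al:E. k al * (PROD j<d. ka j A powi al j)) = F (%j. if j < d then ka j A else 1)" by (simp add: E(3) lmon_def)
qed
qed

section \<open>Homomorphisms from split tori to GL(m)\<close>

definition lhom :: "nat => nat => ((nat => complex) => complex mat) => bool" where
"lhom r m e \<longleftrightarrow> (ALL c:nz. e c:GLs m) & (ALL c:nz. ALL c':nz. e (%i. c i * c' i) = e c * e c') &
 (ALL i<m. ALL j<m. laurent r (%c. e c $$ (i, j)))"

lemma lhomD:
assumes "lhom r m e"
shows "!!c. c:nz ==> e c:GLs m" "!!c. c:nz ==> e c:sqm m"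
 "!!c c'. c:nz ==> c':nz ==> e (%i. c i * c' i) = e c * e c'"
 "!!i j. i < m ==> j < m ==> laurent r (%c. e c $$ (i, j))" using assms GL_mat unfolding lhom_def by blast+

lemma lhom_one:
assumes e: "lhom r m e"
shows "e (%_. 1) = 1\<^sub>m m"
proof -
note e1 = lhomD(1)[OF e nz_one]
have "e (%_. 1) * e (%_. 1) = e (%_. 1)" using lhomD(3)[OF e nz_one nz_one] by simp
thus ?thesis using group.l_cancel_one[OF group_GL e1 e1] by simp
qed

lemma lhom_inverse:
assumes e: "lhom r m e" and c: "c:nz"
shows "ginv m (e c) = e (%i. inverse (c i))"
proof (rule GL_inv_unique[OF lhomD(1)[OF e c] lhomD(2)[OF e nz_inverse[OF c]]])
have "e (%i. inverse (c i)) * e c = e (%i. inverse (c i) * c i)" using lhomD(3)[OF e nz_inverse[OF c] c] by simp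
also have "(%i. inverse (c i) * c i) = (%_. 1)" using c by (auto simp: nz_def)
finally show "e (%i. inverse (c i)) * e c = 1\<^sub>m m" using lhom_one[OF e] by simp
qed

lemma lhom_dep:
assumes e: "lhom r m e" and c: "c:nz" "c':nz" "!!i. i < r ==> c i = c' i"
shows "e c = e c'" using lhomD(2)[OF e c(1)] lhomD(2)[OF e c(2)] laurent_dep[OF lhomD(4)[OF e] c] by (intro eq_matI) auto

lemma lhom_subgroup:
assumes e: "lhom r m e"
shows "subgroup (e ` nz) (GL m)"
proof (rule group.subgroupI[OF group_GL])
show "e ` nz <= GLs m" using lhomD(1)[OF e] by blast
show "e ` nz ~= {}" using nz_one by blast
show "ginv m a:e ` nz" if "a:e ` nz" for a using that lhom_inverse[OF e] by auto
show "a \<otimes>\<^bsub>GL m\<^esub> b:e ` nz" if ab: "a:e ` nz" "b:e ` nz" for a b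
proof -
 obtain c c' where "a = e c" "b = e c'" "c:nz" "c':nz" using ab by blast
 hence "a \<otimes>\<^bsub>GL m\<^esub> b = e (%i. c i * c' i)" using lhomD(3)[OF e, of c c'] by simp
 thus ?thesis using nz_mult \<open>c:nz\<close> \<open>c':nz\<close> by blast
qed
qed

lemma laurent_det:
assumes "!!c. c:nz ==> M c:sqm m" "!!i j. i < m ==> j < m ==> laurent r (%c. M c $$ (i, j))"
shows "laurent r (%c. det (M c))"
proof (rule laurent_cong)
show "laurent r (%c. SUM p:{p. p permutes {0..<m}}. signof p * (PROD i = 0..<m. M c $$ (i, p i)))"
proof (rule laurent_sum, rule laurent_mult, rule laurent_const, rule laurent_prod)
 fix p i assume "p:{p. p permutes {0..<m}}" "i:{0..<m}"
 thus "laurent r (%c. M c $$ (i, p i))" using permutes_in_image[of p "{0..<m}" i] by (intro assms(2)) simp_all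
qed
show "(SUM p:{p. p permutes {0..<m}}. signof p * (PROD i = 0..<m. M c $$ (i, p i))) = det (M c)"
 if "c:nz" for c using det_def'[OF assms(1)[OF that]] by simp
qed

text \<open>Induction over the generators of the coordinate ring; the reciprocal of the determinant
  at c is the determinant at the inverse point, hence again a Laurent polynomial.\<close>

lemma laurent_regular:
assumes e: "lhom r m e" and p: "regular_on m (e ` nz) p"
shows "laurent r (%c. p (e c))"
proof -
obtain q where q: "q:regular_fun m" "ALL g:e ` nz. p g = q g" using p by (auto simp: regular_on_def)
from q(1) have "laurent r (%c. q (e c))"
proof induction
 case (const c)
 thus ?case by (rule laurent_const)
next
 case (entry i j)
 thus ?case by (rule lhomD(4)[OF e])
next
 case inverse_det
 have "laurent r (%c. det (e c))" by (rule laurent_det) (use lhomD[OF e] in auto)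
 hence "laurent r (%c. det (e (%i. inverse (c i))))" by (rule laurent_inverse_arg)
 thus ?case
 proof (rule laurent_cong)
  fix c assume c: "c:nz"
  have "det (e (%i. inverse (c i))) * det (e c) = 1" using det_mult[OF lhomD(2)[OF e nz_inverse[OF c]] lhomD(2)[OF e c]]
   GL_inv_left[OF lhomD(1)[OF e c]] lhom_inverse[OF e c] by simp
  thus "det (e (%i. inverse (c i))) = 1 / det (e c)" using GL_det[OF lhomD(1)[OF e c]] by (simp add: nonzero_eq_divide_eq)
 qed
next
 case (add p q)
 thus ?case by (intro laurent_add)
next
 case (mult p q)
 thus ?case by (intro laurent_mult)
qed
thus ?thesis by (rule laurent_cong) (use q(2) in auto)
qed

section \<open>Bases of finitely generated subgroups of the integer lattice\<close>

definition generates :: "nat => (nat => int) set => nat => (nat => nat => int) => bool" where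
"generates r S d b \<longleftrightarrow> (ALL al:S. EX M. ALL k<r. al k = (SUM j<d. M j * b j k)) &
 (ALL j<d. EX N. ALL k<r. b j k = (SUM al:S. N al * al k))"

text \<open>Replacing \<open>b j\<close> by \<open>b j + s b i\<close> turns a relation \<open>l\<close> into one with \<open>l i - s l j\<close> in place of
  \<open>l i\<close>; so a generating family of minimal size admits no nontrivial relation.\<close>

lemma generates_transvection:
assumes g: "generates r S d b" and ij: "i < d" "j < d" "i ~= j"
shows "generates r S d (b(j := %k. b j k + s * b i k))" (is "generates r S d ?b") unfolding generates_def
proof (intro conjI ballI allI impI)
fix al assume "al:S"
with g have "EX M. ALL k<r. al k = (SUM j<d. M j * b j k)" unfolding generates_def by (elim conjE bspec)
then obtain M where M: "ALL k<r. al k = (SUM j<d. M j * b j k)" ..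
have "al k = (SUM x<d. (M(i := M i - s * M j)) x * ?b x k)" if k: "k < r" for k
proof -
 have "(SUM x<d. (M(i := M i - s * M j)) x * ?b x k)
  = (SUM x<d. M x * b x k + (if x = i then - s * M j * b i k else 0) + (if x = j then M j * s * b i k else 0))"
  using ij(3) by (intro sum.cong) (auto simp: algebra_simps)
 moreover have "al k = (SUM j<d. M j * b j k)" using M k by (elim allE impE)
 ultimately show ?thesis using ij by (simp add: sum.distrib)
qed
thus "EX M. ALL k<r. al k = (SUM j<d. M j * ?b j k)" by (intro exI[of _ "M(i := M i - s * M j)"] allI impI)
next
fix x assume x: "x < d"
have ex: "EX N. ALL k<r. b x k = (SUM al:S. N al * al k)" if "x < d" for x
 using g that unfolding generates_def by (elim conjE allE impE)
show "EX N. ALL k<r. ?b x k = (SUM al:S. N al * al k)"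
proof (cases "x = j")
 case True
 obtain N where N: "ALL k<r. b j k = (SUM al:S. N al * al k)" using ex[OF ij(2)] ..
 obtain N' where N': "ALL k<r. b i k = (SUM al:S. N' al * al k)" using ex[OF ij(1)] ..
 have "ALL k<r. ?b x k = (SUM al:S. (N al + s * N' al) * al k)"
  using True N N' by (simp add: sum_distrib_left sum.distrib distrib_right mult.assoc)
 thus ?thesis by (rule exI[of _ "%al. N al + s * N' al"])
next
 case False
 thus ?thesis using ex[OF x] by simp
qed
qed

lemma generates_drop:
assumes g: "generates r S d b" and j: "j < d" "!!k. k < r ==> b j k = 0"
shows "EX b'. generates r S (d - 1) b'"
proof
let ?f = "%x. if x < j then x else Suc x"
have im: "?f ` {..<d - 1} = {..<d} - {j}"
proof (intro equalityI subsetI)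
 fix y assume y: "y:{..<d} - {j}"
 show "y:?f ` {..<d - 1}"
 proof (cases "y < j")
  case True
  thus ?thesis using y j by (intro image_eqI[of _ _ y]) auto
 next
  case False
  thus ?thesis using y j by (intro image_eqI[of _ _ "y - 1"]) auto
 qed
qed (use j in auto)
have inj: "inj_on ?f {..<d - 1}" by (rule inj_onI) (auto split: if_splits)
show "generates r S (d - 1) (%x. b (?f x))" unfolding generates_def
proof (intro conjI ballI allI impI)
 fix al assume "al:S"
 then obtain M where M: "!!k. k < r ==> al k = (SUM j<d. M j * b j k)" using g unfolding generates_def by blast
 have "al k = (SUM x<d - 1. M (?f x) * b (?f x) k)" if k: "k < r" for k
 proof -
  have "(SUM x<d - 1. M (?f x) * b (?f x) k) = (SUM y:{..<d} - {j}. M y * b y k)"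
  using sum.reindex[OF inj, of "%y. M y * b y k"] unfolding im by (simp only: comp_def)
  thus ?thesis using M[OF k] j k by (simp add: sum_diff1)
 qed
 thus "EX M. ALL k<r. al k = (SUM x<d - 1. M x * b (?f x) k)" by (intro exI[of _ "%x. M (?f x)"]) simp
next
 fix x assume "x < d - 1"
 hence "?f x < d" using im by blast
 thus "EX N. ALL k<r. b (?f x) k = (SUM al:S. N al * al k)" using g unfolding generates_def by blast
qed
qed

lemma lattice_basis:
assumes S: "finite S"
shows "EX d b. generates r S d b & (ALL l. (ALL k<r. (SUM j<d. l j * b j k) = 0) --> (ALL j<d. l j = (0 :: int)))"
proof -
have "EX d b. generates r S d b"
proof -
 obtain f where f: "bij_betw f {..<card S} S" using S ex_bij_betw_nat_finite[OF S] by (auto simp: atLeast0LessThan)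
 have "generates r S (card S) f" unfolding generates_def
 proof (intro conjI ballI allI impI)
  fix al assume "al:S"
  then obtain j where j: "j < card S" "al = f j" using bij_betw_imp_surj_on[OF f] by blast
  have "(SUM x<card S. (if x = j then 1 else 0) * f x k) = al k" for k
  proof -
  have "(SUM x<card S. (if x = j then 1 else 0) * f x k) = (SUM x<card S. if x = j then f j k else 0)" by (rule sum.cong) auto
  thus ?thesis using j by simp
  qed
  thus "EX M. ALL k<r. al k = (SUM j<card S. M j * f j k)" by (intro exI[of _ "%x. if x = j then 1 else 0"]) simp
 next
  fix j assume "j < card S"
  hence fj: "f j:S" using bij_betw_imp_surj_on[OF f] by blast
  have "(SUM al:S. (if al = f j then 1 else 0) * al k) = f j k" for k
  proof -
  have "(SUM al:S. (if al = f j then 1 else 0) * al k) = (SUM al:S. if al = f j then f j k else 0)" by (rule sum.cong) auto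
  thus ?thesis using fj S by simp
  qed
  thus "EX N. ALL k<r. f j k = (SUM al:S. N al * al k)" by (intro exI[of _ "%al. if al = f j then 1 else 0"]) simp
 qed
 thus ?thesis by blast
qed
then obtain d where d: "EX b. generates r S d b" and least: "!!d'. d' < d ==> ~ (EX b. generates r S d' b)"
 using exists_least_iff[of "%d. EX b. generates r S d b"] by auto
have nodep: False
 if "generates r S d b" "ALL k<r. (SUM j<d. l j * b j k) = 0" "j0 < d" "l j0 ~= 0" "m = nat (SUM j<d. \<bar>l j\<bar>)"
 for b j0 m and l :: "nat => int" using that
proof (induction m arbitrary: b l j0 rule: less_induct)
 case (less m)
 show False
 proof (cases "EX i<d. i ~= j0 & l i ~= 0")
  case False
  have "b j0 k = 0" if k: "k < r" for k
  proof -
  have "(SUM j<d. l j * b j k) = (SUM j<d. if j = j0 then l j0 * b j0 k else 0)" using False by (intro sum.cong) auto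
  thus ?thesis using less.prems k by simp
  qed
  thus False using generates_drop[OF less.prems(1,3)] least[of "d - 1"] less.prems(3) by simp
 next
  case True
  \<comment> \<open>A Euclidean step: of two nonzero coefficients the larger is reduced by the
    smaller, the sign \<open>s\<close> making its absolute value drop. The sum of absolute values
    decreases, and \<open>l j\<close> stays nonzero for the induction.\<close>
  have red: False if ij: "i < d" "j < d" "i ~= j" "l j ~= 0" "\<bar>l j\<bar> <= \<bar>l i\<bar>" for i j
  proof -
  define s where "s = sgn (l i) * sgn (l j)"
  have dec: "\<bar>l i - s * l j\<bar> < \<bar>l i\<bar>" unfolding s_def using ij(4,5) by (auto simp: sgn_if abs_if split: if_splits)
  let ?l = "l(i := l i - s * l j)" and ?b = "b(j := %k. b j k + s * b i k)"
  have rel: "ALL k<r. (SUM x<d. ?l x * ?b x k) = 0"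
  proof (intro allI impI)
   fix k assume k: "k < r"
   have "(SUM x<d. ?l x * ?b x k)
    = (SUM x<d. l x * b x k + (if x = i then - s * l j * b i k else 0) + (if x = j then l j * s * b i k else 0))"
    using ij(3) by (intro sum.cong) (auto simp: algebra_simps)
   thus "(SUM x<d. ?l x * ?b x k) = 0" using ij less.prems(2) k by (simp add: sum.distrib)
  qed
  have "(SUM x<d. \<bar>?l x\<bar>) < (SUM x<d. \<bar>l x\<bar>)" using dec ij by (intro sum_strict_mono_ex1) auto
  moreover have "0 <= (SUM x<d. \<bar>?l x\<bar>)" by (rule sum_nonneg) simp
  ultimately have "nat (SUM x<d. \<bar>?l x\<bar>) < m" unfolding less.prems(5) by linarith
  moreover have "?l j ~= 0" using ij by simp
  ultimately show False using less.IH[OF _ generates_transvection[OF less.prems(1) ij(1-3)] rel ij(2) _ refl] by blast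
  qed
  obtain i where i: "i < d" "i ~= j0" "l i ~= 0" using True by blast
  show False using red[of i j0] red[of j0 i] i less.prems(3,4) by linarith
 qed
qed
obtain b where b: "generates r S d b" using d by blast
show ?thesis using b nodep[OF b] by blast
qed

lemma prod_powi_sum: "v ~= (0 :: complex) ==> (PROD i:I. v powi f i) = v powi (SUM i:I. f i)"
by (induction I rule: infinite_finite_induct) (simp_all add: power_int_add)

text \<open>By independence, \<open>span_or_perp\<close> applied to the columns of b gives integral
  exponents c_j that pair to N_j with b_j and to 0 with the other b_k. Monomials in N_j-th roots of
  the u_j then solve the system.\<close>

lemma lmon_surjective:
assumes indep: "!!l :: nat => int. (!!k. k < r ==> (SUM j<d. l j * b j k) = 0) ==> ALL j<d. l j = 0" and u: "u:nz"
shows "EX c:nz. ALL j<d. lmon r (b j) c = u j"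
proof -
have "EX N>0. EX c :: nat => int. ALL k<d. (SUM i<r. c i * b k i) = (if k = j then int N else 0)" if j: "j < d" for j
proof -
 have no: "~ (EX l. (EX k<d. l k ~= 0) & (ALL i:{..<r}. idot d (%j. b j i) l = 0))"
 proof
  assume "EX l. (EX k<d. l k ~= 0) & (ALL i:{..<r}. idot d (%j. b j i) l = 0)"
  then obtain l k where l: "k < d" "l k ~= 0" "ALL i:{..<r}. idot d (%j. b j i) l = 0" by auto
  have "ALL j<d. l j = 0" by (rule indep) (use l(3) in \<open>simp add: idot_def mult.commute\<close>)
  thus False using l(1,2) by simp
 qed
 show ?thesis
 proof (rule disjE[OF span_or_perp[of "{..<r}" j d "%i j. b j i", OF finite_lessThan j]])
  assume "EX N>0. EX c :: nat => int. ALL k<d. (SUM i<r. c i * b k i) = (if k = j then int N else 0)"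
  thus ?thesis .
 qed (rule notE[OF no])
qed
hence "ALL j:{..<d}. EX Nc :: nat \<times> (nat => int). 0 < fst Nc & (ALL k<d. (SUM i<r. snd Nc i * b k i) = (if k = j then int (fst Nc) else 0))"
 unfolding split_paired_Ex fst_conv snd_conv by (intro ballI) (simp only: lessThan_iff ex_simps)
from bchoice[OF this] obtain Nc :: "nat => nat \<times> (nat => int)"
 where Nc: "ALL j:{..<d}. 0 < fst (Nc j) & (ALL k<d. (SUM i<r. snd (Nc j) i * b k i) = (if k = j then int (fst (Nc j)) else 0))" ..
define N where "N j = fst (Nc j)" for j
define c where "c j = snd (Nc j)" for j
have N: "0 < N j" if "j < d" for j using Nc that by (simp add: N_def)
have c: "(SUM i<r. c j i * b k i) = (if k = j then int (N j) else 0)" if "j < d" "k < d" for j k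
 using Nc that by (simp add: N_def c_def)
define v where "v j = exp (Ln (u j) / of_nat (N j))" for j
have v: "v j powi int (N j) = u j" if "j < d" for j
 unfolding v_def using N[OF that] u by (simp add: exp_of_nat_mult[symmetric] nz_def)
have v0: "v j ~= 0" for j by (simp add: v_def)
define w where "w i = (PROD j<d. v j powi c j i)" for i
have "w:nz" by (simp add: nz_def w_def v0)
moreover have "lmon r (b k) w = u k" if k: "k < d" for k
proof -
 have "lmon r (b k) w = (PROD i<r. PROD j<d. v j powi (c j i * b k i))" by (simp add: lmon_def w_def prod_powi power_int_mult)
 also have "... = (PROD j<d. PROD i<r. v j powi (c j i * b k i))" by (rule prod.swap)
 also have "... = (PROD j<d. v j powi (SUM i<r. c j i * b k i))" by (simp add: prod_powi_sum v0)
 also have "... = (PROD j<d. if j = k then v k powi int (N k) else 1)" using c k by (intro prod.cong) auto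
 finally show ?thesis using k v[OF k] by simp
qed
ultimately show ?thesis by blast
qed

section \<open>Projections onto the weight spaces of a torus\<close>

definition expansion :: "nat => nat => ((nat => complex) => complex mat) => (nat => int) set
 => ((nat => int) => complex mat) => bool" where
"expansion r m e W E \<longleftrightarrow> finite W & W <= exps r & (ALL al. E al:sqm m) &
 (ALL c:nz. ALL i<m. ALL j<m. e c $$ (i, j) = (SUM al:W. E al $$ (i, j) * lmon r al c))"

lemma expD:
assumes "expansion r m e W E"
shows "finite W" "W <= exps r" "!!al. E al:sqm m"
 "!!c i j. c:nz ==> i < m ==> j < m ==> e c $$ (i, j) = (SUM al:W. E al $$ (i, j) * lmon r al c)"
using assms by (simp_all add: expansion_def)

text \<open>Compare coefficients in e (c c') = e c * e c', first as Laurent polynomials in c and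
  then in c'. Both times linear independence of monomials is used.\<close>

lemma expansion_orthogonal:
assumes e: "lhom r m e" and x: "expansion r m e W E" and ab: "al:W" "be:W"
shows "E al * E be = (if al = be then E al else 0\<^sub>m m m)"
proof (rule eq_matI)
note X = expD[OF x]
fix i j assume "i < dim_row (if al = be then E al else 0\<^sub>m m m)" "j < dim_col (if al = be then E al else 0\<^sub>m m m)"
hence ij: "i < m" "j < m" using X(3)[of al] by (auto split: if_splits)
have "(if al = be then E al $$ (i, j) else 0) - (E al * E be) $$ (i, j) = 0"
proof -
 have "ALL be:W. (if al = be then E al $$ (i, j) else 0) - (E al * E be) $$ (i, j) = 0"
 proof (rule lmon_independent[OF X(1,2)])
  fix c' assume c': "c':nz"
  have "ALL al:W. E al $$ (i, j) * lmon r al c' - (SUM be:W. (E al * E be) $$ (i, j) * lmon r be c') = 0"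
  proof (rule lmon_independent[OF X(1,2)])
  fix c assume c: "c:nz"
  have "(SUM al:W. E al $$ (i, j) * lmon r al c' * lmon r al c) = e (%k. c k * c' k) $$ (i, j)"
   unfolding X(4)[OF nz_mult[OF c c'] ij] lmon_times by (simp add: mult_ac)
  also have "... = (SUM l = 0..<m. e c $$ (i, l) * e c' $$ (l, j))"
   unfolding lhomD(3)[OF e c c'] using lhomD(2)[OF e c] lhomD(2)[OF e c'] ij by (rule sq_entry)
  also have "... = (SUM l = 0..<m. SUM al:W. SUM be:W. E al $$ (i, l) * lmon r al c * (E be $$ (l, j) * lmon r be c'))"
   using ij X(4)[OF c] X(4)[OF c'] by (simp add: sum_product)
  also have "... = (SUM al:W. SUM be:W. SUM l = 0..<m. E al $$ (i, l) * lmon r al c * (E be $$ (l, j) * lmon r be c'))"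
   by (subst sum.swap) (rule sum.cong[OF refl], rule sum.swap)
  also have "... = (SUM al:W. (SUM be:W. (E al * E be) $$ (i, j) * lmon r be c') * lmon r al c)"
   using ij by (simp add: sq_entry[OF X(3) X(3)] sum_distrib_right sum_distrib_left mult_ac)
  finally show "(SUM al:W. (E al $$ (i, j) * lmon r al c' - (SUM be:W. (E al * E be) $$ (i, j) * lmon r be c')) * lmon r al c) = 0"
   by (simp add: left_diff_distrib sum_subtractf)
  qed
  hence eq: "E al $$ (i, j) * lmon r al c' - (SUM be:W. (E al * E be) $$ (i, j) * lmon r be c') = 0" using ab(1) by (rule bspec)
  have "(SUM be:W. (if al = be then E al $$ (i, j) else 0) * lmon r be c')
   = (SUM be:W. if be = al then E al $$ (i, j) * lmon r al c' else 0)" by (rule sum.cong) auto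
  hence "(SUM be:W. (if al = be then E al $$ (i, j) else 0) * lmon r be c') = E al $$ (i, j) * lmon r al c'"
  using ab(1) X(1) by simp
  thus "(SUM be:W. ((if al = be then E al $$ (i, j) else 0) - (E al * E be) $$ (i, j)) * lmon r be c') = 0"
  using eq by (simp add: left_diff_distrib sum_subtractf)
 qed
 thus ?thesis using ab(2) by (rule bspec)
qed
thus "(E al * E be) $$ (i, j) = (if al = be then E al else 0\<^sub>m m m) $$ (i, j)" using ij by (auto split: if_splits)
qed (use expD(3)[OF x, of al] expD(3)[OF x, of be] in auto)

lemma expansion_exists:
assumes e: "lhom r m e"
shows "EX W E. expansion r m e W E & (ALL al:W. E al ~= 0\<^sub>m m m)"
proof -
have "ALL ij:{..<m} \<times> {..<m}. EX Sk. finite (fst Sk) & fst Sk <= exps r & (ALL c:nz. e c $$ ij = (SUM al:fst Sk. snd Sk al * lmon r al c))"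
 using lhomD(4)[OF e] unfolding laurent_def by auto
from bchoice[OF this] obtain Sk where Sk: "ALL ij:{..<m} \<times> {..<m}. finite (fst (Sk ij)) & fst (Sk ij) <= exps r & (ALL c:nz. e c $$ ij = (SUM al:fst (Sk ij). snd (Sk ij) al * lmon r al c))" ..
define S where "S ij = fst (Sk ij)" for ij
define k where "k ij = snd (Sk ij)" for ij
have S: "finite (S ij)" "S ij <= exps r" if "ij:{..<m} \<times> {..<m}" for ij using bspec[OF Sk that] by (simp_all add: S_def)
have k: "e c $$ ij = (SUM al:S ij. k ij al * lmon r al c)" if "ij:{..<m} \<times> {..<m}" "c:nz" for ij c
 using bspec[OF Sk that(1)] that(2) by (simp add: S_def k_def)
define U where "U = (UN ij:{..<m} \<times> {..<m}. S ij)"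
have U: "finite U" "U <= exps r" unfolding U_def
 by (rule finite_UN_I, simp, rule S(1), assumption) (rule UN_least, rule S(2), assumption)
define E where "E al = mat m m (%ij. if al:S ij then k ij al else 0)" for al
define W where "W = {al:U. E al ~= 0\<^sub>m m m}"
have "expansion r m e W E" unfolding expansion_def
proof (intro conjI allI ballI impI)
 show "finite W" "W <= exps r" using U by (auto simp: W_def)
 show "E al:sqm m" for al by (simp add: E_def)
 fix c i j assume c: "c:nz" and ij: "i < m" "j < m"
 hence ij': "(i, j):{..<m} \<times> {..<m}" by simp
 have "e c $$ (i, j) = (SUM al:S (i, j). E al $$ (i, j) * lmon r al c)" unfolding k[OF ij' c] using ij by (simp add: E_def)
 also have "... = (SUM al:U. E al $$ (i, j) * lmon r al c)"
 proof (rule sum.mono_neutral_left[OF U(1)])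
  show "S (i, j) <= U" unfolding U_def using ij' by (rule UN_upper)
 qed (use ij in \<open>simp add: E_def\<close>)
 also have "... = (SUM al:W. E al $$ (i, j) * lmon r al c)" using ij U(1) by (intro sum.mono_neutral_right) (auto simp: W_def)
 finally show "e c $$ (i, j) = (SUM al:W. E al $$ (i, j) * lmon r al c)" .
qed
thus ?thesis by (intro exI[of _ W] exI[of _ E]) (simp add: W_def)
qed

lemma algebraic_homI:
assumes "!!a. a:G ==> f a:K" "!!a b. a:G ==> b:G ==> f (a * b) = f a * f b"
 "!!i j. i < m ==> j < m ==> regular_on n G (%g. f g $$ (i, j))"
shows "f:algebraic_hom n G m K" using assms by (simp add: algebraic_hom_def hom_def Pi_iff)

text \<open>Negative powers of \<open>p j\<close> are replaced by powers of \<open>q j\<close>. The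
  result is regular everywhere, also where some \<open>p j\<close> vanishes, and has the right value
  wherever \<open>p j * q j = 1\<close>.\<close>

lemma laurent_regular_extension:
assumes F: "laurent d F" and pq: "!!j. j < d ==> regular_on n S (p j)" "!!j. j < d ==> regular_on n S (q j)"
obtains f where "regular_on n S f"
 "!!A. (!!j. j < d ==> p j A * q j A = 1) ==> f A = F (%j. if j < d then p j A else 1)"
proof -
obtain W k where W: "finite W" "W <= exps d" "!!c. c:nz ==> F c = (SUM al:W. k al * lmon d al c)"
 by (rule laurentE[OF F]) (rule that)
define pw where "pw j a A = (if 0 <= a then p j A ^ nat a else q j A ^ nat (- a))" for j a A
define f where "f A = (SUM al:W. k al * (PROD j<d. pw j (al j) A))" for A
show thesis
proof (rule that)
 have pw: "regular_on n S (pw j a)" if "j < d" for j a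
  unfolding pw_def using regular_on_power[OF pq(1)[OF that]] regular_on_power[OF pq(2)[OF that]] by (cases "0 <= a") simp_all
 show "regular_on n S f"
  unfolding f_def by (rule regular_on_sum, rule reg_mult, rule reg_const, rule regular_on_prod) (simp add: pw)
 fix A assume A: "!!j. j < d ==> p j A * q j A = 1"
 have q: "q j A = inverse (p j A)" "p j A ~= 0" if "j < d" for j using A[OF that] inverse_unique[of "p j A" "q j A"] by auto
 have "pw j a A = p j A powi a" if "j < d" for j a using q[OF that] by (simp add: pw_def power_int_def power_inverse)
 moreover have "(%j. if j < d then p j A else 1):nz" using q(2) by (simp add: nz_def)
 ultimately show "f A = F (%j. if j < d then p j A else 1)" by (simp add: W(3) f_def lmon_def)
qed
qed

section \<open>Diagonal matrices and parametrised tori\<close>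

definition dg :: "nat => (nat => complex) => complex mat" where
"dg d u = mat d d (%(i, j). if i = j then u i else 0)"

lemma dg_carrier [simp]: "dg d u:sqm d" by (simp add: dg_def)

lemma dg_entry [simp]: "i < d ==> j < d ==> dg d u $$ (i, j) = (if i = j then u i else 0)" by (simp add: dg_def)

lemma dg_mult: "dg d u * dg d v = dg d (%i. u i * v i)"
proof (rule eq_matI)
fix i j assume "i < dim_row (dg d (%i. u i * v i))" "j < dim_col (dg d (%i. u i * v i))"
hence ij: "i < d" "j < d" by (simp_all add: dg_def)
have "(dg d u * dg d v) $$ (i, j) = (SUM l = 0..<d. dg d u $$ (i, l) * dg d v $$ (l, j))" by (rule sq_entry) (simp_all add: ij)
also have "... = (SUM l = 0..<d. if l = i then u i * dg d v $$ (i, j) else 0)" using ij by (intro sum.cong) auto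
finally show "(dg d u * dg d v) $$ (i, j) = dg d (%i. u i * v i) $$ (i, j)" using ij by simp
qed (simp_all add: dg_def)

lemma dg_one: "dg d (%_. 1) = 1\<^sub>m d" by (rule eq_matI) (simp_all add: dg_def)

lemma dg_GL: "u:nz ==> dg d u:GLs d"
proof -
assume u: "u:nz"
have "dg d u * dg d (%i. inverse (u i)) = 1\<^sub>m d" unfolding dg_mult using u by (simp add: nz_nonzero dg_one)
hence "det (dg d u) * det (dg d (%i. inverse (u i))) = 1" using det_mult[OF dg_carrier dg_carrier] det_one by metis
thus ?thesis by (auto simp: GL_carrier)
qed

lemma lhom_dg: "lhom d d (dg d)" unfolding lhom_def
proof (intro conjI ballI allI impI)
fix i j assume ij: "i < d" "j < d"
show "laurent d (%c. dg d c $$ (i, j))" using ij laurent_coord[OF ij(1)] laurent_const[of d 0] by (cases "i = j") simp_all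
qed (simp_all add: dg_GL dg_mult)

lemma std_torus_dg: "std_torus d = dg d ` nz"
proof (intro equalityI subsetI)
fix A assume A: "A:std_torus d"
hence c: "A:sqm d" and dt: "det A ~= 0" and dm: "diagonal_mat A" by (simp_all add: std_torus_def GL_carrier)
have "A $$ (i, i) ~= 0" if "i < d" for i
proof -
 have "upper_triangular A" using dm c by (auto simp: diagonal_mat_def upper_triangular_def)
 hence "det A = prod_list (diag_mat A)" using det_upper_triangular[OF _ c] by blast
 hence "0 \<notin> set (diag_mat A)" using dt by (simp add: prod_list_zero_iff)
 thus ?thesis using that c by (auto simp: diag_mat_def)
qed
hence "(%i. if i < d then A $$ (i, i) else 1):nz" by (simp add: nz_def)
moreover have "A = dg d (%i. if i < d then A $$ (i, i) else 1)" using c dm by (intro eq_matI) (auto simp: dg_def diagonal_mat_def)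
ultimately show "A:dg d ` nz" by blast
next
fix A assume "A:dg d ` nz"
then obtain u where "u:nz" "A = dg d u" by blast
thus "A:std_torus d" using dg_GL by (auto simp: std_torus_def diagonal_mat_def dg_def)
qed

text \<open>The isomorphism with a split torus, spelled out in sequence coordinates: the functions
  \<open>ka j\<close> form its regular inverse. It is equivalent to \<open>torus_of_rank\<close> by
  the conversions below; that \<open>T\<close> is Zariski closed is a consequence.\<close>

definition tparam :: "nat => nat => complex mat set => ((nat => complex) => complex mat) => bool" where
"tparam d m T e \<longleftrightarrow> lhom d m e & e ` nz = T & (EX ka. ALL j<d. regular_on m T (ka j) & (ALL u:nz. ka j (e u) = u j))"

lemma tparamE:
assumes "tparam d m T e"
obtains ka where "!!j. j < d ==> regular_on m T (ka j)" "!!j u. j < d ==> u:nz ==> ka j (e u) = u j"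
proof -
obtain ka where "ALL j<d. regular_on m T (ka j) & (ALL u:nz. ka j (e u) = u j)" using assms unfolding tparam_def by (elim conjE exE)
thus thesis by (intro that[of ka]) simp_all
qed

lemma tparamD:
assumes "tparam d m T e"
shows "lhom d m e" "e ` nz = T" "!!u. u:nz ==> e u:T" "subgroup T (GL m)"
using assms lhom_subgroup[of d m e] unfolding tparam_def by auto

lemma tparam_inj:
assumes "tparam d m T e" "u:nz" "v:nz" "e u = e v" "j < d"
shows "u j = v j"
proof -
obtain ka where "!!j. j < d ==> regular_on m T (ka j)" "!!j u. j < d ==> u:nz ==> ka j (e u) = u j"
 by (rule tparamE[OF assms(1)]) (rule that)
thus ?thesis using assms(2-5) by metis
qed

lemma torus_of_rank_tparam:
assumes "torus_of_rank m d T"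
shows "EX e. tparam d m T e"
proof -
obtain f f' where f: "f:algebraic_hom d (std_torus d) m T" and f': "f':algebraic_hom m T d (std_torus d)"
 and inv: "ALL a:std_torus d. f' (f a) = a" "ALL s:T. f (f' s) = s" and T: "algebraic_group m T"
 using assms unfolding torus_of_rank_def by blast
have TG: "T <= GLs m" using T sub_GL(1) by (simp add: algebraic_group_def)
note F = alg_homD[OF f, unfolded std_torus_dg] and F' = alg_homD[OF f']
have A: "lhom d m (%u. f (dg d u))" unfolding lhom_def
proof (intro conjI ballI allI impI)
 show "f (dg d c):GLs m" if "c:nz" for c using F(1) TG that by blast
 show "f (dg d (%i. c i * c' i)) = f (dg d c) * f (dg d c')" if "c:nz" "c':nz" for c c'
  using F(2)[of "dg d c" "dg d c'"] that by (simp add: dg_mult)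
 show "laurent d (%c. f (dg d c) $$ (i, j))" if "i < m" "j < m" for i j using laurent_regular[OF lhom_dg F(3)[OF that]] .
qed
have B: "(%u. f (dg d u)) ` nz = T"
proof (intro equalityI subsetI)
 fix A assume A: "A:T"
 then obtain u where "u:nz" "f' A = dg d u" using F'(1) std_torus_dg by blast
 thus "A:(%u. f (dg d u)) ` nz" using inv(2) A by (intro image_eqI[of _ _ u]) auto
qed (use F(1) in blast)
show ?thesis unfolding tparam_def
proof (intro exI[of _ "%u. f (dg d u)"] conjI A B exI[of _ "%j A. f' A $$ (j, j)"] allI impI)
 fix j assume j: "j < d"
 show "regular_on m T (%A. f' A $$ (j, j))" using F'(3)[OF j j] .
 show "ALL u:nz. f' (f (dg d u)) $$ (j, j) = u j" using inv(1) j by (simp add: std_torus_dg)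
qed
qed

lemma tparam_inverse_coord:
assumes T: "tparam d m T e" and ka: "j < d" "regular_on m T ka" "!!u. u:nz ==> ka (e u) = u j"
shows "regular_on m T (%A. 1 / ka A)"
proof -
note TT = tparamD[OF T]
have "regular_on m T (%A. ka (ginv m A))" using sub_GL(1,4)[OF TT(4)] by (intro regular_on_inv[OF _ ka(2)]) auto
thus ?thesis
proof (rule reg_cong)
 fix A assume "A:T"
 then obtain u where u: "u:nz" "A = e u" using TT(2) by blast
 show "ka (ginv m A) = 1 / ka A" unfolding u(2) lhom_inverse[OF TT(1) u(1)] ka(3)[OF u(1)] ka(3)[OF nz_inverse[OF u(1)]]
  by (simp add: inverse_eq_divide)
qed
qed

text \<open>The point is that the image is closed. The relations \<open>p j * q j = 1\<close>
  between the coordinates and their reciprocals persist on the closure, so the coordinates of a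
  point of the closure do not vanish; and the identity between a point and \<open>e\<close> of its
  coordinates persists too.\<close>

lemma tparam_torus_of_rank:
assumes T: "tparam d m T e"
shows "torus_of_rank m d T"
proof -
note TT = tparamD[OF T]
note TG = sub_GL(1)[OF TT(4)]
obtain ka where ka: "!!j. j < d ==> regular_on m T (ka j)" "!!j u. j < d ==> u:nz ==> ka j (e u) = u j"
 by (rule tparamE[OF T]) (rule that)
have ka': "regular_on m T (%A. 1 / ka j A)" if "j < d" for j using that ka by (intro tparam_inverse_coord[OF T that])
have "ALL j:{..<d}. EX p. p:regular_fun m & (ALL A:T. ka j A = p A)" using ka(1) unfolding regular_on_def by blast
from bchoice[OF this] obtain p where p: "ALL j:{..<d}. p j:regular_fun m & (ALL A:T. ka j A = p j A)" ..
have "ALL j:{..<d}. EX q. q:regular_fun m & (ALL A:T. 1 / ka j A = q A)" using ka' unfolding regular_on_def by blast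
from bchoice[OF this] obtain q where q: "ALL j:{..<d}. q j:regular_fun m & (ALL A:T. 1 / ka j A = q j A)" ..
have ka0: "ka j A ~= 0" if "j < d" "A:T" for j A
proof -
 obtain u where "u:nz" "A = e u" using TT(2) \<open>A:T\<close> by blast
 thus ?thesis using ka(2)[OF \<open>j < d\<close>] nz_nonzero by simp
qed
have "zclosure m T <= T"
proof
 fix A assume A: "A:zclosure m T"
 hence AG: "A:sqm m" unfolding zclosure_def using GL_mat by blast
 have pq: "p j A * q j A = 1" if j: "j < d" for j
 proof -
  have "p j A * q j A - 1 = 0"
  proof (rule zclosure_regular[OF _ TG _ A])
  show "regular_on m (GLs m) (%A. p j A * q j A - 1)"
   using p q j by (intro regular_on_minus reg_mult reg_const) (simp_all add: regular_on_fun)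
  show "p j B * q j B - 1 = 0" if "B:T" for B
  proof -
   have "p j B = ka j B" "q j B = 1 / ka j B" using p q j that by simp_all
   thus ?thesis using ka0[OF j that] by simp
  qed
  qed
  thus ?thesis by simp
 qed
 define u where "u j = (if j < d then p j A else 1)" for j
 have "p j A ~= 0" if "j < d" for j using pq[OF that] by auto
 hence u: "u:nz" by (simp add: nz_def u_def)
 have "A = e u"
 proof (rule eq_matI)
  fix a b assume "a < dim_row (e u)" "b < dim_col (e u)"
  hence ab: "a < m" "b < m" using lhomD(2)[OF TT(1) u] by auto
  obtain f where f: "regular_on m (GLs m) f"
  "!!A. (!!j. j < d ==> p j A * q j A = 1) ==> f A = e (%j. if j < d then p j A else 1) $$ (a, b)"
  by (rule laurent_regular_extension[OF lhomD(4)[OF TT(1) ab], of m "GLs m" p q])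
   (use p q in \<open>auto intro: regular_on_fun\<close>)
  have "f A - A $$ (a, b) = 0"
  proof (rule zclosure_regular[OF _ TG _ A])
  show "regular_on m (GLs m) (%A. f A - A $$ (a, b))" using f(1) ab by (intro regular_on_minus reg_entry)
  show "f B - B $$ (a, b) = 0" if B: "B:T" for B
  proof -
   obtain v where v: "v:nz" "B = e v" using TT(2) B by blast
   have pv: "p j B = v j" if "j < d" for j using p that B ka(2)[OF that v(1)] v(2) by simp
   have "p j B * q j B = 1" if "j < d" for j
   proof -
    have "1 / ka j B = q j B" using bspec[OF q, of j] that B by blast
    hence "q j B = 1 / v j" using ka(2)[OF that v(1)] v(2) by simp
    thus ?thesis using pv[OF that] nz_nonzero[OF v(1)] by simp
   qed
   hence "f B = e (%j. if j < d then p j B else 1) $$ (a, b)" by (rule f(2))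
   moreover have "e (%j. if j < d then p j B else 1) = e v" using v(1) pv by (intro lhom_dep[OF TT(1)]) (auto simp: nz_def)
   ultimately show ?thesis using v(2) by simp
  qed
  qed
  moreover have "f A = e u $$ (a, b)" unfolding u_def[abs_def] using pq by (rule f(2))
  ultimately show "A $$ (a, b) = e u $$ (a, b)" by simp
 qed (use AG lhomD(2)[OF TT(1) u] in auto)
 thus "A:T" using TT(3)[OF u] by simp
qed
hence "zclosure m T = T" using zclosure_superset[OF TG] by blast
hence closed: "zariski_closed m T" using zariski_closed_zclosure[of m T] by simp
define f where "f A = e (%j. if j < d then A $$ (j, j) else 1)" for A
define f' where "f' A = dg d (%j. if j < d then ka j A else 1)" for A
have fdg: "f (dg d u) = e u" if "u:nz" for u unfolding f_def using that by (intro lhom_dep[OF TT(1)]) (auto simp: nz_def)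
have f'e: "f' (e u) = dg d u" if "u:nz" for u unfolding f'_def by (rule eq_matI) (auto simp: dg_def ka(2) that)
have stp: "tparam d d (std_torus d) (dg d)" unfolding tparam_def
 by (intro conjI lhom_dg std_torus_dg[symmetric] exI[of _ "%j A. A $$ (j, j)"] allI impI ballI reg_entry) simp_all
have "f:algebraic_hom d (std_torus d) m T"
proof (rule algebraic_homI)
 show "f a:T" if "a:std_torus d" for a using that fdg TT(3) unfolding std_torus_dg by auto
 show "f (a * b) = f a * f b" if ab: "a:std_torus d" "b:std_torus d" for a b
 proof -
  obtain u where u: "u:nz" "a = dg d u" using ab(1) std_torus_dg by blast
  obtain v where v: "v:nz" "b = dg d v" using ab(2) std_torus_dg by blast
  show ?thesis using lhomD(3)[OF TT(1) u(1) v(1)] u v by (simp add: dg_mult fdg)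
 qed
 show "regular_on d (std_torus d) (%g. f g $$ (i, j))" if "i < m" "j < m" for i j unfolding f_def
 proof (rule regular_on_laurent[OF lhomD(4)[OF TT(1) that]])
  fix j assume j: "j < d"
  show "regular_on d (std_torus d) (%A. A $$ (j, j))" using j by (rule reg_entry[OF _ j])
  thus "regular_on d (std_torus d) (%A. 1 / A $$ (j, j))" by (rule tparam_inverse_coord[OF stp j]) (simp add: j)
  show "A $$ (j, j) ~= 0" if "A:std_torus d" for A using that j unfolding std_torus_dg by (auto simp: nz_def)
 qed
qed
moreover have "f':algebraic_hom m T d (std_torus d)"
proof (rule algebraic_homI)
 show "f' a:std_torus d" if a: "a:T" for a
 proof -
  obtain u where u: "u:nz" "a = e u" using a TT(2) by blast
  thus ?thesis unfolding std_torus_dg by (intro image_eqI[OF _ u(1)]) (simp add: f'e)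
 qed
 show "f' (a * b) = f' a * f' b" if ab: "a:T" "b:T" for a b
 proof -
  obtain u where u: "u:nz" "a = e u" using ab(1) TT(2) by blast
  obtain v where v: "v:nz" "b = e v" using ab(2) TT(2) by blast
  note uv = u(1) v(1) u(2) v(2)
  hence "a * b = e (%i. u i * v i)" using lhomD(3)[OF TT(1), of u v] by simp
  thus ?thesis using uv f'e by (simp add: dg_mult)
 qed
 show "regular_on m T (%g. f' g $$ (i, j))" if "i < d" "j < d" for i j
  using ka(1)[OF that(1)] that reg_const[of m T 0] by (cases "i = j") (simp_all add: f'_def)
qed
moreover have "ALL a:std_torus d. f' (f a) = a" unfolding std_torus_dg using fdg f'e by auto
moreover have "ALL s:T. f (f' s) = s" unfolding TT(2)[symmetric] using fdg f'e by auto
ultimately show ?thesis unfolding torus_of_rank_def algebraic_group_def using TT(4) closed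
 by (intro conjI bexI[of _ f] bexI[of _ f'])
qed

lemma torus_tparam: "torus m T \<longleftrightarrow> (EX d e. tparam d m T e)"
unfolding torus_def using tparam_torus_of_rank torus_of_rank_tparam by metis

text \<open>The 2-torsion of a torus determines its rank, which makes \<open>torus_rank\<close> well
  defined.\<close>

lemma tparam_involutions:
assumes T: "tparam d m T e"
shows "card {A:T. A * A = 1\<^sub>m m} = 2 ^ d"
proof -
note TT = tparamD[OF T]
obtain ka where ka: "!!j. j < d ==> regular_on m T (ka j)" "!!j u. j < d ==> u:nz ==> ka j (e u) = u j"
 by (rule tparamE[OF T]) (rule that)
let ?ext = "%s j. if j < d then s j else 1 :: complex"
let ?P = "PiE {..<d} (%_. {1, - 1 :: complex})"
have ext: "?ext s:nz" if "s:?P" for s using that by (auto simp: nz_def PiE_def Pi_def)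
have "bij_betw (%s. e (?ext s)) ?P {A:T. A * A = 1\<^sub>m m}"
proof (rule bij_betw_byWitness[where f' = "%A. restrict (%j. ka j A) {..<d}"])
 show "ALL s:?P. restrict (%j. ka j (e (?ext s))) {..<d} = s"
 proof
  fix s assume s: "s:?P"
  show "restrict (%j. ka j (e (?ext s))) {..<d} = s"
  using s by (intro PiE_ext[of _ "{..<d}" "%_. UNIV"]) (auto simp: ka(2)[OF _ ext[OF s]])
 qed
 have sq: "(u j) * (u j) = 1" if "u:nz" "e u * e u = 1\<^sub>m m" "j < d" for u j
 proof -
  have "e (%i. u i * u i) = e (%_. 1)" using lhomD(3)[OF TT(1) that(1,1)] lhom_one[OF TT(1)] that(2) by simp
  thus ?thesis using tparam_inj[OF T nz_mult[OF that(1,1)] nz_one _ that(3)] by simp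
 qed
 show "ALL A:{A:T. A * A = 1\<^sub>m m}. e (?ext (restrict (%j. ka j A) {..<d})) = A"
 proof
  fix A assume "A:{A:T. A * A = 1\<^sub>m m}"
  then obtain u where u: "u:nz" "A = e u" using TT(2) by blast
  show "e (?ext (restrict (%j. ka j A) {..<d})) = A"
  unfolding u(2) using u(1) by (intro lhom_dep[OF TT(1)]) (auto simp: nz_def ka(2))
 qed
 show "(%s. e (?ext s)) ` ?P <= {A:T. A * A = 1\<^sub>m m}"
 proof (rule image_subsetI)
  fix s assume s: "s:?P"
  have "e (?ext s) * e (?ext s) = e (%j. ?ext s j * ?ext s j)" using lhomD(3)[OF TT(1) ext[OF s] ext[OF s]] by simp
  also have "(%j. ?ext s j * ?ext s j) = (%_. 1)" using s by (auto simp: PiE_def Pi_def fun_eq_iff)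
  finally show "e (?ext s):{A:T. A * A = 1\<^sub>m m}" using TT(3)[OF ext[OF s]] lhom_one[OF TT(1)] by simp
 qed
 show "(%A. restrict (%j. ka j A) {..<d}) ` {A:T. A * A = 1\<^sub>m m} <= ?P"
 proof (rule image_subsetI)
  fix A assume "A:{A:T. A * A = 1\<^sub>m m}"
  then obtain u where u: "u:nz" "A = e u" "e u * e u = 1\<^sub>m m" using TT(2) by blast
  show "restrict (%j. ka j A) {..<d}:?P" using sq[OF u(1,3)] ka(2)[OF _ u(1)] by (simp add: u(2) PiE_def Pi_def square_eq_1_iff)
 qed
qed
hence "card ?P = card {A:T. A * A = 1\<^sub>m m}" by (rule bij_betw_same_card)
thus ?thesis by (simp add: card_PiE numeral_2_eq_2)
qed

lemma torus_rank_tparam: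
assumes T: "tparam d m T e"
shows "torus_rank m T = d" unfolding torus_rank_def
proof (rule the_equality)
show "torus_of_rank m d T" using T by (rule tparam_torus_of_rank)
show "r = d" if "torus_of_rank m r T" for r
proof -
 obtain e' where e': "tparam r m T e'" using torus_of_rank_tparam[OF \<open>torus_of_rank m r T\<close>] ..
 have "(2 :: nat) ^ r = 2 ^ d" using tparam_involutions[OF T] tparam_involutions[OF e'] by simp
 thus ?thesis by simp
qed
qed

lemma expansion_times:
assumes e: "lhom r m e" and x: "expansion r m e W E" and al: "al:W" and c: "c:nz"
shows "E al * e c = lmon r al c \<cdot>\<^sub>m E al"
proof (rule eq_matI)
note X = expD[OF x]
fix i j assume "i < dim_row (lmon r al c \<cdot>\<^sub>m E al)" "j < dim_col (lmon r al c \<cdot>\<^sub>m E al)"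
hence ij: "i < m" "j < m" using X(3)[of al] by auto
have "(E al * e c) $$ (i, j) = (SUM l = 0..<m. E al $$ (i, l) * e c $$ (l, j))" using X(3) lhomD(2)[OF e c] ij by (rule sq_entry)
also have "... = (SUM l = 0..<m. SUM be:W. E al $$ (i, l) * E be $$ (l, j) * lmon r be c)"
 using ij by (simp add: X(4)[OF c] sum_distrib_left mult.assoc)
also have "... = (SUM be:W. SUM l = 0..<m. E al $$ (i, l) * E be $$ (l, j) * lmon r be c)" by (rule sum.swap)
also have "... = (SUM be:W. (E al * E be) $$ (i, j) * lmon r be c)"
 using ij by (simp add: sq_entry[OF X(3) X(3)] sum_distrib_right)
also have "... = (SUM be:W. if be = al then E al $$ (i, j) * lmon r al c else 0)"
 using ij al by (intro sum.cong) (auto simp: expansion_orthogonal[OF e x])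
also have "... = E al $$ (i, j) * lmon r al c" using al X(1) by simp
finally show "(E al * e c) $$ (i, j) = (lmon r al c \<cdot>\<^sub>m E al) $$ (i, j)" using ij X(3)[of al] by simp
qed (use expD(3)[OF x, of al] lhomD(2)[OF e c] in auto)

text \<open>The image of a torus is a torus. The weights of \<open>e\<close> generate a lattice with
  basis \<open>b\<close>, and \<open>e\<close> factors through the coordinates
  \<open>ph c j = lmon r (b j) c\<close>, which take all values by \<open>lmon_surjective\<close>.
  Conversely each \<open>b j\<close> is an integral combination of weights, hence a regular function
  of the matrix \<open>e c\<close>.\<close>

lemma lhom_image_tparam:
assumes e: "lhom r m e"
shows "EX d e'. tparam d m (e ` nz) e'"
proof -
obtain W E where x: "expansion r m e W E" and E0: "ALL al:W. E al ~= 0\<^sub>m m m"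
 using expansion_exists[OF e] by (elim exE conjE) (rule that)
note X = expD[OF x]
obtain d b where g: "generates r W d b" and ind: "ALL l. (ALL k<r. (SUM j<d. l j * b j k) = 0) --> (ALL j<d. l j = (0 :: int))"
 using lattice_basis[OF X(1), of r] by (elim exE conjE) (rule that)
have "ALL al:W. EX M. ALL k<r. al k = (SUM j<d. M j * b j k)" using g by (simp add: generates_def)
from bchoice[OF this] obtain M where M: "ALL al:W. ALL k<r. al k = (SUM j<d. M al j * b j k)" ..
have "ALL j:{..<d}. EX N. ALL k<r. b j k = (SUM al:W. N al * al k)" using g by (simp add: generates_def)
from bchoice[OF this] obtain N where N: "ALL j:{..<d}. ALL k<r. b j k = (SUM al:W. N j al * al k)" ..
define ph where "ph c j = lmon r (b j) c" for c j
have ph: "ph c:nz" if "c:nz" for c unfolding nz_def ph_def using lmon_nonzero[OF that] by simp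
have Mph: "lmon r al c = lmon d (M al) (ph c)" if "al:W" "c:nz" for al c
proof -
 have "lmon r al c = lmon r (%k. SUM j<d. b j k * M al j) c" using M that(1) by (intro lmon_cong_exp) (simp add: mult.commute)
 also have "... = (PROD j<d. lmon r (%k. b j k * M al j) c)" using that(2) by (rule lmon_sum)
 finally show ?thesis by (simp add: lmon_def[of d] ph_def lmon_powi)
qed
define e' where "e' u = mat m m (%ij. SUM al:W. E al $$ ij * lmon d (M al) u)" for u
have e'ph: "e c = e' (ph c)" if "c:nz" for c
 using lhomD(2)[OF e that] by (intro eq_matI) (auto simp: e'_def X(4)[OF that] Mph that)
have surj: "EX c:nz. (ALL j<d. ph c j = u j) & e' u = e c" if u: "u:nz" for u
proof -
 have "EX c:nz. ALL j<d. lmon r (b j) c = u j"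
 proof (rule lmon_surjective[OF _ u])
  show "ALL j<d. l j = 0" if "!!k. k < r ==> (SUM j<d. l j * b j k) = 0" for l :: "nat => int"
  by (rule ind[THEN spec, THEN mp]) (intro allI impI that)
 qed
 then obtain c where c: "c:nz" "ALL j<d. lmon r (b j) c = u j" ..
 have "e' u = e' (ph c)" unfolding e'_def using c(2) lmon_cong[of d u "ph c"] by (simp add: ph_def)
 thus ?thesis using c e'ph[OF c(1)] by (intro bexI[OF _ c(1)]) (simp add: ph_def)
qed
have "lhom d m e'" unfolding lhom_def
proof (intro conjI ballI allI impI)
 show "e' u:GLs m" if u: "u:nz" for u
 proof -
  obtain c where "c:nz" "e' u = e c" using surj[OF u] by (elim bexE conjE) (rule that)
  thus ?thesis using lhomD(1)[OF e] by simp
 qed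
 fix u v assume u: "u:nz" and v: "v:nz"
 obtain c where c: "c:nz" "ALL j<d. ph c j = u j" "e' u = e c" using surj[OF u] by (elim bexE conjE) (rule that)
 obtain c' where c': "c':nz" "ALL j<d. ph c' j = v j" "e' v = e c'" using surj[OF v] by (elim bexE conjE) (rule that)
 have "e' (%i. u i * v i) = e' (ph (%i. c i * c' i))"
  unfolding e'_def using c(2) c'(2) lmon_cong[of d "%i. u i * v i" "ph (%i. c i * c' i)"] by (simp add: ph_def lmon_times)
 also have "... = e' u * e' v" unfolding e'ph[OF nz_mult[OF c(1) c'(1)], symmetric] c(3) c'(3) using lhomD(3)[OF e c(1) c'(1)] .
 finally show "e' (%i. u i * v i) = e' u * e' v" .
next
 fix i j assume ij: "i < m" "j < m"
 have "laurent d (%u. SUM al:W. E al $$ (i, j) * lmon d (M al) u)" by (rule laurent_sum, rule laurent_lmon)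
 thus "laurent d (%u. e' u $$ (i, j))" using ij by (simp add: e'_def)
qed
moreover have im: "e' ` nz = e ` nz"
proof (intro equalityI subsetI)
 fix A assume "A:e ` nz"
 then obtain c where "c:nz" "A = e c" by blast
 thus "A:e' ` nz" using e'ph ph by (intro image_eqI[of _ _ "ph c"]) simp_all
next
 fix A assume "A:e' ` nz"
 then obtain u where u: "u:nz" "A = e' u" by blast
 obtain c where "c:nz" "e' u = e c" using surj[OF u(1)] by (elim bexE conjE) (rule that)
 thus "A:e ` nz" using u(2) by simp
qed
moreover have "EX ka. ALL j<d. regular_on m (e ` nz) (ka j) & (ALL u:nz. ka j (e' u) = u j)"
proof -
 have "ALL al:W. EX ab. fst ab < m & snd ab < m & E al $$ ab ~= 0"
 proof
  fix al assume "al:W"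
  hence "E al ~= 0\<^sub>m m m" using E0 by blast
  have "EX a<m. EX b<m. E al $$ (a, b) ~= 0"
  proof (rule ccontr)
  assume no: "~ (EX a<m. EX b<m. E al $$ (a, b) ~= 0)"
  have "E al = 0\<^sub>m m m"
  proof (rule eq_matI)
   fix i j assume "i < dim_row (0\<^sub>m m m :: complex mat)" "j < dim_col (0\<^sub>m m m :: complex mat)"
   thus "E al $$ (i, j) = 0\<^sub>m m m $$ (i, j)" using no by simp
  qed (use X(3)[of al] in auto)
  thus False using \<open>E al ~= 0\<^sub>m m m\<close> by simp
  qed
  thus "EX ab. fst ab < m & snd ab < m & E al $$ ab ~= 0" by auto
 qed
 from bchoice[OF this] obtain ab where ab: "ALL al:W. fst (ab al) < m & snd (ab al) < m & E al $$ ab al ~= 0" ..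
 \<comment> \<open>Since \<open>E al * e c\<close> is \<open>lmon r al c\<close> times
   \<open>E al\<close>, the value of the weight can be read off at a nonzero entry of
   \<open>E al\<close>.\<close>
 define \<epsilon> where "\<epsilon> al A = (E al * A) $$ ab al * (1 / E al $$ ab al)" for al A
 have \<epsilon>: "\<epsilon> al (e c) = lmon r al c" if "al:W" "c:nz" for al c
 proof -
  obtain a b where abp: "ab al = (a, b)" by (rule prod.exhaust)
  have abm: "a < m" "b < m" "E al $$ (a, b) ~= 0" using bspec[OF ab that(1)] abp by simp_all
  have dims: "dim_row (E al) = m" "dim_col (E al) = m" using X(3)[of al] by simp_all
  show ?thesis unfolding \<epsilon>_def abp expansion_times[OF e x that] using abm dims by simp
 qed
 have sub: "e ` nz <= GLs m" using lhomD(1)[OF e] by blast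
 have reg: "regular_on m (e ` nz) (\<epsilon> al)" if "al:W" for al
 proof -
  obtain a b where abp: "ab al = (a, b)" by (rule prod.exhaust)
  have abm: "a < m" "b < m" using bspec[OF ab that] abp by simp_all
  have "A:sqm m" if "A:e ` nz" for A by (rule GL_mat, rule subsetD[OF sub that])
  hence "regular_on m (e ` nz) (%A. (E al * A) $$ (a, b))"
  by (intro regular_on_times_entry[where a = m and b = m and c = m, OF X(3) _ reg_const reg_entry abm])
  thus ?thesis unfolding \<epsilon>_def abp by (rule reg_mult[OF _ reg_const])
 qed
 have regi: "regular_on m (e ` nz) (%A. 1 / \<epsilon> al A)" if "al:W" for al
 proof -
  have "regular_on m (e ` nz) (%A. \<epsilon> al (ginv m A))"
  using sub_GL(4)[OF lhom_subgroup[OF e]] by (intro regular_on_inv[OF sub reg[OF that]])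
  thus ?thesis
  proof (rule reg_cong)
  fix A assume "A:e ` nz"
  then obtain c where c: "c:nz" "A = e c" by blast
  show "\<epsilon> al (ginv m A) = 1 / \<epsilon> al A"
   unfolding c(2) lhom_inverse[OF e c(1)] \<epsilon>[OF that c(1)] \<epsilon>[OF that nz_inverse[OF c(1)]] lmon_inverse'
   by (simp add: inverse_eq_divide)
  qed
 qed
 define ka where "ka j A = (PROD al:W. \<epsilon> al A powi N j al)" for j A
 have "regular_on m (e ` nz) (ka j)" for j
  unfolding ka_def by (rule regular_on_prod, rule regular_on_powi) (simp_all add: reg regi)
 moreover have "ka j (e' u) = u j" if j: "j < d" and u: "u:nz" for j u
 proof -
  obtain c where c: "c:nz" "ALL j<d. ph c j = u j" "e' u = e c" using surj[OF u] by (elim bexE conjE) (rule that)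
  have "ka j (e' u) = (PROD al:W. lmon r (%k. al k * N j al) c)"
  unfolding ka_def c(3) by (rule prod.cong) (simp_all add: \<epsilon> c(1) lmon_powi)
  also have "... = lmon r (%k. SUM al:W. al k * N j al) c" by (rule lmon_sum[OF c(1), symmetric])
  also have "... = ph c j" unfolding ph_def using N j by (intro lmon_cong_exp) (simp add: mult.commute)
  finally show ?thesis using c(2) j by simp
 qed
 ultimately show ?thesis by (intro exI[of _ ka]) simp
qed
ultimately show ?thesis unfolding tparam_def by (intro exI[of _ d] exI[of _ e'] conjI) simp_all
qed

section \<open>Characters and one-parameter subgroups in coordinates\<close>

definition tpow :: "(nat => int) => complex => nat => complex" where
"tpow l t j = t powi l j"

lemma tpow_nz: "t ~= 0 ==> tpow l t:nz" by (simp add: nz_def tpow_def)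

lemma lmon_tpow: "t ~= 0 ==> lmon d al (tpow l t) = t powi idot d al l"
proof -
assume t: "t ~= 0"
have "lmon d al (tpow l t) = (PROD i<d. t powi (al i * l i))"
 by (simp add: lmon_def tpow_def power_int_mult[symmetric] mult.commute)
thus ?thesis using t by (simp add: prod_powi_sum idot_def)
qed

lemma tpow_mult: "tpow l (s * t) = (%i. tpow l s i * tpow l t i)" by (simp add: fun_eq_iff tpow_def power_int_mult_distrib)

lemma powi_2_inj: "(2 :: complex) powi a = 2 powi b \<longleftrightarrow> a = b"
proof
assume "(2 :: complex) powi a = 2 powi b"
hence "norm ((2 :: complex) powi a) = norm ((2 :: complex) powi b)" by simp
hence "(2 :: real) powi a = 2 powi b" by (simp add: norm_power_int)
thus "a = b" using power_int_strict_increasing[of a b "2 :: real"] power_int_strict_increasing[of b a "2 :: real"] by fastforce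
qed simp

lemma scalar1_dg: "scalar1 t = dg 1 (%_. t)" by (rule eq_matI) (simp_all add: scalar1_def dg_def)

lemma dg_1: "dg 1 c = scalar1 (c 0)" by (rule eq_matI) (simp_all add: scalar1_def dg_def)

lemma GL_1: "GLs 1 = dg 1 ` nz"
proof -
have "diagonal_mat A" if "A:GLs 1" for A using GL_mat[OF that] by (auto simp: diagonal_mat_def)
thus ?thesis unfolding std_torus_dg[symmetric] std_torus_def by auto
qed

lemma scalar1_GL: "t ~= 0 ==> scalar1 t:GLs 1" unfolding GL_1 scalar1_dg by (rule imageI) (simp add: nz_def)

lemma scalar1_mult: "scalar1 s * scalar1 t = scalar1 (s * t)" by (simp add: scalar1_dg dg_mult)

lemma Gm_character:
assumes g: "regular_on 1 (GLs 1) g" and mult: "!!s t. s ~= 0 ==> t ~= 0 ==> g (scalar1 (s * t)) = g (scalar1 s) * g (scalar1 t)"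
 and nonzero: "!!t. t ~= 0 ==> g (scalar1 t) ~= 0"
shows "EX a. ALL t. t ~= 0 --> g (scalar1 t) = t powi a"
proof -
have "EX al:exps 1. ALL c:nz. g (dg 1 c) = lmon 1 al c"
proof (rule laurent_multiplicative)
 show "laurent 1 (%c. g (dg 1 c))" using g unfolding GL_1 by (rule laurent_regular[OF lhom_dg])
qed (simp_all only: dg_1 mult nonzero nz_nonzero not_False_eq_True)
then obtain al where al: "ALL c:nz. g (dg 1 c) = lmon 1 al c" by blast
have "g (scalar1 t) = t powi al 0" if "t ~= 0" for t using bspec[OF al, of "%_. t"] that by (simp add: scalar1_dg nz_def lmon_def)
thus ?thesis by (intro exI[of _ "al 0"]) simp
qed

lemma one_paramD:
assumes "mu:one_param_subgroups m T"
shows "!!t. t ~= 0 ==> mu (scalar1 t):T"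
 "!!s t. s ~= 0 ==> t ~= 0 ==> mu (scalar1 (s * t)) = mu (scalar1 s) * mu (scalar1 t)"
using alg_homD(1,2)[OF assms[unfolded one_param_subgroups_def]] scalar1_GL by (simp_all add: scalar1_mult[symmetric])

lemma character_one_param:
assumes ph: "regular_on m T ph" "!!g. g:T ==> ph g ~= 0" "!!g h. g:T ==> h:T ==> ph (g * h) = ph g * ph h"
 and T: "T <= GLs m" and mu: "mu:one_param_subgroups m T"
shows "EX a. ALL t. t ~= 0 --> ph (mu (scalar1 t)) = t powi a"
proof (rule Gm_character)
have "subgroup (GLs 1) (GL 1)" by (rule group.subgroup_self[OF group_GL])
thus "regular_on 1 (GLs 1) (%A. ph (mu A))"
 using regular_on_algebraic_hom[OF mu[unfolded one_param_subgroups_def] _ T ph(1)] by blast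
qed (simp_all add: one_paramD[OF mu] ph)

lemma char_pairing_eq:
assumes "!!t. t ~= 0 ==> ph (mu (scalar1 t)) = t powi a"
shows "char_pairing ph mu = a" unfolding char_pairing_def
proof (rule the_equality)
show "b = a" if "ALL t. t ~= 0 --> ph (mu (scalar1 t)) = t powi b" for b
 using spec[OF that, of 2] assms[of 2] powi_2_inj[of a b] by simp
qed (simp add: assms)

text \<open>The choice of the parameter is harmless because \<open>e\<close> is injective on the
  first \<open>d\<close> coordinates. The value 1 off \<open>T\<close> follows the convention of
  \<open>characters\<close>.\<close>

definition tchar :: "nat => complex mat set => ((nat => complex) => complex mat) => (nat => int) => complex mat => complex" where
"tchar d T e al A = (if A:T then lmon d al (SOME u. u:nz & e u = A) else 1)"

context
fixes d m T e
assumes T: "tparam d m T e"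
begin

lemma tchar_e: "u:nz ==> tchar d T e al (e u) = lmon d al u"
proof -
assume u: "u:nz"
define v where "v = (SOME v. v:nz & e v = e u)"
have v: "v:nz & e v = e u" unfolding v_def using u by (intro someI[of "%v. v:nz & e v = e u" u]) simp
have "tchar d T e al (e u) = lmon d al v" unfolding tchar_def v_def using tparamD(3)[OF T u] by simp
also have "... = lmon d al u" using v u by (intro lmon_cong tparam_inj[OF T]) simp_all
finally show ?thesis .
qed

lemma tchar_nonzero: "tchar d T e al A ~= 0"
proof (cases "A:T")
case True
then obtain u where "u:nz" "A = e u" using tparamD(2)[OF T] by blast
thus ?thesis by (simp add: tchar_e lmon_nonzero)
qed (simp add: tchar_def)

lemma tchar_characters: "tchar d T e al:characters m T" unfolding characters_def
proof (intro CollectI conjI ballI allI impI)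
obtain ka where ka: "!!j. j < d ==> regular_on m T (ka j)" "!!j u. j < d ==> u:nz ==> ka j (e u) = u j"
 by (rule tparamE[OF T]) (rule that)
have "regular_on m T (%A. PROD j<d. ka j A powi al j)"
 by (rule regular_on_prod, rule regular_on_powi) (simp_all add: ka tparam_inverse_coord[OF T])
thus "regular_on m T (tchar d T e al)"
proof (rule reg_cong)
 fix A assume "A:T"
 then obtain u where u: "u:nz" "A = e u" using tparamD(2)[OF T] by blast
 show "(PROD j<d. ka j A powi al j) = tchar d T e al A" unfolding u(2) tchar_e[OF u(1)] by (simp add: ka(2) u(1) lmon_def)
qed
fix A B assume AB: "A:T" "B:T"
obtain u where u: "u:nz" "A = e u" using tparamD(2)[OF T] AB(1) by blast
obtain v where v: "v:nz" "B = e v" using tparamD(2)[OF T] AB(2) by blast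
show "tchar d T e al (A * B) = tchar d T e al A * tchar d T e al B"
 unfolding u(2) v(2) lhomD(3)[OF tparamD(1)[OF T] u(1) v(1), symmetric] by (simp add: tchar_e u(1) v(1) lmon_times)
qed (simp_all add: tchar_nonzero, simp add: tchar_def)

lemma characters_tchar:
assumes ph: "ph:characters m T"
shows "EX al:exps d. ph = tchar d T e al"
proof -
note TT = tparamD[OF T]
have P: "regular_on m T ph" "!!g. g:T ==> ph g ~= 0" "!!g. g \<notin> T ==> ph g = 1"
 "!!g h. g:T ==> h:T ==> ph (g * h) = ph g * ph h" using ph by (simp_all add: characters_def)
have "EX al:exps d. ALL c:nz. ph (e c) = lmon d al c"
proof (rule laurent_multiplicative)
 show "laurent d (%c. ph (e c))" using P(1) unfolding TT(2)[symmetric] by (rule laurent_regular[OF TT(1)])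
 show "ph (e (%i. c i * c' i)) = ph (e c) * ph (e c')" if "c:nz" "c':nz" for c c'
  unfolding lhomD(3)[OF TT(1) that] by (rule P(4)) (use TT(3) that in simp_all)
 show "ph (e c) ~= 0" if "c:nz" for c by (rule P(2)[OF TT(3)[OF that]])
qed
then obtain al where al: "al:exps d" "ALL c:nz. ph (e c) = lmon d al c" ..
have "ph A = tchar d T e al A" for A
proof (cases "A:T")
 case True
 then obtain u where u: "u:nz" "A = e u" using TT(2) by blast
 show ?thesis unfolding u(2) tchar_e[OF u(1)] using al(2) u(1) by (rule bspec)
next
 case False
 thus ?thesis using P(3) by (simp add: tchar_def)
qed
thus ?thesis using al(1) by (intro bexI[OF _ al(1)]) (rule ext)
qed

lemma tchar_inject:
assumes "al:exps d" "be:exps d" "!!u. u:nz ==> lmon d al u = lmon d be u"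
shows "al = be" using lmon_separates[OF assms(1,2)] assms(3) by (cases "al = be") auto

lemma one_param_tpow: "(%A. e (tpow l (A $$ (0, 0)))):one_param_subgroups m T" unfolding one_param_subgroups_def
proof (rule algebraic_homI)
note TT = tparamD[OF T]
have nz0: "A $$ (0, 0) ~= 0" if "A:GLs 1" for A using that unfolding GL_1 by (auto simp: nz_def)
show "e (tpow l (A $$ (0, 0))):T" if "A:GLs 1" for A using TT(3) tpow_nz[OF nz0[OF that]] .
show "e (tpow l ((A * B) $$ (0, 0))) = e (tpow l (A $$ (0, 0))) * e (tpow l (B $$ (0, 0)))" if AB: "A:GLs 1" "B:GLs 1" for A B
proof -
 have "(A * B) $$ (0, 0) = A $$ (0, 0) * B $$ (0, 0)"
  using sq_entry[OF GL_mat[OF AB(1)] GL_mat[OF AB(2)], of 0 0] by simp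
 thus ?thesis using lhomD(3)[OF TT(1) tpow_nz[OF nz0[OF AB(1)]] tpow_nz[OF nz0[OF AB(2)]]] by (simp add: tpow_mult)
qed
fix i j assume ij: "i < m" "j < m"
have st: "tparam 1 1 (GLs 1) (dg 1)" unfolding tparam_def
 by (intro conjI lhom_dg GL_1[symmetric] exI[of _ "%j A. A $$ (j, j)"] allI impI ballI reg_entry) simp_all
have en: "regular_on 1 (GLs 1) (%A. A $$ (0, 0))" by (rule reg_entry) simp_all
have eni: "regular_on 1 (GLs 1) (%A. 1 / A $$ (0, 0))" using tparam_inverse_coord[OF st, of 0 "%A. A $$ (0, 0)"] en by simp
have en2: "regular_on 1 (GLs 1) (%A. 1 / (A $$ (0, 0) powi a))" for a
 using regular_on_powi[OF en eni, of "- a"] by (simp add: power_int_minus inverse_eq_divide)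
have "regular_on 1 (GLs 1) (%A. e (%j. if j < d then A $$ (0, 0) powi l j else 1) $$ (i, j))"
 by (rule regular_on_laurent[OF lhomD(4)[OF TT(1) ij]]) (use regular_on_powi[OF en eni] en2 nz0 in simp_all)
thus "regular_on 1 (GLs 1) (%A. e (tpow l (A $$ (0, 0))) $$ (i, j))"
proof (rule reg_cong)
 fix A assume A: "A:GLs 1"
 have "e (%j. if j < d then A $$ (0, 0) powi l j else 1) = e (tpow l (A $$ (0, 0)))"
  using nz0[OF A] by (intro lhom_dep[OF TT(1)]) (simp_all add: nz_def tpow_def)
 thus "e (%j. if j < d then A $$ (0, 0) powi l j else 1) $$ (i, j) = e (tpow l (A $$ (0, 0))) $$ (i, j)" by simp
qed
qed

text \<open>Each coordinate \<open>ka j\<close> along the subgroup is a character of the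
  multiplicative group, hence a power of t.\<close>

lemma one_param_classification:
assumes mu: "mu:one_param_subgroups m T"
shows "EX l. ALL t. t ~= 0 --> mu (scalar1 t) = e (tpow l t)"
proof -
note TT = tparamD[OF T]
obtain ka where ka: "!!j. j < d ==> regular_on m T (ka j)" "!!j u. j < d ==> u:nz ==> ka j (e u) = u j"
 by (rule tparamE[OF T]) (rule that)
have "EX a. ALL t. t ~= 0 --> ka j (mu (scalar1 t)) = t powi a" if j: "j < d" for j
proof (rule character_one_param[OF ka(1)[OF j] _ _ sub_GL(1)[OF TT(4)] mu])
 fix g assume g: "g:T"
 obtain u where u: "u:nz" "g = e u" using TT(2) g by blast
 show "ka j g ~= 0" unfolding u(2) ka(2)[OF j u(1)] using u(1) by (rule nz_nonzero)
 fix h assume h: "h:T"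
 obtain v where v: "v:nz" "h = e v" using TT(2) h by blast
 show "ka j (g * h) = ka j g * ka j h" unfolding u(2) v(2) lhomD(3)[OF TT(1) u(1) v(1), symmetric]
  using ka(2)[OF j nz_mult[OF u(1) v(1)]] ka(2)[OF j u(1)] ka(2)[OF j v(1)] by simp
qed
hence "ALL j:{..<d}. EX a. ALL t. t ~= 0 --> ka j (mu (scalar1 t)) = t powi a" by simp
from bchoice[OF this] obtain l where l: "ALL j:{..<d}. ALL t. t ~= 0 --> ka j (mu (scalar1 t)) = t powi l j" ..
have "mu (scalar1 t) = e (tpow l t)" if t: "t ~= 0" for t
proof -
 obtain u where u: "u:nz" "mu (scalar1 t) = e u" using one_paramD(1)[OF mu t] TT(2) by blast
 have "u j = tpow l t j" if j: "j < d" for j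
 proof -
  have "ka j (mu (scalar1 t)) = t powi l j" using l t j by blast
  thus ?thesis unfolding u(2) ka(2)[OF j u(1)] tpow_def .
 qed
 thus ?thesis unfolding u(2) by (intro lhom_dep[OF TT(1) u(1) tpow_nz[OF t]])
qed
thus ?thesis by (intro exI[of _ l]) simp
qed

end

section \<open>Rational characters as characters up to torsion\<close>

lemma qchar_rel_refl: "(!!a. f a ~= 0) ==> 0 < n ==> qchar_rel (f, n) (f, n)" by (rule qchar_relI[of _ _ _ _ 1]) simp_all

lemma qchar_of_eq_iff:
assumes "!!a. f a ~= 0" "!!a. g a ~= 0"
shows "qchar_of f = qchar_of g \<longleftrightarrow> (EX k>0. ALL a. f a ^ k = g a ^ k)"
proof -
have "qchar_of f = qchar_of g \<longleftrightarrow> qchar_rel (f, 1) (g, 1)" unfolding qchar_of_def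
 using Quotient3_rel[OF Quotient3_qchar, of "(f, 1)" "(g, 1)"] qchar_rel_refl[of f 1, OF assms(1)] qchar_rel_refl[of g 1, OF assms(2)]
 by simp
thus ?thesis using assms by (simp add: qchar_rel_def)
qed

lemma qchar_of_mult:
assumes "!!a. f a ~= 0" "!!a. g a ~= 0"
shows "qchar_of (%a. f a * g a) = qchar_of f + qchar_of g" unfolding qchar_of_def
using plus_qchar.abs_eq[OF qchar_rel_refl[of f 1, OF assms(1)] qchar_rel_refl[of g 1, OF assms(2)]] by simp

lemma qchar_of_one: "qchar_of (%_. 1) = 0" unfolding qchar_of_def zero_qchar_def ..

lemma qchar_of_powi:
assumes "!!a. f a ~= 0"
shows "qchar_of (%a. f a powi k) = qscale (of_int k) (qchar_of f)" unfolding qchar_of_def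
using qscale.abs_eq[OF qchar_rel_refl[of f 1, OF assms], of "of_int k"] by simp

lemma qchar_of_prod:
assumes "!!i a. i:I ==> f i a ~= 0"
shows "qchar_of (%a. PROD i:I. f i a) = (SUM i:I. qchar_of (f i))" using assms
proof (induction I rule: infinite_finite_induct)
case (insert x F)
thus ?case using qchar_of_mult[of "f x" "%a. PROD i:F. f i a"] by simp
qed (simp_all add: qchar_of_one)

lemma qchar_pullback_of:
assumes "!!a. f a ~= 0"
shows "qchar_pullback w (qchar_of f) = qchar_of (f \<circ> w)"
unfolding qchar_of_def using qchar_pullback.abs_eq[OF qchar_rel_refl[of f 1, OF assms], of w] by simp

section \<open>Products of groups as block matrices\<close>

lemma block_carrier [simp]: "A:sqm n ==> B:sqm k ==> block A B:sqm (n + k)" by (simp add: block_def)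

lemma block_index:
assumes "A:sqm n" "B:sqm k" "i < n + k" "j < n + k"
shows "block A B $$ (i, j) = (if i < n then if j < n then A $$ (i, j) else 0 else if j < n then 0 else B $$ (i - n, j - n))"
using assms by (auto simp: block_def)

lemma block_mult:
assumes "A:sqm n" "B:sqm k" "A':sqm n" "B':sqm k"
shows "block A B * block A' B' = block (A * A') (B * B')"
proof -
have "block A B * block A' B' = four_block_mat (A * A' + 0\<^sub>m n k * 0\<^sub>m k n) (A * 0\<^sub>m n k + 0\<^sub>m n k * B')
  (0\<^sub>m k n * A' + B * 0\<^sub>m k n) (0\<^sub>m k n * 0\<^sub>m n k + B * B')"
 using assms mult_four_block_mat[OF assms(1) zero_carrier_mat[of n k] zero_carrier_mat[of k n] assms(2)
  assms(3) zero_carrier_mat[of n k] zero_carrier_mat[of k n] assms(4)] by (simp add: block_def)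
thus ?thesis using assms by (simp add: block_def)
qed

lemma block_one: "block (1\<^sub>m n) (1\<^sub>m k) = 1\<^sub>m (n + k)" by (simp add: block_def)

lemma block_fst_block: "A:sqm n ==> B:sqm k ==> block_fst n (block A B) = A"
and block_snd_block: "A:sqm n ==> B:sqm k ==> block_snd n (block A B) = B"
by (rule eq_matI; simp add: block_fst_def block_snd_def split_block_def Let_def block_def)+

lemma block_GL:
assumes "A:GLs n" "B:GLs k"
shows "block A B:GLs (n + k)"
proof -
note c = GL_mat[OF assms(1)] GL_mat[OF assms(2)]
have "det (block A B) = det A * det B" unfolding block_def using c by (intro det_four_block_mat_lower_left_zero) auto
thus ?thesis using assms c by (simp add: GL_carrier)
qed

lemma block_inv:
assumes "A:GLs n" "B:GLs k"
shows "ginv (n + k) (block A B) = block (ginv n A) (ginv k B)"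
proof (rule GL_inv_unique[OF block_GL[OF assms]])
note c = GL_mat[OF assms(1)] GL_mat[OF assms(2)]
 GL_mat[OF GL_inv_closed[OF assms(1)]] GL_mat[OF GL_inv_closed[OF assms(2)]]
show "block (ginv n A) (ginv k B):sqm (n + k)" using c by simp
show "block (ginv n A) (ginv k B) * block A B = 1\<^sub>m (n + k)"
 using block_mult[OF c(3,4) c(1,2)] GL_inv_left[OF assms(1)] GL_inv_left[OF assms(2)] by (simp add: block_one)
qed

lemma lhom_block:
assumes e: "lhom h n e" and f: "lhom d k f"
shows "lhom (h + d) (n + k) (%c. block (e c) (f (%i. c (h + i))))" unfolding lhom_def
proof (intro conjI ballI allI impI)
note E = lhomD[OF e] and F = lhomD[OF f]
show "block (e c) (f (%i. c (h + i))):GLs (n + k)" if "c:nz" for c using block_GL[OF E(1)[OF that] F(1)[OF nz_shift[OF that]]] .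
show "block (e (%i. c i * c' i)) (f (%i. c (h + i) * c' (h + i)))
  = block (e c) (f (%i. c (h + i))) * block (e c') (f (%i. c' (h + i)))" if "c:nz" "c':nz" for c c'
 unfolding E(3)[OF that] F(3)[OF nz_shift[OF that(1)] nz_shift[OF that(2)]]
 by (rule block_mult[symmetric, OF E(2)[OF that(1)] F(2)[OF nz_shift[OF that(1)]] E(2)[OF that(2)] F(2)[OF nz_shift[OF that(2)]]])
fix i j assume ij: "i < n + k" "j < n + k"
let ?g = "%c. if i < n then if j < n then e c $$ (i, j) else 0 else if j < n then 0 else f (%i. c (h + i)) $$ (i - n, j - n)"
have "laurent (h + d) ?g"
proof (cases "i < n")
 case True
 thus ?thesis using laurent_extend[OF E(4)[of i j], of d] laurent_const[of "h + d" 0] by (cases "j < n") simp_all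
next
 case False
 have "laurent (h + d) (%c. f (%i. c (h + i)) $$ (i - n, j - n))" if "~ j < n"
  by (rule laurent_shift[OF F(4)]) (use False that ij in linarith)+
 thus ?thesis using False laurent_const[of "h + d" 0] by (cases "j < n") simp_all
qed
thus "laurent (h + d) (%c. block (e c) (f (%i. c (h + i))) $$ (i, j))"
proof (rule laurent_cong)
 fix c assume "c:nz"
 thus "?g c = block (e c) (f (%i. c (h + i))) $$ (i, j)" using block_index[OF E(2) F(2)[OF nz_shift] ij] by simp
qed
qed

lemma join_nz: "c:nz ==> c':nz ==> join h c c':nz" by (simp add: nz_def join_def)

lemma block_image:
assumes e: "lhom h n e" and f: "lhom d k f"
shows "(%c. block (e c) (f (%i. c (h + i)))) ` nz = group_prod (e ` nz) (f ` nz)"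
proof (intro equalityI subsetI)
fix A assume "A:(%c. block (e c) (f (%i. c (h + i)))) ` nz"
thus "A:group_prod (e ` nz) (f ` nz)" unfolding group_prod_def using nz_shift by blast
next
fix A assume "A:group_prod (e ` nz) (f ` nz)"
then obtain c c' where c: "c:nz" "c':nz" "A = block (e c) (f c')" unfolding group_prod_def by blast
have "e (join h c c') = e c" by (rule lhom_dep[OF e join_nz[OF c(1,2)] c(1)]) (simp add: join_def)
moreover have "f (%i. join h c c' (h + i)) = f c'"
 by (rule lhom_dep[OF f nz_shift[OF join_nz[OF c(1,2)]] c(2)]) (simp add: join_def)
ultimately show "A:(%c. block (e c) (f (%i. c (h + i)))) ` nz" using c join_nz by (intro image_eqI[of _ _ "join h c c'"]) simp_all
qed

lemma regular_on_block_fst: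
assumes "i < n" "j < n"
shows "regular_on (n + k) S (%A. block_fst n A $$ (i, j))"
using assms by (intro reg_cong[OF reg_entry[of i "n + k" j]])
 (simp_all add: block_fst_def split_block_def Let_def)

lemma group_prodE:
assumes "A:group_prod H D"
obtains h d where "h:H" "d:D" "A = block h d" using assms unfolding group_prod_def by blast

lemma regular_on_block_snd:
assumes "i < k" "j < k" "H <= sqm n" "D <= sqm k"
shows "regular_on (n + k) (group_prod H D) (%A. block_snd n A $$ (i, j))"
proof (rule reg_cong[OF reg_entry[of "n + i" "n + k" "n + j"]])
fix A assume "A:group_prod H D"
then obtain h d where hd: "h:H" "d:D" "A = block h d" by (rule group_prodE)
hence c: "h:sqm n" "d:sqm k" using assms by blast+
show "A $$ (n + i, n + j) = block_snd n A $$ (i, j)"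
 unfolding hd(3) block_snd_block[OF c] using block_index[OF c, of "n + i" "n + j"] assms(1,2) by simp
qed (use assms in simp_all)

lemma group_prod_mult:
assumes "H <= sqm n" "D <= sqm k" "A:group_prod H D" "B:group_prod H D"
shows "block_fst n (A * B) = block_fst n A * block_fst n B" "block_snd n (A * B) = block_snd n A * block_snd n B"
proof -
obtain h d where hd: "h:H" "d:D" "A = block h d" using assms(3) by (rule group_prodE)
obtain h' d' where hd': "h':H" "d':D" "B = block h' d'" using assms(4) by (rule group_prodE)
have c: "h:sqm n" "d:sqm k" "h':sqm n" "d':sqm k" using hd hd' assms(1,2) by blast+
show "block_fst n (A * B) = block_fst n A * block_fst n B" "block_snd n (A * B) = block_snd n A * block_snd n B"
 unfolding hd(3) hd'(3) block_mult[OF c]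
  block_fst_block[OF c(1,2)] block_fst_block[OF c(3,4)] block_fst_block[OF sq_mult[OF c(1,3)] sq_mult[OF c(2,4)]]
  block_snd_block[OF c(1,2)] block_snd_block[OF c(3,4)] block_snd_block[OF sq_mult[OF c(1,3)] sq_mult[OF c(2,4)]] by (rule refl)+
qed

lemma group_prod_proj:
assumes "H <= sqm n" "D <= sqm k" "A:group_prod H D"
shows "block_fst n A:H" "block_snd n A:D" "A = block (block_fst n A) (block_snd n A)"
proof -
obtain h d where hd: "h:H" "d:D" "A = block h d" using assms(3) by (rule group_prodE)
hence c: "h:sqm n" "d:sqm k" using assms(1,2) by blast+
show "block_fst n A:H" "block_snd n A:D" "A = block (block_fst n A) (block_snd n A)"
 unfolding hd(3) block_fst_block[OF c] block_snd_block[OF c] using hd by simp_all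
qed

text \<open>To use a coordinate of a factor on the product, the reciprocal determinant of the
  corresponding block must be regular; it is the determinant of that block in the inverse
  matrix.\<close>

lemma tparam_block:
assumes e: "tparam h n TH e" and f: "tparam d k TD f"
shows "tparam (h + d) (n + k) (group_prod TH TD) (%c. block (e c) (f (%i. c (h + i))))"
proof -
note E = tparamD[OF e] and F = tparamD[OF f]
obtain ka where ka: "!!j. j < h ==> regular_on n TH (ka j)" "!!j u. j < h ==> u:nz ==> ka j (e u) = u j"
 by (rule tparamE[OF e]) (rule that)
obtain ka' where ka': "!!j. j < d ==> regular_on k TD (ka' j)" "!!j u. j < d ==> u:nz ==> ka' j (f u) = u j"
 by (rule tparamE[OF f]) (rule that)
have sub: "TH <= sqm n" "TD <= sqm k" using sub_GL(1)[OF E(4)] sub_GL(1)[OF F(4)] GL_mat by blast+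
have gGL: "block_fst n A:GLs n" "block_snd n A:GLs k" if "A:group_prod TH TD" for A
 using group_prod_proj[OF sub that] sub_GL(1)[OF E(4)] sub_GL(1)[OF F(4)] by blast+
let ?S = "group_prod TH TD"
have SG: "?S <= GLs (n + k)"
proof
 fix A assume "A:?S"
 thus "A:GLs (n + k)" using group_prod_proj(3)[OF sub] gGL block_GL by metis
qed
have invS: "ginv (n + k) A:?S" "ginv (n + k) A = block (ginv n (block_fst n A)) (ginv k (block_snd n A))" if A: "A:?S" for A
proof -
 have "A = block (block_fst n A) (block_snd n A)" by (rule group_prod_proj(3)[OF sub A])
 thus eq: "ginv (n + k) A = block (ginv n (block_fst n A)) (ginv k (block_snd n A))" using block_inv[OF gGL[OF A]] by simp
 show "ginv (n + k) A:?S"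
  unfolding eq group_prod_def using sub_GL(4)[OF E(4)] sub_GL(4)[OF F(4)] group_prod_proj(1,2)[OF sub A] by blast
qed
have r1: "regular_on (n + k) ?S (%A. ka j (block_fst n A))" if j: "j < h" for j
proof (rule regular_on_compose[OF _ _ _ ka(1)[OF j]])
 show "block_fst n A:TH" if "A:?S" for A using group_prod_proj(1)[OF sub that] .
 show ent: "regular_on (n + k) ?S (%A. block_fst n A $$ (i, j))" if "i < n" "j < n" for i j
  by (rule regular_on_block_fst[OF that])
 have dt: "regular_on (n + k) ?S (%A. det (block_fst n A))" using GL_mat[OF gGL(1)] ent by (rule regular_on_det)
 have "regular_on (n + k) ?S (%A. det (block_fst n (ginv (n + k) A)))" by (rule regular_on_inv[OF SG dt invS(1)])
 thus "regular_on (n + k) ?S (%A. 1 / det (block_fst n A))"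
 proof (rule reg_cong)
  fix A assume A: "A:?S"
  have gi: "ginv n (block_fst n A):sqm n" "ginv k (block_snd n A):sqm k" using GL_mat GL_inv_closed gGL[OF A] by blast+
  have "det (ginv n (block_fst n A)) * det (block_fst n A) = 1"
  using det_mult[OF gi(1) GL_mat[OF gGL(1)[OF A]]] GL_inv_left[OF gGL(1)[OF A]] by simp
  thus "det (block_fst n (ginv (n + k) A)) = 1 / det (block_fst n A)"
  unfolding invS(2)[OF A] block_fst_block[OF gi] using GL_det[OF gGL(1)[OF A]] by (simp add: nonzero_eq_divide_eq)
 qed
qed
have r2: "regular_on (n + k) ?S (%A. ka' j (block_snd n A))" if j: "j < d" for j
proof (rule regular_on_compose[OF _ _ _ ka'(1)[OF j]])
 show "block_snd n A:TD" if "A:?S" for A using group_prod_proj(2)[OF sub that] .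
 show ent: "regular_on (n + k) ?S (%A. block_snd n A $$ (i, j))" if "i < k" "j < k" for i j
  by (rule regular_on_block_snd[OF that sub])
 have dt: "regular_on (n + k) ?S (%A. det (block_snd n A))" using GL_mat[OF gGL(2)] ent by (rule regular_on_det)
 have "regular_on (n + k) ?S (%A. det (block_snd n (ginv (n + k) A)))" by (rule regular_on_inv[OF SG dt invS(1)])
 thus "regular_on (n + k) ?S (%A. 1 / det (block_snd n A))"
 proof (rule reg_cong)
  fix A assume A: "A:?S"
  have gi: "ginv n (block_fst n A):sqm n" "ginv k (block_snd n A):sqm k" using GL_mat GL_inv_closed gGL[OF A] by blast+
  have "det (ginv k (block_snd n A)) * det (block_snd n A) = 1"
  using det_mult[OF gi(2) GL_mat[OF gGL(2)[OF A]]] GL_inv_left[OF gGL(2)[OF A]] by simp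
  thus "det (block_snd n (ginv (n + k) A)) = 1 / det (block_snd n A)"
  unfolding invS(2)[OF A] block_snd_block[OF gi] using GL_det[OF gGL(2)[OF A]] by (simp add: nonzero_eq_divide_eq)
 qed
qed
show ?thesis unfolding tparam_def
proof (intro conjI lhom_block[OF E(1) F(1)])
 show "(%c. block (e c) (f (%i. c (h + i)))) ` nz = ?S" using block_image[OF E(1) F(1)] E(2) F(2) by simp
 let ?ka = "%j A. if j < h then ka j (block_fst n A) else ka' (j - h) (block_snd n A)"
 show "EX ka. ALL j<h + d. regular_on (n + k) ?S (ka j) & (ALL u:nz. ka j (block (e u) (f (%i. u (h + i)))) = u j)"
 proof (intro exI[of _ ?ka] allI impI conjI ballI)
  fix j assume j: "j < h + d"
  show "regular_on (n + k) ?S (?ka j)" using r1 r2[of "j - h"] j by (cases "j < h") simp_all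
  fix u assume u: "u:nz"
  note c = lhomD(2)[OF E(1) u] lhomD(2)[OF F(1) nz_shift[OF u]]
  show "?ka j (block (e u) (f (%i. u (h + i)))) = u j" unfolding block_fst_block[OF c] block_snd_block[OF c]
  using ka(2)[OF _ u] ka'(2)[OF _ nz_shift[OF u], of "j - h"] j by auto
 qed
qed
qed

text \<open>The projection \<open>TH\<close> of \<open>T\<close> to \<open>H\<close> is a torus,
  being the image of one. Then T lies in the torus TH x D and equals it by maximality; the same
  argument for a torus between TH and H shows that TH is maximal.\<close>

lemma maximal_torus_group_prod:
assumes H: "subgroup H (GL n)" and D: "tparam d k D f" and T: "maximal_torus (n + k) (group_prod H D) T"
shows "EX TH. maximal_torus n H TH & T = group_prod TH D"
proof -
note F = tparamD[OF D]
have sub: "H <= sqm n" "D <= sqm k" using sub_GL(1)[OF H] sub_GL(1)[OF F(4)] GL_mat by blast+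
obtain r e where e: "tparam r (n + k) T e" using T unfolding maximal_torus_def torus_tparam by blast
note E = tparamD[OF e]
have TG: "T <= group_prod H D" using T by (simp add: maximal_torus_def)
define TH where "TH = block_fst n ` T"
have THH: "TH <= H" unfolding TH_def using TG group_prod_proj(1)[OF sub] by blast
have eG: "e c:group_prod H D" if "c:nz" for c using E(3)[OF that] TG by blast
have l: "lhom r n (%c. block_fst n (e c))" unfolding lhom_def
proof (intro conjI ballI allI impI)
 show "block_fst n (e c):GLs n" if "c:nz" for c using group_prod_proj(1)[OF sub eG[OF that]] sub_GL(1)[OF H] by blast
 show "block_fst n (e (%i. c i * c' i)) = block_fst n (e c) * block_fst n (e c')" if "c:nz" "c':nz" for c c'
  unfolding lhomD(3)[OF E(1) that] by (rule group_prod_mult(1)[OF sub eG[OF that(1)] eG[OF that(2)]])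
 show "laurent r (%c. block_fst n (e c) $$ (i, j))" if "i < n" "j < n" for i j
  by (rule laurent_regular[OF E(1) regular_on_block_fst[OF that]])
qed
have im: "(%c. block_fst n (e c)) ` nz = TH" unfolding TH_def E(2)[symmetric] by (rule image_image[symmetric])
obtain h eH where eH: "tparam h n TH eH" using lhom_image_tparam[OF l] unfolding im by blast
have sup: "T = group_prod S D" if S: "torus n S" "TH <= S" "S <= H" for S
proof -
 obtain h' e' where "tparam h' n S e'" using S(1) unfolding torus_tparam by blast
 hence "torus (n + k) (group_prod S D)" using tparam_block[OF _ D] torus_tparam by blast
 moreover have "T <= group_prod S D"
 proof
  fix A assume A: "A:T"
  hence "A = block (block_fst n A) (block_snd n A)" "block_snd n A:D" using group_prod_proj(2,3)[OF sub] TG by blast+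
  moreover have "block_fst n A:S" using A S(2) unfolding TH_def by blast
  ultimately show "A:group_prod S D" unfolding group_prod_def by blast
 qed
 moreover have "group_prod S D <= group_prod H D" using S(3) unfolding group_prod_def by blast
 ultimately show ?thesis using T unfolding maximal_torus_def by blast
qed
have tTH: "torus n TH" using eH torus_tparam by blast
have "T = group_prod TH D" by (rule sup[OF tTH subset_refl THH])
moreover have "maximal_torus n H TH" unfolding maximal_torus_def
proof (intro conjI tTH THH allI impI)
 fix S assume S: "torus n S & TH <= S & S <= H"
 hence "T = group_prod S D" by (intro sup) simp_all
 have "S <= TH"
 proof
  fix A assume A: "A:S"
  have "block A (1\<^sub>m k):group_prod S D" unfolding group_prod_def using A sub_GL(2)[OF F(4)] by blast
  hence "block A (1\<^sub>m k):T" using \<open>T = group_prod S D\<close> by simp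
  hence "block_fst n (block A (1\<^sub>m k)):TH" unfolding TH_def by (rule imageI)
  moreover have "A:sqm n" using A S sub(1) by blast
  ultimately show "A:TH" by (simp add: block_fst_block[of A n "1\<^sub>m k" k])
 qed
 thus "S = TH" using S by blast
qed
ultimately show ?thesis by blast
qed

section \<open>Linear coordinates on rational characters, and the pairing\<close>

definition unit_exp :: "nat => nat => int" where "unit_exp j k = (if k = j then 1 else 0)"

lemma idot_unit_exp: "j < d ==> idot d z (unit_exp j) = z j"
proof -
assume j: "j < d"
have "idot d z (unit_exp j) = (SUM k<d. if k = j then z j else 0)" unfolding idot_def unit_exp_def by (rule sum.cong) auto
thus ?thesis using j by simp
qed

lemma lmon_unit_exp: "j < d ==> lmon d (unit_exp j) u = u j"
proof -
assume j: "j < d"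
have "lmon d (unit_exp j) u = (PROD k<d. if k = j then u j else 1)" unfolding lmon_def unit_exp_def by (rule prod.cong) auto
thus ?thesis using j by simp
qed

lemma tchar_prod:
assumes T: "tparam d m T e"
shows "tchar d T e al = (%A. PROD j<d. tchar d T e (unit_exp j) A powi al j)"
proof (rule ext)
fix A
show "tchar d T e al A = (PROD j<d. tchar d T e (unit_exp j) A powi al j)"
proof (cases "A:T")
 case True
 then obtain u where u: "u:nz" "A = e u" using tparamD(2)[OF T] by blast
 have "(PROD j<d. lmon d (unit_exp j) u powi al j) = (PROD j<d. u j powi al j)" by (rule prod.cong) (simp_all add: lmon_unit_exp)
 thus ?thesis unfolding u(2) tchar_e[OF T u(1)] by (simp only: lmon_def[of d al u])
next
 case False
 thus ?thesis by (simp add: tchar_def)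
qed
qed

lemma qchar_of_tchar:
assumes T: "tparam d m T e"
shows "qchar_of (tchar d T e al) = (SUM j<d. qscale (of_int (al j)) (qchar_of (tchar d T e (unit_exp j))))"
proof -
have "qchar_of (tchar d T e al) = (SUM j<d. qchar_of (%A. tchar d T e (unit_exp j) A powi al j))"
 unfolding tchar_prod[OF T, of al] by (rule qchar_of_prod) (simp add: tchar_nonzero[OF T])
thus ?thesis by (simp add: qchar_of_powi tchar_nonzero[OF T])
qed

text \<open>Vanishing means that some positive power of the character is trivial; evaluated on the
  j-th coordinate subgroup at 2 this reads 2 ^ (k z_j) = 1.\<close>

lemma qchar_of_tchar_zero:
assumes T: "tparam d m T e" and "qchar_of (tchar d T e z) = 0" "j < d"
shows "z j = 0"
proof -
have "qchar_of (tchar d T e z) = qchar_of (%_. 1)" using assms(2) by (simp add: qchar_of_one)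
hence "EX k>0. ALL A. tchar d T e z A ^ k = 1 ^ k" using qchar_of_eq_iff[of "tchar d T e z" "%_. 1"] tchar_nonzero[OF T] by simp
then obtain k where k: "0 < k" "ALL A. tchar d T e z A ^ k = 1 ^ k" by (elim exE conjE) (rule that)
have "tchar d T e z (e (tpow (unit_exp j) 2)) = 2 powi z j"
 using tchar_e[OF T tpow_nz[of 2 "unit_exp j"], of z] lmon_tpow[of 2 d z "unit_exp j"] idot_unit_exp[OF assms(3)] by simp
hence "(2 powi z j) ^ k = (1 :: complex)" using spec[OF k(2), of "e (tpow (unit_exp j) 2)"] by simp
hence "(2 :: complex) powi (z j * int k) = 2 powi 0" by (simp add: power_int_mult)
hence "z j * int k = 0" unfolding powi_2_inj .
thus ?thesis using k(1) by simp
qed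

lemma tchar_basis_independent:
fixes c :: "nat => rat"
assumes T: "tparam d m T e" and "(SUM j<d. qscale (c j) (qchar_of (tchar d T e (unit_exp j)))) = 0" "j < d"
shows "c j = 0"
proof -
obtain N z where N: "(0 :: nat) < N" and z: "ALL k:{..<d}. of_int (z k) = of_nat N * c k"
 using clear_denominators[OF finite_lessThan, of d c] by (elim exE conjE) (rule that)
have "qchar_of (tchar d T e z) = (SUM j<d. qscale (of_nat N) (qscale (c j) (qchar_of (tchar d T e (unit_exp j)))))"
 unfolding qchar_of_tchar[OF T, of z] using z by simp
also have "... = qscale (of_nat N) (SUM j<d. qscale (c j) (qchar_of (tchar d T e (unit_exp j))))"
 by (rule qchar.scale_sum_right[symmetric])
also have "... = 0" unfolding assms(2) by simp
finally have "z j = 0" using assms(3) by (rule qchar_of_tchar_zero[OF T])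
moreover have "of_int (z j) = of_nat N * c j" using z assms(3) by blast
ultimately show ?thesis using N by simp
qed

lemma dim_rational_characters:
assumes T: "tparam d m T e"
shows "qchar.dim (rational_characters m T) = d"
proof -
let ?b = "%j. qchar_of (tchar d T e (unit_exp j))"
have inj: "inj_on ?b {..<d}"
proof (rule inj_onI)
 fix i j assume ij: "i:{..<d}" "j:{..<d}" "?b i = ?b j"
 show "i = j"
 proof (rule ccontr)
  assume "i ~= j"
  have "EX k>0. ALL A. tchar d T e (unit_exp i) A ^ k = tchar d T e (unit_exp j) A ^ k"
  using ij(3) qchar_of_eq_iff[of "tchar d T e (unit_exp i)" "tchar d T e (unit_exp j)"] tchar_nonzero[OF T] by simp
  then obtain k where k: "0 < k" "ALL A. tchar d T e (unit_exp i) A ^ k = tchar d T e (unit_exp j) A ^ k"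
  by (elim exE conjE) (rule that)
  have "tchar d T e ga (e (tpow (unit_exp i) 2)) = 2 powi ga i" for ga
  using tchar_e[OF T tpow_nz[of 2 "unit_exp i"], of ga] lmon_tpow[of 2 d ga "unit_exp i"] idot_unit_exp[of i d ga] ij(1) by simp
  hence "(2 :: complex) ^ k = 1"
  using spec[OF k(2), of "e (tpow (unit_exp i) 2)"] \<open>i ~= j\<close> by (simp add: unit_exp_def)
  hence "(2 :: complex) powi int k = 2 powi 0" by simp
  hence "int k = 0" unfolding powi_2_inj .
  thus False using k(1) by simp
 qed
qed
have span: "qchar_of (tchar d T e al):qchar.span (?b ` {..<d})" for al
 unfolding qchar_of_tchar[OF T, of al] by (intro qchar.span_sum qchar.span_scale qchar.span_base) auto
have "qchar.dim (qchar_of ` characters m T) = d"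
proof (rule qchar.dim_unique)
 show "?b ` {..<d} <= qchar_of ` characters m T" using tchar_characters[OF T] by blast
 show "qchar_of ` characters m T <= qchar.span (?b ` {..<d})"
 proof (rule image_subsetI)
  fix ph assume "ph:characters m T"
  then obtain al where "ph = tchar d T e al" using characters_tchar[OF T] by blast
  thus "qchar_of ph:qchar.span (?b ` {..<d})" using span by simp
 qed
 show "qchar.independent (?b ` {..<d})"
 proof (rule qchar.independent_if_scalars_zero)
  fix f x assume f: "(SUM x:?b ` {..<d}. qscale (f x) x) = 0" and x: "x:?b ` {..<d}"
  have "(SUM j<d. qscale (f (?b j)) (?b j)) = 0" using f unfolding sum.reindex[OF inj] comp_def .
  hence "f (?b j) = 0" if "j < d" for j using that by (rule tchar_basis_independent[OF T, of "%j. f (?b j)"])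
  thus "f x = 0" using x by auto
 qed simp
 show "card (?b ` {..<d}) = d" by (simp add: card_image[OF inj])
qed
thus ?thesis by (simp add: rational_characters_def)
qed

text \<open>If all weights were orthogonal to \<open>u\<close>, the coordinate \<open>j\<close> of
  each would be determined by the others. The weights would lie in the span of the d - 1 vectors
  \<open>?v i\<close>, too few for the dimension of the cone.\<close>

lemma weight_cone_spans:
assumes T: "tparam d m T e" and dim: "qchar.dim (weight_cone m T q \<rho>) = qchar.dim (rational_characters m T)"
 and u: "j < d" "u j ~= 0"
shows "EX be:exps d. tchar d T e be:weights m T q \<rho> & idot d be u ~= 0"
proof (rule ccontr)
assume no: "~ ?thesis"
let ?b = "%j. qchar_of (tchar d T e (unit_exp j))"
let ?v = "%i. ?b i + qscale (- (of_int (u i) / of_int (u j))) (?b j)"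
let ?S = "?v ` ({..<d} - {j})"
have sp: "qchar_of ph:qchar.span ?S" if ph: "ph:weights m T q \<rho>" for ph
proof -
 obtain be where be: "be:exps d" "ph = tchar d T e be" using characters_tchar[OF T, of ph] ph unfolding weights_def by blast
 have "idot d be u = 0" using no be ph by blast
 hence "be j * u j + (SUM i:{..<d} - {j}. be i * u i) = 0" using u(1) by (simp add: idot_def sum.remove[of "{..<d}" j])
 hence "of_int (be j * u j + (SUM i:{..<d} - {j}. be i * u i)) = (0 :: rat)" by simp
 hence bj: "of_int (be j) = (SUM i:{..<d} - {j}. of_int (be i) * (- (of_int (u i) / of_int (u j))) :: rat)"
  using u(2) by (simp add: sum_negf sum_divide_distrib[symmetric] field_simps add_eq_0_iff)
 have "qchar_of ph = (SUM i:{..<d} - {j}. qscale (of_int (be i)) (?b i)) + qscale (of_int (be j)) (?b j)"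
  unfolding be(2) qchar_of_tchar[OF T, of be] using u(1) by (simp add: sum.remove[of "{..<d}" j] add.commute)
 also have "... = (SUM i:{..<d} - {j}. qscale (of_int (be i)) (?v i))"
  unfolding bj qchar.scale_sum_left by (simp only: sum.distrib[symmetric] qchar.scale_right_distrib qchar.scale_scale)
 finally show ?thesis by (simp only:) (intro qchar.span_sum qchar.span_scale qchar.span_base imageI)
qed
have "weight_cone m T q \<rho> <= qchar.span ?S"
proof
 fix x assume "x:weight_cone m T q \<rho>"
 then obtain S c where S: "S <= weights m T q \<rho>" "x = (SUM ph:S. qscale (c ph) (qchar_of ph))"
  unfolding weight_cone_def by auto
 show "x:qchar.span ?S" unfolding S(2) using S(1) by (intro qchar.span_sum qchar.span_scale sp) blast
qed
hence "qchar.dim (weight_cone m T q \<rho>) <= card ?S" by (rule qchar.dim_le_card) simp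
also have "... <= card ({..<d} - {j})" by (rule card_image_le) simp
also have "... < d" using u(1) by simp
finally show False using dim dim_rational_characters[OF T] by simp
qed

text \<open>Clearing denominators on the basis of coordinate characters turns a rational functional
  into a genuine cocharacter \<open>z\<close>, up to the factor N.\<close>

lemma linear_functional_integral:
assumes T: "tparam d m T e" and \<nu>: "linear_functional_on (rational_characters m T) \<nu>"
shows "EX N z. (0 :: nat) < N & (ALL be. of_int (idot d be z) = of_nat N * \<nu> (qchar_of (tchar d T e be)))"
proof -
let ?b = "%j. qchar_of (tchar d T e (unit_exp j))"
obtain N z where N: "(0 :: nat) < N" and z: "ALL k:{..<d}. of_int (z k) = of_nat N * \<nu> (?b k)"
 using clear_denominators[OF finite_lessThan, of d "%k. \<nu> (?b k)"] by (elim exE conjE) (rule that)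
have b: "?b j:rational_characters m T" for j
 unfolding rational_characters_def using tchar_characters[OF T] by (intro qchar.span_base imageI)
have sub: "(SUM j:J. qscale (c j) (?b j)):rational_characters m T" for J c
 unfolding rational_characters_def using b[unfolded rational_characters_def] by (intro qchar.span_sum qchar.span_scale)
have add: "\<nu> (x + y) = \<nu> x + \<nu> y" if "x:rational_characters m T" "y:rational_characters m T" for x y
 using \<nu> that by (simp add: linear_functional_on_def)
have scale: "\<nu> (qscale c x) = c * \<nu> x" if "x:rational_characters m T" for c x
 using \<nu> that by (simp add: linear_functional_on_def)
have sum: "\<nu> (SUM j:J. qscale (c j) (?b j)) = (SUM j:J. c j * \<nu> (?b j))" if "finite J" for J c using that
proof (induction J rule: finite_induct)
 case empty
 show ?case using scale[OF sub[of c "{}"], of 0] by simp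
next
 case (insert x F)
 have "qscale (c x) (?b x):rational_characters m T" using sub[of c "{x}"] by simp
 thus ?case using insert add[OF _ sub[of c F]] scale[OF b[of x], of "c x"] by simp
qed
have "of_int (idot d be z) = of_nat N * \<nu> (qchar_of (tchar d T e be))" for be
proof -
 have "of_int (idot d be z) = (SUM k<d. of_int (be k) * (of_nat N * \<nu> (?b k)))" using z by (simp add: idot_def)
 also have "... = of_nat N * \<nu> (qchar_of (tchar d T e be))"
  unfolding qchar_of_tchar[OF T, of be] sum[OF finite_lessThan] by (simp add: sum_distrib_left mult_ac)
 finally show ?thesis .
qed
thus ?thesis using N by blast
qed

text \<open>A rational character has many presentations as a fraction of a character. Two of them
  agree after raising to a common power, and evaluation at the point \<open>e (tpow l 2)\<close>
  shows that they give the same rational number.\<close>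

lemma pairing_tchar:
assumes T: "tparam d m T e" and mu: "mu:one_param_subgroups m T" "!!t. t ~= 0 ==> mu (scalar1 t) = e (tpow l t)"
shows "pairing m T (qchar_of (tchar d T e de)) mu = of_int (idot d de l)"
proof -
have cp: "char_pairing (tchar d T e al) mu = idot d al l" for al
 by (rule char_pairing_eq) (simp add: mu(2) tchar_e[OF T] tpow_nz lmon_tpow)
show ?thesis unfolding pairing_def
proof (rule the_equality)
 show "EX ph:characters m T. EX N>0::nat. qchar_of (tchar d T e de) = qscale (1 / of_nat N) (qchar_of ph) &
  of_int (idot d de l) = of_int (char_pairing ph mu) / (of_nat N :: rat)"
  by (intro bexI[OF _ tchar_characters[OF T, of de]] exI[of _ 1]) (simp add: cp)
next
 fix q :: rat assume "EX ph:characters m T. EX N>0::nat. qchar_of (tchar d T e de) = qscale (1 / of_nat N) (qchar_of ph) &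
  q = of_int (char_pairing ph mu) / of_nat N"
 then obtain ph N where ph: "ph:characters m T" and N: "(0 :: nat) < N"
  and eq: "qchar_of (tchar d T e de) = qscale (1 / of_nat N) (qchar_of ph)" and q: "q = of_int (char_pairing ph mu) / of_nat N"
  by (elim bexE exE conjE) (rule that)
 obtain al where al: "ph = tchar d T e al" using characters_tchar[OF T ph] by blast
 have "qchar_of (%A. tchar d T e de A powi int N) = qscale (of_int (int N)) (qchar_of (tchar d T e de))"
  by (rule qchar_of_powi) (rule tchar_nonzero[OF T])
 also have "... = qchar_of (tchar d T e al)" unfolding eq al using N by simp
 finally have "EX k>0. ALL A. (tchar d T e de A powi int N) ^ k = tchar d T e al A ^ k"
  by (subst (asm) qchar_of_eq_iff) (simp_all add: tchar_nonzero[OF T])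
 then obtain k where k: "0 < k" "ALL A. (tchar d T e de A powi int N) ^ k = tchar d T e al A ^ k" by (elim exE conjE) (rule that)
 have "tchar d T e ga (e (tpow l 2)) = 2 powi idot d ga l" for ga
  using tchar_e[OF T tpow_nz[of 2 l], of ga] lmon_tpow[of 2 d ga l] by simp
 hence "((2 powi idot d de l) powi int N) ^ k = (2 powi idot d al l :: complex) ^ k"
  using spec[OF k(2), of "e (tpow l 2)"] by simp
 hence "(2 :: complex) powi (idot d de l * int N * int k) = 2 powi (idot d al l * int k)" by (simp add: power_int_mult)
 hence e1: "idot d al l = idot d de l * int N" unfolding powi_2_inj using k(1) by simp
 show "q = of_int (idot d de l)"
  unfolding q al cp e1 of_int_mult of_int_of_nat_eq by (rule nonzero_mult_div_cancel_right) (use N in simp)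
qed
qed

section \<open>Weight components of vectors, and the weights of a representation\<close>

lemma mat_vec_entry: "A:sqm m ==> v:carrier_vec m ==> i < m ==> (A *\<^sub>v v) $ i = (SUM l = 0..<m. A $$ (i, l) * v $ l)"
by (simp add: scalar_prod_def)

lemma expansion_vec:
assumes e: "lhom r m e" and x: "expansion r m e W E" and c: "c:nz" "v:carrier_vec m" "i < m"
shows "(e c *\<^sub>v v) $ i = (SUM al:W. (E al *\<^sub>v v) $ i * lmon r al c)"
proof -
note X = expD[OF x]
have "(e c *\<^sub>v v) $ i = (SUM l = 0..<m. SUM al:W. E al $$ (i, l) * v $ l * lmon r al c)"
 unfolding mat_vec_entry[OF lhomD(2)[OF e c(1)] c(2,3)] using c(3) by (simp add: X(4)[OF c(1)] sum_distrib_left mult_ac)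
also have "... = (SUM al:W. SUM l = 0..<m. E al $$ (i, l) * v $ l * lmon r al c)" by (rule sum.swap)
finally show ?thesis by (simp add: mat_vec_entry[OF X(3) c(2,3)] sum_distrib_right)
qed

lemma expansion_vec_sum:
assumes e: "lhom r m e" and x: "expansion r m e W E" and v: "v:carrier_vec m" "i < m"
shows "(SUM al:W. (E al *\<^sub>v v) $ i) = v $ i" using expansion_vec[OF e x nz_one v] v by (simp add: lhom_one[OF e])

lemma expansion_vec_idem:
assumes e: "lhom r m e" and x: "expansion r m e W E" and v: "v:carrier_vec m" and ab: "al:W" "be:W"
shows "E al *\<^sub>v (E be *\<^sub>v v) = (if al = be then E al *\<^sub>v v else 0\<^sub>v m)"
proof -
note X = expD[OF x]
have "E al *\<^sub>v (E be *\<^sub>v v) = (E al * E be) *\<^sub>v v" using assoc_mult_mat_vec[OF X(3) X(3) v] by simp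
thus ?thesis unfolding expansion_orthogonal[OF e x ab] using v by (auto intro!: eq_vecI)
qed

lemma expansion_vec_weight:
assumes e: "lhom r m e" and x: "expansion r m e W E" and v: "v:carrier_vec m" and al: "al:W" and c: "c:nz"
shows "e c *\<^sub>v (E al *\<^sub>v v) = lmon r al c \<cdot>\<^sub>v (E al *\<^sub>v v)"
proof (rule eq_vecI)
note X = expD[OF x]
have Ev: "E al *\<^sub>v v:carrier_vec m" using X(3)[of al] v by simp
fix i assume "i < dim_vec (lmon r al c \<cdot>\<^sub>v (E al *\<^sub>v v))"
hence i: "i < m" using X(3)[of al] by simp
have "(e c *\<^sub>v (E al *\<^sub>v v)) $ i = (SUM be:W. (E be *\<^sub>v (E al *\<^sub>v v)) $ i * lmon r be c)"
 by (rule expansion_vec[OF e x c Ev i])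
also have "... = (SUM be:W. if be = al then (E al *\<^sub>v v) $ i * lmon r al c else 0)"
 using i by (intro sum.cong) (auto simp: expansion_vec_idem[OF e x v _ al])
also have "... = (E al *\<^sub>v v) $ i * lmon r al c" using al X(1) by simp
finally show "(e c *\<^sub>v (E al *\<^sub>v v)) $ i = (lmon r al c \<cdot>\<^sub>v (E al *\<^sub>v v)) $ i" using i X(3)[of al] by simp
qed (use lhomD(2)[OF e c] expD(3)[OF x, of al] in auto)

lemma nonzero_column:
fixes A :: "complex mat"
assumes "A:sqm m" "A ~= 0\<^sub>m m m"
shows "EX v:carrier_vec m. A *\<^sub>v v ~= 0\<^sub>v m"
proof (rule ccontr)
assume no: "~ ?thesis"
have "A = 0\<^sub>m m m"
proof (rule eq_matI)
 fix i j assume "i < dim_row (0\<^sub>m m m :: complex mat)" "j < dim_col (0\<^sub>m m m :: complex mat)"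
 hence ij: "i < m" "j < m" by simp_all
 have "A *\<^sub>v unit_vec m j = 0\<^sub>v m" using no unit_vec_carrier by blast
 hence "(A *\<^sub>v unit_vec m j) $ i = 0" using ij by simp
 thus "A $$ (i, j) = 0\<^sub>m m m $$ (i, j)" using ij assms(1) by simp
qed (use assms(1) in auto)
thus False using assms(2) by simp
qed

lemma rep_lhom:
assumes e: "lhom d m e" and \<rho>: "\<rho>:algebraic_hom m G q (GLs q)" and sub: "e ` nz <= G"
shows "lhom d q (%c. \<rho> (e c))" unfolding lhom_def
proof (intro conjI ballI allI impI)
note R = alg_homD[OF \<rho>]
have G: "e c:G" if "c:nz" for c using sub that by blast
show "\<rho> (e c):GLs q" if "c:nz" for c using R(1) G that by blast
show "\<rho> (e (%i. c i * c' i)) = \<rho> (e c) * \<rho> (e c')" if "c:nz" "c':nz" for c c'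
 unfolding lhomD(3)[OF e that] using G that by (intro R(2))
show "laurent d (%c. \<rho> (e c) $$ (i, j))" if "i < q" "j < q" for i j
 by (rule laurent_regular[OF e regular_on_subset[OF R(3)[OF that] sub]])
qed

text \<open>Nonzero columns of \<open>E al\<close> are weight vectors. Conversely, a weight vector
  whose exponent is missing from \<open>W\<close> would give a nontrivial relation between distinct
  monomials.\<close>

lemma weights_expansion:
assumes T: "tparam d m T e" and \<rho>: "lhom d q (%c. \<rho> (e c))"
 and x: "expansion d q (%c. \<rho> (e c)) W E" and E0: "ALL al:W. E al ~= 0\<^sub>m q q"
shows "weights m T q \<rho> = tchar d T e ` W"
proof (intro equalityI subsetI)
note X = expD[OF x] and TT = tparamD[OF T]
fix ph assume "ph:tchar d T e ` W"
then obtain al where al: "al:W" "ph = tchar d T e al" by blast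
obtain v where v: "v:carrier_vec q" "E al *\<^sub>v v ~= 0\<^sub>v q" using nonzero_column[OF X(3)] E0 al(1) by blast
have "E al *\<^sub>v v:weight_space T q \<rho> ph" unfolding weight_space_def
proof (intro CollectI conjI ballI)
 show "E al *\<^sub>v v:carrier_vec q" using X(3)[of al] v(1) by simp
 fix s assume "s:T"
 then obtain u where u: "u:nz" "s = e u" using TT(2) by blast
 show "\<rho> s *\<^sub>v (E al *\<^sub>v v) = ph s \<cdot>\<^sub>v (E al *\<^sub>v v)"
  unfolding u(2) al(2) tchar_e[OF T u(1)] by (rule expansion_vec_weight[OF \<rho> x v(1) al(1) u(1)])
qed
hence "weight_space T q \<rho> ph ~= {0\<^sub>v q}" using v(2) by blast
thus "ph:weights m T q \<rho>" unfolding weights_def al(2) using tchar_characters[OF T] by simp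
next
note X = expD[OF x] and TT = tparamD[OF T]
fix ph assume ph: "ph:weights m T q \<rho>"
obtain be where be: "be:exps d" "ph = tchar d T e be" using characters_tchar[OF T, of ph] ph by (auto simp: weights_def)
have "0\<^sub>v q:weight_space T q \<rho> ph"
proof -
 have "\<rho> s *\<^sub>v 0\<^sub>v q = ph s \<cdot>\<^sub>v 0\<^sub>v q" if s: "s:T" for s
 proof -
  obtain u where u: "u:nz" "s = e u" using TT(2) s by blast
  have "\<rho> s:sqm q" unfolding u(2) by (rule lhomD(2)[OF \<rho> u(1)])
  thus ?thesis by (intro eq_vecI) auto
 qed
 thus ?thesis by (simp add: weight_space_def)
qed
then obtain v where v: "v:weight_space T q \<rho> ph" "v ~= 0\<^sub>v q" using ph unfolding weights_def by blast
have vc: "v:carrier_vec q" using v(1) by (simp add: weight_space_def)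
obtain i where i: "i < q" "v $ i ~= 0"
proof -
 have "EX i<q. v $ i ~= 0"
 proof (rule ccontr)
  assume "~ (EX i<q. v $ i ~= 0)"
  hence "v = 0\<^sub>v q" using vc by (intro eq_vecI) auto
  thus False using v(2) by simp
 qed
 thus thesis using that by blast
qed
have "be:W"
proof (rule ccontr)
 assume beW: "be \<notin> W"
 have "ALL al:insert be W. (if al = be then - v $ i else (E al *\<^sub>v v) $ i) = 0"
 proof (rule lmon_independent)
  show "finite (insert be W)" "insert be W <= exps d" using X(1,2) be(1) by simp_all
  fix c assume c: "c:nz"
  have "\<rho> (e c) *\<^sub>v v = lmon d be c \<cdot>\<^sub>v v"
  using v(1) TT(3)[OF c] tchar_e[OF T c, of be] by (simp add: weight_space_def be(2))
  hence "(SUM al:W. (E al *\<^sub>v v) $ i * lmon d al c) = lmon d be c * v $ i"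
  using expansion_vec[OF \<rho> x c vc i(1)] i(1) vc by simp
  moreover have "(SUM al:W. (if al = be then - v $ i else (E al *\<^sub>v v) $ i) * lmon d al c) = (SUM al:W. (E al *\<^sub>v v) $ i * lmon d al c)"
  using beW by (intro sum.cong) auto
  ultimately show "(SUM al:insert be W. (if al = be then - v $ i else (E al *\<^sub>v v) $ i) * lmon d al c) = 0"
  using beW X(1) by (simp add: mult.commute)
 qed
 hence "(if be = be then - v $ i else (E be *\<^sub>v v) $ i) = 0" by (rule bspec) simp
 thus False using i(2) by simp
qed
thus "ph:tchar d T e ` W" using be(2) by blast
qed

section \<open>Bounds on exponents that are uniform in the torus\<close>

definition box :: "nat => nat => (nat => int) set" where
"box m B = {al:exps m. ALL i. \<bar>al i\<bar> <= int B}"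

lemma finite_box: "finite (box m B)"
proof (rule finite_subset)
show "box m B <= {f. ALL x. (x:{..<m} --> f x:{- int B..int B}) & (x \<notin> {..<m} --> f x = 0)}"
 by (auto simp: box_def exps_def abs_le_iff minus_le_iff)
show "finite {f. ALL x. (x:{..<m} --> f x:{- int B..int B}) & (x \<notin> {..<m} --> f x = 0)}"
 by (rule finite_set_of_finite_funs) simp_all
qed

lemma box_exps: "box m B <= exps m" by (simp add: box_def)

lemma box_mono: "B <= B' ==> box m B <= box m B'" unfolding box_def by (auto intro: order_trans)

lemma box_add: "al:box m B ==> be:box m B' ==> (%i. al i + be i):box m (B + B')"
unfolding box_def exps_def by (auto intro!: order_trans[OF abs_triangle_ineq] add_mono)

lemma box_diff: "al:box m B ==> be:box m B' ==> (%i. al i - be i):box m (B + B')"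
unfolding box_def exps_def by (auto intro!: order_trans[OF abs_triangle_ineq4] add_mono)

definition boxed :: "nat => nat => ((nat => complex) => complex) => bool" where
"boxed m B F \<longleftrightarrow> (EX k. ALL c:nz. F c = (SUM al:box m B. k al * lmon m al c))"

lemma boxed_cong: "boxed m B F ==> (!!c. c:nz ==> F c = G c) ==> boxed m B G" by (simp add: boxed_def)

lemma boxed_weaken:
assumes "boxed m B F" "B <= B'"
shows "boxed m B' F"
proof -
obtain k where k: "ALL c:nz. F c = (SUM al:box m B. k al * lmon m al c)" using assms(1) unfolding boxed_def ..
have "F c = (SUM al:box m B'. (if al:box m B then k al else 0) * lmon m al c)" if "c:nz" for c
 unfolding bspec[OF k that] by (rule sum.mono_neutral_cong_left[OF finite_box box_mono[OF assms(2)]]) simp_all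
thus ?thesis unfolding boxed_def by (intro exI[of _ "%al. if al:box m B then k al else 0"] ballI)
qed

lemma boxed_single:
assumes "al:box m B"
shows "boxed m B (%c. a * lmon m al c)"
proof -
have "a * lmon m al c = (SUM be:box m B. (if be = al then a else 0) * lmon m be c)" for c
proof -
 have "(SUM be:box m B. (if be = al then a else 0) * lmon m be c) = (SUM be:box m B. if be = al then a * lmon m al c else 0)"
  by (rule sum.cong) auto
 thus ?thesis using assms by (simp add: finite_box)
qed
thus ?thesis unfolding boxed_def by (intro exI[of _ "%be. if be = al then a else 0"] ballI)
qed

lemma boxed_add:
assumes "boxed m B F" "boxed m B G"
shows "boxed m B (%c. F c + G c)"
proof -
obtain k where k: "ALL c:nz. F c = (SUM al:box m B. k al * lmon m al c)" using assms(1) unfolding boxed_def ..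
obtain l where l: "ALL c:nz. G c = (SUM al:box m B. l al * lmon m al c)" using assms(2) unfolding boxed_def ..
have "F c + G c = (SUM al:box m B. (k al + l al) * lmon m al c)" if "c:nz" for c
 unfolding bspec[OF k that] bspec[OF l that] by (simp only: sum.distrib distrib_right)
thus ?thesis unfolding boxed_def by (intro exI[of _ "%al. k al + l al"] ballI)
qed

lemma boxed_zero: "boxed m B (%_. 0)" unfolding boxed_def by (rule exI[of _ "%_. 0"]) simp

lemma boxed_sum: "(!!i. i:I ==> boxed m B (F i)) ==> boxed m B (%c. SUM i:I. F i c)"
by (induction I rule: infinite_finite_induct) (simp_all add: boxed_zero boxed_add)

lemma boxed_mult:
assumes "boxed m B F" "boxed m B' G"
shows "boxed m (B + B') (%c. F c * G c)"
proof -
obtain k where k: "ALL c:nz. F c = (SUM al:box m B. k al * lmon m al c)" using assms(1) unfolding boxed_def ..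
obtain l where l: "ALL c:nz. G c = (SUM al:box m B'. l al * lmon m al c)" using assms(2) unfolding boxed_def ..
have "boxed m (B + B') (%c. SUM al:box m B. SUM be:box m B'. (k al * l be) * lmon m (%i. al i + be i) c)"
 by (rule boxed_sum, rule boxed_sum, rule boxed_single, rule box_add)
thus ?thesis
proof (rule boxed_cong)
 fix c assume c: "c:nz"
 show "(SUM al:box m B. SUM be:box m B'. (k al * l be) * lmon m (%i. al i + be i) c) = F c * G c"
  unfolding bspec[OF k c] bspec[OF l c] sum_product lmon_add[OF c] by (simp only: mult_ac)
qed
qed

lemma boxed_const: "boxed m 0 (%_. a)" using boxed_single[of "%_. 0" m 0 a] by (simp add: box_def exps_def)

lemma boxed_prod:
assumes "finite I" "!!i. i:I ==> boxed m B (F i)"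
shows "boxed m (card I * B) (%c. PROD i:I. F i c)" using assms
proof (induction I rule: finite_induct)
case empty
show ?case using boxed_const[of m 1] by simp
next
case (insert x I)
thus ?case using boxed_mult[of m B "F x" "card I * B" "%c. PROD i:I. F i c"] by simp
qed

text \<open>Models the diagonal torus of an eigenspace decomposition. As the entries are linear in
  the coordinates, degrees can be bounded without knowing the decomposition.\<close>

definition linear_lhom :: "nat => nat => ((nat => complex) => complex mat) => bool" where
"linear_lhom m n e \<longleftrightarrow> lhom m n e & (ALL i<n. ALL j<n. EX E. ALL c:nz. e c $$ (i, j) = (SUM k<m. E k * c k))"

lemma linear_lhom_entry:
assumes e: "linear_lhom m n e" and ij: "i < n" "j < n"
shows "boxed m 1 (%c. e c $$ (i, j))"
proof -
obtain E where E: "ALL c:nz. e c $$ (i, j) = (SUM k<m. E k * c k)" using e ij unfolding linear_lhom_def by blast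
have "boxed m 1 (%c. SUM k<m. E k * lmon m (unit_exp k) c)"
proof (rule boxed_sum, rule boxed_single)
 fix k assume "k:{..<m}"
 thus "unit_exp k:box m 1" by (auto simp: box_def exps_def unit_exp_def)
qed
thus ?thesis by (rule boxed_cong) (simp add: E lmon_unit_exp)
qed

text \<open>The order of quantifiers is the point: \<open>B\<close> depends on \<open>p\<close>
  alone. For \<open>1 / det\<close>, the determinant has exponents in the box of size n and is
  multiplicative, so it is a single monomial of that box; the box is symmetric and also contains the
  exponent of the inverse.\<close>

lemma regular_boxed:
assumes "p:regular_fun n"
shows "EX B. ALL m e. linear_lhom m n e --> boxed m B (%c. p (e c))" using assms
proof induction
case (const c)
thus ?case using boxed_const by blast
next
case (entry i j)
thus ?case using linear_lhom_entry by blast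
next
case inverse_det
have "boxed m n (%c. 1 / det (e c))" if lin: "linear_lhom m n e" for m e
proof -
 have e: "lhom m n e" using lin by (simp add: linear_lhom_def)
 note E = lhomD[OF e]
 have dt: "boxed m n (%c. det (e c))"
 proof (rule boxed_cong)
  have "boxed m (0 + card {0..<n} * 1) (%c. signof p * (PROD i = 0..<n. e c $$ (i, p i)))" if "p:{p. p permutes {0..<n}}" for p
  proof (rule boxed_mult[OF boxed_const boxed_prod])
  fix i assume "i:{0..<n}"
  thus "boxed m 1 (%c. e c $$ (i, p i))"
   using that permutes_in_image[of p "{0..<n}" i] by (intro linear_lhom_entry[OF lin]) simp_all
  qed simp
  thus "boxed m n (%c. SUM p:{p. p permutes {0..<n}}. signof p * (PROD i = 0..<n. e c $$ (i, p i)))" by (intro boxed_sum) simp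
  show "(SUM p:{p. p permutes {0..<n}}. signof p * (PROD i = 0..<n. e c $$ (i, p i))) = det (e c)"
  if "c:nz" for c using det_def'[OF E(2)[OF that]] by simp
 qed
 have "EX al:exps m. ALL c:nz. det (e c) = lmon m al c"
 proof (rule laurent_multiplicative)
  show "laurent m (%c. det (e c))" using E(2,4) by (rule laurent_det)
  show "det (e (%i. c i * c' i)) = det (e c) * det (e c')" if "c:nz" "c':nz" for c c'
  unfolding E(3)[OF that] by (rule det_mult[OF E(2)[OF that(1)] E(2)[OF that(2)]])
  show "det (e c) ~= 0" if "c:nz" for c by (rule GL_det[OF E(1)[OF that]])
 qed
 then obtain al where al: "al:exps m" "ALL c:nz. det (e c) = lmon m al c" ..
 obtain k where k: "ALL c:nz. det (e c) = (SUM be:box m n. k be * lmon m be c)" using dt unfolding boxed_def ..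
 have "al:box m n"
 proof (rule ccontr)
  assume no: "al \<notin> box m n"
  have "ALL be:insert al (box m n). (if be = al then - 1 else k be) = 0"
  proof (rule lmon_independent)
  show "finite (insert al (box m n))" "insert al (box m n) <= exps m" using finite_box box_exps al(1) by simp_all
  fix c assume c: "c:nz"
  have "(SUM be:box m n. (if be = al then - 1 else k be) * lmon m be c) = (SUM be:box m n. k be * lmon m be c)"
   using no by (intro sum.cong) auto
  also have "... = lmon m al c" using bspec[OF k c] bspec[OF al(2) c] by simp
  finally show "(SUM be:insert al (box m n). (if be = al then - 1 else k be) * lmon m be c) = 0"
   using no by (simp add: finite_box)
  qed
  hence "(if al = al then - 1 else k al) = 0" by (rule bspec) simp
  thus False by simp
 qed
 hence "(%i. - al i):box m n" by (simp add: box_def exps_def)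
 hence "boxed m n (%c. 1 * lmon m (%i. - al i) c)" by (rule boxed_single)
 thus ?thesis
 proof (rule boxed_cong)
  fix c assume c: "c:nz"
  have "lmon m (%i. - al i) c = inverse (lmon m al c)" using lmon_inverse[of m al c] lmon_inverse'[of m al c] by simp
  thus "1 * lmon m (%i. - al i) c = 1 / det (e c)" using bspec[OF al(2) c] by (simp add: inverse_eq_divide)
 qed
qed
thus ?case by blast
next
case (add p q)
then obtain B where B: "!!m e. linear_lhom m n e ==> boxed m B (%c. p (e c))" by blast
obtain B' where B': "!!m e. linear_lhom m n e ==> boxed m B' (%c. q (e c))" using add by blast
have "boxed m (max B B') (%c. p (e c) + q (e c))" if "linear_lhom m n e" for m e
 by (intro boxed_add boxed_weaken[OF B[OF that]] boxed_weaken[OF B'[OF that]]) simp_all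
thus ?case by blast
next
case (mult p q)
then obtain B where B: "!!m e. linear_lhom m n e ==> boxed m B (%c. p (e c))" by blast
obtain B' where B': "!!m e. linear_lhom m n e ==> boxed m B' (%c. q (e c))" using mult by blast
have "boxed m (B + B') (%c. p (e c) * q (e c))" if "linear_lhom m n e" for m e by (rule boxed_mult[OF B[OF that] B'[OF that]])
thus ?case by blast
qed

lemma uniform_boxed:
assumes "finite P" "P <= regular_fun n"
shows "EX B. ALL p:P. ALL m e. linear_lhom m n e --> boxed m B (%c. p (e c))"
proof -
have "ALL p:P. EX B. ALL m e. linear_lhom m n e --> boxed m B (%c. p (e c))" using regular_boxed assms(2) by blast
from bchoice[OF this] obtain B where B: "ALL p:P. ALL m e. linear_lhom m n e --> boxed m (B p) (%c. p (e c))" ..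
have "boxed m (SUM p:P. B p) (%c. p (e c))" if "p:P" "linear_lhom m n e" for p m e
proof (rule boxed_weaken)
 show "boxed m (B p) (%c. p (e c))" using B that by blast
 show "B p <= (SUM p:P. B p)" using that(1) assms(1) by (intro member_le_sum) simp_all
qed
thus ?thesis by (intro exI[of _ "SUM p:P. B p"] ballI allI impI)
qed

text \<open>The differentials at the identity of the functions vanishing on \<open>G\<close> live in
  a space of dimension n * n, so finitely many of them span all. They are encoded by the matrices
  \<open>M p\<close>, and evaluated on x through the trace of \<open>M p\<close> times the transpose
  of x.\<close>

lemma lie_finite_equations: "EX P. finite P & P <= vanishing n G &
(ALL x:carrier_mat n n. (ALL p:P. ddir n p (1\<^sub>m n) x = 0) --> x:lie n G)"
proof -
define M where "M p = mat n n (%(i, j). grad n p i j (1\<^sub>m n))" for p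
have Mc: "M p:sqm n" for p by (simp add: M_def)
have dd: "ddir n p (1\<^sub>m n) x = ltr n (of_mat n (M p) * of_mat n (transpose_mat x))" if x: "x:sqm n" for p x
proof -
 have xt: "transpose_mat x:sqm n" using x by simp
 have "ltr n (of_mat n (M p) * of_mat n (transpose_mat x)) = (SUM i<n. (M p * transpose_mat x) $$ (i, i))"
  using ltr_of_mat[of n "M p * transpose_mat x"] of_mat_times[OF Mc xt] by simp
 also have "... = (SUM i<n. SUM j = 0..<n. M p $$ (i, j) * transpose_mat x $$ (j, i))"
  by (intro sum.cong refl sq_entry[OF Mc xt]) simp_all
 also have "... = (SUM i<n. SUM j<n. grad n p i j (1\<^sub>m n) * x $$ (i, j))" using x by (simp add: M_def atLeast0LessThan)
 finally show ?thesis by (simp add: ddir_def)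
qed
define S where "S = (%p. of_mat n (M p)) ` vanishing n G"
obtain B where B: "B <= S" "lop.independent B" "S <= lop.span B" by (rule lop.maximal_independent_subset[of S])
have "B <= mats n" using B(1) Mc unfolding S_def mats_def by blast
hence "B <= lop.span ((%(i, j). of_mat n (mat_unit n i j)) ` ({..<n} \<times> {..<n}))" using mats_span by blast
hence fB: "finite B" using lop.independent_span_bound[of "(%(i, j). of_mat n (mat_unit n i j)) ` ({..<n} \<times> {..<n})" B] B(2) by simp
obtain P where P: "P <= vanishing n G" "finite P" "B = (%p. of_mat n (M p)) ` P"
 using finite_subset_image[OF fB B(1)[unfolded S_def]] by blast
have "x:lie n G" if x: "x:sqm n" and z: "ALL p:P. ddir n p (1\<^sub>m n) x = 0" for x unfolding lie_def
proof (intro CollectI conjI x ballI)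
 fix p assume p: "p:vanishing n G"
 let ?V = "{f. ltr n (f * of_mat n (transpose_mat x)) = 0}"
 have "lop.subspace ?V" unfolding lop.subspace_def
 proof (intro conjI ballI allI)
  have "ltr n (lscale 0 0) = 0" unfolding ltr_scale by simp
  thus "0:?V" by simp
 qed (simp_all add: distrib_right ltr_add lop.scale_mult_left ltr_scale)
 moreover have "B <= ?V" unfolding P(3) using z dd[OF x] by auto
 ultimately have "lop.span B <= ?V" by (intro lop.span_minimal)
 moreover have "of_mat n (M p):lop.span B" using B(3) p unfolding S_def by blast
 ultimately have "of_mat n (M p):?V" by blast
 thus "ddir n p (1\<^sub>m n) x = 0" using dd[OF x] by simp
qed
thus ?thesis using P(1,2) by blast
qed

section \<open>The diagonal torus containing a given torus\<close>

definition eigen_param :: "nat => nat => ((nat => complex) => complex mat) => nat => (nat => nat => int)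
 => ((nat => int) => complex mat) => bool" where
"eigen_param h n e m w E \<longleftrightarrow> lhom h n e & expansion h n e (w ` {..<m}) E & inj_on w {..<m} &
 (ALL al:w ` {..<m}. E al ~= 0\<^sub>m n n)"

text \<open>The matrix that scales the k-th weight space of \<open>e\<close> by \<open>z k\<close>;
  the torus itself consists of the points where \<open>z k\<close> is the value of the weight
  \<open>w k\<close>.\<close>

definition ez :: "nat => nat => (nat => nat => int) => ((nat => int) => complex mat) => (nat => complex) => complex mat" where
"ez n m w E z = mat n n (%ij. SUM k<m. E (w k) $$ ij * z k)"

lemma ez_carrier [simp]: "ez n m w E z:sqm n" by (simp add: ez_def)

lemma ez_index: "i < n ==> j < n ==> ez n m w E z $$ (i, j) = (SUM k<m. E (w k) $$ (i, j) * z k)" by (simp add: ez_def)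

text \<open>The bound m <= n, needed for finiteness of the set of configurations, holds because
  nonzero vectors of distinct weights are linearly independent: more than n of them would satisfy a
  relation, and the projections isolate its terms.\<close>

lemma eigen_param_exists:
assumes e: "lhom h n e"
shows "EX m w E. m <= n & eigen_param h n e m w E"
proof -
obtain W E where x: "expansion h n e W E" and E0: "ALL al:W. E al ~= 0\<^sub>m n n"
 using expansion_exists[OF e] by (elim exE conjE) (rule that)
note X = expD[OF x]
obtain w where w: "bij_betw w {..<card W} W" using ex_bij_betw_nat_finite[OF X(1)] by (auto simp: atLeast0LessThan)
hence im: "w ` {..<card W} = W" and inj: "inj_on w {..<card W}" by (simp_all add: bij_betw_def)
have "card W <= n"
proof (rule ccontr)
 assume "~ card W <= n"
 have "ALL al:W. EX v. v:carrier_vec n & E al *\<^sub>v v ~= 0\<^sub>v n" using nonzero_column[OF X(3)] E0 by blast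
 from bchoice[OF this] obtain v where v: "ALL al:W. v al:carrier_vec n & E al *\<^sub>v v al ~= 0\<^sub>v n" ..
 define y where "y al = E al *\<^sub>v v al" for al
 have y: "y al:carrier_vec n" if "al:W" for al unfolding y_def using X(3)[of al] v that by simp
 obtain u where u: "EX al:W. u al ~= 0" "ALL j:{..<n}. (SUM al:W. y al $ j * u al) = 0"
  using underdetermined_system[OF X(1), of "{..<n}" "%j al. y al $ j"] \<open>~ card W <= n\<close> by auto
 obtain be where be: "be:W" "u be ~= 0" using u(1) by blast
 have "y be = 0\<^sub>v n"
 proof (rule eq_vecI)
  fix l assume "l < dim_vec (0\<^sub>v n :: complex Matrix.vec)"
  hence l: "l < n" by simp
  have "0 = (SUM j = 0..<n. E be $$ (l, j) * (SUM al:W. y al $ j * u al))" using u(2) by simp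
  also have "... = (SUM j = 0..<n. SUM al:W. E be $$ (l, j) * y al $ j * u al)" by (simp add: sum_distrib_left mult.assoc)
  also have "... = (SUM al:W. SUM j = 0..<n. E be $$ (l, j) * y al $ j * u al)" by (rule sum.swap)
  also have "... = (SUM al:W. (E be *\<^sub>v y al) $ l * u al)"
  by (rule sum.cong) (simp_all add: mat_vec_entry[OF X(3) y l] sum_distrib_right)
  also have "... = (SUM al:W. if al = be then y be $ l * u be else 0)"
  proof (rule sum.cong[OF refl])
  fix al assume al: "al:W"
  hence "v al:carrier_vec n" using v by blast
  hence "E be *\<^sub>v y al = (if be = al then E be *\<^sub>v v al else 0\<^sub>v n)"
   unfolding y_def by (rule expansion_vec_idem[OF e x _ be(1) al])
  thus "(E be *\<^sub>v y al) $ l * u al = (if al = be then y be $ l * u be else 0)" using l by (simp add: y_def)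
  qed
  also have "... = y be $ l * u be" using be(1) X(1) by simp
  finally show "y be $ l = 0\<^sub>v n $ l" using be(2) l by simp
 qed (use y[OF be(1)] in simp)
 thus False using v be(1) by (simp add: y_def)
qed
thus ?thesis unfolding eigen_param_def using e x E0 inj im by (intro exI[of _ "card W"] exI[of _ w] exI[of _ E]) simp
qed

context
fixes h n e m w E
assumes P: "eigen_param h n e m w E"
begin

lemma P': "lhom h n e" "expansion h n e (w ` {..<m}) E" "inj_on w {..<m}" "k < m ==> E (w k) ~= 0\<^sub>m n n"
using P by (simp_all add: eigen_param_def)

lemma w_exps: "k < m ==> w k:exps h" using expD(2)[OF P'(2)] by blast

lemma eigen_times: "k < m ==> l < m ==> E (w k) * E (w l) = (if k = l then E (w k) else 0\<^sub>m n n)"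
using expansion_orthogonal[OF P'(1,2), of "w k" "w l"] inj_onD[OF P'(3), of k l] by auto

lemma ez_mult: "ez n m w E z * ez n m w E z' = ez n m w E (%k. z k * z' k)"
proof (rule eq_matI)
note X = expD[OF P'(2)]
fix i j assume "i < dim_row (ez n m w E (%k. z k * z' k))" "j < dim_col (ez n m w E (%k. z k * z' k))"
hence ij: "i < n" "j < n" by (simp_all add: ez_def)
have "(ez n m w E z * ez n m w E z') $$ (i, j) = (SUM l = 0..<n. ez n m w E z $$ (i, l) * ez n m w E z' $$ (l, j))"
 by (rule sq_entry) (simp_all add: ij)
also have "... = (SUM l = 0..<n. SUM a<m. SUM b<m. E (w a) $$ (i, l) * z a * (E (w b) $$ (l, j) * z' b))"
 using ij by (simp add: ez_index sum_product)
also have "... = (SUM a<m. SUM b<m. SUM l = 0..<n. E (w a) $$ (i, l) * z a * (E (w b) $$ (l, j) * z' b))"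
 by (subst sum.swap) (rule sum.cong[OF refl], rule sum.swap)
also have "... = (SUM a<m. SUM b<m. (E (w a) * E (w b)) $$ (i, j) * (z a * z' b))"
 using ij by (simp add: sq_entry[OF X(3) X(3)] sum_distrib_left mult_ac)
also have "... = (SUM a<m. SUM b<m. if b = a then E (w a) $$ (i, j) * (z a * z' a) else 0)"
 using ij by (intro sum.cong refl) (auto simp: eigen_times)
also have "... = ez n m w E (%k. z k * z' k) $$ (i, j)" using ij by (simp add: ez_index)
finally show "(ez n m w E z * ez n m w E z') $$ (i, j) = ez n m w E (%k. z k * z' k) $$ (i, j)" .
qed (simp_all add: ez_def)

lemma ez_lmon:
assumes c: "c:nz"
shows "ez n m w E (%k. lmon h (w k) c) = e c"
proof (rule eq_matI)
fix i j assume "i < dim_row (e c)" "j < dim_col (e c)"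
hence ij: "i < n" "j < n" using lhomD(2)[OF P'(1) c] by auto
show "ez n m w E (%k. lmon h (w k) c) $$ (i, j) = e c $$ (i, j)"
 unfolding ez_index[OF ij] expD(4)[OF P'(2) c ij] sum.reindex[OF P'(3)] comp_def ..
qed (use lhomD(2)[OF P'(1) c] in \<open>auto simp: ez_def\<close>)

lemma ez_one: "ez n m w E (%_. 1) = 1\<^sub>m n" using ez_lmon[OF nz_one] lhom_one[OF P'(1)] by simp

lemma ez_GL: "(!!k. z k ~= 0) ==> ez n m w E z:GLs n"
proof -
assume z: "!!k. z k ~= 0"
have "ez n m w E z * ez n m w E (%k. inverse (z k)) = 1\<^sub>m n" unfolding ez_mult using z by (simp add: ez_one)
hence "det (ez n m w E z) * det (ez n m w E (%k. inverse (z k))) = 1"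
 using det_mult[OF ez_carrier ez_carrier, of n m w E z m w E "%k. inverse (z k)"] by simp
thus ?thesis by (auto simp: GL_carrier)
qed

lemma linear_lhom_ez: "linear_lhom m n (ez n m w E)" unfolding linear_lhom_def
proof (intro conjI allI impI)
show "lhom m n (ez n m w E)" unfolding lhom_def
proof (intro conjI ballI allI impI)
 show "ez n m w E c:GLs n" if "c:nz" for c using that by (intro ez_GL) (simp add: nz_def)
 show "ez n m w E (%i. c i * c' i) = ez n m w E c * ez n m w E c'" for c c' by (rule ez_mult[symmetric])
 fix i j assume ij: "i < n" "j < n"
 have "laurent m (%c. SUM k<m. E (w k) $$ (i, j) * lmon m (unit_exp k) c)" by (rule laurent_sum, rule laurent_lmon)
 thus "laurent m (%c. ez n m w E c $$ (i, j))" by (rule laurent_cong) (simp add: ez_index[OF ij] lmon_unit_exp)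
qed
show "EX E'. ALL c:nz. ez n m w E c $$ (i, j) = (SUM k<m. E' k * c k)" if "i < n" "j < n" for i j
 by (intro exI[of _ "%k. E (w k) $$ (i, j)"] ballI ez_index[OF that])
qed

lemma ez_inj:
assumes "ez n m w E z = ez n m w E z'" "k < m"
shows "z k = z' k"
proof -
note X = expD[OF P'(2)]
obtain v where v: "v:carrier_vec n" "E (w k) *\<^sub>v v ~= 0\<^sub>v n" using nonzero_column[OF X(3) P'(4)[OF assms(2)]] by blast
have "EX i<n. EX j<n. E (w k) $$ (i, j) ~= 0"
proof (rule ccontr)
 assume no: "~ ?thesis"
 have "E (w k) = 0\<^sub>m n n"
 proof (rule eq_matI)
  fix i j assume "i < dim_row (0\<^sub>m n n :: complex mat)" "j < dim_col (0\<^sub>m n n :: complex mat)"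
  thus "E (w k) $$ (i, j) = 0\<^sub>m n n $$ (i, j)" using no by simp
 qed (use X(3)[of "w k"] in auto)
 thus False using P'(4)[OF assms(2)] by simp
qed
then obtain i j where ij: "i < n" "j < n" "E (w k) $$ (i, j) ~= 0" by blast
have "(E (w k) * ez n m w E y) $$ (i, j) = E (w k) $$ (i, j) * y k" for y
proof -
 have "(E (w k) * ez n m w E y) $$ (i, j) = (SUM l = 0..<n. SUM b<m. E (w k) $$ (i, l) * (E (w b) $$ (l, j) * y b))"
  unfolding sq_entry[OF X(3) ez_carrier ij(1,2)] using ij by (simp add: ez_index sum_distrib_left)
 also have "... = (SUM b<m. SUM l = 0..<n. E (w k) $$ (i, l) * (E (w b) $$ (l, j) * y b))" by (rule sum.swap)
 also have "... = (SUM b<m. (E (w k) * E (w b)) $$ (i, j) * y b)"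
  using ij by (simp add: sq_entry[OF X(3) X(3)] sum_distrib_right mult.assoc)
 also have "... = (SUM b<m. if b = k then E (w k) $$ (i, j) * y k else 0)"
  using ij assms(2) by (intro sum.cong refl) (auto simp: eigen_times)
 finally show ?thesis using assms(2) by simp
qed
hence "E (w k) $$ (i, j) * z k = E (w k) $$ (i, j) * z' k" using assms(1) by metis
thus ?thesis using ij(3) by simp
qed

text \<open>The polynomials in \<open>z\<close> given by \<open>P\<close> have exponents in a fixed box, and they vanish on the
  torus; hence the sums of their coefficients over the classes of exponents that agree on the torus
  are zero. So they vanish on every one-parameter group of diagonal matrices that does not separate
  these classes, and this group is tangent to \<open>H\<close>.\<close>

lemma torus_rigidity:
assumes H: "algebraic_group n H" and TH: "maximal_torus n H TH" and T: "tparam h n TH e"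
 and P: "P <= vanishing n H" "!!x. x:sqm n ==> (ALL p:P. ddir n p (1\<^sub>m n) x = 0) ==> x:lie n H"
 and B: "!!p. p:P ==> boxed m B (%z. p (ez n m w E z))"
 and a: "!!ka. ka:box m (B + B) ==> (!!k. k < h ==> (SUM i<m. ka i * w i k) = 0) ==> idot m ka a = 0"
shows "EX l. ALL i<m. idot h (w i) l = a i"
proof -
note TT = tparamD[OF T]
have subH: "TH <= H" using TH by (simp add: maximal_torus_def)
let ?W = "%al. trunc h (%k. SUM i<m. al i * w i k)"
have pz: "p (ez n m w E (tpow a t)) = 0" if p: "p:P" and t: "t ~= 0" for p t
proof -
 obtain k where k: "ALL c:nz. p (ez n m w E c) = (SUM al:box m B. k al * lmon m al c)" using B[OF p] unfolding boxed_def ..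
 have cls: "ALL u:?W ` box m B. (SUM al:{al:box m B. ?W al = u}. k al) = 0"
 proof (rule lmon_independent)
  show "finite (?W ` box m B)" using finite_box by simp
  show "?W ` box m B <= exps h" by auto
  fix c assume c: "c:nz"
  define z where "z i = lmon h (w i) c" for i
  have z: "z:nz" unfolding nz_def z_def using lmon_nonzero[OF c] by simp
  have "p (ez n m w E z) = 0" using ez_lmon[OF c] TT(3)[OF c] subH P(1) p unfolding z_def[abs_def] vanishing_def by auto
  hence "(SUM al:box m B. k al * lmon m al z) = 0" using bspec[OF k z] by simp
  moreover have "lmon m al z = lmon h (?W al) c" for al
  proof -
  have "lmon m al z = (PROD i<m. lmon h (%k. al i * w i k) c)" by (simp add: lmon_def[of m] z_def lmon_powi mult.commute)
  also have "... = lmon h (%k. SUM i<m. al i * w i k) c" by (rule lmon_sum[OF c, symmetric])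
  finally show ?thesis by simp
  qed
  ultimately have "(SUM al:box m B. k al * lmon h (?W al) c) = 0" by simp
  moreover have "(SUM al:box m B. k al * lmon h (?W al) c)
   = (SUM u:?W ` box m B. SUM al:{al:box m B. ?W al = u}. k al * lmon h (?W al) c)" by (rule sum.image_gen[OF finite_box])
  moreover have "... = (SUM u:?W ` box m B. (SUM al:{al:box m B. ?W al = u}. k al) * lmon h u c)"
  by (rule sum.cong[OF refl]) (simp add: sum_distrib_right)
  ultimately show "(SUM u:?W ` box m B. (SUM al:{al:box m B. ?W al = u}. k al) * lmon h u c) = 0" by simp
 qed
 have "p (ez n m w E (tpow a t)) = (SUM al:box m B. k al * t powi idot m al a)"
  unfolding bspec[OF k tpow_nz[OF t]] lmon_tpow[OF t] ..
 also have "... = (SUM u:?W ` box m B. SUM al:{al:box m B. ?W al = u}. k al * t powi idot m al a)"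
  by (rule sum.image_gen[OF finite_box])
 also have "... = (SUM u:?W ` box m B. 0)"
 proof (rule sum.cong[OF refl])
  fix u assume u: "u:?W ` box m B"
  then obtain be where be: "be:box m B" "u = ?W be" by blast
  have "idot m al a = idot m be a" if al: "al:box m B" "?W al = u" for al
  proof -
  \<comment> \<open>Exponents agreeing on the torus differ by a character that is trivial on it.
    Differences of elements of the box of size B lie in the box of size B + B, which explains the
    doubled box in the hypothesis on \<open>a\<close>.\<close>
  have "idot m (%i. al i - be i) a = 0"
  proof (rule a[OF box_diff[OF al(1) be(1)]])
   fix k assume "k < h"
   thus "(SUM i<m. (al i - be i) * w i k) = 0"
    using fun_cong[OF trans[OF al(2) be(2)], of k] by (simp add: trunc_def left_diff_distrib sum_subtractf)
  qed
  thus ?thesis by (simp add: idot_def left_diff_distrib sum_subtractf)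
  qed
  hence "(SUM al:{al:box m B. ?W al = u}. k al * t powi idot m al a)
   = (SUM al:{al:box m B. ?W al = u}. k al * t powi idot m be a)" by (intro sum.cong) auto
  also have "... = 0" using bspec[OF cls u] by (simp add: sum_distrib_right[symmetric])
  finally show "(SUM al:{al:box m B. ?W al = u}. k al * t powi idot m al a) = 0" .
 qed
 finally show ?thesis by simp
qed
\<comment> \<open>The substitution t = exp s turns the diagonal one-parameter group into a curve
  through the identity with velocity \<open>V\<close>.\<close>
define ga where "ga s = ez n m w E (%k. exp (of_int (a k) * s))" for s
have gat: "ga s = ez n m w E (tpow a (exp s))" for s unfolding ga_def tpow_def by (simp add: exp_power_int mult.commute)
define V where "V = ez n m w E (%k. of_int (a k))"
have gad: "mderiv n ga (ga s * V) s" for s unfolding mderiv_def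
proof (intro conjI allI impI)
 show "ga t:sqm n" for t by (simp add: ga_def)
 show "ga s * V:sqm n" by (simp add: ga_def V_def)
 fix i j assume ij: "i < n" "j < n"
 have "((%t. SUM k<m. E (w k) $$ (i, j) * exp (of_int (a k) * t)) has_field_derivative
  (SUM k<m. E (w k) $$ (i, j) * (exp (of_int (a k) * s) * of_int (a k)))) (at s)" by (auto intro!: derivative_eq_intros sum.cong)
 thus "((%t. ga t $$ (i, j)) has_field_derivative (ga s * V) $$ (i, j)) (at s)" unfolding ga_def V_def ez_mult ez_index[OF ij] .
qed
have ga0: "ga 0 = 1\<^sub>m n" by (simp add: ga_def ez_one)
have Vc: "V:sqm n" by (simp add: V_def)
have "V:lie n H"
proof (rule P(2)[OF Vc], rule ballI)
 fix p assume p: "p:P"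
 have "mderiv n ga V 0" using gad[of 0] Vc by (simp add: ga0)
 hence "((%t. p (ga t)) has_field_derivative ddir n p (ga 0) V) (at 0)"
  using p P(1) GL_one_closed[of n] by (intro ddir_chain) (auto simp: vanishing_def ga0)
 moreover have "(%t. p (ga t)) = (%_. 0)" using pz[OF p] by (simp add: gat)
 ultimately have "((%t. 0) has_field_derivative ddir n p (ga 0) V) (at (0 :: complex))" by simp
 thus "ddir n p (1\<^sub>m n) V = 0" using DERIV_unique[OF _ DERIV_const[of 0]] ga0 by metis
qed
hence "ga s:H" for s using mexp_unique[OF gad ga0 Vc, of s] mexp_mem[OF H, of V s] by simp
hence aH: "ez n m w E (tpow a t):H" if "t ~= 0" for t using gat[of "Ln t"] that by (metis exp_Ln)
\<comment> \<open>The torus generated by \<open>TH\<close> and the one-parameter group, with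
  \<open>c h\<close> as the additional coordinate. It lies in \<open>H\<close> and contains
  \<open>TH\<close>, so by maximality it equals \<open>TH\<close>. Thus the one-parameter group lies
  in \<open>TH\<close>, and its coordinates there are powers of t whose exponents are the required
  \<open>l\<close>.\<close>
define f where "f c = ez n m w E (%i. lmon h (w i) c * c h powi a i)" for c
have f: "f c = e c * ez n m w E (tpow a (c h))" if "c:nz" for c unfolding f_def ez_lmon[OF that, symmetric] ez_mult tpow_def ..
have lm1: "lmon 1 (%_. b) (%i. c (h + i)) = c h powi b" for b c by (simp add: lmon_def)
have fl: "lhom (h + 1) n f" unfolding lhom_def
proof (intro conjI ballI allI impI)
 show "f c:GLs n" if "c:nz" for c unfolding f_def using lmon_nonzero[OF that] nz_nonzero[OF that] by (intro ez_GL) simp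
 show "f (%i. c i * c' i) = f c * f c'" for c c' unfolding f_def ez_mult by (simp add: lmon_times power_int_mult_distrib mult_ac)
 fix i j assume ij: "i < n" "j < n"
 have "laurent (h + 1) (%c. SUM k<m. E (w k) $$ (i, j) * lmon (h + 1) (join h (w k) (%_. a k)) c)"
  by (rule laurent_sum, rule laurent_lmon)
 thus "laurent (h + 1) (%c. f c $$ (i, j))" by (rule laurent_cong) (simp only: f_def ez_index[OF ij] lmon_join lm1)
qed
obtain d' e' where "tparam d' n (f ` nz) e'" using lhom_image_tparam[OF fl] by blast
hence tor: "torus n (f ` nz)" using torus_tparam by blast
have "TH <= f ` nz"
proof
 fix A assume "A:TH"
 then obtain c where c: "c:nz" "A = e c" using TT(2) by blast
 let ?c = "%i. if i = h then 1 else c i"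
 have c': "?c:nz" using c(1) by (simp add: nz_def)
 have "e ?c = e c" by (rule lhom_dep[OF TT(1) c' c(1)]) simp
 moreover have "ez n m w E (tpow a 1) = 1\<^sub>m n" by (simp add: tpow_def[abs_def] ez_one)
 ultimately have "f ?c = e c" unfolding f[OF c'] using lhomD(2)[OF TT(1) c(1)] by simp
 thus "A:f ` nz" using c' c(2) by (intro image_eqI[of _ _ ?c]) simp_all
qed
moreover have "f ` nz <= H"
proof (rule image_subsetI)
 fix c assume c: "c:nz"
 have "subgroup H (GL n)" using H by (simp add: algebraic_group_def)
 moreover have "e c:H" using TT(3)[OF c] subH by blast
 ultimately show "f c:H" unfolding f[OF c] using aH[OF nz_nonzero[OF c]] sub_GL(3) by blast
qed
ultimately have fTH: "f ` nz = TH" using TH tor unfolding maximal_torus_def by blast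
have ezT: "ez n m w E (tpow a t):TH" if "t ~= 0" for t
proof -
 let ?c = "%i. if i = h then t else 1 :: complex"
 have c: "?c:nz" using that by (simp add: nz_def)
 have "e ?c = e (%_. 1)" by (rule lhom_dep[OF TT(1) c nz_one]) simp
 hence "f ?c = ez n m w E (tpow a t)" unfolding f[OF c] using lhom_one[OF TT(1)] by (simp add: left_mult_one_mat[OF ez_carrier])
 thus ?thesis using fTH c by (metis imageI)
qed
obtain ka where ka: "!!j. j < h ==> regular_on n TH (ka j)" "!!j u. j < h ==> u:nz ==> ka j (e u) = u j"
 by (rule tparamE[OF T]) (rule that)
have gl: "lhom 1 n (%c. ez n m w E (tpow a (c 0)))" unfolding lhom_def
proof (intro conjI ballI allI impI)
 show "ez n m w E (tpow a (c 0)):GLs n" if "c:nz" for c using that by (intro ez_GL) (simp add: tpow_def nz_def)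
 show "ez n m w E (tpow a (c 0 * c' 0)) = ez n m w E (tpow a (c 0)) * ez n m w E (tpow a (c' 0))" for c c'
  unfolding ez_mult tpow_mult ..
 fix i j assume ij: "i < n" "j < n"
 have "laurent 1 (%c. SUM k<m. E (w k) $$ (i, j) * lmon 1 (%_. a k) c)" by (rule laurent_sum, rule laurent_lmon)
 thus "laurent 1 (%c. ez n m w E (tpow a (c 0)) $$ (i, j))" by (rule laurent_cong) (simp add: ez_index[OF ij] lmon_def tpow_def)
qed
have "EX b. ALL c:nz. ka j (ez n m w E (tpow a (c 0))) = c 0 powi b" if j: "j < h" for j
proof -
 have sub: "(%c. ez n m w E (tpow a (c 0))) ` nz <= TH" using ezT nz_nonzero by blast
 have "EX al:exps 1. ALL c:nz. ka j (ez n m w E (tpow a (c 0))) = lmon 1 al c"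
 proof (rule laurent_multiplicative)
  show "laurent 1 (%c. ka j (ez n m w E (tpow a (c 0))))" by (rule laurent_regular[OF gl regular_on_subset[OF ka(1)[OF j] sub]])
  fix c c' assume cc: "c:nz" "c':nz"
  obtain u where u: "u:nz" "ez n m w E (tpow a (c 0)) = e u" using ezT[OF nz_nonzero[OF cc(1)]] TT(2) by blast
  obtain v where v: "v:nz" "ez n m w E (tpow a (c' 0)) = e v" using ezT[OF nz_nonzero[OF cc(2)]] TT(2) by blast
  have "ez n m w E (tpow a (c 0 * c' 0)) = e (%i. u i * v i)"
  unfolding lhomD(3)[OF TT(1) u(1) v(1)] u(2)[symmetric] v(2)[symmetric] ez_mult tpow_mult ..
  thus "ka j (ez n m w E (tpow a (c 0 * c' 0))) = ka j (ez n m w E (tpow a (c 0))) * ka j (ez n m w E (tpow a (c' 0)))"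
  unfolding u(2) v(2) by (simp add: ka(2)[OF j] u(1) v(1))
  show "ka j (ez n m w E (tpow a (c 0))) ~= 0" unfolding u(2) ka(2)[OF j u(1)] by (rule nz_nonzero[OF u(1)])
 qed
 then obtain al where "ALL c:nz. ka j (ez n m w E (tpow a (c 0))) = lmon 1 al c" by blast
 thus ?thesis by (intro exI[of _ "al 0"]) (simp add: lmon_def)
qed
hence "ALL j:{..<h}. EX b. ALL c:nz. ka j (ez n m w E (tpow a (c 0))) = c 0 powi b" by blast
from bchoice[OF this] obtain l where l: "ALL j:{..<h}. ALL c:nz. ka j (ez n m w E (tpow a (c 0))) = c 0 powi l j" ..
have "(2 :: complex) ~= 0" by simp
then obtain u where u: "u:nz" "ez n m w E (tpow a 2) = e u" using ezT[of 2] TT(2) by blast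
have two: "(%_. 2 :: complex):nz" by (simp add: nz_def)
have "u j = tpow l 2 j" if j: "j < h" for j
proof -
 have "ka j (ez n m w E (tpow a 2)) = 2 powi l j" using bspec[OF bspec[OF l, of j] two] j by simp
 thus ?thesis unfolding u(2) ka(2)[OF j u(1)] tpow_def .
qed
hence "e u = e (tpow l 2)" by (intro lhom_dep[OF TT(1) u(1) tpow_nz]) simp_all
hence eq: "ez n m w E (tpow a 2) = ez n m w E (%k. lmon h (w k) (tpow l 2))" using u(2) ez_lmon[OF tpow_nz[of 2 l]] by simp
have "idot h (w i) l = a i" if i: "i < m" for i
proof -
 have "tpow a 2 i = lmon h (w i) (tpow l 2)" by (rule ez_inj[OF eq i])
 hence "(2 :: complex) powi a i = 2 powi idot h (w i) l" using lmon_tpow[of 2 h "w i" l] by (simp add: tpow_def)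
 thus ?thesis unfolding powi_2_inj by simp
qed
thus ?thesis by blast
qed

end

section \<open>Semistability in terms of weights\<close>

lemma powi_tendsto_0:
assumes "0 <= a"
shows "((%t. t powi a) \<longlongrightarrow> (if a = 0 then 1 else 0 :: complex)) (at 0)"
proof -
have "((%t :: complex. t ^ nat a) \<longlongrightarrow> 0 ^ nat a) (at 0)" by (intro tendsto_intros)
thus ?thesis using assms by (auto simp: power_int_def power_0_left)
qed

lemma eventually_nonzero: "\<forall>\<^sub>F t in at (0 :: complex). t ~= 0" by (simp add: eventually_at_filter)

text \<open>A limit along \<open>l\<close> can exist only if \<open>l\<close> is nonnegative on the
  weights occurring in \<open>v\<close>: if a weight pairs to -a < 0, then the projected orbit times
  t ^ a is a nonzero constant, but it would tend to 0.\<close>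

lemma semistable_tcharI:
assumes T: "tparam r n T e" and V: "lhom r M (%c. V (e c))" and x: "expansion r M (%c. V (e c)) W E" and v: "v:carrier_vec M"
 and de: "!!l. (!!al. al:W ==> E al *\<^sub>v v ~= 0\<^sub>v M ==> 0 <= idot r al l) ==> 0 <= idot r de l"
shows "v:semistable n T M V (qchar_of (tchar r T e de))" unfolding semistable_def
proof (intro CollectI conjI v ballI impI)
note X = expD[OF x] and TT = tparamD[OF T]
fix mu assume mu: "mu:one_param_subgroups n T"
 and lim: "EX L:carrier_vec M. ALL i<M. ((%t. (V (mu (scalar1 t)) *\<^sub>v v) $ i) \<longlongrightarrow> L $ i) (at 0)"
obtain l where l: "ALL t. t ~= 0 --> mu (scalar1 t) = e (tpow l t)" using one_param_classification[OF T mu] ..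
obtain L where L: "ALL i<M. ((%t. (V (mu (scalar1 t)) *\<^sub>v v) $ i) \<longlongrightarrow> L $ i) (at 0)" using lim by blast
have "0 <= idot r de l"
proof (rule de, rule ccontr)
 fix al assume al: "al:W" "E al *\<^sub>v v ~= 0\<^sub>v M" and neg: "~ 0 <= idot r al l"
 define a where "a = nat (- idot r al l)"
 have a: "0 < a" "idot r al l = - int a" using neg by (simp_all add: a_def)
 have "EX j<M. (E al *\<^sub>v v) $ j ~= 0"
 proof (rule ccontr)
  assume "~ (EX j<M. (E al *\<^sub>v v) $ j ~= 0)"
  hence "E al *\<^sub>v v = 0\<^sub>v M" using X(3)[of al] by (intro eq_vecI) auto
  thus False using al(2) by simp
 qed
 then obtain j where j: "j < M" "(E al *\<^sub>v v) $ j ~= 0" by blast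
 define g where "g t = (SUM i = 0..<M. E al $$ (j, i) * (V (mu (scalar1 t)) *\<^sub>v v) $ i)" for t
 have "(g \<longlongrightarrow> (SUM i = 0..<M. E al $$ (j, i) * L $ i)) (at 0)"
  unfolding g_def by (intro tendsto_sum tendsto_mult tendsto_const) (use L in simp)
 hence "((%t. t ^ a * g t) \<longlongrightarrow> 0 ^ a * (SUM i = 0..<M. E al $$ (j, i) * L $ i)) (at 0)"
  by (intro tendsto_mult tendsto_power tendsto_ident_at)
 hence lim0: "((%t. t ^ a * g t) \<longlongrightarrow> 0) (at 0)" by (simp only: zero_power[OF a(1)] mult_zero_left)
 have gt: "t ^ a * g t = (E al *\<^sub>v v) $ j" if t: "t ~= 0" for t
 proof -
  note tp = tpow_nz[OF t, of l]
  have mt: "mu (scalar1 t) = e (tpow l t)" using l t by simp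
  have Vv: "V (e (tpow l t)) *\<^sub>v v:carrier_vec M" using lhomD(2)[OF V tp] v by simp
  have "g t = (E al *\<^sub>v (V (e (tpow l t)) *\<^sub>v v)) $ j" unfolding g_def mt using mat_vec_entry[OF X(3) Vv j(1)] by simp
  also have "E al *\<^sub>v (V (e (tpow l t)) *\<^sub>v v) = (E al * V (e (tpow l t))) *\<^sub>v v"
  using assoc_mult_mat_vec[OF X(3) lhomD(2)[OF V tp] v] by simp
  also have "E al * V (e (tpow l t)) = lmon r al (tpow l t) \<cdot>\<^sub>m E al" by (rule expansion_times[OF V x al(1) tp])
  also have "((lmon r al (tpow l t) \<cdot>\<^sub>m E al) *\<^sub>v v) $ j = lmon r al (tpow l t) * (E al *\<^sub>v v) $ j"
  using mat_vec_entry[OF smult_carrier_mat[OF X(3)] v j(1), of "lmon r al (tpow l t)" al]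
   mat_vec_entry[OF X(3) v j(1), of al] X(3)[of al] j(1) by (simp add: sum_distrib_left mult.assoc)
  finally have "g t = t powi (- int a) * (E al *\<^sub>v v) $ j" unfolding lmon_tpow[OF t] a(2) .
  thus ?thesis using t by (simp add: power_int_minus)
 qed
 have "((%t. (E al *\<^sub>v v) $ j) \<longlongrightarrow> 0) (at (0 :: complex))"
 proof (rule Lim_transform_eventually[OF lim0])
  show "\<forall>\<^sub>F t in at 0. t ^ a * g t = (E al *\<^sub>v v) $ j"
  by (rule eventually_mono[OF eventually_nonzero]) (rule gt)
 qed
 hence "(E al *\<^sub>v v) $ j = 0" using tendsto_unique[OF _ tendsto_const] by (metis at_neq_bot)
 thus False using j(2) by simp
qed
moreover have "pairing n T (qchar_of (tchar r T e de)) mu = of_int (idot r de l)" using l by (intro pairing_tchar[OF T mu]) simp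
ultimately show "0 <= pairing n T (qchar_of (tchar r T e de)) mu" by simp
qed

text \<open>When \<open>l\<close> is nonnegative on the weights of \<open>v\<close>, the limit
  exists and is the sum of the components on which \<open>l\<close> is zero; so semistability can be
  tested on \<open>l\<close>.\<close>

lemma semistable_tcharD:
assumes T: "tparam r n T e" and V: "lhom r M (%c. V (e c))" and x: "expansion r M (%c. V (e c)) W E"
 and v: "v:semistable n T M V (qchar_of (tchar r T e de))"
 and l: "!!al. al:W ==> E al *\<^sub>v v ~= 0\<^sub>v M ==> 0 <= idot r al l"
shows "0 <= idot r de l"
proof -
note X = expD[OF x] and TT = tparamD[OF T]
have vc: "v:carrier_vec M" using v by (simp add: semistable_def)
define mu where "mu A = e (tpow l (A $$ (0, 0)))" for A
have mu: "mu:one_param_subgroups n T" unfolding mu_def[abs_def] by (rule one_param_tpow[OF T])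
have mut: "mu (scalar1 t) = e (tpow l t)" for t by (simp add: mu_def scalar1_def)
define L where "L = vec M (%i. SUM al:W. (E al *\<^sub>v v) $ i * (if idot r al l = 0 then 1 else 0))"
have "((%t. (V (mu (scalar1 t)) *\<^sub>v v) $ i) \<longlongrightarrow> L $ i) (at 0)" if i: "i < M" for i
proof (rule Lim_transform_eventually)
 show "((%t. SUM al:W. (E al *\<^sub>v v) $ i * t powi idot r al l) \<longlongrightarrow> L $ i) (at 0)"
  unfolding L_def index_vec[OF i]
 proof (rule tendsto_sum)
  fix al assume al: "al:W"
  show "((%t. (E al *\<^sub>v v) $ i * t powi idot r al l) \<longlongrightarrow> (E al *\<^sub>v v) $ i * (if idot r al l = 0 then 1 else 0)) (at 0)"
  proof (cases "E al *\<^sub>v v = 0\<^sub>v M")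
  case True
  thus ?thesis using i by simp
  next
  case False
  thus ?thesis by (intro tendsto_mult tendsto_const powi_tendsto_0 l[OF al])
  qed
 qed
 show "\<forall>\<^sub>F t in at 0. (SUM al:W. (E al *\<^sub>v v) $ i * t powi idot r al l) = (V (mu (scalar1 t)) *\<^sub>v v) $ i"
 proof (rule eventually_mono[OF eventually_nonzero])
  fix t :: complex assume t: "t ~= 0"
  show "(SUM al:W. (E al *\<^sub>v v) $ i * t powi idot r al l) = (V (mu (scalar1 t)) *\<^sub>v v) $ i"
  unfolding mut expansion_vec[OF V x tpow_nz[OF t] vc i] lmon_tpow[OF t] ..
 qed
qed
moreover have "L:carrier_vec M" by (simp add: L_def)
ultimately have "0 <= pairing n T (qchar_of (tchar r T e de)) mu" using v mu unfolding semistable_def by blast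
thus ?thesis using pairing_tchar[OF T mu, of l de] mut by simp
qed

section \<open>Finite stabilizers and a criterion for Weyl-genericity\<close>

lemma finite_zariski_closed:
assumes "finite F" "F <= GLs n"
shows "zariski_closed n F"
proof -
have "zclosure n F <= F"
proof (rule subsetI, rule ccontr)
 fix A assume A: "A:zclosure n F" "A \<notin> F"
 have AG: "A:sqm n" using A(1) GL_mat unfolding zclosure_def by blast
 have "ALL B:F. EX ij. fst ij < n & snd ij < n & A $$ ij ~= B $$ ij"
 proof (rule ballI, rule ccontr)
  fix B assume B: "B:F" and no: "~ (EX ij. fst ij < n & snd ij < n & A $$ ij ~= B $$ ij)"
  have "B:sqm n" using B assms(2) GL_mat by blast
  hence "A = B" using AG no by (intro eq_matI) auto
  thus False using A(2) B by simp
 qed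
 from bchoice[OF this] obtain ij where ij: "ALL B:F. fst (ij B) < n & snd (ij B) < n & A $$ ij B ~= B $$ ij B" ..
 have "(PROD B:F. A $$ ij B - B $$ ij B) = 0"
 proof (rule zclosure_regular[OF _ assms(2) _ A(1)])
  show "regular_on n (GLs n) (%A. PROD B:F. A $$ ij B - B $$ ij B)"
  proof (rule regular_on_prod, rule regular_on_minus[OF _ reg_const])
  fix B assume "B:F"
  thus "regular_on n (GLs n) (%A. A $$ ij B)" using ij reg_entry[of "fst (ij B)" n "snd (ij B)"] by simp
  qed
  show "(PROD B:F. C $$ ij B - B $$ ij B) = 0" if "C:F" for C using that assms(1) by (intro prod_zero) auto
 qed
 thus False using ij assms(1) by (auto simp: prod_zero_iff)
qed
hence "zclosure n F = F" using zclosure_superset[OF assms(2)] by blast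
thus ?thesis using zariski_closed_zclosure[of n F] by simp
qed

text \<open>In a chain of length one the larger set contains a point \<open>a\<close> of the smaller
  one and something else. Splitting off \<open>a\<close> covers it by two proper subsets, closed
  because finite, against irreducibility.\<close>

lemma finite_zariski_dim:
assumes F: "finite F" "F <= GLs n"
shows "~ 0 < zariski_dim n F"
proof
assume "0 < zariski_dim n F"
then obtain k where k: "0 < enat k" and ex: "EX C :: nat => complex mat set.
 (ALL i<=k. zariski_closed n (C i) & zariski_irreducible n (C i) & C i <= F) & (ALL i<k. C i \<subset> C (Suc i))"
 unfolding zariski_dim_def less_Sup_iff by blast
obtain C :: "nat => complex mat set" where C: "ALL i<=k. zariski_closed n (C i) & zariski_irreducible n (C i) & C i <= F"
 "ALL i<k. C i \<subset> C (Suc i)" using ex by (elim exE conjE) (rule that)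
have k1: "0 < k" using k by (simp add: zero_enat_def)
have "C 0 ~= {}" using C(1) by (auto simp: zariski_irreducible_def)
then obtain a where a: "a:C 0" by blast
have sub: "C 0 \<subset> C 1" using C(2) k1 by auto
then obtain b where b: "b:C 1" "b \<notin> C 0" by blast
have C1: "C 1 <= F" "zariski_irreducible n (C 1)" using C(1) k1 by auto
have "zariski_closed n {a}" "zariski_closed n (C 1 - {a})"
 using a sub C1(1) F by (auto intro!: finite_zariski_closed intro: finite_subset)
moreover have "C 1 <= {a} \<union> (C 1 - {a})" by blast
ultimately have "C 1 <= {a} \<or> C 1 <= C 1 - {a}" using C1(2) unfolding zariski_irreducible_def by blast
thus False using a b sub by blast
qed

text \<open>The weights occurring in \<open>v\<close> are 1 on the stabilizer. They generate a
  subgroup of finite index in the character lattice, so every coordinate of a stabilizing element is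
  a root of unity of bounded order.\<close>

lemma stabilizer_finite:
assumes T: "tparam r n T e" and V: "lhom r M (%c. V (e c))" and x: "expansion r M (%c. V (e c)) W E" and v: "v:carrier_vec M"
 and span: "!!j. j < r ==> EX N>0. EX c :: (nat => int) => int. ALL k<r. (SUM al:{al:W. E al *\<^sub>v v ~= 0\<^sub>v M}. c al * al k) = (if k = j then int N else 0)"
shows "finite (stabilizer_in T V v)"
proof -
note X = expD[OF x] and TT = tparamD[OF T]
let ?S = "{al:W. E al *\<^sub>v v ~= 0\<^sub>v M}"
have one: "lmon r al u = 1" if u: "u:nz" "V (e u) *\<^sub>v v = v" and al: "al:?S" for u al
proof -
 have alW: "al:W" using al by simp
 have "E al *\<^sub>v v = E al *\<^sub>v (V (e u) *\<^sub>v v)" using u(2) by simp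
 also have "... = (E al * V (e u)) *\<^sub>v v" using assoc_mult_mat_vec[OF X(3) lhomD(2)[OF V u(1)] v] by simp
 also have "... = (lmon r al u \<cdot>\<^sub>m E al) *\<^sub>v v" unfolding expansion_times[OF V x alW u(1)] ..
 finally have eq: "E al *\<^sub>v v = (lmon r al u \<cdot>\<^sub>m E al) *\<^sub>v v" .
 show ?thesis
 proof (rule ccontr)
  assume ne: "lmon r al u ~= 1"
  have "E al *\<^sub>v v = 0\<^sub>v M"
  proof (rule eq_vecI)
  fix j assume "j < dim_vec (0\<^sub>v M :: complex Matrix.vec)"
  hence j: "j < M" by simp
  have "(E al *\<^sub>v v) $ j = lmon r al u * (E al *\<^sub>v v) $ j"
   using mat_vec_entry[OF smult_carrier_mat[OF X(3)] v j, of "lmon r al u" al]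
    mat_vec_entry[OF X(3) v j, of al] X(3)[of al] j eq by (simp add: sum_distrib_left mult.assoc)
  thus "(E al *\<^sub>v v) $ j = 0\<^sub>v M $ j" using ne j by simp
  qed (use X(3)[of al] in simp)
  thus False using al by simp
 qed
qed
have "ALL j:{..<r}. EX N>0. ALL u:nz. V (e u) *\<^sub>v v = v --> u j ^ N = 1"
proof
 fix j assume "j:{..<r}"
 hence j: "j < r" by simp
 obtain N c where N: "0 < (N :: nat)" and c: "ALL k<r. (SUM al:?S. c al * al k) = (if k = j then int N else 0)"
  using span[OF j] by (elim exE conjE) (rule that)
 have "u j ^ N = 1" if u: "u:nz" "V (e u) *\<^sub>v v = v" for u
 proof -
  have "u j ^ N = lmon r (%k. SUM al:?S. al k * c al) u"
  proof -
  have "lmon r (%k. SUM al:?S. al k * c al) u = lmon r (%k. unit_exp j k * int N) u"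
   using c by (intro lmon_cong_exp) (simp add: unit_exp_def mult.commute)
  also have "... = lmon r (unit_exp j) u powi int N" by (rule lmon_powi[symmetric])
  finally show ?thesis using lmon_unit_exp[OF j, of u] by simp
  qed
  also have "... = (PROD al:?S. lmon r (%k. al k * c al) u)" by (rule lmon_sum[OF u(1)])
  also have "... = (PROD al:?S. 1)" by (rule prod.cong[OF refl]) (simp only: lmon_powi[symmetric] one[OF u] power_int_1_left)
  finally show ?thesis by simp
 qed
 thus "EX N>0. ALL u:nz. V (e u) *\<^sub>v v = v --> u j ^ N = 1" using N by blast
qed
from bchoice[OF this] obtain N where N: "ALL j:{..<r}. 0 < N j & (ALL u:nz. V (e u) *\<^sub>v v = v --> u j ^ N j = 1)" ..
let ?P = "PiE {..<r} (%j. {z :: complex. z ^ N j = 1})"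
have "finite ?P"
proof (rule finite_PiE)
 fix j assume "j:{..<r}"
 hence "1 <= N j" using N by force
 thus "finite {z :: complex. z ^ N j = 1}" by (rule finite_roots_unity)
qed simp
moreover have "stabilizer_in T V v <= (%f. e (%j. if j < r then f j else 1)) ` ?P"
proof
 fix A assume A: "A:stabilizer_in T V v"
 then obtain u where u: "u:nz" "A = e u" using TT(2) unfolding stabilizer_in_def by blast
 hence Vu: "V (e u) *\<^sub>v v = v" using A by (simp add: stabilizer_in_def)
 have "restrict u {..<r}:?P" using N u(1) Vu by (auto simp: PiE_def Pi_def)
 moreover have "A = e (%j. if j < r then restrict u {..<r} j else 1)"
  unfolding u(2) using u(1) by (intro lhom_dep[OF TT(1)]) (auto simp: nz_def)
 ultimately show "A:(%f. e (%j. if j < r then f j else 1)) ` ?P" by blast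
qed
ultimately show ?thesis using finite_surj by blast
qed

text \<open>One vector of each weight is summed; by orthogonality the projection for a weight
  returns its own summand.\<close>

lemma generic_vector:
assumes V: "lhom r M F" and x: "expansion r M F W E" and E0: "ALL al:W. E al ~= 0\<^sub>m M M"
shows "EX v:carrier_vec M. ALL al:W. E al *\<^sub>v v ~= 0\<^sub>v M"
proof -
note X = expD[OF x]
have "ALL al:W. EX v. v:carrier_vec M & E al *\<^sub>v v ~= 0\<^sub>v M" using nonzero_column[OF X(3)] E0 by blast
from bchoice[OF this] obtain v where v: "ALL al:W. v al:carrier_vec M & E al *\<^sub>v v al ~= 0\<^sub>v M" ..
define y where "y = vec M (%i. SUM al:W. (E al *\<^sub>v v al) $ i)"
have y: "y:carrier_vec M" by (simp add: y_def)
have "E be *\<^sub>v y = E be *\<^sub>v v be" if be: "be:W" for be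
proof (rule eq_vecI)
 fix l assume "l < dim_vec (E be *\<^sub>v v be)"
 hence l: "l < M" using X(3)[of be] by simp
 have "(E be *\<^sub>v y) $ l = (SUM j = 0..<M. SUM al:W. E be $$ (l, j) * (E al *\<^sub>v v al) $ j)"
  unfolding mat_vec_entry[OF X(3) y l] by (simp add: y_def sum_distrib_left)
 also have "... = (SUM al:W. SUM j = 0..<M. E be $$ (l, j) * (E al *\<^sub>v v al) $ j)" by (rule sum.swap)
 also have "... = (SUM al:W. if al = be then (E be *\<^sub>v v be) $ l else 0)"
 proof (rule sum.cong[OF refl])
  fix al assume al: "al:W"
  hence vc: "v al:carrier_vec M" using v by blast
  hence "E al *\<^sub>v v al:carrier_vec M" using X(3)[of al] by simp
  hence "(SUM j = 0..<M. E be $$ (l, j) * (E al *\<^sub>v v al) $ j) = (E be *\<^sub>v (E al *\<^sub>v v al)) $ l"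
  by (rule mat_vec_entry[OF X(3) _ l, symmetric])
  thus "(SUM j = 0..<M. E be $$ (l, j) * (E al *\<^sub>v v al) $ j) = (if al = be then (E be *\<^sub>v v be) $ l else 0)"
  unfolding expansion_vec_idem[OF V x vc be al] using l by auto
 qed
 finally show "(E be *\<^sub>v y) $ l = (E be *\<^sub>v v be) $ l" using be X(1) by simp
qed (use X(3)[of be] in simp)
thus ?thesis using v y by (intro bexI[OF _ y]) simp
qed

text \<open>By \<open>A\<close> a vector with all weight components nonzero is semistable, so the
  character is in Sigma. For omega, \<open>span_or_perp\<close> is applied to the weights of a
  semistable point: either they are orthogonal to a nonzero cocharacter, and \<open>B\<close>
  contradicts semistability, or a multiple of each unit vector is a combination of them and the
  stabilizer is finite.\<close>

lemma weyl_generic_torus: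
assumes T: "tparam r n T e" and V: "lhom r M (%c. V (e c))" and x: "expansion r M (%c. V (e c)) W E"
 and E0: "ALL al:W. E al ~= 0\<^sub>m M M" and A: "!!l. (!!al. al:W ==> 0 <= idot r al l) ==> 0 <= idot r de l"
 and B: "!!S mu. S <= W ==> EX k<r. mu k ~= 0 ==> (!!al. al:S ==> idot r al mu = 0) ==>
  EX l. (ALL al:S. 0 <= idot r al l) & idot r de l < 0"
 and inv: "!!w. w:weyl_group n G T ==> tchar r T e de \<circ> w = tchar r T e de"
shows "~ {\<theta>:Sigma_set n T M V. ALL w:weyl_group n G T. qchar_pullback w \<theta> = \<theta>} <= omega_set n T M V"
proof -
let ?\<theta> = "qchar_of (tchar r T e de)"
have "?\<theta>:rational_characters n T"
 unfolding rational_characters_def using tchar_characters[OF T] by (intro qchar.span_base imageI)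
moreover obtain v where v: "v:carrier_vec M" "ALL al:W. E al *\<^sub>v v ~= 0\<^sub>v M" using generic_vector[OF V x E0] by blast
have "v:semistable n T M V ?\<theta>" by (rule semistable_tcharI[OF T V x v(1)]) (rule A, use v(2) in blast)
ultimately have \<Sigma>: "?\<theta>:Sigma_set n T M V" unfolding Sigma_set_def by blast
have inv': "qchar_pullback w ?\<theta> = ?\<theta>" if "w:weyl_group n G T" for w
 using qchar_pullback_of[of "tchar r T e de" w] tchar_nonzero[OF T] inv[OF that] by simp
have "?\<theta> \<notin> omega_set n T M V"
proof
 assume "?\<theta>:omega_set n T M V"
 then obtain y where y: "y:semistable n T M V ?\<theta>" "0 < zariski_dim n (stabilizer_in T V y)"
  unfolding omega_set_def by blast
 have yc: "y:carrier_vec M" using y(1) by (simp add: semistable_def)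
 let ?S = "{al:W. E al *\<^sub>v y ~= 0\<^sub>v M}"
 have fS: "finite ?S" using expD(1)[OF x] by simp
 have noperp: "~ (EX l. (EX k<r. l k ~= 0) & (ALL al:?S. idot r al l = 0))"
 proof
  assume "EX l. (EX k<r. l k ~= 0) & (ALL al:?S. idot r al l = 0)"
  then obtain mu where mu: "(EX k<r. mu k ~= 0) & (ALL al:?S. idot r al mu = 0)" ..
  obtain l where l: "ALL al:?S. 0 <= idot r al l" "idot r de l < 0" using B[of ?S mu] mu by blast
  have "0 <= idot r de l" by (rule semistable_tcharD[OF T V x y(1)]) (use l(1) in simp)
  thus False using l(2) by simp
 qed
 have "finite (stabilizer_in T V y)"
 proof (rule stabilizer_finite[OF T V x yc])
  fix j assume j: "j < r"
  show "EX N>0. EX c :: (nat => int) => int. ALL k<r. (SUM al:?S. c al * al k) = (if k = j then int N else 0)"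
  proof (rule disjE[OF span_or_perp[of ?S j r "%al. al", OF fS j]])
  assume "EX N>0. EX c :: (nat => int) => int. ALL k<r. (SUM al:?S. c al * al k) = (if k = j then int N else 0)"
  thus ?thesis .
  qed (rule notE[OF noperp])
 qed
 moreover have "stabilizer_in T V y <= GLs n" using sub_GL(1)[OF tparamD(4)[OF T]] unfolding stabilizer_in_def by blast
 ultimately show False using finite_zariski_dim y(2) by blast
qed
thus ?thesis using \<Sigma> inv' by blast
qed

text \<open>Compares two presentations of one Laurent polynomial. The map \<open>ph\<close> may
  identify indices, so the coefficient is a sum over a fibre, and terms of a fibre could
  cancel.\<close>

lemma expansion_coeff:
assumes x: "expansion r M F W E" and ij: "i < M" "j < M" and I: "finite I"
 and F: "!!c. c:nz ==> F c $$ (i, j) = (SUM s:I. k s * lmon r (ph s) c)" and ph: "!!s. s:I ==> ph s:exps r" and ga: "ga:exps r"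
shows "(if ga:W then E ga $$ (i, j) else 0) = (SUM s:{s:I. ph s = ga}. k s)"
proof -
note X = expD[OF x]
let ?U = "insert ga (W \<union> ph ` I)"
have fU: "finite ?U" using X(1) I by simp
have "ALL ga:?U. (if ga:W then E ga $$ (i, j) else 0) - (SUM s:{s:I. ph s = ga}. k s) = 0"
proof (rule lmon_independent[OF fU])
 show "?U <= exps r" using X(2) ph ga by blast
 fix c assume c: "c:nz"
 have "(SUM ga:?U. (if ga:W then E ga $$ (i, j) else 0) * lmon r ga c) = F c $$ (i, j)"
  unfolding X(4)[OF c ij] by (rule sum.mono_neutral_cong_right[OF fU]) auto
 moreover have "(SUM ga:?U. (SUM s:{s:I. ph s = ga}. k s) * lmon r ga c) = F c $$ (i, j)"
 proof -
  have "(SUM ga:?U. (SUM s:{s:I. ph s = ga}. k s) * lmon r ga c) = (SUM ga:?U. SUM s:{s:I. ph s = ga}. k s * lmon r (ph s) c)"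
  by (rule sum.cong[OF refl]) (simp add: sum_distrib_right)
  also have "... = (SUM s:I. k s * lmon r (ph s) c)" using fU I by (intro sum.group) auto
  finally show ?thesis using F[OF c] by simp
 qed
 ultimately show "(SUM ga:?U. ((if ga:W then E ga $$ (i, j) else 0) - (SUM s:{s:I. ph s = ga}. k s)) * lmon r ga c) = 0"
  by (simp only: left_diff_distrib sum_subtractf diff_self)
qed
hence "(if ga:W then E ga $$ (i, j) else 0) - (SUM s:{s:I. ph s = ga}. k s) = 0" by (rule bspec) simp
thus ?thesis by simp
qed

section \<open>Kronecker products, direct sums and scaled weights\<close>

lemma sum_divmod: "(SUM l<a * b. g (l div b) (l mod b)) = (SUM u<a. SUM v<b. g u (v :: nat))"
proof -
have "(SUM l<a * b. g (l div b) (l mod b)) = (SUM u<a. SUM l:{u * b..<u * b + b}. g (l div b) (l mod b))"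
 by (rule sum.nat_group[symmetric])
also have "... = (SUM u<a. SUM v<b. g u v)"
proof (rule sum.cong[OF refl])
 fix u
 have "(SUM l:{u * b..<u * b + b}. g (l div b) (l mod b)) = (SUM v = 0..<b. g ((v + u * b) div b) ((v + u * b) mod b))"
  using sum.shift_bounds_nat_ivl[of "%l. g (l div b) (l mod b)" 0 "u * b" b] by (simp add: add.commute)
 also have "... = (SUM v<b. g u v)" unfolding atLeast0LessThan by (rule sum.cong[OF refl]) simp
 finally show "(SUM l:{u * b..<u * b + b}. g (l div b) (l mod b)) = (SUM v<b. g u v)" .
qed
finally show ?thesis .
qed

lemma kronecker_carrier: "A:sqm a ==> B:sqm b ==> kronecker A B:sqm (a * b)" by (simp add: kronecker_def)

lemma kronecker_index:
assumes "A:sqm a" "B:sqm b" "i < a * b" "j < a * b"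
shows "kronecker A B $$ (i, j) = A $$ (i div b, j div b) * B $$ (i mod b, j mod b)" using assms by (simp add: kronecker_def)

lemma divmod_bounds:
assumes "i < a * (b :: nat)"
shows "i div b < a" "i mod b < b" using assms less_mult_imp_div_less[of i a b] by (cases "b = 0"; simp)+

lemma kronecker_mult:
assumes "A:sqm a" "B:sqm b" "A':sqm a" "B':sqm b"
shows "kronecker A B * kronecker A' B' = kronecker (A * A') (B * B')"
proof (rule eq_matI)
note K = kronecker_carrier[OF assms(1,2)] kronecker_carrier[OF assms(3,4)]
note AA = sq_mult[OF assms(1,3)] sq_mult[OF assms(2,4)]
fix i j assume "i < dim_row (kronecker (A * A') (B * B'))" "j < dim_col (kronecker (A * A') (B * B'))"
hence ij: "i < a * b" "j < a * b" using kronecker_carrier[OF AA] by auto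
note bd = divmod_bounds[OF ij(1)] divmod_bounds[OF ij(2)]
have "(kronecker A B * kronecker A' B') $$ (i, j) = (SUM l<a * b. kronecker A B $$ (i, l) * kronecker A' B' $$ (l, j))"
 unfolding sq_entry[OF K ij] atLeast0LessThan ..
also have "... = (SUM l<a * b. (A $$ (i div b, l div b) * B $$ (i mod b, l mod b)) * (A' $$ (l div b, j div b) * B' $$ (l mod b, j mod b)))"
 by (rule sum.cong[OF refl]) (simp add: kronecker_index[OF assms(1,2) ij(1)] kronecker_index[OF assms(3,4) _ ij(2)])
also have "... = (SUM u<a. SUM v<b. (A $$ (i div b, u) * B $$ (i mod b, v)) * (A' $$ (u, j div b) * B' $$ (v, j mod b)))"
 by (rule sum_divmod)
also have "... = (SUM u<a. A $$ (i div b, u) * A' $$ (u, j div b)) * (SUM v<b. B $$ (i mod b, v) * B' $$ (v, j mod b))"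
 by (simp only: sum_product mult_ac)
also have "... = kronecker (A * A') (B * B') $$ (i, j)"
 unfolding kronecker_index[OF AA ij] sq_entry[OF assms(1,3) bd(1,3)] sq_entry[OF assms(2,4) bd(2,4)] atLeast0LessThan ..
finally show "(kronecker A B * kronecker A' B') $$ (i, j) = kronecker (A * A') (B * B') $$ (i, j)" .
qed (use assms in \<open>simp_all add: kronecker_def\<close>)

lemma kronecker_one: "kronecker (1\<^sub>m a) (1\<^sub>m b) = 1\<^sub>m (a * b)"
proof (rule eq_matI)
fix i j assume "i < dim_row (1\<^sub>m (a * b) :: complex mat)" "j < dim_col (1\<^sub>m (a * b) :: complex mat)"
hence ij: "i < a * b" "j < a * b" by simp_all
have "i = j \<longleftrightarrow> i div b = j div b & i mod b = j mod b" by (metis div_mult_mod_eq)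
thus "kronecker (1\<^sub>m a) (1\<^sub>m b) $$ (i, j) = 1\<^sub>m (a * b) $$ (i, j)"
 using kronecker_index[OF one_carrier_mat one_carrier_mat ij] divmod_bounds[OF ij(1)] divmod_bounds[OF ij(2)] ij by auto
qed (simp_all add: kronecker_def)

lemma lhomI:
assumes F: "!!c. c:nz ==> F c:sqm m" "!!c c'. c:nz ==> c':nz ==> F (%i. c i * c' i) = F c * F c'"
 "F (%_. 1) = 1\<^sub>m m" "!!i j. i < m ==> j < m ==> laurent r (%c. F c $$ (i, j))"
shows "lhom r m F" unfolding lhom_def
proof (intro conjI ballI allI impI)
fix c assume c: "c:nz"
have "F c * F (%i. inverse (c i)) = F (%i. c i * inverse (c i))" using F(2)[OF c nz_inverse[OF c]] by simp
also have "(%i. c i * inverse (c i)) = (%_. 1)" using c by (simp add: nz_nonzero)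
finally have "det (F c) * det (F (%i. inverse (c i))) = 1" using det_mult[OF F(1)[OF c] F(1)[OF nz_inverse[OF c]]] F(3) by simp
thus "F c:GLs m" using F(1)[OF c] by (auto simp: GL_carrier)
qed (use F in simp_all)

lemma lhom_kronecker:
assumes e: "lhom r a e" and f: "lhom r b f"
shows "lhom r (a * b) (%c. kronecker (e c) (f c))"
proof (rule lhomI)
note E = lhomD[OF e] and F = lhomD[OF f]
show "kronecker (e c) (f c):sqm (a * b)" if "c:nz" for c by (rule kronecker_carrier[OF E(2)[OF that] F(2)[OF that]])
show "kronecker (e (%i. c i * c' i)) (f (%i. c i * c' i)) = kronecker (e c) (f c) * kronecker (e c') (f c')"
 if "c:nz" "c':nz" for c c' unfolding E(3)[OF that] F(3)[OF that]
 by (rule kronecker_mult[symmetric, OF E(2)[OF that(1)] F(2)[OF that(1)] E(2)[OF that(2)] F(2)[OF that(2)]])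
show "kronecker (e (%_. 1)) (f (%_. 1)) = 1\<^sub>m (a * b)" unfolding lhom_one[OF e] lhom_one[OF f] by (rule kronecker_one)
fix i j assume ij: "i < a * b" "j < a * b"
note bd = divmod_bounds[OF ij(1)] divmod_bounds[OF ij(2)]
have "laurent r (%c. e c $$ (i div b, j div b) * f c $$ (i mod b, j mod b))"
 by (rule laurent_mult[OF E(4)[OF bd(1,3)] F(4)[OF bd(2,4)]])
thus "laurent r (%c. kronecker (e c) (f c) $$ (i, j))" by (rule laurent_cong) (simp only: kronecker_index[OF E(2) F(2) ij])
qed

lemma lhom_direct_sum:
assumes e: "lhom r a e" and f: "lhom r b f"
shows "lhom r (a + b) (%c. block (e c) (f c))"
proof (rule lhomI)
note E = lhomD[OF e] and F = lhomD[OF f]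
show "block (e c) (f c):sqm (a + b)" if "c:nz" for c by (rule block_carrier[OF E(2)[OF that] F(2)[OF that]])
show "block (e (%i. c i * c' i)) (f (%i. c i * c' i)) = block (e c) (f c) * block (e c') (f c')" if "c:nz" "c':nz" for c c'
 unfolding E(3)[OF that] F(3)[OF that]
 by (rule block_mult[symmetric, OF E(2)[OF that(1)] F(2)[OF that(1)] E(2)[OF that(2)] F(2)[OF that(2)]])
show "block (e (%_. 1)) (f (%_. 1)) = 1\<^sub>m (a + b)" unfolding lhom_one[OF e] lhom_one[OF f] by (rule block_one)
fix i j assume ij: "i < a + b" "j < a + b"
have "laurent r (%c. if i < a then if j < a then e c $$ (i, j) else 0 else if j < a then 0 else f c $$ (i - a, j - a))"
 using E(4)[of i j] F(4)[of "i - a" "j - a"] ij laurent_const[of r 0] by (cases "i < a"; cases "j < a") simp_all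
thus "laurent r (%c. block (e c) (f c) $$ (i, j))" by (rule laurent_cong) (simp only: block_index[OF E(2) F(2) ij])
qed

lemma nz_power: "c:nz ==> (%i. c i ^ t):nz" by (simp add: nz_def)

lemma lmon_power: "lmon r al (%i. c i ^ t) = lmon r (%i. int t * al i) c" by (simp add: lmon_def power_int_mult)

lemma lmon_power': "lmon r al (%i. c i ^ t) = lmon r al c ^ t"
using lmon_powi[of r al c "int t"] by (simp add: lmon_power mult.commute)

lemma lhom_power:
assumes e: "lhom r m e"
shows "lhom r m (%c. e (%i. c i ^ t))"
proof (rule lhomI)
note E = lhomD[OF e]
show "e (%i. c i ^ t):sqm m" if "c:nz" for c by (rule E(2)[OF nz_power[OF that]])
show "e (%i. (c i * c' i) ^ t) = e (%i. c i ^ t) * e (%i. c' i ^ t)" if "c:nz" "c':nz" for c c'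
 unfolding power_mult_distrib by (rule E(3)[OF nz_power[OF that(1)] nz_power[OF that(2)]])
show "e (%_. 1 ^ t) = 1\<^sub>m m" using lhom_one[OF e] by simp
fix i j assume ij: "i < m" "j < m"
obtain S k where S: "finite S" "S <= exps r" "!!c. c:nz ==> e c $$ (i, j) = (SUM al:S. k al * lmon r al c)"
 by (rule laurentE[OF E(4)[OF ij]]) (rule that)
have "laurent r (%c. SUM al:S. k al * lmon r (%i. int t * al i) c)" by (rule laurent_sum, rule laurent_lmon)
thus "laurent r (%c. e (%i. c i ^ t) $$ (i, j))" by (rule laurent_cong) (simp only: S(3)[OF nz_power] lmon_power)
qed

lemma group_prod_memI: "h:H ==> d:D ==> block h d:group_prod H D" unfolding group_prod_def by blast

text \<open>As \<open>D\<close> is a torus, \<open>\<alpha>(d)\<^sup>t = \<alpha>(d\<^sup>t)\<close>; so \<open>Z\<^sup>(\<^sup>t\<^sup>)(h, d) = Z(h, d\<^sup>t)\<close>.\<close>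

lemma scale_weights_eq:
assumes H: "subgroup H (GL n)" and D: "tparam d k D f" and Z: "Z:algebraic_hom (n + k) (group_prod H D) s (GLs s)"
 and ZD: "lhom d s (%c. Z (block (1\<^sub>m n) (f c)))" and h: "h:H" and u: "u:nz"
shows "scale_weights n k D s t Z (block h (f u)) = Z (block h (f (%i. u i ^ t)))"
proof -
note F = tparamD[OF D]
have hc: "h:sqm n" using sub_GL(1)[OF H] h GL_mat by blast
note fc = lhomD(2)[OF F(1)]
have Zmult: "Z (block h (f v)) = Z (block h (1\<^sub>m k)) * Z (block (1\<^sub>m n) (f v))" if v: "v:nz" for v
proof -
 have "block h (f v) = block h (1\<^sub>m k) * block (1\<^sub>m n) (f v)"
  using block_mult[OF hc one_carrier_mat one_carrier_mat fc[OF v]] hc fc[OF v] by simp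
 thus ?thesis
  using alg_homD(2)[OF Z group_prod_memI[OF h sub_GL(2)[OF F(4)]] group_prod_memI[OF sub_GL(2)[OF H] F(3)[OF v]]] by simp
qed
have Zhc: "Z (block h (1\<^sub>m k)):sqm s"
 using alg_homD(1)[OF Z group_prod_memI[OF h sub_GL(2)[OF F(4)]]] GL_mat by blast
have Zc: "Z (block h (f v)):sqm s" if "v:nz" for v
 using alg_homD(1)[OF Z group_prod_memI[OF h F(3)[OF that]]] GL_mat by blast
obtain W E where x: "expansion d s (%c. Z (block (1\<^sub>m n) (f c))) W E" and E0: "ALL al:W. E al ~= 0\<^sub>m s s"
 using expansion_exists[OF ZD] by (elim exE conjE) (rule that)
note X = expD[OF x]
let ?ZD = "%d. Z (block (1\<^sub>m n) d)"
have wts: "weights k D s ?ZD = tchar d D f ` W" by (rule weights_expansion[OF D ZD x E0])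
let ?C = "%M. M:sqm s & (ALL al:weights k D s ?ZD. ALL v:weight_space D s ?ZD al.
   M *\<^sub>v v = al (f u) ^ t \<cdot>\<^sub>v (Z (block h (1\<^sub>m k)) *\<^sub>v v))"
have sol: "?C (Z (block h (f (%i. u i ^ t))))"
proof (intro conjI ballI Zc[OF nz_power[OF u]])
 fix al v assume al: "al:weights k D s ?ZD" and v: "v:weight_space D s ?ZD al"
 obtain ga where ga: "al = tchar d D f ga" using al wts by blast
 have vc: "v:carrier_vec s" using v by (simp add: weight_space_def)
 have w: "Z (block (1\<^sub>m n) (f (%i. u i ^ t))) *\<^sub>v v = al (f (%i. u i ^ t)) \<cdot>\<^sub>v v"
  using v F(3)[OF nz_power[OF u]] by (simp add: weight_space_def)
 have at: "al (f (%i. u i ^ t)) = al (f u) ^ t" unfolding ga tchar_e[OF D nz_power[OF u]] tchar_e[OF D u] by (rule lmon_power')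
 have "Z (block h (f (%i. u i ^ t))) *\<^sub>v v = Z (block h (1\<^sub>m k)) *\<^sub>v (Z (block (1\<^sub>m n) (f (%i. u i ^ t))) *\<^sub>v v)"
  unfolding Zmult[OF nz_power[OF u]] by (rule assoc_mult_mat_vec[OF Zhc lhomD(2)[OF ZD nz_power[OF u]] vc])
 also have "... = al (f u) ^ t \<cdot>\<^sub>v (Z (block h (1\<^sub>m k)) *\<^sub>v v)"
  unfolding w at by (rule mult_mat_vec[OF Zhc vc])
 finally show "Z (block h (f (%i. u i ^ t))) *\<^sub>v v = al (f u) ^ t \<cdot>\<^sub>v (Z (block h (1\<^sub>m k)) *\<^sub>v v)" .
qed
\<comment> \<open>Each unit vector is the sum of its weight components
  \<open>E ga *\<^sub>v unit_vec s j\<close>, and on these the condition prescribes the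
  matrix.\<close>
have uniq: "M = M'" if M: "?C M" and M': "?C M'" for M M'
proof (rule eq_matI)
 have Mc: "M:sqm s" "M':sqm s" using M M' by simp_all
 have sp: "(N * 1\<^sub>m s) $$ (i, j) = (SUM ga:W. (N *\<^sub>v (E ga *\<^sub>v unit_vec s j)) $ i)"
  if N: "N:sqm s" and ij: "i < s" "j < s" for N i j
 proof -
  have "(SUM ga:W. (N *\<^sub>v (E ga *\<^sub>v unit_vec s j)) $ i)
   = (SUM ga:W. SUM l = 0..<s. N $$ (i, l) * (E ga *\<^sub>v unit_vec s j) $ l)"
  by (rule sum.cong[OF refl], rule mat_vec_entry[OF N _ ij(1)]) (use X(3) unit_vec_carrier[of s j] mult_mat_vec_carrier in blast)
  also have "... = (SUM l = 0..<s. SUM ga:W. N $$ (i, l) * (E ga *\<^sub>v unit_vec s j) $ l)" by (rule sum.swap)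
  also have "... = (SUM l = 0..<s. N $$ (i, l) * unit_vec s j $ l)"
  by (rule sum.cong[OF refl]) (simp add: sum_distrib_left[symmetric] expansion_vec_sum[OF ZD x unit_vec_carrier])
  also have "... = (SUM l = 0..<s. N $$ (i, l) * 1\<^sub>m s $$ (l, j))" using ij by (intro sum.cong refl) (simp add: unit_vec_def)
  finally show ?thesis using sq_entry[OF N one_carrier_mat ij] by simp
 qed
 fix i j assume "i < dim_row M'" "j < dim_col M'"
 hence ij: "i < s" "j < s" using Mc by auto
 have "M *\<^sub>v (E ga *\<^sub>v unit_vec s j) = M' *\<^sub>v (E ga *\<^sub>v unit_vec s j)" if ga: "ga:W" for ga
 proof -
  have "E ga *\<^sub>v unit_vec s j:weight_space D s ?ZD (tchar d D f ga)" unfolding weight_space_def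
  proof (intro CollectI conjI ballI)
  show "E ga *\<^sub>v unit_vec s j:carrier_vec s" using X(3)[of ga] by simp
  fix y assume "y:D"
  then obtain c where c: "c:nz" "y = f c" using F(2) by blast
  show "?ZD y *\<^sub>v (E ga *\<^sub>v unit_vec s j) = tchar d D f ga y \<cdot>\<^sub>v (E ga *\<^sub>v unit_vec s j)"
   unfolding c(2) tchar_e[OF D c(1)] by (rule expansion_vec_weight[OF ZD x unit_vec_carrier ga c(1)])
  qed
  moreover have "tchar d D f ga:weights k D s ?ZD" unfolding wts using ga by (rule imageI)
  ultimately show ?thesis using M M' by simp
 qed
 hence "(M * 1\<^sub>m s) $$ (i, j) = (M' * 1\<^sub>m s) $$ (i, j)" unfolding sp[OF Mc(1) ij] sp[OF Mc(2) ij] by simp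
 thus "M $$ (i, j) = M' $$ (i, j)" using Mc by simp
qed (use M M' in auto)
have "(THE M. ?C M) = Z (block h (f (%i. u i ^ t)))" using sol uniq by (intro the_equality) blast+
thus ?thesis unfolding scale_weights_def Let_def block_fst_block[OF hc fc[OF u]] block_snd_block[OF hc fc[OF u]] .
qed

text \<open>Otherwise Gordan's alternative gives \<open>l\<close> positive on all weights, so that X
  tends to the zero matrix along the corresponding one-parameter subgroup, and its determinant to 0
  because p > 0. But the determinant of X is a character of a semisimple group, and is 1 along the
  subgroup.\<close>

lemma zero_weight_combination:
assumes ss: "semisimple_group n H" and X: "X:algebraic_hom n H p (GLs p)" and p: "0 < p"
 and T: "tparam h n TH e" and sub: "TH <= H" and x: "expansion h p (%c. X (e c)) W E"
shows "EX c :: (nat => int) => nat. (EX xi:W. 0 < c xi) & (ALL k<h. (SUM xi:W. int (c xi) * xi k) = 0)"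
proof -
note TT = tparamD[OF T] and XW = expD[OF x]
have H: "subgroup H (GL n)" using ss by (simp add: semisimple_group_def algebraic_group_def)
have Xl: "lhom h p (%c. X (e c))" using TT(2) sub by (intro rep_lhom[OF TT(1) X]) simp
have no: False if l: "ALL xi:W. 1 <= idot h xi l" for l
proof -
 define mu where "mu A = e (tpow l (A $$ (0, 0)))" for A
 have muT: "mu:one_param_subgroups n TH" unfolding mu_def[abs_def] by (rule one_param_tpow[OF T])
 have mu: "mu:one_param_subgroups n H" using alg_homD[OF muT[unfolded one_param_subgroups_def]] sub
  unfolding one_param_subgroups_def by (intro algebraic_homI) blast+
 have mut: "mu (scalar1 t) = e (tpow l t)" for t by (simp add: mu_def scalar1_def)
 have Xg: "X g:GLs p" if "g:H" for g by (rule alg_homD(1)[OF X that])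
 have r: "regular_on n H (%g. det (X g))" by (rule regular_on_det[OF GL_mat[OF Xg] alg_homD(3)[OF X]])
 have nzd: "det (X g) ~= 0" if "g:H" for g by (rule GL_det[OF Xg[OF that]])
 have mul: "det (X (g * g')) = det (X g) * det (X g')" if "g:H" "g':H" for g g'
  unfolding alg_homD(2)[OF X that] by (rule det_mult[OF GL_mat[OF Xg[OF that(1)]] GL_mat[OF Xg[OF that(2)]]])
 obtain a where a: "ALL t. t ~= 0 --> det (X (mu (scalar1 t))) = t powi a"
  using character_one_param[OF r nzd mul sub_GL(1)[OF H] mu] ..
 have "a = 0" by (rule semisimple_char_trivial[OF ss r nzd mul mu]) (use a in simp_all)
 hence one: "det (X (e (tpow l t))) = 1" if "t ~= 0" for t using a that mut by simp
 have ent: "((%t. X (e (tpow l t)) $$ (i, j)) \<longlongrightarrow> 0) (at 0)" if ij: "i < p" "j < p" for i j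
 proof (rule Lim_transform_eventually)
  have "((%t. SUM al:W. E al $$ (i, j) * t powi idot h al l) \<longlongrightarrow> (SUM al:W. E al $$ (i, j) * 0)) (at 0)"
  proof (intro tendsto_sum tendsto_mult tendsto_const)
  fix al assume "al:W"
  hence "1 <= idot h al l" using l by blast
  thus "((%t :: complex. t powi idot h al l) \<longlongrightarrow> 0) (at 0)" using powi_tendsto_0[of "idot h al l"] by simp
  qed
  thus "((%t. SUM al:W. E al $$ (i, j) * t powi idot h al l) \<longlongrightarrow> 0) (at 0)" by simp
  show "\<forall>\<^sub>F t in at 0. (SUM al:W. E al $$ (i, j) * t powi idot h al l) = X (e (tpow l t)) $$ (i, j)"
  proof (rule eventually_mono[OF eventually_nonzero])
  fix t :: complex assume t: "t ~= 0"
  show "(SUM al:W. E al $$ (i, j) * t powi idot h al l) = X (e (tpow l t)) $$ (i, j)"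
   unfolding XW(4)[OF tpow_nz[OF t] ij] lmon_tpow[OF t] ..
  qed
 qed
 have "((%t. SUM q:{q. q permutes {0..<p}}. signof q * (PROD i = 0..<p. X (e (tpow l t)) $$ (i, q i)))
  \<longlongrightarrow> (SUM q:{q. q permutes {0..<p}}. signof q * (PROD i = 0..<p. 0))) (at 0)"
 proof (intro tendsto_sum tendsto_mult tendsto_const tendsto_prod ent)
  fix q i assume "q:{q. q permutes {0..<p}}" "i:{0..<p}"
  thus "i < p" "q i < p" using permutes_in_image[of q "{0..<p}" i] by simp_all
 qed
 hence lim: "((%t. SUM q:{q. q permutes {0..<p}}. signof q * (PROD i = 0..<p. X (e (tpow l t)) $$ (i, q i))) \<longlongrightarrow> 0) (at 0)"
  using p by simp
 have "((%t. 1) \<longlongrightarrow> (0 :: complex)) (at (0 :: complex))"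
 proof (rule Lim_transform_eventually[OF lim], rule eventually_mono[OF eventually_nonzero])
  fix t :: complex assume t: "t ~= 0"
  show "(SUM q:{q. q permutes {0..<p}}. signof q * (PROD i = 0..<p. X (e (tpow l t)) $$ (i, q i))) = 1"
  using det_def'[OF lhomD(2)[OF Xl tpow_nz[OF t]]] one[OF t] by simp
 qed
 hence "(0 :: complex) = 1" using tendsto_unique[OF at_neq_bot _ tendsto_const] by blast
 thus False by simp
qed
show ?thesis
proof (rule disjE[OF gordan[of W h "%xi. xi", OF XW(1)]])
 assume "EX c :: (nat => int) => nat. (EX i:W. 0 < c i) & (ALL k<h. (SUM i:W. int (c i) * i k) = 0)"
 thus ?thesis .
next
 assume "EX l. ALL i:W. 1 <= idot h i l"
 thus ?thesis using no by blast
qed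
qed

text \<open>For weights inside a hyperplane, \<open>caratheodory_hyperplane\<close> cuts a relation
  down to at most h of them; normalised to sum 1 it shows that the degeneracy is at most h -
  1.\<close>

lemma nondegenerate_hyperplane:
assumes T: "tparam h n TH e" and dg: "degen n TH p X = h" and wts: "weights n TH p X = tchar h TH e ` W"
 and S: "S <= W" "finite W" and mu: "EX j<h. mu j ~= 0" "!!xi. xi:S ==> idot h xi mu = 0"
 and c: "EX xi:S. 0 < (c xi :: nat)" "!!k. k < h ==> (SUM xi:S. int (c xi) * xi k) = 0"
shows False
proof -
obtain j where j: "j < h" "mu j ~= 0" using mu(1) by blast
have fS: "finite S" using S finite_subset by blast
have "EX J<=S. EX b :: (nat => int) => rat. J ~= {} & card J <= h & (ALL i:J. 0 < b i) & (ALL k<h. (SUM i:J. b i * of_int (i k)) = 0)"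
 by (rule caratheodory_hyperplane[OF fS c(1) _ j mu(2)]) (use c(2) in simp_all)
then obtain J b where J: "J <= S" "J ~= {}" "card J <= h" and b: "ALL i:J. 0 < b i" "ALL k<h. (SUM i:J. b i * of_int (i k)) = (0 :: rat)"
 by (elim exE conjE) (rule that)
have fJ: "finite J" using J(1) fS finite_subset by blast
\<comment> \<open>\<open>degen\<close> takes n for a relation between n + 1 weights, so
  \<open>card J\<close> weights witness the value \<open>card J - 1\<close>.\<close>
define N where "N = card J - 1"
have cJ: "card J = N + 1" unfolding N_def using J(2) fJ card_gt_0_iff[of J] by simp
obtain g where g: "bij_betw g {1..N + 1} J" using ex_bij_betw_nat_finite_1[OF fJ] by (auto simp: cJ)
have reidx: "(SUM i = 1..N + 1. F (g i)) = (SUM xi:J. F xi)" for F :: "(nat => int) => 'z::comm_monoid_add"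
 by (rule sum.reindex_bij_betw[OF g])
define s where "s = (SUM xi:J. b xi)"
have s: "0 < s" unfolding s_def using b(1) J(2) fJ by (intro sum_pos) auto
have "degen n TH p X <= N" unfolding degen_def
proof (rule Least_le, intro exI[of _ "%i. tchar h TH e (g i)"] exI[of _ "%i. b (g i) / s"] conjI ballI)
 fix i assume "i:{1..N + 1}"
 hence gi: "g i:J" using g by (auto simp: bij_betw_def)
 thus "tchar h TH e (g i):weights n TH p X" unfolding wts using J(1) S(1) by blast
 show "0 <= b (g i) / s" using b(1) gi s by (simp add: less_imp_le)
next
 show "(SUM i = 1..N + 1. b (g i) / s) = 1" using reidx[of "%xi. b xi / s"] s by (simp add: sum_divide_distrib[symmetric] s_def)
 let ?u = "%k. qchar_of (tchar h TH e (unit_exp k))"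
 have "(SUM i = 1..N + 1. qscale (b (g i) / s) (qchar_of (tchar h TH e (g i))))
  = (SUM xi:J. qscale (b xi / s) (qchar_of (tchar h TH e xi)))"
  by (rule reidx[of "%xi. qscale (b xi / s) (qchar_of (tchar h TH e xi))"])
 also have "... = (SUM xi:J. qscale (b xi / s) (SUM k<h. qscale (of_int (xi k)) (?u k)))"
  by (rule sum.cong[OF refl]) (rule arg_cong[OF qchar_of_tchar[OF T]])
 also have "... = (SUM xi:J. SUM k<h. qscale (b xi / s * of_int (xi k)) (?u k))"
  by (simp only: qchar.scale_sum_right qchar.scale_scale)
 also have "... = (SUM k<h. SUM xi:J. qscale (b xi / s * of_int (xi k)) (?u k))" by (rule sum.swap)
 also have "... = (SUM k<h. qscale (SUM xi:J. b xi / s * of_int (xi k)) (?u k))" by (simp only: qchar.scale_sum_left)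
 also have "... = (SUM k<h. 0)"
 proof (rule sum.cong[OF refl])
  fix k assume "k:{..<h}"
  hence "(SUM xi:J. b xi * of_int (xi k)) = 0" using b(2) by simp
  hence "(SUM xi:J. b xi / s * of_int (xi k)) = 0" by (simp add: sum_divide_distrib[symmetric])
  thus "qscale (SUM xi:J. b xi / s * of_int (xi k)) (?u k) = 0" by simp
 qed
 finally show "(SUM i = 1..N + 1. qscale (b (g i) / s) (qchar_of (tchar h TH e (g i)))) = 0" by simp
qed
thus False using dg J(3) cJ by simp
qed

section \<open>Reduction to finitely many configurations of exponents\<close>

definition pi_exp :: "nat => nat => (nat => nat => int) => (nat => int) => nat => int" where
"pi_exp h m w al = trunc h (%k. SUM i<m. al i * w i k)"

lemma idot_cong: "(!!k. k < r ==> x k = x' k) ==> (!!k. k < r ==> y k = y' k) ==> idot r x y = idot r x' y'"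
by (simp add: idot_def)

text \<open>\<open>pi_exp\<close> is restriction of characters from the diagonal torus of rank m to
  the torus of rank h; its adjoint is the inclusion of cocharacters, which sends \<open>l\<close> to
  its pairings with the weights \<open>w i\<close>.\<close>

lemma idot_pi_exp: "idot h (pi_exp h m w al) l = idot m al (%i. idot h (w i) l)"
proof -
have "idot h (pi_exp h m w al) l = (SUM k<h. SUM i<m. al i * (w i k * l k))"
 by (simp add: idot_def pi_exp_def trunc_def sum_distrib_right mult.assoc)
also have "... = (SUM i<m. SUM k<h. al i * (w i k * l k))" by (rule sum.swap)
finally show ?thesis by (simp add: idot_def sum_distrib_left)
qed

lemma lmon_pi_exp: "c:nz ==> lmon m al (%i. lmon h (w i) c) = lmon h (pi_exp h m w al) c"
proof -
assume c: "c:nz"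
have "lmon m al (%i. lmon h (w i) c) = (PROD i<m. lmon h (%k. al i * w i k) c)"
 by (simp add: lmon_def[of m] lmon_powi mult.commute)
also have "... = lmon h (%k. SUM i<m. al i * w i k) c" by (rule lmon_sum[OF c, symmetric])
finally show ?thesis by (simp add: pi_exp_def)
qed

lemma rep_polynomials:
assumes "\<rho>:algebraic_hom n G q K"
shows "EX P. finite P & P <= regular_fun n & (ALL i<q. ALL j<q. EX p:P. ALL g:G. \<rho> g $$ (i, j) = p g)"
proof -
have "ALL ij:{..<q} \<times> {..<q}. EX p. p:regular_fun n & (ALL g:G. \<rho> g $$ ij = p g)"
proof
 fix ij assume "ij:{..<q} \<times> {..<q}"
 then obtain i j where ij: "ij = (i, j)" "i < q" "j < q" by auto
 show "EX p. p:regular_fun n & (ALL g:G. \<rho> g $$ ij = p g)"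
  using alg_homD(3)[OF assms ij(2,3)] unfolding ij(1) regular_on_def Bex_def .
qed
from bchoice[OF this] obtain p where p: "ALL ij:{..<q} \<times> {..<q}. p ij:regular_fun n & (ALL g:G. \<rho> g $$ ij = p ij g)" ..
show ?thesis by (intro exI[of _ "p ` ({..<q} \<times> {..<q})"]) (use p in auto)
qed

text \<open>On the torus the matrix entries of the representation are boxed functions on the
  diagonal torus, so every exponent with a nonzero coefficient is the restriction of one in the
  box.\<close>

lemma weights_in_box:
assumes T: "tparam h n TH e" and w: "eigen_param h n e m w E'"
 and P: "ALL i<q. ALL j<q. EX p:P. ALL g:G. \<rho> g $$ (i, j) = p g" "TH <= G"
 and B: "!!p. p:P ==> boxed m B (%z. p (ez n m w E' z))"
 and x: "expansion h q (%c. \<rho> (e c)) W E" and xi: "xi:W" "E xi ~= 0\<^sub>m q q"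
shows "EX al:box m B. pi_exp h m w al = xi"
proof (rule ccontr)
note X = expD[OF x]
assume no: "~ ?thesis"
have "E xi = 0\<^sub>m q q"
proof (rule eq_matI)
 fix i j assume "i < dim_row (0\<^sub>m q q :: complex mat)" "j < dim_col (0\<^sub>m q q :: complex mat)"
 hence ij: "i < q" "j < q" by simp_all
 obtain p where p: "p:P" "ALL g:G. \<rho> g $$ (i, j) = p g" using P(1) ij by blast
 obtain k where k: "ALL z:nz. p (ez n m w E' z) = (SUM al:box m B. k al * lmon m al z)" using B[OF p(1)] unfolding boxed_def ..
 have "(if xi:W then E xi $$ (i, j) else 0) = (SUM al:{al:box m B. pi_exp h m w al = xi}. k al)"
 proof (rule expansion_coeff[OF x ij finite_box])
  fix c assume c: "c:nz"
  have z: "(%i. lmon h (w i) c):nz" using lmon_nonzero[OF c] by (simp add: nz_def)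
  have "e c:G" using tparamD(3)[OF T c] P(2) by blast
  hence "\<rho> (e c) $$ (i, j) = p (ez n m w E' (%i. lmon h (w i) c))" using p(2) ez_lmon[OF w c] by simp
  thus "\<rho> (e c) $$ (i, j) = (SUM al:box m B. k al * lmon h (pi_exp h m w al) c)" unfolding bspec[OF k z] lmon_pi_exp[OF c] .
 qed (use xi(1) X(2) in \<open>auto simp: pi_exp_def\<close>)
 moreover have "{al:box m B. pi_exp h m w al = xi} = {}" using no by blast
 ultimately have "E xi $$ (i, j) = 0" using xi(1) by simp
 thus "E xi $$ (i, j) = 0\<^sub>m q q $$ (i, j)" using ij by simp
qed (use X(3)[of xi] in auto)
thus False using xi(2) by simp
qed

text \<open>The conclusion of the convexity argument in terms of data of which there are finitely many: the
  cocharacters of the maximal torus of \<open>H\<close> are the integer vectors orthogonal to \<open>K\<close>, and \<open>Xm\<close>, \<open>Hm\<close>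
are the lifts to \<open>\<int>\<^sup>m\<close> of the weights of \<open>X\<close> and \<open>Z\<close>. This makes the bound on \<open>t\<close> uniform over all
maximal tori.\<close>

definition destab :: "nat => (nat => int) set => (nat => int) set => nat => nat => (nat => int) set =>
 (nat => int) set => (nat => int) set => bool" where
"destab d Y G t m K Xm Hm \<longleftrightarrow> (EX nn :: (nat => int) => nat. ALL S1 S2 a b. S1 <= Xm \<times> Y --> S2 <= Hm \<times> G -->
 (ALL ka:K. idot m ka a = 0) --> (EX i<m. a i ~= 0) \<or> (EX j<d. b j ~= 0) --> (ALL s:S1. idot2 m d s a b = 0) -->
 (ALL s:S2. idot2t m d t s a b = 0) --> (EX va vb. (ALL ka:K. idot m ka va = 0) & (ALL s:S1. 0 <= idot2 m d s va vb) &
  (ALL s:S2. 0 <= idot2t m d t s va vb) & (SUM be:Y. int (nn be) * idot d be vb) < 0))"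

text \<open>Transports \<open>destabilising_cocharacter\<close> to the diagonal torus. By
  \<open>R\<close> a vector orthogonal to \<open>K\<close> comes from a cocharacter \<open>l\<close>
  of the torus of H, and pairings with lifted weights become pairings of the weights with
  \<open>l\<close>.\<close>

lemma destab_forward:
assumes fin: "finite X" "finite Y" "finite H" "finite G" and d: "0 < d"
 and Y: "!!u. EX j<d. u j ~= 0 ==> EX be:Y. idot d be u ~= 0"
 and \<nu>: "!!be. be:Y ==> 0 <= idot d be \<nu>" "!!ga. ga:G ==> idot d ga \<nu> <= - 1"
 and nondeg: "!!S mu (c :: (nat => int) => nat). S <= X ==> EX j<h. mu j ~= 0 ==> (!!xi. xi:S ==> idot h xi mu = 0) ==>
  EX xi:S. 0 < c xi ==> (!!k. k < h ==> (SUM xi:S. int (c xi) * xi k) = 0) ==> False"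
 and R: "!!a. (!!ka. ka:K ==> idot m ka a = 0) ==> EX l. ALL i<m. idot h (w i) l = a i"
 and K: "!!ka v. ka:K ==> idot m ka (%i. idot h (w i) v) = 0"
 and Xm: "!!al. al:Xm ==> pi_exp h m w al:X" and Hm: "!!al. al:Hm ==> pi_exp h m w al:H"
shows "EX t0>0. ALL t>=t0. destab d Y G t m K Xm Hm"
proof -
have \<nu>': "idot d (snd z) \<nu> <= - 1" if "z:H \<times> G" for z using \<nu>(2) that by auto
have fZ: "finite (H \<times> G)" using fin by simp
have "EX t0>0. ALL t>=t0. EX n :: (nat => int) => nat. ALL S1 S2 muH muD. S1 <= X \<times> Y --> S2 <= H \<times> G -->
 (EX j<h. muH j ~= 0) \<or> (EX j<d. muD j ~= 0) --> (ALL s:S1. idot2 h d s muH muD = 0) -->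
 (ALL s:S2. idot2t h d t s muH muD = 0) --> (EX vH vD. (ALL s:S1. 0 <= idot2 h d s vH vD) &
  (ALL s:S2. 0 <= idot2t h d t s vH vD) & (SUM be:Y. int (n be) * idot d be vD) < 0)"
proof (rule destabilising_cocharacter[OF fin(1,2) fZ d])
 show "EX be:Y. idot d be u ~= 0" if "EX j<d. u j ~= 0" for u using that by (rule Y)
 show "0 <= idot d be \<nu>" if "be:Y" for be using that by (rule \<nu>(1))
 show "idot d (snd z) \<nu> <= - 1" if "z:H \<times> G" for z using that by (rule \<nu>')
 show False if "S <= X" "EX j<h. mu j ~= 0" "!!xi. xi:S ==> idot h xi mu = 0" "EX xi:S. 0 < c xi"
  "!!k. k < h ==> (SUM xi:S. int (c xi) * xi k) = 0" for S mu and c :: "(nat => int) => nat" using that by (rule nondeg)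
qed
then obtain t0 where t0: "0 < t0" and main: "ALL t>=t0. EX n :: (nat => int) => nat. ALL S1 S2 muH muD. S1 <= X \<times> Y --> S2 <= H \<times> G -->
 (EX j<h. muH j ~= 0) \<or> (EX j<d. muD j ~= 0) --> (ALL s:S1. idot2 h d s muH muD = 0) -->
 (ALL s:S2. idot2t h d t s muH muD = 0) --> (EX vH vD. (ALL s:S1. 0 <= idot2 h d s vH vD) &
  (ALL s:S2. 0 <= idot2t h d t s vH vD) & (SUM be:Y. int (n be) * idot d be vD) < 0)" by (elim exE conjE) (rule that)
have "destab d Y G t m K Xm Hm" if t: "t0 <= t" for t
proof -
 obtain nn :: "(nat => int) => nat" where nn: "ALL S1 S2 muH muD. S1 <= X \<times> Y --> S2 <= H \<times> G -->
 (EX j<h. muH j ~= 0) \<or> (EX j<d. muD j ~= 0) --> (ALL s:S1. idot2 h d s muH muD = 0) -->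
 (ALL s:S2. idot2t h d t s muH muD = 0) --> (EX vH vD. (ALL s:S1. 0 <= idot2 h d s vH vD) &
  (ALL s:S2. 0 <= idot2t h d t s vH vD) & (SUM be:Y. int (nn be) * idot d be vD) < 0)" using main[THEN spec, THEN mp, OF t] ..
 show ?thesis unfolding destab_def
 proof (intro exI[of _ nn] allI impI)
  fix S1 S2 a b
  assume S: "S1 <= Xm \<times> Y" "S2 <= Hm \<times> G" and aK: "ALL ka:K. idot m ka a = 0"
  and nz: "(EX i<m. a i ~= 0) \<or> (EX j<d. b j ~= 0)" and p1: "ALL s:S1. idot2 m d s a b = 0"
  and p2: "ALL s:S2. idot2t m d t s a b = 0"
  have "EX l. ALL i<m. idot h (w i) l = a i" by (rule R) (use aK in blast)
  then obtain l where l: "ALL i<m. idot h (w i) l = a i" ..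
  have pil: "idot h (pi_exp h m w al) l = idot m al a" for al unfolding idot_pi_exp using l by (intro idot_cong) simp_all
  let ?g = "%s :: (nat => int) \<times> (nat => int). (pi_exp h m w (fst s), snd s)"
  have "EX vH vD. (ALL s:?g ` S1. 0 <= idot2 h d s vH vD) &
  (ALL s:?g ` S2. 0 <= idot2t h d t s vH vD) & (SUM be:Y. int (nn be) * idot d be vD) < 0"
  proof (rule nn[THEN spec, THEN spec, THEN spec, THEN spec, THEN mp, THEN mp, THEN mp, THEN mp, THEN mp])
  show "?g ` S1 <= X \<times> Y" using S(1) Xm by auto
  show "?g ` S2 <= H \<times> G" using S(2) Hm by auto
  show "(EX j<h. l j ~= 0) \<or> (EX j<d. b j ~= 0)"
  proof (rule disjE[OF nz])
   assume "EX i<m. a i ~= 0"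
   then obtain i where i: "i < m" "idot h (w i) l ~= 0" using l by auto
   have "EX j<h. l j ~= 0"
   proof (rule ccontr)
    assume "~ (EX j<h. l j ~= 0)"
    hence "idot h (w i) l = 0" by (simp add: idot_def)
    thus False using i(2) by simp
   qed
   thus ?thesis ..
  qed simp
  show "ALL s:?g ` S1. idot2 h d s l b = 0" using p1 pil by simp
  show "ALL s:?g ` S2. idot2t h d t s l b = 0" using p2 pil by simp
  qed
  then obtain vH vD where v: "ALL s:?g ` S1. 0 <= idot2 h d s vH vD"
  "ALL s:?g ` S2. 0 <= idot2t h d t s vH vD" "(SUM be:Y. int (nn be) * idot d be vD) < 0" by (elim exE conjE) (rule that)
  show "EX va vb. (ALL ka:K. idot m ka va = 0) & (ALL s:S1. 0 <= idot2 m d s va vb) &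
  (ALL s:S2. 0 <= idot2t m d t s va vb) & (SUM be:Y. int (nn be) * idot d be vb) < 0"
  using K v by (intro exI[of _ "%i. idot h (w i) vH"] exI[of _ vD]) (simp add: idot_pi_exp)
 qed
qed
thus ?thesis using t0 by (intro exI[of _ t0]) simp
qed

text \<open>The opposite transport: a set of weights is replaced by the set of all its bounded
  lifts. \<open>faithful\<close> ensures that a nonzero cocharacter of the torus of H remains
  nonzero in the diagonal torus.\<close>

lemma destab_backward:
assumes ds: "destab d Y G t m K Xm Hm" and R: "!!a. (!!ka. ka:K ==> idot m ka a = 0) ==> EX l. ALL i<m. idot h (w i) l = a i"
 and K: "!!ka v. ka:K ==> idot m ka (%i. idot h (w i) v) = 0"
 and faithful: "!!l. ALL i<m. idot h (w i) l = 0 ==> ALL j<h. l j = 0"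
 and Xm: "!!xi. xi:X ==> EX al:Xm. pi_exp h m w al = xi" and Hm: "!!xi. xi:H ==> EX al:Hm. pi_exp h m w al = xi"
shows "EX nn :: (nat => int) => nat. ALL S1 S2 muH muD. S1 <= X \<times> Y --> S2 <= H \<times> G -->
 (EX j<h. muH j ~= 0) \<or> (EX j<d. muD j ~= 0) --> (ALL s:S1. idot2 h d s muH muD = 0) -->
 (ALL s:S2. idot2t h d t s muH muD = 0) --> (EX vH vD. (ALL s:S1. 0 <= idot2 h d s vH vD) &
  (ALL s:S2. 0 <= idot2t h d t s vH vD) & (SUM be:Y. int (nn be) * idot d be vD) < 0)"
proof -
obtain nn :: "(nat => int) => nat" where nn: "ALL S1 S2 a b. S1 <= Xm \<times> Y --> S2 <= Hm \<times> G -->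
 (ALL ka:K. idot m ka a = 0) --> (EX i<m. a i ~= 0) \<or> (EX j<d. b j ~= 0) --> (ALL s:S1. idot2 m d s a b = 0) -->
 (ALL s:S2. idot2t m d t s a b = 0) --> (EX va vb. (ALL ka:K. idot m ka va = 0) & (ALL s:S1. 0 <= idot2 m d s va vb) &
  (ALL s:S2. 0 <= idot2t m d t s va vb) & (SUM be:Y. int (nn be) * idot d be vb) < 0)" using ds unfolding destab_def ..
show ?thesis
proof (intro exI[of _ nn] allI impI)
 fix S1 S2 muH muD
 assume S: "S1 <= X \<times> Y" "S2 <= H \<times> G" and nz: "(EX j<h. muH j ~= 0) \<or> (EX j<d. muD j ~= 0)"
  and p1: "ALL s:S1. idot2 h d s muH muD = 0" and p2: "ALL s:S2. idot2t h d t s muH muD = 0"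
 let ?a = "%i. idot h (w i) muH"
 let ?S1 = "{s:Xm \<times> Y. (pi_exp h m w (fst s), snd s):S1}"
 let ?S2 = "{s:Hm \<times> G. (pi_exp h m w (fst s), snd s):S2}"
 have "EX va vb. (ALL ka:K. idot m ka va = 0) & (ALL s:?S1. 0 <= idot2 m d s va vb) &
  (ALL s:?S2. 0 <= idot2t m d t s va vb) & (SUM be:Y. int (nn be) * idot d be vb) < 0"
 proof (rule nn[THEN spec, THEN spec, THEN spec, THEN spec, THEN mp, THEN mp, THEN mp, THEN mp, THEN mp, THEN mp])
  show "?S1 <= Xm \<times> Y" "?S2 <= Hm \<times> G" by blast+
  show "ALL ka:K. idot m ka ?a = 0" using K by blast
  show "(EX i<m. ?a i ~= 0) \<or> (EX j<d. muD j ~= 0)"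
  proof (rule disjE[OF nz])
  assume j: "EX j<h. muH j ~= 0"
  have "EX i<m. ?a i ~= 0"
  proof (rule ccontr)
   assume "~ (EX i<m. ?a i ~= 0)"
   hence "ALL j<h. muH j = 0" by (intro faithful) simp
   thus False using j by blast
  qed
  thus ?thesis ..
  qed simp
  show "ALL s:?S1. idot2 m d s ?a muD = 0" using p1 by (auto simp: idot_pi_exp[symmetric])
  show "ALL s:?S2. idot2t m d t s ?a muD = 0" using p2 by (auto simp: idot_pi_exp[symmetric])
 qed
 then obtain va vb where v: "ALL ka:K. idot m ka va = 0" "ALL s:?S1. 0 <= idot2 m d s va vb"
  "ALL s:?S2. 0 <= idot2t m d t s va vb" "(SUM be:Y. int (nn be) * idot d be vb) < 0" by (elim exE conjE) (rule that)
 have "EX l. ALL i<m. idot h (w i) l = va i" by (rule R) (use v(1) in blast)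
 then obtain l where l: "ALL i<m. idot h (w i) l = va i" ..
 have pil: "idot h (pi_exp h m w al) l = idot m al va" for al unfolding idot_pi_exp using l by (intro idot_cong) simp_all
 have "0 <= idot2 h d s l vb" if s: "s:S1" for s
 proof -
  have sX: "fst s:X" "snd s:Y" using S(1) s by (cases s; auto)+
  obtain al where al: "al:Xm" "pi_exp h m w al = fst s" using Xm[OF sX(1)] by blast
  hence "(al, snd s):?S1" using sX s by simp
  hence "0 <= idot m al va + idot d (snd s) vb" using bspec[OF v(2)] by fastforce
  thus ?thesis using pil[of al] al(2) by simp
 qed
 moreover have "0 <= idot2t h d t s l vb" if s: "s:S2" for s
 proof -
  have sX: "fst s:H" "snd s:G" using S(2) s by (cases s; auto)+
  obtain al where al: "al:Hm" "pi_exp h m w al = fst s" using Hm[OF sX(1)] by blast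
  hence "(al, snd s):?S2" using sX s by simp
  hence "0 <= idot m al va + int t * idot d (snd s) vb" using bspec[OF v(3)] by fastforce
  thus ?thesis using pil[of al] al(2) by simp
 qed
 ultimately show "EX vH vD. (ALL s:S1. 0 <= idot2 h d s vH vD) &
  (ALL s:S2. 0 <= idot2t h d t s vH vD) & (SUM be:Y. int (nn be) * idot d be vD) < 0"
  using v(4) by (intro exI[of _ l] exI[of _ vb]) simp
qed
qed

section \<open>The weights of the whole representation of H x D\<close>

lemma lhom_extend: "lhom h m F ==> lhom (h + d) m F" by (simp add: lhom_def laurent_extend)

lemma lhom_shift:
assumes F: "lhom d m F"
shows "lhom (h + d) m (%c. F (%i. c (h + i)))" unfolding lhom_def
proof (intro conjI ballI allI impI)
show "F (%i. c (h + i)):GLs m" if "c:nz" for c by (rule lhomD(1)[OF F nz_shift[OF that]])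
show "F (%i. c (h + i) * c' (h + i)) = F (%i. c (h + i)) * F (%i. c' (h + i))" if "c:nz" "c':nz" for c c'
 by (rule lhomD(3)[OF F nz_shift[OF that(1)] nz_shift[OF that(2)]])
show "laurent (h + d) (%c. F (%i. c (h + i)) $$ (i, j))" if "i < m" "j < m" for i j
 by (rule laurent_shift[OF lhomD(4)[OF F that]])
qed

lemma idot_join: "idot (h + d) (join h xi be) l = idot h xi l + idot d be (%i. l (h + i))"
proof -
have "idot (h + d) (join h xi be) l = (SUM k = 0..<h. join h xi be k * l k) + (SUM k = h..<h + d. join h xi be k * l k)"
 unfolding idot_def atLeast0LessThan[symmetric] by (rule sum.atLeastLessThan_concat[symmetric]) simp_all
also have "(SUM k = h..<h + d. join h xi be k * l k) = (SUM k = 0..<d. join h xi be (k + h) * l (k + h))"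
 using sum.shift_bounds_nat_ivl[of "%k. join h xi be k * l k" 0 h d] by (simp add: add.commute)
finally show ?thesis by (simp add: idot_def join_def atLeast0LessThan add.commute)
qed

lemma join_exps: "be:exps d ==> join h xi be:exps (h + d)" by (auto simp: exps_def join_def)

lemma join_inject:
assumes "join h xi be = join h xi' be'" "xi:exps h" "xi':exps h"
shows "xi = xi' & be = be'"
proof
show "xi = xi'"
proof (rule ext)
 fix i show "xi i = xi' i" using fun_cong[OF assms(1), of i] assms(2,3) by (cases "i < h") (simp_all add: join_def exps_def)
qed
show "be = be'"
proof (rule ext)
 fix i show "be i = be' i" using fun_cong[OF assms(1), of "h + i"] by (simp add: join_def)
qed
qed

lemma nonzero_entry:
assumes "A:sqm m" "A ~= (0\<^sub>m m m :: complex mat)"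
obtains i j where "i < m" "j < m" "A $$ (i, j) ~= 0"
proof -
have "EX i<m. EX j<m. A $$ (i, j) ~= 0"
proof (rule ccontr)
 assume no: "~ ?thesis"
 have "A = 0\<^sub>m m m"
 proof (rule eq_matI)
  fix i j assume "i < dim_row (0\<^sub>m m m :: complex mat)" "j < dim_col (0\<^sub>m m m :: complex mat)"
  thus "A $$ (i, j) = 0\<^sub>m m m $$ (i, j)" using no by simp
 qed (use assms(1) in auto)
 thus False using assms(2) by simp
qed
thus thesis using that by blast
qed

text \<open>The character depends on the D-component alone, and conjugation by an element of H x D
  leaves that component unchanged because D is commutative.\<close>

lemma weyl_invariant:
fixes de :: "nat => int"
assumes H: "subgroup H (GL n)" and D: "tparam d k D f" and TH: "tparam h n TH e" "TH <= H"
 and w: "w:weyl_group (n + k) (group_prod H D) (group_prod TH D)"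
defines "ch \<equiv> tchar (h + d) (group_prod TH D) (%c. block (e c) (f (%i. c (h + i)))) (join h (%_. 0) de)"
shows "ch \<circ> w = ch"
proof (rule ext)
fix s
let ?G = "group_prod H D" and ?T = "group_prod TH D"
note F = tparamD[OF D] and E = tparamD[OF TH(1)]
note T = tparam_block[OF TH(1) D]
have sub: "H <= sqm n" "D <= sqm k" using sub_GL(1)[OF H] sub_GL(1)[OF F(4)] GL_mat by blast+
have TG: "?T <= ?G" using TH(2) unfolding group_prod_def by blast
have GG: "?G <= GLs (n + k)"
proof
 fix A assume "A:?G"
 then obtain a b where "a:H" "b:D" "A = block a b" by (rule group_prodE)
 thus "A:GLs (n + k)" using block_GL sub_GL(1)[OF H] sub_GL(1)[OF F(4)] by blast
qed
have chsnd: "ch A = tchar d D f de (block_snd n A)" if A: "A:?T" for A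
proof -
 obtain c where c: "c:nz" "A = block (e c) (f (%i. c (h + i)))" using tparamD(2)[OF T] A by blast
 have "ch A = lmon (h + d) (join h (%_. 0) de) c" unfolding ch_def c(2) by (rule tchar_e[OF T c(1)])
 also have "... = tchar d D f de (f (%i. c (h + i)))" by (simp add: lmon_join tchar_e[OF D nz_shift[OF c(1)]])
 finally show ?thesis unfolding c(2) block_snd_block[OF lhomD(2)[OF E(1) c(1)] lhomD(2)[OF F(1) nz_shift[OF c(1)]]] .
qed
obtain g where g: "g:normalizer (sub_grp (n + k) ?G) ?T"
 and wg: "w = (%s. if s:?T then g \<otimes>\<^bsub>GL (n + k)\<^esub> s \<otimes>\<^bsub>GL (n + k)\<^esub> ginv (n + k) g else s)"
 using w unfolding weyl_group_def by blast
have gG: "g:?G" using g by (simp add: normalizer_def stabilizer_def)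
obtain a b where ab: "a:H" "b:D" "g = block a b" using gG by (rule group_prodE)
have abGL: "a:GLs n" "b:GLs k" using ab sub_GL(1)[OF H] sub_GL(1)[OF F(4)] by blast+
have ginv: "ginv (n + k) g = block (ginv n a) (ginv k b)" unfolding ab(3) by (rule block_inv[OF abGL])
have giG: "ginv (n + k) g:?G"
 unfolding ginv by (rule group_prod_memI[OF sub_GL(4)[OF H ab(1)] sub_GL(4)[OF F(4) ab(2)]])
have Gmult: "A * B:?G" if AB: "A:?G" "B:?G" for A B
proof -
 obtain x y where x: "x:H" "y:D" "A = block x y" using AB(1) by (rule group_prodE)
 obtain x' y' where x': "x':H" "y':D" "B = block x' y'" using AB(2) by (rule group_prodE)
 have "A * B = block (x * x') (y * y')" unfolding x(3) x'(3) using x x' sub by (intro block_mult) blast+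
 thus ?thesis using group_prod_memI[OF sub_GL(3)[OF H x(1) x'(1)] sub_GL(3)[OF F(4) x(2) x'(2)]] by simp
qed
have sgG: "subgroup ?G (GL (n + k))"
proof (rule group.subgroupI[OF group_GL GG])
 show "?G ~= {}" using gG by blast
 show "A \<otimes>\<^bsub>GL (n + k)\<^esub> B:?G" if "A:?G" "B:?G" for A B using Gmult[OF that] by simp
 fix A assume "A:?G"
 then obtain x y where x: "x:H" "y:D" "A = block x y" by (rule group_prodE)
 have xy: "x:GLs n" "y:GLs k" using x sub_GL(1)[OF H] sub_GL(1)[OF F(4)] by blast+
 show "ginv (n + k) A:?G"
  unfolding x(3) block_inv[OF xy] by (rule group_prod_memI[OF sub_GL(4)[OF H x(1)] sub_GL(4)[OF F(4) x(2)]])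
qed
have gT: "g * s * ginv (n + k) g:?T" if s: "s:?T" for s
proof -
 have "g <#\<^bsub>sub_grp (n + k) ?G\<^esub> ?T #>\<^bsub>sub_grp (n + k) ?G\<^esub> (inv\<^bsub>sub_grp (n + k) ?G\<^esub> g) = ?T"
  using g TG by (simp add: normalizer_def stabilizer_def)
 moreover have "inv\<^bsub>sub_grp (n + k) ?G\<^esub> g = ginv (n + k) g" by (rule group.m_inv_consistent[OF group_GL sgG gG])
 ultimately show ?thesis using s by (auto simp: l_coset_def r_coset_def)
qed
show "(ch \<circ> w) s = ch s"
proof (cases "s:?T")
 case False
 thus ?thesis by (simp add: wg)
next
 case True
 have sG: "s:?G" using True TG by blast
 have sD: "block_snd n s:D" by (rule group_prod_proj(2)[OF sub sG])
 have bc: "a:sqm n" "b:sqm k" "ginv n a:sqm n" "ginv k b:sqm k"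
  "block_snd n s:sqm k" using GL_mat abGL GL_inv_closed sD sub(2) by blast+
 have "block_snd n (g * s * ginv (n + k) g) = block_snd n (g * s) * block_snd n (ginv (n + k) g)"
  by (rule group_prod_mult(2)[OF sub Gmult[OF gG sG] giG])
 also have "block_snd n (g * s) = block_snd n g * block_snd n s" by (rule group_prod_mult(2)[OF sub gG sG])
 also have "block_snd n g = b" unfolding ab(3) by (rule block_snd_block[OF bc(1,2)])
 also have "block_snd n (ginv (n + k) g) = ginv k b" unfolding ginv by (rule block_snd_block[OF bc(3,4)])
 also have "b * block_snd n s = block_snd n s * b"
 proof -
  obtain u where u: "u:nz" "b = f u" using F(2) ab(2) by blast
  obtain v where v: "v:nz" "block_snd n s = f v" using F(2) sD by blast
  show ?thesis unfolding u(2) v(2) lhomD(3)[OF F(1) u(1) v(1), symmetric] lhomD(3)[OF F(1) v(1) u(1), symmetric]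
  by (simp add: mult.commute)
 qed
 also have "block_snd n s * b * ginv k b = block_snd n s"
  using assoc_mult_mat[OF bc(5,2,4)] GL_inv_right[OF abGL(2)] bc(5) by simp
 finally have "block_snd n (g * s * ginv (n + k) g) = block_snd n s" .
 thus ?thesis using True chsnd[OF gT[OF True]] chsnd[OF True] by (simp add: wg)
qed
qed

text \<open>The weights of the representation are among the pairs (xi, be) from X and Y and the
  pairs (zeta, t ga) from Z, and all pairs of the first kind do occur. The former fact yields
  hypothesis \<open>B\<close> of the criterion, the latter hypothesis \<open>A\<close>.\<close>

lemma weyl_generic_product_torus:
assumes H: "subgroup H (GL n)" and D: "tparam d k D f" and TH: "tparam h n TH e" "TH <= H"
 and X: "lhom h p (%c. X (e c))" "expansion h p (%c. X (e c)) Xw Xproj" "ALL xi:Xw. Xproj xi ~= 0\<^sub>m p p"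
 and Y: "lhom d q (%c. Y (f c))" "expansion d q (%c. Y (f c)) Yw Yproj" "ALL be:Yw. Yproj be ~= 0\<^sub>m q q"
 and Z: "Z:algebraic_hom (n + k) (group_prod H D) s (GLs s)"
 and ZH: "lhom h s (%c. Z (block (e c) (1\<^sub>m k)))" "expansion h s (%c. Z (block (e c) (1\<^sub>m k))) Hw Hproj"
 and ZD: "lhom d s (%c. Z (block (1\<^sub>m n) (f c)))" "expansion d s (%c. Z (block (1\<^sub>m n) (f c))) Gw Gproj"
 and zero: "EX c :: (nat => int) => nat. (EX xi:Xw. 0 < c xi) & (ALL j<h. (SUM xi:Xw. int (c xi) * xi j) = 0)"
 and nn: "!!S1 S2 muH muD. S1 <= Xw \<times> Yw ==> S2 <= Hw \<times> Gw ==> (EX j<h. muH j ~= 0) \<or> (EX j<d. muD j ~= 0) ==>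
 (ALL s:S1. idot2 h d s muH muD = 0) ==> (ALL s:S2. idot2t h d t s muH muD = 0) ==>
 (EX vH vD. (ALL s:S1. 0 <= idot2 h d s vH vD) & (ALL s:S2. 0 <= idot2t h d t s vH vD) &
  (SUM be:Yw. int (nn be) * idot d be vD) < 0)"
defines "V \<equiv> direct_sum (ext_tensor n X Y) (scale_weights n k D s t Z)" and "T \<equiv> group_prod TH D"
shows "~ {\<theta>:Sigma_set (n + k) T (p * q + s) V. ALL w:weyl_group (n + k) (group_prod H D) T. qchar_pullback w \<theta> = \<theta>}
  <= omega_set (n + k) T (p * q + s) V"
proof -
note F = tparamD[OF D] and E = tparamD[OF TH(1)]
note xX = expD[OF X(2)] and xY = expD[OF Y(2)] and xH = expD[OF ZH(2)] and xG = expD[OF ZD(2)]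
define e' where "e' c = block (e c) (f (%i. c (h + i)))" for c
have T: "tparam (h + d) (n + k) T e'" unfolding T_def e'_def[abs_def] by (rule tparam_block[OF TH(1) D])
define K where "K c = kronecker (X (e c)) (Y (f (%i. c (h + i))))" for c
define L where "L c = Z (block (e c) (f (%i. c (h + i) ^ t)))" for c
have eH: "e c:H" if "c:nz" for c using E(3)[OF that] TH(2) by blast
have Ve: "V (e' c) = block (K c) (L c)" if c: "c:nz" for c
proof -
 note cc = lhomD(2)[OF E(1) c] lhomD(2)[OF F(1) nz_shift[OF c]]
 show ?thesis unfolding V_def direct_sum_def ext_tensor_def e'_def block_fst_block[OF cc] block_snd_block[OF cc] K_def L_def
  by (rule arg_cong[OF scale_weights_eq[OF H D Z ZD(1) eH[OF c] nz_shift[OF c]]])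
qed
have Kl: "lhom (h + d) (p * q) K" unfolding K_def[abs_def] by (rule lhom_kronecker[OF lhom_extend[OF X(1)] lhom_shift[OF Y(1)]])
have Ll: "lhom (h + d) s L" unfolding L_def[abs_def]
proof (rule rep_lhom[OF lhom_block[OF E(1) lhom_power[OF F(1)]] Z])
 show "(%c. block (e c) (f (%i. c (h + i) ^ t))) ` nz <= group_prod H D"
 proof (rule image_subsetI)
  fix c assume c: "c:nz"
  show "block (e c) (f (%i. c (h + i) ^ t)):group_prod H D"
  by (rule group_prod_memI[OF eH[OF c] F(3)[OF nz_power[OF nz_shift[OF c]]]])
 qed
qed
have KL: "lhom (h + d) (p * q + s) (%c. block (K c) (L c))" by (rule lhom_direct_sum[OF Kl Ll])
have Vl: "lhom (h + d) (p * q + s) (%c. V (e' c))"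
proof (rule lhomI)
 show "V (e' c):sqm (p * q + s)" if "c:nz" for c using lhomD(2)[OF KL that] Ve[OF that] by simp
 show "V (e' (%i. c i * c' i)) = V (e' c) * V (e' c')" if "c:nz" "c':nz" for c c'
  unfolding Ve[OF that(1)] Ve[OF that(2)] Ve[OF nz_mult[OF that]] by (rule lhomD(3)[OF KL that])
 show "V (e' (%_. 1)) = 1\<^sub>m (p * q + s)" unfolding Ve[OF nz_one] by (rule lhom_one[OF KL])
 show "laurent (h + d) (%c. V (e' c) $$ (i, j))" if "i < p * q + s" "j < p * q + s" for i j
  by (rule laurent_cong[OF lhomD(4)[OF KL that]]) (simp add: Ve)
qed
obtain W EE where x: "expansion (h + d) (p * q + s) (%c. V (e' c)) W EE" and E0: "ALL al:W. EE al ~= 0\<^sub>m (p * q + s) (p * q + s)"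
 using expansion_exists[OF Vl] by (elim exE conjE) (rule that)
note XX = expD[OF x]
\<comment> \<open>Index set for an explicit expansion of \<open>V\<close>: \<open>ph\<close> gives
  the exponent and \<open>kk\<close> the matrix coefficient of an index. Different indices may have
  equal exponents, so weights are identified through \<open>expansion_coeff\<close>.\<close>
define I where "I = (Xw \<times> Yw) <+> (Hw \<times> Gw)"
define ph where "ph s = (case s of Inl a => join h (fst a) (snd a) | Inr a => join h (fst a) (%i. int t * snd a i))"
 for s :: "(nat => int) \<times> (nat => int) + (nat => int) \<times> (nat => int)"
define kk where "kk i j s = (case s of
  Inl a => if i < p * q & j < p * q then Xproj (fst a) $$ (i div q, j div q) * Yproj (snd a) $$ (i mod q, j mod q) else 0
 | Inr a => if ~ i < p * q & ~ j < p * q then (Hproj (fst a) * Gproj (snd a)) $$ (i - p * q, j - p * q) else 0)"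
 for i j and s :: "(nat => int) \<times> (nat => int) + (nat => int) \<times> (nat => int)"
have fI: "finite I" unfolding I_def using xX(1) xY(1) xH(1) xG(1) by simp
have phI: "ph s:exps (h + d)" if "s:I" for s
proof (cases s)
 case (Inl a)
 hence "snd a:exps d" using that xY(2) by (auto simp: I_def)
 thus ?thesis by (simp add: ph_def Inl join_exps)
next
 case (Inr a)
 hence "snd a:exps d" using that xG(2) by (auto simp: I_def)
 hence "(%i. int t * snd a i):exps d" by (simp add: exps_def)
 thus ?thesis by (simp add: ph_def Inr join_exps)
qed
have Kent: "K c $$ (i, j) = (SUM a:Xw \<times> Yw. Xproj (fst a) $$ (i div q, j div q) * Yproj (snd a) $$ (i mod q, j mod q) * lmon (h + d) (ph (Inl a)) c)"
 if c: "c:nz" and ij: "i < p * q" "j < p * q" for c i j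
proof -
 note bd = divmod_bounds[OF ij(1)] divmod_bounds[OF ij(2)]
 have "K c $$ (i, j) = X (e c) $$ (i div q, j div q) * Y (f (%i. c (h + i))) $$ (i mod q, j mod q)"
  unfolding K_def by (rule kronecker_index[OF lhomD(2)[OF X(1) c] lhomD(2)[OF Y(1) nz_shift[OF c]] ij])
 also have "... = (SUM xi:Xw. SUM be:Yw. Xproj xi $$ (i div q, j div q) * lmon h xi c * (Yproj be $$ (i mod q, j mod q) * lmon d be (%i. c (h + i))))"
  unfolding xX(4)[OF c bd(1,3)] xY(4)[OF nz_shift[OF c] bd(2,4)] by (rule sum_product)
 also have "... = (SUM a:Xw \<times> Yw. Xproj (fst a) $$ (i div q, j div q) * Yproj (snd a) $$ (i mod q, j mod q) * lmon (h + d) (ph (Inl a)) c)"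
  unfolding sum.cartesian_product by (rule sum.cong[OF refl]) (auto simp: ph_def lmon_join mult_ac)
 finally show ?thesis .
qed
have Lent: "L c $$ (i, j) = (SUM a:Hw \<times> Gw. (Hproj (fst a) * Gproj (snd a)) $$ (i, j) * lmon (h + d) (ph (Inr a)) c)"
 if c: "c:nz" and ij: "i < s" "j < s" for c i j
proof -
 let ?u = "%i. c (h + i) ^ t"
 have u: "?u:nz" by (rule nz_power[OF nz_shift[OF c]])
 have bl: "block (e c) (f ?u) = block (e c) (1\<^sub>m k) * block (1\<^sub>m n) (f ?u)"
  using block_mult[OF lhomD(2)[OF E(1) c] one_carrier_mat one_carrier_mat lhomD(2)[OF F(1) u]]
  lhomD(2)[OF E(1) c] lhomD(2)[OF F(1) u] by simp
 have "L c = Z (block (e c) (1\<^sub>m k)) * Z (block (1\<^sub>m n) (f ?u))" unfolding L_def bl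
  by (rule alg_homD(2)[OF Z group_prod_memI[OF eH[OF c] sub_GL(2)[OF F(4)]] group_prod_memI[OF sub_GL(2)[OF H] F(3)[OF u]]])
 hence "L c $$ (i, j) = (SUM l = 0..<s. (SUM \<zeta>:Hw. Hproj \<zeta> $$ (i, l) * lmon h \<zeta> c) * (SUM ga:Gw. Gproj ga $$ (l, j) * lmon d ga ?u))"
  using sq_entry[OF lhomD(2)[OF ZH(1) c] lhomD(2)[OF ZD(1) u] ij] xH(4)[OF c ij(1)] xG(4)[OF u _ ij(2)] by simp
 also have "... = (SUM l = 0..<s. SUM a:Hw \<times> Gw. Hproj (fst a) $$ (i, l) * Gproj (snd a) $$ (l, j) * lmon (h + d) (ph (Inr a)) c)"
  unfolding sum_product sum.cartesian_product
  by (intro sum.cong refl) (auto simp: ph_def lmon_join lmon_power[of d _ "%i. c (h + i)"] mult_ac)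
 also have "... = (SUM a:Hw \<times> Gw. SUM l = 0..<s. Hproj (fst a) $$ (i, l) * Gproj (snd a) $$ (l, j) * lmon (h + d) (ph (Inr a)) c)" by (rule sum.swap)
 finally show ?thesis by (simp add: sq_entry[OF xH(3) xG(3) ij] sum_distrib_right)
qed
have Vent: "V (e' c) $$ (i, j) = (SUM a:I. kk i j a * lmon (h + d) (ph a) c)"
 if c: "c:nz" and ij: "i < p * q + s" "j < p * q + s" for c i j
proof -
 have "(SUM a:I. kk i j a * lmon (h + d) (ph a) c)
  = (SUM a:Xw \<times> Yw. kk i j (Inl a) * lmon (h + d) (ph (Inl a)) c) + (SUM a:Hw \<times> Gw. kk i j (Inr a) * lmon (h + d) (ph (Inr a)) c)"
  unfolding I_def using xX(1) xY(1) xH(1) xG(1) by (subst sum.Plus) (simp_all only: finite_cartesian_product comp_def)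
 moreover have "V (e' c) $$ (i, j) = (if i < p * q then if j < p * q then K c $$ (i, j) else 0 else if j < p * q then 0 else L c $$ (i - p * q, j - p * q))"
  unfolding Ve[OF c] by (rule block_index[OF lhomD(2)[OF Kl c] lhomD(2)[OF Ll c] ij])
 ultimately show ?thesis using Kent[OF c, of i j] Lent[OF c, of "i - p * q" "j - p * q"] ij
  by (cases "i < p * q"; cases "j < p * q") (simp_all add: kk_def)
qed
have coeff: "(if ga:W then EE ga $$ (i, j) else 0) = (SUM a:{a:I. ph a = ga}. kk i j a)"
 if "i < p * q + s" "j < p * q + s" "ga:exps (h + d)" for i j ga
 by (rule expansion_coeff[OF x that(1,2) fI Vent[OF _ that(1,2)] phI that(3)])
have WI: "EX a:I. ph a = al" if al: "al:W" for al
proof (rule ccontr)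
 assume no: "~ ?thesis"
 have "EE al ~= 0\<^sub>m (p * q + s) (p * q + s)" using E0 al by blast
 then obtain i j where ij: "i < p * q + s" "j < p * q + s" "EE al $$ (i, j) ~= 0" using nonzero_entry[OF XX(3)] by blast
 have "{a:I. ph a = al} = {}" using no by blast
 moreover have "EE al $$ (i, j) = (SUM a:{a:I. ph a = al}. kk i j a)"
  using coeff[OF ij(1,2), of al] al subsetD[OF XX(2) al] by simp
 ultimately have "EE al $$ (i, j) = 0" by (simp only: sum.empty)
 thus False using ij(3) by simp
qed
have XYW: "join h xi be:W" if xi: "xi:Xw" and be: "be:Yw" for xi be
proof (rule ccontr)
 assume no: "join h xi be \<notin> W"
 have "Xproj xi ~= 0\<^sub>m p p" "Yproj be ~= 0\<^sub>m q q" using X(3) Y(3) xi be by blast+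
 obtain i1 j1 where 1: "i1 < p" "j1 < p" "Xproj xi $$ (i1, j1) ~= 0" using nonzero_entry[OF xX(3) \<open>Xproj xi ~= 0\<^sub>m p p\<close>] by blast
 obtain i2 j2 where 2: "i2 < q" "j2 < q" "Yproj be $$ (i2, j2) ~= 0" using nonzero_entry[OF xY(3) \<open>Yproj be ~= 0\<^sub>m q q\<close>] by blast
 \<comment> \<open>The same weight might also come from Z. Its coefficient is therefore read at an
   entry inside the tensor product block, where the contributions of Z vanish.\<close>
 define i where "i = i1 * q + i2"
 define j where "j = j1 * q + j2"
 have lt: "a1 * q + a2 < p * q" if "a1 < p" "a2 < q" for a1 a2
 proof -
  have "a1 * q + a2 < Suc a1 * q" using that(2) by simp
  also have "... <= p * q" using that(1) by (intro mult_le_mono1) simp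
  finally show ?thesis .
 qed
 have i: "i < p * q" "i div q = i1" "i mod q = i2" and j: "j < p * q" "j div q = j1" "j mod q = j2"
  unfolding i_def j_def using lt 1 2 by simp_all
 have ga: "join h xi be:exps (h + d)" using xY(2) be by (intro join_exps) blast
 have "0 = (SUM a:{a:I. ph a = join h xi be}. kk i j a)" using coeff[OF _ _ ga, of i j] i(1) j(1) no by simp
 also have "... = (SUM a:{a:I. ph a = join h xi be}. if a = Inl (xi, be) then Xproj xi $$ (i1, j1) * Yproj be $$ (i2, j2) else 0)"
 proof (rule sum.cong[OF refl])
  fix a assume a: "a:{a:I. ph a = join h xi be}"
  show "kk i j a = (if a = Inl (xi, be) then Xproj xi $$ (i1, j1) * Yproj be $$ (i2, j2) else 0)"
  proof (cases a)
  case (Inl y)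
  have "fst y:exps h" "xi:exps h" using a xi xX(2) by (auto simp: I_def Inl)
  moreover have "join h (fst y) (snd y) = join h xi be" using a by (simp add: ph_def Inl)
  ultimately have "fst y = xi & snd y = be" using join_inject[of h "fst y" "snd y" xi be] by blast
  hence "a = Inl (xi, be)" by (simp add: Inl prod_eq_iff)
  thus ?thesis using i j by (simp add: kk_def)
  next
  case (Inr y)
  thus ?thesis using i(1) by (simp add: kk_def)
  qed
 qed
 also have "... = Xproj xi $$ (i1, j1) * Yproj be $$ (i2, j2)"
 proof -
  have "Inl (xi, be):{a:I. ph a = join h xi be}" using xi be unfolding I_def ph_def by (simp add: InlI)
  thus ?thesis using fI by simp
 qed
 finally show False using 1(3) 2(3) by simp
qed
define deD where "deD k = (SUM be:Yw. int (nn be) * be k)" for k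
have deD: "idot d deD v = (SUM be:Yw. int (nn be) * idot d be v)" for v unfolding deD_def idot_sum idot_mult ..
define de where "de = join h (%_. 0 :: int) deD"
have de: "idot (h + d) de l = (SUM be:Yw. int (nn be) * idot d be (%i. l (h + i)))" for l
 unfolding de_def idot_join deD by (simp add: idot_def[of h])
\<comment> \<open>The inequalities for the weights \<open>join h xi be\<close> are added with
  multiplicities \<open>a xi * nn be\<close>. The X-parts cancel by the choice of \<open>a\<close>,
  and a positive multiple of \<open>idot (h + d) de l\<close> is left.\<close>
have A: "0 <= idot (h + d) de l" if l: "!!al. al:W ==> 0 <= idot (h + d) al l" for l
proof -
 obtain a :: "(nat => int) => nat" where a: "EX xi:Xw. 0 < a xi" "ALL j<h. (SUM xi:Xw. int (a xi) * xi j) = 0"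
  using zero by (elim exE conjE) (rule that)
 let ?l = "%i. l (h + i)"
 have "0 <= (SUM xi:Xw. SUM be:Yw. int (a xi) * int (nn be) * (idot h xi l + idot d be ?l))"
  using l[OF XYW] by (intro sum_nonneg mult_nonneg_nonneg) (simp_all add: idot_join)
 also have "... = (SUM xi:Xw. SUM be:Yw. int (nn be) * (int (a xi) * idot h xi l)) + (SUM xi:Xw. SUM be:Yw. int (a xi) * (int (nn be) * idot d be ?l))"
  unfolding sum.distrib[symmetric] by (intro sum.cong refl) (simp add: algebra_simps)
 also have "(SUM xi:Xw. SUM be:Yw. int (nn be) * (int (a xi) * idot h xi l)) = (SUM be:Yw. int (nn be) * idot h (%j. SUM xi:Xw. int (a xi) * xi j) l)"
  unfolding idot_sum idot_mult sum_distrib_left by (rule sum.swap)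
 also have "idot h (%j. SUM xi:Xw. int (a xi) * xi j) l = 0" using a(2) by (simp add: idot_def)
 also have "(SUM xi:Xw. SUM be:Yw. int (a xi) * (int (nn be) * idot d be ?l)) = (SUM xi:Xw. int (a xi)) * idot (h + d) de l"
  unfolding de sum_product ..
 finally have "0 <= (SUM xi:Xw. int (a xi)) * idot (h + d) de l" by simp
 moreover have "0 < (SUM xi:Xw. int (a xi))"
 proof -
  obtain xi where "xi:Xw" "0 < a xi" using a(1) by blast
  thus ?thesis using xX(1) by (intro sum_pos2[of _ xi]) simp_all
 qed
 ultimately show ?thesis by (simp add: zero_le_mult_iff)
qed
have B: "EX l. (ALL al:S. 0 <= idot (h + d) al l) & idot (h + d) de l < 0"
 if S: "S <= W" and mu: "EX j<h + d. mu j ~= 0" and perp: "!!al. al:S ==> idot (h + d) al mu = 0" for S mu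
proof -
 let ?S1 = "{a:Xw \<times> Yw. ph (Inl a):S}" and ?S2 = "{a:Hw \<times> Gw. ph (Inr a):S}"
 let ?muD = "%i. mu (h + i)"
 have ph1: "idot (h + d) (ph (Inl a)) l = idot h (fst a) l + idot d (snd a) (%i. l (h + i))" for a l
  by (simp add: ph_def idot_join)
 have ph2: "idot (h + d) (ph (Inr a)) l = idot h (fst a) l + int t * idot d (snd a) (%i. l (h + i))" for a l
  by (simp add: ph_def idot_join idot_mult)
 have "EX vH vD. (ALL s:?S1. 0 <= idot2 h d s vH vD) &
  (ALL s:?S2. 0 <= idot2t h d t s vH vD) & (SUM be:Yw. int (nn be) * idot d be vD) < 0"
 proof (rule nn)
  show "?S1 <= Xw \<times> Yw" "?S2 <= Hw \<times> Gw" by blast+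
  obtain j where j: "j < h + d" "mu j ~= 0" using mu by blast
  show "(EX j<h. mu j ~= 0) \<or> (EX j<d. ?muD j ~= 0)"
  proof (cases "j < h")
  case True
  thus ?thesis using j by blast
  next
  case False
  hence "EX j<d. ?muD j ~= 0" using j by (intro exI[of _ "j - h"]) simp
  thus ?thesis ..
  qed
  show "ALL s:?S1. idot2 h d s mu ?muD = 0" using perp unfolding ph1[of _ mu, symmetric] by blast
  show "ALL s:?S2. idot2t h d t s mu ?muD = 0" using perp unfolding ph2[of _ mu, symmetric] by blast
 qed
 then obtain vH vD where v: "ALL s:?S1. 0 <= idot2 h d s vH vD"
  "ALL s:?S2. 0 <= idot2t h d t s vH vD" "(SUM be:Yw. int (nn be) * idot d be vD) < 0" by (elim exE conjE) (rule that)
 let ?l = "join h vH vD"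
 have l1: "idot h xi ?l = idot h xi vH" for xi by (rule idot_cong) (simp_all add: join_def)
 have l2: "(%i. ?l (h + i)) = vD" by (simp add: join_def)
 have "0 <= idot (h + d) al ?l" if al: "al:S" for al
 proof -
  obtain b where b: "b:I" "ph b = al" using WI al S by blast
  show ?thesis
  proof (cases b)
  case (Inl a)
  hence "a:?S1" using b al unfolding I_def by (auto elim: PlusE)
  hence "0 <= idot2 h d a vH vD" using v(1) by blast
  thus ?thesis using b(2) ph1[of a ?l] unfolding Inl l1 l2 by simp
  next
  case (Inr a)
  hence "a:?S2" using b al unfolding I_def by (auto elim: PlusE)
  hence "0 <= idot2t h d t a vH vD" using v(2) by blast
  thus ?thesis using b(2) ph2[of a ?l] unfolding Inr l1 l2 by simp
  qed
 qed
 moreover have "idot (h + d) de ?l < 0" unfolding de l2 by (rule v(3))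
 ultimately show ?thesis by blast
qed
show ?thesis
proof (rule weyl_generic_torus[OF T Vl x E0 A B])
 fix w assume "w:weyl_group (n + k) (group_prod H D) T"
 thus "tchar (h + d) T e' de \<circ> w = tchar (h + d) T e' de"
  unfolding T_def e'_def[abs_def] de_def by (rule weyl_invariant[OF H D TH])
qed
qed

theorem theorem1p3p2:
  fixes n k p q s :: nat and H D :: "complex mat set" and X Y Z :: "complex mat \<Rightarrow> complex mat"
    and \<nu> :: "complex mat qchar \<Rightarrow> rat"
  assumes "semisimple_group n H" and "torus k D" and "D \<noteq> {1\<^sub>m k}"
    and "alg_representation n H p X" and "nondegenerate n H p X" and "alg_representation k D q Y"
    and "alg_representation (n + k) (group_prod H D) s Z"
    and "qchar.dim (weight_cone k D q Y) = qchar.dim (rational_characters k D)"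
    and "linear_functional_on (rational_characters k D) \<nu>"
    and "\<And>\<alpha>. \<alpha> \<in> weights k D q Y \<Longrightarrow> 0 \<le> \<nu> (qchar_of \<alpha>)"
    and "\<And>\<alpha>. \<alpha> \<in> weights k D s (\<lambda>d. Z (block (1\<^sub>m n) d)) \<Longrightarrow> \<nu> (qchar_of \<alpha>) < 0"
  shows "\<exists>t0>0. \<forall>t\<ge>t0. weyl_generic (n + k) (group_prod H D) (p * q + s)
           (direct_sum (ext_tensor n X Y) (scale_weights n k D s t Z))"
proof -
have Hag: "algebraic_group n H" using assms(1) by (simp add: semisimple_group_def)
hence H: "subgroup H (GL n)" by (simp add: algebraic_group_def)
obtain d f where D: "tparam d k D f" using assms(2) torus_tparam by blast
note F = tparamD[OF D]
\<comment> \<open>A torus of rank 0 consists of the identity only. Positive rank lets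
  \<open>de\<close> be chosen nonzero in \<open>destabilising_cocharacter\<close>.\<close>
have d: "0 < d"
proof (rule ccontr)
 assume "~ 0 < d"
 hence "f c = 1\<^sub>m k" if "c:nz" for c using lhom_dep[OF F(1) that nz_one] lhom_one[OF F(1)] by simp
 hence "f ` nz = (%_. 1\<^sub>m k) ` nz" by (rule image_cong[OF refl])
 hence "f ` nz = {1\<^sub>m k}" using image_constant[OF nz_one, of "1\<^sub>m k"] by simp
 hence "D = {1\<^sub>m k}" using F(2) by simp
 thus False using assms(3) by simp
qed
have X: "X:algebraic_hom n H p (GLs p)" and Y: "Y:algebraic_hom k D q (GLs q)"
 and Z: "Z:algebraic_hom (n + k) (group_prod H D) s (GLs s)" using assms(4,6,7) by (simp_all add: alg_representation_def)
have p: "0 < p" using assms(5) by (simp add: nondegenerate_def)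
have sub: "H <= GLs n" "D <= GLs k" using sub_GL(1)[OF H] sub_GL(1)[OF F(4)] .
let ?ZH = "%g. Z (block g (1\<^sub>m k))" and ?ZD = "%d. Z (block (1\<^sub>m n) d)"
have ZH: "?ZH:algebraic_hom n H s (GLs s)"
proof (rule algebraic_homI)
 have m: "block g (1\<^sub>m k):group_prod H D" if "g:H" for g by (rule group_prod_memI[OF that sub_GL(2)[OF F(4)]])
 have gc: "g:sqm n" if "g:H" for g using sub(1) that GL_mat by blast
 show "?ZH g:GLs s" if "g:H" for g by (rule alg_homD(1)[OF Z m[OF that]])
 show "?ZH (g * g') = ?ZH g * ?ZH g'" if "g:H" "g':H" for g g' using alg_homD(2)[OF Z m[OF that(1)] m[OF that(2)]]
  block_mult[OF gc[OF that(1)] one_carrier_mat[of k] gc[OF that(2)] one_carrier_mat[of k]] by simp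
 fix i j assume ij: "i < s" "j < s"
 show "regular_on n H (%g. ?ZH g $$ (i, j))"
 proof (rule regular_on_compose[OF m _ _ alg_homD(3)[OF Z ij]])
  fix a b assume ab: "a < n + k" "b < n + k"
  have "regular_on n H (%g. if a < n then if b < n then g $$ (a, b) else 0 else if b < n then 0 else 1\<^sub>m k $$ (a - n, b - n))"
  using reg_const reg_entry[of a n b H] by (cases "a < n"; cases "b < n") simp_all
  thus "regular_on n H (%g. block g (1\<^sub>m k) $$ (a, b))"
  by (rule reg_cong) (simp only: block_index[OF gc one_carrier_mat ab])
 next
  show "regular_on n H (%g. 1 / det (block g (1\<^sub>m k)))"
  proof (rule reg_cong[OF regular_on_inverse_det])
  fix g assume "g:H"
  hence c: "g:sqm n" by (rule gc)
  have "det (block g (1\<^sub>m k)) = det g * det (1\<^sub>m k :: complex mat)"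
   unfolding block_def using c by (intro det_four_block_mat_lower_left_zero[of _ n _ k]) auto
  thus "1 / det g = 1 / det (block g (1\<^sub>m k))" by simp
  qed
 qed
qed
have fG: "block (1\<^sub>m n) (f c):group_prod H D" if "c:nz" for c
 by (rule group_prod_memI[OF sub_GL(2)[OF H] F(3)[OF that]])
have ZDl: "lhom d s (%c. ?ZD (f c))"
proof -
 \<comment> \<open>The first block is filled by the trivial homomorphism from a torus of rank
   0.\<close>
 have "lhom (0 + d) (n + k) (%c. block (1\<^sub>m n) (f (%i. c (0 + i))))"
 proof (rule lhom_block[OF _ F(1)])
  show "lhom 0 n (%c. 1\<^sub>m n)" unfolding lhom_def using GL_one_closed[of n] by (simp add: laurent_const)
 qed
 hence "lhom d (n + k) (%c. block (1\<^sub>m n) (f c))" by simp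
 thus ?thesis by (rule rep_lhom[OF _ Z]) (use fG in blast)
qed
have Yl: "lhom d q (%c. Y (f c))" by (rule rep_lhom[OF F(1) Y]) (use F(2) in simp)
obtain Yw Yproj where Yx: "expansion d q (%c. Y (f c)) Yw Yproj" and Y0: "ALL \<beta>:Yw. Yproj \<beta> ~= 0\<^sub>m q q"
 using expansion_exists[OF Yl] by (elim exE conjE) (rule that)
obtain Gw Gproj where Gx: "expansion d s (%c. ?ZD (f c)) Gw Gproj" and G0: "ALL \<beta>:Gw. Gproj \<beta> ~= 0\<^sub>m s s"
 using expansion_exists[OF ZDl] by (elim exE conjE) (rule that)
have wY: "weights k D q Y = tchar d D f ` Yw" by (rule weights_expansion[OF D Yl Yx Y0])
have wG: "weights k D s ?ZD = tchar d D f ` Gw" by (rule weights_expansion[OF D ZDl Gx G0])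
have spanY: "EX \<beta>:Yw. idot d \<beta> u ~= 0" if u: "EX j<d. u j ~= 0" for u
proof -
 obtain j where j: "j < d" "u j ~= 0" using u by blast
 obtain \<beta> where \<beta>: "\<beta>:exps d" "tchar d D f \<beta>:weights k D q Y" "idot d \<beta> u ~= 0"
  using weight_cone_spans[OF D assms(8), of j u, OF j] by blast
 obtain \<beta>' where \<beta>': "\<beta>':Yw" "tchar d D f \<beta> = tchar d D f \<beta>'" using \<beta>(2) wY by blast
 have "\<beta> = \<beta>'"
 proof (rule tchar_inject[OF D \<beta>(1)])
  show "\<beta>':exps d" using \<beta>'(1) expD(2)[OF Yx] by blast
  show "lmon d \<beta> u = lmon d \<beta>' u" if "u:nz" for u
  using fun_cong[OF \<beta>'(2), of "f u"] tchar_e[OF D that, of \<beta>] tchar_e[OF D that, of \<beta>'] by simp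
 qed
 thus ?thesis using \<beta>(3) \<beta>'(1) by blast
qed
obtain N z where N: "(0 :: nat) < N" and z: "ALL \<beta>. of_int (idot d \<beta> z) = of_nat N * \<nu> (qchar_of (tchar d D f \<beta>))"
 using linear_functional_integral[OF D assms(9)] by (elim exE conjE) (rule that)
have zY: "0 <= idot d \<beta> z" if "\<beta>:Yw" for \<beta>
proof -
 have "0 <= \<nu> (qchar_of (tchar d D f \<beta>))" by (rule assms(10)) (use that wY in blast)
 hence "(0 :: rat) <= of_int (idot d \<beta> z)" unfolding spec[OF z] by simp
 thus ?thesis by simp
qed
have zG: "idot d \<gamma> z <= - 1" if "\<gamma>:Gw" for \<gamma>
proof -
 have "\<nu> (qchar_of (tchar d D f \<gamma>)) < 0" by (rule assms(11)) (use that wG in blast)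
 hence "of_int (idot d \<gamma> z) < (0 :: rat)" unfolding spec[OF z] using N by (simp add: mult_pos_neg)
 thus ?thesis by simp
qed
\<comment> \<open>\<open>PL\<close>, \<open>PX\<close> and \<open>PZ\<close> are chosen before any
  torus: they control the Lie algebra of H and the weights of X and of Z on H, and the bound
  \<open>B\<close> is common to all of them.\<close>
obtain PL where PL: "finite PL" "PL <= vanishing n H"
 "ALL x:carrier_mat n n. (ALL p:PL. ddir n p (1\<^sub>m n) x = 0) --> x:lie n H" using lie_finite_equations[of n H] by blast
obtain PX where PX: "finite PX" "PX <= regular_fun n" "ALL i<p. ALL j<p. EX r:PX. ALL g:H. X g $$ (i, j) = r g"
 using rep_polynomials[OF X] by (elim exE conjE) (rule that)
obtain PZ where PZ: "finite PZ" "PZ <= regular_fun n" "ALL i<s. ALL j<s. EX r:PZ. ALL g:H. ?ZH g $$ (i, j) = r g"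
 using rep_polynomials[OF ZH] by (elim exE conjE) (rule that)
have "finite (PL \<union> PX \<union> PZ)" "PL \<union> PX \<union> PZ <= regular_fun n"
 using PL(1,2) PX(1,2) PZ(1,2) by (auto simp: vanishing_def)
then obtain B where B: "ALL r:PL \<union> PX \<union> PZ. ALL m e. linear_lhom m n e --> boxed m B (%c. r (e c))"
 using uniform_boxed[of "PL \<union> PX \<union> PZ" n] by blast
\<comment> \<open>The possible configurations (m, K, Xm, Hm): the number of eigenspaces, a set of
  relations in the doubled box, and the lifted weights of X and of Z.\<close>
define DD where "DD = (SIGMA m : {..n}. Pow (box m (B + B)) \<times> (Pow (box m B) \<times> Pow (box m B)))"
have fDD: "finite DD" unfolding DD_def using finite_box by (intro finite_SigmaI) simp_all
define good where "good \<Delta> t = destab d Yw Gw t (fst \<Delta>) (fst (snd \<Delta>)) (fst (snd (snd \<Delta>))) (snd (snd (snd \<Delta>)))"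
 for \<Delta> :: "nat \<times> (nat => int) set \<times> (nat => int) set \<times> (nat => int) set" and t
\<comment> \<open>The choice is meaningful for configurations admitting a threshold, which includes
  all that come from maximal tori; the other summands can only enlarge \<open>t0\<close>. The
  summand 1 makes \<open>t0\<close> positive.\<close>
define \<tau> where "\<tau> \<Delta> = (SOME t0. ALL t>=t0. good \<Delta> t)" for \<Delta>
define t0 where "t0 = 1 + (SUM \<Delta>:DD. \<tau> \<Delta>)"
have uniform: "good \<Delta> t" if \<Delta>: "\<Delta>:DD" "EX t0. ALL t>=t0. good \<Delta> t" and t: "t0 <= t" for \<Delta> t
proof -
 have "ALL t>=\<tau> \<Delta>. good \<Delta> t" unfolding \<tau>_def using \<Delta>(2) by (rule someI_ex)
 moreover have "\<tau> \<Delta> <= (SUM \<Delta>:DD. \<tau> \<Delta>)" using \<Delta>(1) fDD by (intro member_le_sum) simp_all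
 ultimately show ?thesis using t unfolding t0_def by simp
qed
have "weyl_generic (n + k) (group_prod H D) (p * q + s) (direct_sum (ext_tensor n X Y) (scale_weights n k D s t Z))"
 if t: "t0 <= t" for t unfolding weyl_generic_def
proof (intro allI impI)
 fix T assume "maximal_torus (n + k) (group_prod H D) T"
 then obtain TH where TH: "maximal_torus n H TH" and Teq: "T = group_prod TH D" using maximal_torus_group_prod[OF H D] by blast
 obtain h e where e: "tparam h n TH e" using TH unfolding maximal_torus_def torus_tparam by blast
 note E = tparamD[OF e]
 have THH: "TH <= H" using TH by (simp add: maximal_torus_def)
 hence im: "e ` nz <= H" using E(2) by simp
 have Xl: "lhom h p (%c. X (e c))" by (rule rep_lhom[OF E(1) X im])
 have Hl: "lhom h s (%c. ?ZH (e c))" by (rule rep_lhom[OF E(1) ZH im])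
 obtain Xw Xproj where Xx: "expansion h p (%c. X (e c)) Xw Xproj" and X0: "ALL \<xi>:Xw. Xproj \<xi> ~= 0\<^sub>m p p"
  using expansion_exists[OF Xl] by (elim exE conjE) (rule that)
 obtain Hw Hproj where Hx: "expansion h s (%c. ?ZH (e c)) Hw Hproj" and H0: "ALL \<xi>:Hw. Hproj \<xi> ~= 0\<^sub>m s s"
  using expansion_exists[OF Hl] by (elim exE conjE) (rule that)
 obtain m w E' where m: "m <= n" and w: "eigen_param h n e m w E'"
  using eigen_param_exists[OF E(1)] by (elim exE conjE) (rule that)
 have Bz: "boxed m B (%z. r (ez n m w E' z))" if "r:PL \<union> PX \<union> PZ" for r using B that linear_lhom_ez[OF w] by blast
 \<comment> \<open>Bounded characters of the diagonal torus that are trivial on \<open>TH\<close>.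
   By \<open>torus_rigidity\<close> the vectors orthogonal to all of them are exactly the
   cocharacters of \<open>TH\<close>.\<close>
 define K where "K = {\<kappa>:box m (B + B). ALL j<h. (SUM i<m. \<kappa> i * w i j) = 0}"
 define Xm where "Xm = {\<alpha>:box m B. pi_exp h m w \<alpha>:Xw}"
 define Hm where "Hm = {\<alpha>:box m B. pi_exp h m w \<alpha>:Hw}"
 have R: "EX l. ALL i<m. idot h (w i) l = a i" if a: "!!\<kappa>. \<kappa>:K ==> idot m \<kappa> a = 0" for a
 proof (rule torus_rigidity[OF w Hag TH e PL(2)])
  show "x:lie n H" if "x:sqm n" "ALL p:PL. ddir n p (1\<^sub>m n) x = 0" for x using PL(3) that by blast
  show "boxed m B (%z. r (ez n m w E' z))" if "r:PL" for r using Bz that by blast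
  show "idot m \<kappa> a = 0" if "\<kappa>:box m (B + B)" "!!j. j < h ==> (SUM i<m. \<kappa> i * w i j) = 0" for \<kappa>
  by (rule a) (use that in \<open>simp add: K_def\<close>)
 qed
 have Kv: "idot m \<kappa> (%i. idot h (w i) v) = 0" if "\<kappa>:K" for \<kappa> v
  using that unfolding idot_pi_exp[symmetric] by (simp add: K_def pi_exp_def idot_def trunc_def)
 have faithful: "ALL j<h. l j = 0" if l: "ALL i<m. idot h (w i) l = 0" for l
 proof (intro allI impI)
  fix j assume j: "j < h"
  have two: "tpow l 2:nz" by (rule tpow_nz) simp
  have "ez n m w E' (%i. lmon h (w i) (tpow l 2)) = ez n m w E' (%i. 1)" unfolding ez_def using l lmon_tpow[of 2 h _ l] by simp
  hence "e (tpow l 2) = e (%_. 1)" using ez_lmon[OF w two] ez_one[OF w] lhom_one[OF E(1)] by simp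
  hence "tpow l 2 j = 1" using tparam_inj[OF e two nz_one _ j] by simp
  hence "(2 :: complex) powi l j = 2 powi 0" by (simp add: tpow_def)
  thus "l j = 0" unfolding powi_2_inj .
 qed
 have XmX: "EX \<alpha>:Xm. pi_exp h m w \<alpha> = \<xi>" if "\<xi>:Xw" for \<xi>
 proof -
  have "EX \<alpha>:box m B. pi_exp h m w \<alpha> = \<xi>"
  by (rule weights_in_box[OF e w PX(3) THH _ Xx that]) (use Bz X0 that in auto)
  thus ?thesis using that by (auto simp: Xm_def)
 qed
 have HmH: "EX \<alpha>:Hm. pi_exp h m w \<alpha> = \<xi>" if "\<xi>:Hw" for \<xi>
 proof -
  have "EX \<alpha>:box m B. pi_exp h m w \<alpha> = \<xi>"
  by (rule weights_in_box[OF e w PZ(3) THH _ Hx that]) (use Bz H0 that in auto)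
  thus ?thesis using that by (auto simp: Hm_def)
 qed
 have dg: "degen n TH p X = h" using assms(5) TH torus_rank_tparam[OF e] unfolding nondegenerate_def by simp
 have wX: "weights n TH p X = tchar h TH e ` Xw" by (rule weights_expansion[OF e Xl Xx X0])
 let ?\<Delta> = "(m, K, Xm, Hm)"
 have "EX t0>0. ALL t>=t0. destab d Yw Gw t m K Xm Hm"
 proof (rule destab_forward[OF expD(1)[OF Xx] expD(1)[OF Yx] expD(1)[OF Hx] expD(1)[OF Gx] d])
  show False if "S <= Xw" "EX j<h. \<mu> j ~= 0" "!!\<xi>. \<xi>:S ==> idot h \<xi> \<mu> = 0" "EX \<xi>:S. 0 < c \<xi>"
  "!!j. j < h ==> (SUM \<xi>:S. int (c \<xi>) * \<xi> j) = 0" for S \<mu> and c :: "(nat => int) => nat"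
  by (rule nondegenerate_hyperplane[OF e dg wX that(1) expD(1)[OF Xx] that(2) that(3) that(4) that(5)])
  show "EX \<beta>:Yw. idot d \<beta> u ~= 0" if "EX j<d. u j ~= 0" for u using that by (rule spanY)
  show "0 <= idot d \<beta> z" if "\<beta>:Yw" for \<beta> using that by (rule zY)
  show "idot d \<gamma> z <= - 1" if "\<gamma>:Gw" for \<gamma> using that by (rule zG)
  show "EX l. ALL i<m. idot h (w i) l = a i" if "!!\<kappa>. \<kappa>:K ==> idot m \<kappa> a = 0" for a using that by (rule R)
  show "idot m \<kappa> (%i. idot h (w i) v) = 0" if "\<kappa>:K" for \<kappa> v using that by (rule Kv)
 qed (simp_all add: Xm_def Hm_def)
 hence "EX t0. ALL t>=t0. good ?\<Delta> t" unfolding good_def by auto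
 moreover have "?\<Delta>:DD" using m unfolding DD_def K_def Xm_def Hm_def by auto
 ultimately have "good ?\<Delta> t" using t by (intro uniform)
 hence ds: "destab d Yw Gw t m K Xm Hm" by (simp add: good_def)
 have "EX nn :: (nat => int) => nat. ALL S1 S2 \<mu>H \<mu>D. S1 <= Xw \<times> Yw --> S2 <= Hw \<times> Gw -->
 (EX j<h. \<mu>H j ~= 0) \<or> (EX j<d. \<mu>D j ~= 0) --> (ALL s:S1. idot2 h d s \<mu>H \<mu>D = 0) -->
 (ALL s:S2. idot2t h d t s \<mu>H \<mu>D = 0) --> (EX vH vD. (ALL s:S1. 0 <= idot2 h d s vH vD) &
  (ALL s:S2. 0 <= idot2t h d t s vH vD) & (SUM \<beta>:Yw. int (nn \<beta>) * idot d \<beta> vD) < 0)"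
 proof (rule destab_backward[OF ds])
  show "EX l. ALL i<m. idot h (w i) l = a i" if "!!\<kappa>. \<kappa>:K ==> idot m \<kappa> a = 0" for a using that by (rule R)
  show "idot m \<kappa> (%i. idot h (w i) v) = 0" if "\<kappa>:K" for \<kappa> v using that by (rule Kv)
  show "ALL j<h. l j = 0" if "ALL i<m. idot h (w i) l = 0" for l using that by (rule faithful)
  show "EX \<alpha>:Xm. pi_exp h m w \<alpha> = \<xi>" if "\<xi>:Xw" for \<xi> using that by (rule XmX)
  show "EX \<alpha>:Hm. pi_exp h m w \<alpha> = \<xi>" if "\<xi>:Hw" for \<xi> using that by (rule HmH)
 qed
 then obtain nn :: "(nat => int) => nat" where nn: "ALL S1 S2 \<mu>H \<mu>D. S1 <= Xw \<times> Yw --> S2 <= Hw \<times> Gw -->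
 (EX j<h. \<mu>H j ~= 0) \<or> (EX j<d. \<mu>D j ~= 0) --> (ALL s:S1. idot2 h d s \<mu>H \<mu>D = 0) -->
 (ALL s:S2. idot2t h d t s \<mu>H \<mu>D = 0) --> (EX vH vD. (ALL s:S1. 0 <= idot2 h d s vH vD) &
  (ALL s:S2. 0 <= idot2t h d t s vH vD) & (SUM \<beta>:Yw. int (nn \<beta>) * idot d \<beta> vD) < 0)" ..
 show "~ {\<theta>:Sigma_set (n + k) T (p * q + s) (direct_sum (ext_tensor n X Y) (scale_weights n k D s t Z)).
   ALL w:weyl_group (n + k) (group_prod H D) T. qchar_pullback w \<theta> = \<theta>}
  <= omega_set (n + k) T (p * q + s) (direct_sum (ext_tensor n X Y) (scale_weights n k D s t Z))" unfolding Teq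
 proof (rule weyl_generic_product_torus[OF H D e THH Xl Xx X0 Yl Yx Y0 Z Hl Hx ZDl Gx])
  show "EX c :: (nat => int) => nat. (EX \<xi>:Xw. 0 < c \<xi>) & (ALL j<h. (SUM \<xi>:Xw. int (c \<xi>) * \<xi> j) = 0)"
  by (rule zero_weight_combination[OF assms(1) X p e THH Xx])
  show "EX vH vD. (ALL s:S1. 0 <= idot2 h d s vH vD) &
  (ALL s:S2. 0 <= idot2t h d t s vH vD) & (SUM \<beta>:Yw. int (nn \<beta>) * idot d \<beta> vD) < 0"
  if "S1 <= Xw \<times> Yw" "S2 <= Hw \<times> Gw" "(EX j<h. \<mu>H j ~= 0) \<or> (EX j<d. \<mu>D j ~= 0)"
   "ALL s:S1. idot2 h d s \<mu>H \<mu>D = 0"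
   "ALL s:S2. idot2t h d t s \<mu>H \<mu>D = 0" for S1 S2 \<mu>H \<mu>D
  by (rule nn[THEN spec, THEN spec, THEN spec, THEN spec, THEN mp, THEN mp, THEN mp, THEN mp, THEN mp, OF that])
 qed
qed
moreover have "0 < t0" by (simp add: t0_def)
ultimately show ?thesis by blast
qed

end
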